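(* Let $n\in\mathbb{N}$, let $\alpha,\beta\in(0,1]$ with $\beta<\alpha$, and let $p,q\in[1,+\infty]$ be such that $p\le q<\frac{n}{n+\beta-\alpha}$. Then $BV^{\alpha,p}(\mathbb{R}^n)\subset S^{\beta,q}(\mathbb{R}^n)$ with continuous inclusion.
   Context: For $\gamma\in(0,1)$ let $\mu_{n,\gamma}=2^{\gamma}\pi^{-n/2}\Gamma\left(\frac{n+\gamma+1}{2}\right)/\Gamma\left(\frac{1-\gamma}{2}\right)$ and, for $\varphi\in C^\infty_c(\mathbb{R}^n;\mathbb{R}^n)$, $\operatorname{div}^\gamma\varphi(x)=\mu_{n,\gamma}\int_{\mathbb{R}^n}\frac{(y-x)\cdot(\varphi(y)-\varphi(x))}{|y-x|^{n+\gamma+1}}\,dy$; $\operatorname{div}^1$ is the classical divergence. For $\gamma\in(0,1]$ and $p\in[1,+\infty]$, $BV^{\gamma,p}(\mathbb{R}^n)$ is the set of $f\in L^p(\mathbb{R}^n)$ with $|D^\gamma f|(\mathbb{R}^n):=\sup\{\int f\operatorname{div}^\gamma\varphi\,dx:\varphi\in C^\infty_c(\mathbb{R}^n;\mathbb{R}^n),\ \|\varphi\|_{L^\infty}\le1\}<+\infty$, normed by $\|f\|_{L^p}+|D^\gamma f|(\mathbb{R}^n)$ (for $\gamma=1$ this is $L^p$ with finite total variation). For $\beta\in(0,1)$ and $q\in[1,+\infty]$, $S^{\beta,q}(\mathbb{R}^n)$ is the space of $f\in L^q(\mathbb{R}^n)$ for which there is $\nabla^\beta f\in L^q(\mathbb{R}^n;\mathbb{R}^n)$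 (weak fractional gradient) with $\int f\operatorname{div}^\beta\varphi\,dx=-\int\nabla^\beta f\cdot\varphi\,dx$ for all $\varphi\in C^\infty_c(\mathbb{R}^n;\mathbb{R}^n)$, normed by $\|f\|_{L^q}+\|\nabla^\beta f\|_{L^q}$. *)

theory Defs
  imports "HOL-Analysis.Analysis"
begin

fun dirderiv :: "'a::euclidean_space list \<Rightarrow> ('a \<Rightarrow> 'b::real_normed_vector) \<Rightarrow> 'a \<Rightarrow> 'b" where
  "dirderiv [] f = f"
| "dirderiv (d # ds) f = (\<lambda>x. frechet_derivative (dirderiv ds f) (at x) d)"

definition smooth :: "('a::euclidean_space \<Rightarrow> 'b::real_normed_vector) \<Rightarrow> bool" where
  "smooth f \<longleftrightarrow> (\<forall>ds. set ds \<subseteq> Basis \<longrightarrow>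
      (\<forall>x. dirderiv ds f differentiable (at x)) \<and> continuous_on UNIV (dirderiv ds f))"

definition test_fields :: "('a::euclidean_space \<Rightarrow> 'a) set" where
  "test_fields = {\<phi>. smooth \<phi> \<and> compact (closure {x. \<phi> x \<noteq> 0})}"

definition mu_const :: "nat \<Rightarrow> real \<Rightarrow> real" where
  "mu_const n \<gamma> = 2 powr \<gamma> * pi powr (- real n / 2) * Gamma ((real n + \<gamma> + 1) / 2)
                   / Gamma ((1 - \<gamma>) / 2)"

definition frac_div :: "real \<Rightarrow> ('a::euclidean_space \<Rightarrow> 'a) \<Rightarrow> 'a \<Rightarrow> real" where
  "frac_div \<gamma> \<phi> x =
     (if \<gamma> = 1 then (\<Sum>b\<in>Basis. frechet_derivative \<phi> (at x) b \<bullet> b)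
      else mu_const DIM('a) \<gamma> *
        (LINT y|lborel. ((y - x) \<bullet> (\<phi> y - \<phi> x)) / norm (y - x) powr (real DIM('a) + \<gamma> + 1)))"

definition lp_norm :: "ennreal \<Rightarrow> ('a::euclidean_space \<Rightarrow> 'b::real_normed_vector) \<Rightarrow> ennreal" where
  "lp_norm p f =
     (if p = \<infinity> then Inf {C. AE x in lebesgue. ennreal (norm (f x)) \<le> C}
      else (let I = (\<integral>\<^sup>+ x. ennreal (norm (f x) powr enn2real p) \<partial>lebesgue) in
            if I = \<infinity> then \<infinity> else ennreal (enn2real I powr (1 / enn2real p))))"

definition Lp :: "ennreal \<Rightarrow> ('a::euclidean_space \<Rightarrow> 'b::real_normed_vector) set" where
  "Lp p = {f. f \<in> borel_measurable lebesgue \<and> lp_norm p f < \<infinity>}"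

definition frac_var :: "real \<Rightarrow> ('a::euclidean_space \<Rightarrow> real) \<Rightarrow> ereal" where
  "frac_var \<gamma> f = (SUP \<phi>\<in>{\<phi>\<in>test_fields. \<forall>x. norm (\<phi> x) \<le> 1}.
                       ereal (LINT x|lebesgue. f x * frac_div \<gamma> \<phi> x))"

definition BV_space :: "real \<Rightarrow> ennreal \<Rightarrow> ('a::euclidean_space \<Rightarrow> real) set" where
  "BV_space \<gamma> p = {f. f \<in> Lp p \<and> frac_var \<gamma> f < \<infinity>}"

definition BV_norm :: "real \<Rightarrow> ennreal \<Rightarrow> ('a::euclidean_space \<Rightarrow> real) \<Rightarrow> ereal" where
  "BV_norm \<gamma> p f = enn2ereal (lp_norm p f) + frac_var \<gamma> f"

definition weak_frac_grad :: "real \<Rightarrow> ('a::euclidean_space \<Rightarrow> real) \<Rightarrow> ('a \<Rightarrow> 'a) \<Rightarrow> bool" where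
  "weak_frac_grad \<beta> f g \<longleftrightarrow> (\<forall>\<phi>\<in>test_fields.
      (LINT x|lebesgue. f x * frac_div \<beta> \<phi> x) = - (LINT x|lebesgue. g x \<bullet> \<phi> x))"

definition S_space :: "real \<Rightarrow> ennreal \<Rightarrow> ('a::euclidean_space \<Rightarrow> real) set" where
  "S_space \<beta> q = {f. f \<in> Lp q \<and> (\<exists>g. g \<in> Lp q \<and> weak_frac_grad \<beta> f g)}"

end

theory Submission
  imports Defs
begin

text \<open>
  The fractional divergence is a superposition of heat semigroup gradients:
  \<open>div\<^sup>\<gamma> \<phi> = c \<integral> t\<^bsup>(1 - \<gamma>)/2 - 1\<^esup> (\<nabla> heat t * \<phi>) dt\<close>. Writing the exponent \<open>(1 - \<beta>)/2\<close> as
  \<open>(1 - \<alpha>)/2 + (\<alpha> - \<beta>)/2\<close> and using that Riemann--Liouville weights convolve by the Beta integral, one gets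
  \<open>div\<^sup>\<beta> \<phi> = c' \<integral> s\<^bsup>(\<alpha> - \<beta>)/2 - 1\<^esup> div\<^sup>\<alpha> (heat s * \<phi>) ds\<close>.
  Pair this with \<open>f\<close>, where \<open>\<phi>\<close> lies in the unit ball of \<open>L\<^bsup>q'\<^esup>\<close>. For small \<open>s\<close> the variation of \<open>f\<close> bounds the
  integrand by \<open>|D\<^sup>\<alpha> f| \<parallel>heat s * \<phi>\<parallel>\<^sub>\<infinity>\<close>, that is by a multiple of \<open>s\<^bsup>- n (1 - 1/q) / 2\<^esup>\<close>, and the
  \<open>s\<close>-integral converges at \<open>0\<close> because \<open>n (1 - 1/q) < \<alpha> - \<beta>\<close>; for large \<open>s\<close> the norm of \<open>f\<close> in \<open>L\<^sup>q\<close> gives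
  integrable decay. Hence \<open>\<integral> f div\<^sup>\<beta> \<phi>\<close> is represented by an \<open>L\<^sup>q\<close> field.
  That \<open>f\<close> lies in \<open>L\<^sup>q\<close> at all when \<open>p < q\<close> follows in the same way by applying the splitting to
  \<open>heat \<delta> * \<phi> = - \<integral> \<partial>\<^sub>t heat (t + \<delta>) * \<phi> dt\<close> and letting \<open>\<delta>\<close> tend to \<open>0\<close>.
\<close>

section \<open>The heat kernel\<close>

text \<open>The variation of \<open>f\<close> controls only fields in \<open>test_fields\<close>,
  while heat-smoothed fields need not have compact support. Each use of the variation therefore goes
  through fields \<open>heat_approx\<close>, in which both the kernel and the field are cut off; the
  limit is taken by dominated convergence with a majorant in L^1 and L^\<infinity> that does not
  depend on the cut-off (\<open>modulus_dom\<close>, \<open>frac_dom\<close>). A second obstacle is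
  Fubini: bounds for the pairings of \<open>f\<close> with single fields, one for each smoothing
  time, are not bounds for absolute integrals. Testing against the normalised sign of the transform
  of \<open>f\<close> on a ball turns them into local L^1 bounds. After that the gradient is an
  explicit pointwise integral, found without any compactness argument, and its L^q bound is read off
  by duality. No Fourier transform occurs: the semigroup law comes from completing the square.
  Constants such as \<open>gauss_mass\<close> or the one in \<open>rl_gamma\<close> are never
  evaluated, because positivity and finiteness suffice.\<close>

lemma nn_integral_lborel_translate:
  fixes f :: "'a::euclidean_space \<Rightarrow> ennreal"
  assumes [measurable]: "f \<in> borel_measurable borel"
  shows "(\<integral>\<^sup>+x. f (a + x) \<partial>lborel) = (\<integral>\<^sup>+x. f x \<partial>lborel)"
  by (subst (2) lborel_distr_plus[symmetric, of a]) (simp add: nn_integral_distr)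

lemma nn_integral_lborel_reflect:
  fixes f :: "'a::euclidean_space \<Rightarrow> ennreal"
  assumes [measurable]: "f \<in> borel_measurable borel"
  shows "(\<integral>\<^sup>+x. f (a - x) \<partial>lborel) = (\<integral>\<^sup>+x. f x \<partial>lborel)"
  by (subst (2) lborel_affine[of "-1" a]) (simp_all add: nn_integral_density nn_integral_distr)

lemma integral_lborel_translate:
  fixes f :: "'a::euclidean_space \<Rightarrow> 'b::euclidean_space"
  assumes [measurable]: "f \<in> borel_measurable borel"
  shows "(\<integral>x. f (a + x) \<partial>lborel) = (\<integral>x. f x \<partial>lborel)"
  by (subst (2) lborel_distr_plus[symmetric, of a]) (simp add: integral_distr)

lemma integral_lborel_reflect:
  fixes f :: "'a::euclidean_space \<Rightarrow> 'b::euclidean_space"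
  assumes [measurable]: "f \<in> borel_measurable borel"
  shows "(\<integral>x. f (a - x) \<partial>lborel) = (\<integral>x. f x \<partial>lborel)"
proof -
  have "density (distr lborel borel (\<lambda>x::'a. a - x)) (\<lambda>_. 1) = lborel"
    using lborel_affine[of "-1" a] by simp
  then have "distr lborel borel (\<lambda>x::'a. a - x) = lborel" by (simp add: density_1)
  then show ?thesis
    using integral_distr[of "\<lambda>x. a - x" lborel borel f] by simp
qed

lemma integrable_lborel_translate:
  fixes f :: "'a::euclidean_space \<Rightarrow> 'b::euclidean_space"
  assumes "integrable lborel f"
  shows "integrable lborel (\<lambda>x. f (a + x))"
proof -
  have [measurable]: "f \<in> borel_measurable borel" using assms by auto
  show ?thesis using assms
    unfolding integrable_iff_bounded
    using nn_integral_lborel_translate[of "\<lambda>x. ennreal (norm (f x))" a] by auto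
qed

lemma integrable_lborel_reflect:
  fixes f :: "'a::euclidean_space \<Rightarrow> 'b::euclidean_space"
  assumes "integrable lborel f"
  shows "integrable lborel (\<lambda>x. f (a - x))"
proof -
  have [measurable]: "f \<in> borel_measurable borel" using assms by auto
  show ?thesis using assms
    unfolding integrable_iff_bounded
    using nn_integral_lborel_reflect[of "\<lambda>x. ennreal (norm (f x))" a] by auto
qed

section \<open>The Gaussian integral\<close>

lemma nn_integral_exp_minus_square_finite:
  "(\<integral>\<^sup>+x. ennreal (exp (- x\<^sup>2)) \<partial>lborel) < (\<infinity>::ennreal)"
proof -
  have half: "(\<integral>\<^sup>+x. ennreal (indicator {0..} x * exp (- x)) \<partial>lborel) = ennreal 1"
    using nn_integral_has_integral_lebesgue[OF _ has_integral_exp_minus_to_infinity[of 1 0]] by simp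
  have half': "(\<integral>\<^sup>+x. ennreal (indicator {0..} (-x) * exp (- (- x))) \<partial>lborel) = ennreal 1"
    unfolding half[symmetric]
    using nn_integral_lborel_reflect[of "\<lambda>x. ennreal (indicator {0..} x * exp (- x))" "0::real"] by simp
  \<comment> \<open>Comparison with a two-sided exponential, from
    \<open>0 \<le> (\<bar>x\<bar> - 1)\<^sup>2\<close>. Only finiteness is wanted here, so the value
    of the integral is not computed.\<close>
  have pw: "exp (- x\<^sup>2) \<le> exp 1 * (indicator {0..} x * exp (- x)) + exp 1 * (indicator {0..} (-x) * exp (- (- x)))" for x :: real
  proof -
    have "0 \<le> (\<bar>x\<bar> - 1)\<^sup>2" by simp
    then have "- x\<^sup>2 \<le> 1 - \<bar>x\<bar>" unfolding power2_diff by simp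
    then have "exp (- x\<^sup>2) \<le> exp 1 * exp (-\<bar>x\<bar>)" by (simp flip: exp_add)
    also have "\<dots> \<le> exp 1 * (indicator {0..} x * exp (- x)) + exp 1 * (indicator {0..} (-x) * exp (- (- x)))"
      by (auto split: split_indicator)
    finally show ?thesis .
  qed
  have "(\<integral>\<^sup>+x. ennreal (exp (- x\<^sup>2)) \<partial>lborel) \<le> (\<integral>\<^sup>+x. ennreal (exp 1) * ennreal (indicator {0..} x * exp (- x)) +
      ennreal (exp 1) * ennreal (indicator {0..} (-x) * exp (- (- x))) \<partial>lborel)"
    using pw by (intro nn_integral_mono) (simp flip: ennreal_mult ennreal_plus)
  also have "\<dots> = ennreal (exp 1) * ennreal 1 + ennreal (exp 1) * ennreal 1"
    by (subst nn_integral_add) (simp_all add: nn_integral_cmult half half' del: minus_minus)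
  also have "\<dots> < \<infinity>" by (simp add: ennreal_mult_less_top)
  finally show ?thesis .
qed

text \<open>The value is pi^(n/2), but it is kept as a symbol: the normalisation of
  \<open>heat\<close> needs only that it is finite and positive.\<close>

definition gauss_mass :: "'a::euclidean_space itself \<Rightarrow> real" where
  "gauss_mass _ = (\<integral>x. exp (- (norm x)\<^sup>2) \<partial>(lborel :: 'a measure))"

text \<open>The Gaussian is a product of one-dimensional ones, so Tonelli over the coordinates
  reduces the claim to the line.\<close>

lemma integrable_gauss: "integrable (lborel :: 'a::euclidean_space measure) (\<lambda>x. exp (- (norm x)\<^sup>2))"
proof -
  have eq: "ennreal (exp (- (norm x)\<^sup>2)) = (\<Prod>b\<in>Basis. ennreal (exp (- (x \<bullet> b)\<^sup>2)))" for x :: 'a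
    unfolding power2_norm_eq_inner
    by (subst prod_ennreal) (auto simp: exp_sum[symmetric] sum_negf euclidean_inner[of x x] power2_eq_square)
  have "(\<integral>\<^sup>+x. ennreal (exp (- (norm x)\<^sup>2)) \<partial>(lborel :: 'a measure)) < \<infinity>"
    unfolding eq using nn_integral_exp_minus_square_finite
    by (subst nn_integral_lborel_prod) (auto simp: power_less_top_ennreal)
  then show ?thesis by (intro integrableI_bounded) auto
qed

lemma gauss_mass_pos: "gauss_mass TYPE('a::euclidean_space) > 0"
proof -
  have "gauss_mass TYPE('a) \<noteq> 0"
  proof
    assume "gauss_mass TYPE('a) = 0"
    then have "AE x in (lborel :: 'a measure). exp (- (norm x)\<^sup>2) = 0"
      unfolding gauss_mass_def using integrable_gauss by (subst (asm) integral_nonneg_eq_0_iff_AE) auto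
    then have "AE x in (lborel :: 'a measure). False" by simp
    then show False by (simp add: AE_iff_null null_sets_def)
  qed
  moreover have "gauss_mass TYPE('a) \<ge> 0" unfolding gauss_mass_def by simp
  ultimately show ?thesis by simp
qed

text \<open>The Gaussian is \<open>exp (- |x|\<^sup>2 / t)\<close>, so \<open>t\<close> is four times the usual time parameter of the heat semigroup.\<close>
definition heat :: "real \<Rightarrow> 'a::euclidean_space \<Rightarrow> real" where
  "heat t x = t powr (- real DIM('a) / 2) * exp (- (norm x)\<^sup>2 / t) / gauss_mass TYPE('a)"

lemma heat_nonneg [simp]: "0 \<le> heat t x"
  unfolding heat_def using gauss_mass_pos[where 'a='a] by simp

lemma heat_minus [simp]: "heat t (- x) = heat t x"
  by (simp add: heat_def)

lemma measurable_heat [measurable (raw)]: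
  fixes f :: "'b \<Rightarrow> 'a::euclidean_space"
  assumes [measurable]: "g \<in> borel_measurable N" "f \<in> borel_measurable N"
  shows "(\<lambda>x. heat (g x) (f x)) \<in> borel_measurable N"
  unfolding heat_def by measurable

text \<open>Replacing \<open>x\<close> by \<open>sqrt t *\<^sub>R x\<close> removes
  \<open>t\<close>: the Jacobian \<open>sqrt t ^ n\<close> cancels the prefactor
  \<open>t powr (- n / 2)\<close>.\<close>

lemma nn_integral_heat:
  assumes t: "t > 0"
  shows "(\<integral>\<^sup>+x. ennreal (heat t x) \<partial>(lborel :: 'a::euclidean_space measure)) = 1"
proof -
  have c: "sqrt t \<noteq> 0" using t by simp
  have "(\<integral>\<^sup>+x. ennreal (heat t x) \<partial>(lborel :: 'a measure)) =
      (\<integral>\<^sup>+x. ennreal (sqrt t ^ DIM('a)) * ennreal (heat t (sqrt t *\<^sub>R x)) \<partial>(lborel :: 'a measure))"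
    using t by (subst lborel_affine[OF c, of 0])
      (simp add: nn_integral_density nn_integral_distr ennreal_power flip: ennreal_mult)
  also have "\<dots> = (\<integral>\<^sup>+x. ennreal (exp (- (norm x)\<^sup>2) / gauss_mass TYPE('a)) \<partial>(lborel :: 'a measure))"
  proof (intro nn_integral_cong)
    fix x :: 'a
    have "sqrt t ^ DIM('a) * t powr (- real DIM('a) / 2) = 1"
      using t by (simp add: powr_half_sqrt[symmetric] powr_powr flip: powr_realpow powr_add)
    moreover have "heat t (sqrt t *\<^sub>R x) = t powr (- real DIM('a) / 2) * exp (- (norm x)\<^sup>2) / gauss_mass TYPE('a)"
      unfolding heat_def using t by (simp add: power_mult_distrib)
    ultimately have "sqrt t ^ DIM('a) * heat t (sqrt t *\<^sub>R x) = exp (- (norm x)\<^sup>2) / gauss_mass TYPE('a)"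
      by (metis mult.assoc mult_1 times_divide_eq_right)
    then show "ennreal (sqrt t ^ DIM('a)) * ennreal (heat t (sqrt t *\<^sub>R x)) = ennreal (exp (- (norm x)\<^sup>2) / gauss_mass TYPE('a))"
      using t by (simp flip: ennreal_mult)
  qed
  also have "\<dots> = ennreal (\<integral>x. exp (- (norm x)\<^sup>2) / gauss_mass TYPE('a) \<partial>(lborel :: 'a measure))"
    using gauss_mass_pos[where 'a='a] integrable_gauss by (intro nn_integral_eq_integral) auto
  also have "\<dots> = 1"
    using gauss_mass_pos[where 'a='a] by (simp add: gauss_mass_def)
  finally show ?thesis .
qed

lemma integrable_heat: "t > 0 \<Longrightarrow> integrable (lborel :: 'a::euclidean_space measure) (heat t)"
  using nn_integral_heat[where 'a='a] by (intro integrableI_bounded) auto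

lemma integral_heat: "t > 0 \<Longrightarrow> (\<integral>x. heat t x \<partial>(lborel :: 'a::euclidean_space measure)) = 1"
  using nn_integral_heat[where 'a='a] by (subst integral_eq_nn_integral) auto

lemma nn_integral_heat_translate [simp]:
  "t > 0 \<Longrightarrow> (\<integral>\<^sup>+y. ennreal (heat t (x - y)) \<partial>(lborel :: 'a::euclidean_space measure)) = 1"
  "t > 0 \<Longrightarrow> (\<integral>\<^sup>+y. ennreal (heat t (y - x)) \<partial>(lborel :: 'a::euclidean_space measure)) = 1"
proof -
  assume t: "t > 0"
  show 1: "(\<integral>\<^sup>+y. ennreal (heat t (x - y)) \<partial>(lborel :: 'a measure)) = 1"
    using nn_integral_lborel_reflect[of "\<lambda>y. ennreal (heat t y)" x] nn_integral_heat[OF t, where 'a='a] by simp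
  have "heat t (y - x) = heat t (x - y)" for y using heat_minus[of t "x - y"] by simp
  then show "(\<integral>\<^sup>+y. ennreal (heat t (y - x)) \<partial>(lborel :: 'a measure)) = 1" using 1 by simp
qed

text \<open>The price of doubling the time. Half of the Gaussian exponent at time \<open>t\<close>
  is the exponent at time \<open>2 * t\<close>, and the prefactors of the two kernels differ by
  \<open>2 powr (n / 2)\<close>; see \<open>heat_double\<close>.\<close>

definition heat_const :: "'a::euclidean_space itself \<Rightarrow> real" where
  "heat_const _ = 2 powr (real DIM('a) / 2)"

lemma heat_const_pos: "heat_const TYPE('a::euclidean_space) \<ge> 1"
  unfolding heat_const_def by (simp add: ge_one_powr_ge_zero)

lemma heat_le_sup:
  "t > 0 \<Longrightarrow> heat t (x::'a::euclidean_space) \<le> t powr (- real DIM('a) / 2) / gauss_mass TYPE('a)"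
  unfolding heat_def using gauss_mass_pos[where 'a='a] by (intro divide_right_mono) (auto intro!: mult_left_le)

lemma heat_double:
  assumes "t > 0"
  shows "exp ((norm x)\<^sup>2 / (2 * t)) * heat t x = heat_const TYPE('a) * heat (2 * t) (x::'a::euclidean_space)"
proof -
  have "exp ((norm x)\<^sup>2 / (2 * t)) * exp (- (norm x)\<^sup>2 / t) = exp (- (norm x)\<^sup>2 / (2 * t))"
    using assms by (simp flip: exp_add add: field_simps)
  moreover have "t powr (- real DIM('a) / 2) = heat_const TYPE('a) * (2 * t) powr (- real DIM('a) / 2)"
    using assms unfolding heat_const_def by (simp add: powr_mult flip: powr_add mult.assoc)
  ultimately show ?thesis
    unfolding heat_def by (simp add: mult.assoc mult.left_commute)
qed

text \<open>Polynomial factors are absorbed by giving away half of the Gaussian exponent. The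
  majorant is again a multiple of a heat kernel, which has mass 1, so moment and derivative bounds
  need no further integration.\<close>

lemma heat_moment_bound:
  assumes "t > 0" and "\<bar>c\<bar> \<le> C * exp ((norm x)\<^sup>2 / (2 * t))"
  shows "\<bar>c\<bar> * heat t x \<le> C * heat_const TYPE('a) * heat (2 * t) (x::'a::euclidean_space)"
proof -
  have "\<bar>c\<bar> * heat t x \<le> (C * exp ((norm x)\<^sup>2 / (2 * t))) * heat t x"
    using assms(2) by (intro mult_right_mono) auto
  also have "\<dots> = C * (heat_const TYPE('a) * heat (2 * t) x)"
    unfolding heat_double[OF assms(1), symmetric] by simp
  finally show ?thesis by (simp add: mult_ac)
qed

lemma heat_le_double:
  "t > 0 \<Longrightarrow> heat t x \<le> heat_const TYPE('a) * heat (2 * t) (x::'a::euclidean_space)"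
  using heat_moment_bound[of t 1 1 x] by (simp)

lemma norm_heat_le:
  assumes "t > 0"
  shows "norm x * heat t x \<le> heat_const TYPE('a) * sqrt t * heat (2 * t) (x::'a::euclidean_space)"
proof -
  have "norm x / sqrt t \<le> exp ((norm x)\<^sup>2 / (2 * t))"
  proof -
    have "0 \<le> (norm x / sqrt t - 1)\<^sup>2" by simp
    then have "norm x / sqrt t \<le> 1 + (norm x / sqrt t)\<^sup>2 / 2" unfolding power2_diff by simp
    also have "\<dots> = 1 + (norm x)\<^sup>2 / (2 * t)" using assms by (simp add: power_divide)
    also have "\<dots> \<le> exp ((norm x)\<^sup>2 / (2 * t))" by (rule exp_ge_add_one_self)
    finally show ?thesis .
  qed
  then show ?thesis
    using heat_moment_bound[of t "norm x" "sqrt t" x] assms by (simp add: field_simps)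
qed

lemma norm_sq_heat_le:
  assumes "t > 0"
  shows "(norm x)\<^sup>2 * heat t x \<le> 2 * heat_const TYPE('a) * t * heat (2 * t) (x::'a::euclidean_space)"
proof -
  have "(norm x)\<^sup>2 / (2 * t) \<le> exp ((norm x)\<^sup>2 / (2 * t))"
    using exp_ge_add_one_self[of "(norm x)\<^sup>2 / (2 * t)"] by linarith
  then show ?thesis
    using heat_moment_bound[of t "(norm x)\<^sup>2" "2 * t" x] assms by (simp add: field_simps)
qed

section \<open>Derivatives and moments of the kernel\<close>

definition heat_grad :: "real \<Rightarrow> 'a::euclidean_space \<Rightarrow> 'a" where
  "heat_grad t x = (- 2 / t * heat t x) *\<^sub>R x"

text \<open>Since \<open>heat t\<close> is the standard kernel at time \<open>t / 4\<close>, four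
  times its time derivative is its Laplacian. Hence the factor 4 that relates \<open>heat_dt\<close>
  to compositions of \<open>heat_grad\<close> later on.\<close>

definition heat_dt :: "real \<Rightarrow> 'a::euclidean_space \<Rightarrow> real" where
  "heat_dt t x = ((norm x)\<^sup>2 / t\<^sup>2 - real DIM('a) / (2 * t)) * heat t x"

lemma measurable_heat_grad [measurable (raw)]:
  fixes f :: "'b \<Rightarrow> 'a::euclidean_space"
  assumes [measurable]: "g \<in> borel_measurable N" "f \<in> borel_measurable N"
  shows "(\<lambda>x. heat_grad (g x) (f x)) \<in> borel_measurable N"
  unfolding heat_grad_def by measurable

lemma measurable_heat_dt [measurable (raw)]:
  fixes f :: "'b \<Rightarrow> 'a::euclidean_space"
  assumes [measurable]: "g \<in> borel_measurable N" "f \<in> borel_measurable N"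
  shows "(\<lambda>x. heat_dt (g x) (f x)) \<in> borel_measurable N"
  unfolding heat_dt_def by measurable

lemma norm_heat_grad_le:
  assumes "t > 0"
  shows "norm (heat_grad t x) \<le> 2 * heat_const TYPE('a) * t powr (-1/2) * heat (2 * t) (x::'a::euclidean_space)"
proof -
  have "norm (heat_grad t x) = 2 / t * (norm x * heat t x)"
    using assms by (simp add: heat_grad_def abs_mult)
  also have "\<dots> \<le> 2 / t * (heat_const TYPE('a) * sqrt t * heat (2 * t) x)"
    using assms norm_heat_le[of t x] by (intro mult_left_mono) auto
  also have "\<dots> = 2 * heat_const TYPE('a) * (sqrt t / t) * heat (2 * t) x" by simp
  also have "sqrt t / t = t powr (-1/2)"
  proof -
    have "t powr (1/2) / t powr 1 = t powr (1/2 - 1)" by (simp only: powr_diff)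
    then show ?thesis using assms by (simp add: powr_half_sqrt)
  qed
  finally show ?thesis .
qed

lemma abs_heat_dt_le:
  assumes "t > 0"
  shows "\<bar>heat_dt t x\<bar> \<le> (2 + real DIM('a)) * heat_const TYPE('a) * t powr (-1) * heat (2 * t) (x::'a::euclidean_space)"
proof -
  have "\<bar>(norm x)\<^sup>2 / t\<^sup>2 - real DIM('a) / (2 * t)\<bar> \<le> (norm x)\<^sup>2 / t\<^sup>2 + real DIM('a) / (2 * t)"
    using assms abs_triangle_ineq4[of "(norm x)\<^sup>2 / t\<^sup>2" "real DIM('a) / (2 * t)"] by simp
  then have "\<bar>heat_dt t x\<bar> \<le> (norm x)\<^sup>2 / t\<^sup>2 * heat t x + real DIM('a) / (2 * t) * heat t x"
    unfolding heat_dt_def abs_mult distrib_right[symmetric] abs_of_nonneg[OF heat_nonneg]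
    by (intro mult_right_mono) auto
  also have "(norm x)\<^sup>2 / t\<^sup>2 * heat t x \<le> (2 * heat_const TYPE('a) * t * heat (2 * t) x) / t\<^sup>2"
    using norm_sq_heat_le[OF assms, of x] by (simp add: divide_right_mono)
  also have "\<dots> = 2 * heat_const TYPE('a) * t powr (-1) * heat (2 * t) x"
    using assms by (simp add: power2_eq_square powr_minus_divide)
  also have "real DIM('a) / (2 * t) * heat t x \<le> real DIM('a) / (2 * t) * (heat_const TYPE('a) * heat (2 * t) x)"
    using assms heat_le_double[OF assms, of x] by (intro mult_left_mono) auto
  also have "\<dots> \<le> real DIM('a) * heat_const TYPE('a) * t powr (-1) * heat (2 * t) x"
    using assms heat_const_pos[where 'a='a] by (simp add: powr_minus_divide divide_simps mult_mono)
  finally show ?thesis by (simp add: algebra_simps)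
qed

lemma heat_has_derivative_time:
  assumes "t > 0"
  shows "((\<lambda>t. heat t x) has_real_derivative heat_dt t x) (at t)"
proof -
  have g: "gauss_mass TYPE('a) \<noteq> 0" using gauss_mass_pos[where 'a='a] by simp
  have 1: "((\<lambda>t. t powr (- real DIM('a) / 2)) has_real_derivative (- real DIM('a) / 2) * (t powr (- real DIM('a) / 2) / t)) (at t)"
    using assms by (auto intro!: derivative_eq_intros simp: powr_diff)
  have 2: "((\<lambda>t. exp (- (norm x)\<^sup>2 / t)) has_real_derivative exp (- (norm x)\<^sup>2 / t) * ((norm x)\<^sup>2 / t\<^sup>2)) (at t)"
    using assms by (auto intro!: derivative_eq_intros simp: power2_eq_square)
  show ?thesis
    unfolding heat_def[abs_def] heat_dt_def heat_def
    by (rule DERIV_cong[OF DERIV_cdivide[OF DERIV_mult[OF 1 2]]])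
       (use assms g in \<open>simp add: divide_simps power2_eq_square, simp add: algebra_simps\<close>)
qed

lemma integrable_heat_moments:
  fixes t :: real assumes "t > 0"
  shows integrable_norm_sq_heat: "integrable (lborel :: 'a::euclidean_space measure) (\<lambda>x. (norm x)\<^sup>2 * heat t x)"
    and integrable_heat_grad: "integrable (lborel :: 'a::euclidean_space measure) (heat_grad t)"
    and integrable_heat_dt: "integrable (lborel :: 'a::euclidean_space measure) (heat_dt t)"
    and integrable_heat_scaleR: "integrable (lborel :: 'a::euclidean_space measure) (\<lambda>x. heat t x *\<^sub>R x)"
proof -
  have h: "integrable (lborel :: 'a measure) (\<lambda>x. C * heat (2 * t) x)" for C
    using integrable_heat[of "2 * t", where 'a='a] assms by auto
  show "integrable (lborel :: 'a measure) (\<lambda>x. (norm x)\<^sup>2 * heat t x)"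
    by (rule Bochner_Integration.integrable_bound[OF h[of "2 * heat_const TYPE('a) * t"]])
       (use norm_sq_heat_le[OF assms, where 'a='a] in \<open>auto intro!: AE_I2 intro: order_trans[OF _ abs_ge_self]\<close>)
  show "integrable (lborel :: 'a measure) (heat_grad t)"
    by (rule Bochner_Integration.integrable_bound[OF h[of "2 * heat_const TYPE('a) * t powr (-1/2)"]])
       (use norm_heat_grad_le[OF assms] in \<open>auto intro!: AE_I2 intro: order_trans[OF _ abs_ge_self]\<close>)
  show "integrable (lborel :: 'a measure) (heat_dt t)"
    by (rule Bochner_Integration.integrable_bound[OF h[of "(2 + real DIM('a)) * heat_const TYPE('a) * t powr (-1)"]])
       (measurable, intro AE_I2, unfold real_norm_def, rule order_trans[OF abs_heat_dt_le[OF assms] abs_ge_self])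
  show "integrable (lborel :: 'a measure) (\<lambda>x. heat t x *\<^sub>R x)"
    by (rule Bochner_Integration.integrable_bound[OF h[of "heat_const TYPE('a) * sqrt t"]])
       (use norm_heat_le[OF assms] in \<open>auto intro!: AE_I2 simp: mult.commute intro: order_trans[OF _ abs_ge_self]\<close>)
qed

lemma integral_odd_heat:
  "(\<integral>x. heat t x *\<^sub>R x \<partial>(lborel :: 'a::euclidean_space measure)) = 0"
proof -
  have "(\<integral>x. heat t x *\<^sub>R x \<partial>(lborel :: 'a measure)) = (\<integral>x. - (heat t x *\<^sub>R x) \<partial>(lborel :: 'a measure))"
    using integral_lborel_reflect[of "\<lambda>x. heat t x *\<^sub>R x" "0::'a"] by simp
  then have "2 *\<^sub>R (\<integral>x. heat t x *\<^sub>R x \<partial>(lborel :: 'a measure)) = 0"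
    by (simp add: scaleR_2 eq_neg_iff_add_eq_0)
  then show ?thesis by simp
qed

lemma integral_norm_sq_heat_scale:
  assumes t: "t > 0"
  shows "(\<integral>x. (norm x)\<^sup>2 * heat t x \<partial>(lborel :: 'a::euclidean_space measure)) =
         t * (\<integral>x. (norm x)\<^sup>2 * heat 1 x \<partial>(lborel :: 'a measure))"
proof -
  have c: "sqrt t \<noteq> 0" using t by simp
  have "(\<integral>x. (norm x)\<^sup>2 * heat t x \<partial>(lborel :: 'a measure)) =
      (\<integral>x. (sqrt t ^ DIM('a)) * ((norm (sqrt t *\<^sub>R x))\<^sup>2 * heat t (sqrt t *\<^sub>R x)) \<partial>(lborel :: 'a measure))"
    using t by (subst lborel_affine[OF c, of 0])
      (simp add: integral_density integral_distr ennreal_power)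
  also have "\<dots> = (\<integral>x. t * ((norm x)\<^sup>2 * heat 1 x) \<partial>(lborel :: 'a measure))"
  proof (intro Bochner_Integration.integral_cong refl)
    fix x :: 'a
    have "sqrt t ^ DIM('a) * t powr (- real DIM('a) / 2) = 1"
      using t by (simp add: powr_half_sqrt[symmetric] powr_powr flip: powr_realpow powr_add)
    moreover have "heat t (sqrt t *\<^sub>R x) = t powr (- real DIM('a) / 2) * heat 1 x"
      unfolding heat_def using t by (simp add: power_mult_distrib)
    ultimately have *: "sqrt t ^ DIM('a) * heat t (sqrt t *\<^sub>R x) = heat 1 x"
      by (metis mult.assoc mult_1)
    have "(sqrt t ^ DIM('a)) * ((norm (sqrt t *\<^sub>R x))\<^sup>2 * heat t (sqrt t *\<^sub>R x)) =
        (norm (sqrt t *\<^sub>R x))\<^sup>2 * (sqrt t ^ DIM('a) * heat t (sqrt t *\<^sub>R x))" by (simp only: mult.left_commute)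
    also have "\<dots> = t * ((norm x)\<^sup>2 * heat 1 x)" unfolding * using t by (simp add: power_mult_distrib)
    finally show "(sqrt t ^ DIM('a)) * ((norm (sqrt t *\<^sub>R x))\<^sup>2 * heat t (sqrt t *\<^sub>R x)) = t * ((norm x)\<^sup>2 * heat 1 x)" .
  qed
  finally show ?thesis by simp
qed

text \<open>Since \<open>\<integral> heat t\<close> does not depend on \<open>t\<close>, integrating \<open>heat_dt\<close> over \<open>[1,2] \<times> \<real>\<^sup>n\<close> gives \<open>0\<close>.\<close>
lemma integral_norm_sq_heat:
  assumes "t > 0"
  shows "(\<integral>x. (norm x)\<^sup>2 * heat t x \<partial>(lborel :: 'a::euclidean_space measure)) = real DIM('a) * t / 2"
proof -
  define m where "m = (\<integral>x. (norm x)\<^sup>2 * heat 1 x \<partial>(lborel :: 'a measure))"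
  \<comment> \<open>\<open>k\<close> is the error in the claimed second moment at time 1. By
    scaling, \<open>heat_dt t\<close> has integral \<open>k / t\<close>, and \<open>k = 0\<close>
    will follow because the integral of \<open>1 / t\<close> over [1,2] is \<open>ln 2\<close>, not
    0.\<close>
  define k where "k = m - real DIM('a) / 2"
  have int_dt: "(\<integral>x. heat_dt t x \<partial>(lborel :: 'a measure)) = k / t" if "t > 0" for t
  proof -
    have "(\<integral>x. heat_dt t x \<partial>(lborel :: 'a measure)) = (\<integral>x. (1 / t\<^sup>2) * ((norm x)\<^sup>2 * heat t x) - real DIM('a) / (2 * t) * heat t x \<partial>(lborel :: 'a measure))"
      by (simp add: heat_dt_def left_diff_distrib)
    also have "\<dots> = (1 / t\<^sup>2) * (t * m) - real DIM('a) / (2 * t)"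
      using integral_norm_sq_heat_scale[OF that, where 'a='a] integral_heat[OF that, where 'a='a]
        integrable_heat[OF that, where 'a='a] integrable_norm_sq_heat[OF that, where 'a='a]
      by (subst Bochner_Integration.integral_diff) (auto simp: m_def)
    also have "\<dots> = k / t" unfolding k_def using that by (simp add: field_simps power2_eq_square)
    finally show ?thesis .
  qed
  have ftc: "(\<integral>t. indicator {1..2} t *\<^sub>R heat_dt t x \<partial>lborel) = heat 2 x - heat 1 x" for x :: 'a
  proof (rule integral_FTC_Icc)
    show "((\<lambda>t. heat t x) has_vector_derivative heat_dt s x) (at s within {1..2})" if "1 \<le> s" "s \<le> 2" for s
      using heat_has_derivative_time[of s x] that
      by (auto simp: has_real_derivative_iff_has_vector_derivative intro: has_vector_derivative_at_within)
    show "continuous_on {1..2} (\<lambda>s. heat_dt s x)"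
      unfolding heat_dt_def heat_def using gauss_mass_pos[where 'a='a]
      by (intro continuous_intros) auto
  qed simp
  have "integrable (lborel \<Otimes>\<^sub>M lborel) (\<lambda>(t, x::'a). indicator {1..2} t *\<^sub>R heat_dt t x)"
  proof (rule integrableI_bounded)
    show "(\<lambda>(t, x::'a). indicator {1..2} t *\<^sub>R heat_dt t x) \<in> borel_measurable (lborel \<Otimes>\<^sub>M lborel)"
      by measurable
    \<comment> \<open>Joint integrability for Fubini: on [1,2] the factor \<open>t powr (-1)\<close>
      is at most 1, and the kernel at time \<open>2 * t\<close> has mass 1.\<close>
    have b: "(\<integral>\<^sup>+x. ennreal (norm (indicator {1..2} t *\<^sub>R heat_dt t (x::'a))) \<partial>lborel) \<le>
      ennreal ((2 + real DIM('a)) * heat_const TYPE('a)) * indicator {1..2} t" (is "?l t \<le> ?r t") for t :: real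
    proof (cases "t \<in> {1..2}")
      case True
      then have t: "t > 0" by simp
      have "?l t \<le> (\<integral>\<^sup>+x. ennreal ((2 + real DIM('a)) * heat_const TYPE('a)) * ennreal (heat (2 * t) (x::'a)) \<partial>lborel)"
      proof (intro nn_integral_mono)
        fix x :: 'a
        have "\<bar>heat_dt t x\<bar> \<le> (2 + real DIM('a)) * heat_const TYPE('a) * t powr (-1) * heat (2 * t) x"
          by (rule abs_heat_dt_le[OF t])
        also have "\<dots> \<le> (2 + real DIM('a)) * heat_const TYPE('a) * 1 * heat (2 * t) x"
          using True heat_const_pos[where 'a='a] by (intro mult_right_mono mult_left_mono) (auto simp: powr_minus_divide)
        finally show "ennreal (norm (indicator {1..2} t *\<^sub>R heat_dt t x)) \<le> ennreal ((2 + real DIM('a)) * heat_const TYPE('a)) * ennreal (heat (2 * t) x)"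
          using True heat_const_pos[where 'a='a] by (simp flip: ennreal_mult)
      qed
      then show ?thesis using True t by (simp add: nn_integral_cmult nn_integral_heat)
    qed simp
    have "(\<integral>\<^sup>+p. ennreal (norm (case p of (t, x::'a) \<Rightarrow> indicator {1..2} t *\<^sub>R heat_dt t x)) \<partial>(lborel \<Otimes>\<^sub>M lborel)) = (\<integral>\<^sup>+t. ?l t \<partial>lborel)"
      by (subst lborel.nn_integral_fst[symmetric]) (auto simp: split_beta')
    also have "\<dots> \<le> (\<integral>\<^sup>+t. ?r t \<partial>lborel)" by (intro nn_integral_mono b)
    also have "\<dots> < \<infinity>" by (simp add: nn_integral_cmult ennreal_mult_less_top)
    finally show "(\<integral>\<^sup>+p. ennreal (norm (case p of (t, x::'a) \<Rightarrow> indicator {1..2} t *\<^sub>R heat_dt t x)) \<partial>(lborel \<Otimes>\<^sub>M lborel)) < \<infinity>" .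
  qed
  then have "(\<integral>x. (\<integral>t. indicator {1..2} t *\<^sub>R heat_dt t x \<partial>lborel) \<partial>(lborel :: 'a measure)) =
      (\<integral>t. (\<integral>x. indicator {1..2} t *\<^sub>R heat_dt t x \<partial>(lborel :: 'a measure)) \<partial>lborel)"
    by (rule lborel_pair.Fubini_integral)
  moreover have "(\<integral>x. (\<integral>t. indicator {1..2} t *\<^sub>R heat_dt t x \<partial>lborel) \<partial>(lborel :: 'a measure)) = 0"
    unfolding ftc using integrable_heat[of 1, where 'a='a] integrable_heat[of 2, where 'a='a]
      integral_heat[of 1, where 'a='a] integral_heat[of 2, where 'a='a] by simp
  moreover have "(\<integral>x. indicator {1..2} t *\<^sub>R heat_dt t x \<partial>(lborel :: 'a measure)) = k * (indicator {1..2} t *\<^sub>R (1 / t))" for t :: real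
    using int_dt[of t] by (auto split: split_indicator)
  moreover have "(\<integral>t. indicator {1..2} t *\<^sub>R (1 / t) \<partial>lborel) = ln 2 - ln (1::real)"
    by (rule integral_FTC_Icc[where F = ln])
       (auto intro!: continuous_intros derivative_eq_intros simp flip: has_real_derivative_iff_has_vector_derivative)
  ultimately have "k * ln 2 = 0"
    by (simp only: integral_mult_right_zero ln_one diff_zero)
  then have "k = 0" by simp
  then show ?thesis
    using integral_norm_sq_heat_scale[OF assms, where 'a='a] unfolding k_def m_def by simp
qed

text \<open>Completing the square in \<open>y\<close>: the product is a Gaussian in \<open>x\<close>
  at the summed time and a Gaussian in \<open>y\<close> at the time \<open>t * s / (t + s)\<close>,
  centred at \<open>(s / (t + s)) *\<^sub>R x\<close>. Convolution identities thereby become moments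
  of a centred Gaussian.\<close>

lemma heat_mult_heat:
  fixes x y :: "'a::euclidean_space"
  assumes "t > 0" "s > 0"
  shows "heat t (x - y) * heat s y = heat (t + s) x * heat (t * s / (t + s)) (y - (s / (t + s)) *\<^sub>R x)"
proof -
  define u where "u = y - (s / (t + s)) *\<^sub>R x"
  have y: "y = u + (s / (t + s)) *\<^sub>R x" by (simp add: u_def)
  have st: "1 - s / (t + s) = t / (t + s)" using assms by (simp add: field_simps)
  have xy: "x - y = (t / (t + s)) *\<^sub>R x - u"
    unfolding y st[symmetric] by (simp add: scaleR_diff_left)
  have n1: "(norm (x - y))\<^sup>2 = (t / (t + s))\<^sup>2 * (norm x)\<^sup>2 - 2 * (t / (t + s)) * (x \<bullet> u) + (norm u)\<^sup>2"
    unfolding xy power2_norm_eq_inner by (simp add: inner_diff_left inner_diff_right inner_commute power2_eq_square)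
  have n2: "(norm y)\<^sup>2 = (s / (t + s))\<^sup>2 * (norm x)\<^sup>2 + 2 * (s / (t + s)) * (x \<bullet> u) + (norm u)\<^sup>2"
    unfolding y power2_norm_eq_inner by (simp add: inner_add_left inner_add_right inner_commute power2_eq_square)
  have ts: "t + s \<noteq> 0" "t \<noteq> 0" "s \<noteq> 0" using assms by auto
  have e: "- (norm (x - y))\<^sup>2 / t + - (norm y)\<^sup>2 / s = - (norm x)\<^sup>2 / (t + s) + - (norm u)\<^sup>2 / (t * s / (t + s))"
    unfolding n1 n2 using ts by (simp add: divide_simps power2_eq_square) (simp add: algebra_simps)
  have p: "t powr a * s powr a = (t + s) powr a * (t * s / (t + s)) powr a" for a
    using assms by (simp add: powr_mult[symmetric])
  let ?g = "gauss_mass TYPE('a)" let ?a = "- real DIM('a) / 2"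
  have "heat t (x - y) * heat s y = (t powr ?a * s powr ?a) * exp (- (norm (x - y))\<^sup>2 / t + - (norm y)\<^sup>2 / s) / ?g / ?g"
    unfolding heat_def exp_add by simp
  also have "\<dots> = ((t + s) powr ?a * (t * s / (t + s)) powr ?a) * exp (- (norm x)\<^sup>2 / (t + s) + - (norm u)\<^sup>2 / (t * s / (t + s))) / ?g / ?g"
    unfolding e p ..
  also have "\<dots> = heat (t + s) x * heat (t * s / (t + s)) u"
    unfolding heat_def exp_add by simp
  finally show ?thesis unfolding u_def .
qed

text \<open>After recentring, the first moment of the remaining Gaussian vanishes and only the
  constant \<open>(t / (t + s)) *\<^sub>R x\<close> survives; its factor turns \<open>1 / t\<close>
  into \<open>1 / (t + s)\<close>.\<close>

lemma heat_grad_conv_heat: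
  fixes x :: "'a::euclidean_space"
  assumes "t > 0" "s > 0"
  shows "(\<integral>y. heat s y *\<^sub>R heat_grad t (x - y) \<partial>lborel) = heat_grad (t + s) x"
proof -
  define r where "r = t * s / (t + s)"
  have r: "r > 0" using assms by (simp add: r_def)
  let ?c = "(s / (t + s)) *\<^sub>R x"
  have st: "1 - s / (t + s) = t / (t + s)" using assms by (simp add: field_simps)
  have "(\<integral>y. heat s y *\<^sub>R heat_grad t (x - y) \<partial>lborel) = (\<integral>y. (\<lambda>u. (- 2 / t * heat (t + s) x) *\<^sub>R (heat r u *\<^sub>R ((t / (t + s)) *\<^sub>R x - u))) (- ?c + y) \<partial>lborel)"
  proof (intro Bochner_Integration.integral_cong refl)
    fix y
    have "(t / (t + s)) *\<^sub>R x - (- ?c + y) = x - y"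
      unfolding st[symmetric] by (simp add: scaleR_diff_left)
    moreover have "heat s y *\<^sub>R heat_grad t (x - y) = (- 2 / t * (heat t (x - y) * heat s y)) *\<^sub>R (x - y)"
      by (simp add: heat_grad_def)
    ultimately show "heat s y *\<^sub>R heat_grad t (x - y) = (\<lambda>u. (- 2 / t * heat (t + s) x) *\<^sub>R (heat r u *\<^sub>R ((t / (t + s)) *\<^sub>R x - u))) (- ?c + y)"
      unfolding heat_mult_heat[OF assms] r_def by (simp only: scaleR_scaleR) (simp add: mult_ac)
  qed
  also have "\<dots> = (\<integral>u. (- 2 / t * heat (t + s) x) *\<^sub>R (heat r u *\<^sub>R ((t / (t + s)) *\<^sub>R x - u)) \<partial>lborel)"
    by (rule integral_lborel_translate) measurable
  also have "\<dots> = (- 2 / t * heat (t + s) x) *\<^sub>R (\<integral>u. heat r u *\<^sub>R ((t / (t + s)) *\<^sub>R x - u) \<partial>lborel)"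
    by (rule integral_scaleR_right)
  also have "(\<integral>u. heat r u *\<^sub>R ((t / (t + s)) *\<^sub>R x - u) \<partial>lborel) = (t / (t + s)) *\<^sub>R x"
    unfolding scaleR_diff_right using integrable_heat[OF r, where 'a='a] integrable_heat_scaleR[OF r, where 'a='a]
    by (subst Bochner_Integration.integral_diff) (simp_all add: integral_odd_heat integral_heat[OF r])
  finally show ?thesis using assms by (simp add: heat_grad_def)
qed

text \<open>The divergence of a gradient is the Laplacian, here four times the time derivative. The
  identity is computed instead of differentiated: \<open>(x - y) \<bullet> y\<close> is expanded
  about the centre, the cross term is odd, and the quadratic term is the second moment
  \<open>integral_norm_sq_heat\<close>.\<close>

lemma heat_grad_conv_heat_grad:
  fixes x :: "'a::euclidean_space"
  assumes "t > 0" "s > 0"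
  shows "(\<integral>y. heat_grad t (x - y) \<bullet> heat_grad s y \<partial>lborel) = 4 * heat_dt (t + s) x"
proof -
  define r where "r = t * s / (t + s)"
  have r: "r > 0" using assms by (simp add: r_def)
  let ?c = "(s / (t + s)) *\<^sub>R x"
  have st: "1 - s / (t + s) = t / (t + s)" using assms by (simp add: field_simps)
  let ?k = "4 / (t * s) * heat (t + s) x"
  define e where "e = (t - s) / (t + s)"
  let ?F = "\<lambda>u. ?k * ((t * s / (t + s)\<^sup>2 * (norm x)\<^sup>2) * heat r u + e * (x \<bullet> (heat r u *\<^sub>R u)) - (norm u)\<^sup>2 * heat r u)"
  have "(\<integral>y. heat_grad t (x - y) \<bullet> heat_grad s y \<partial>lborel) = (\<integral>y. ?F (- ?c + y) \<partial>lborel)"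
  proof (intro Bochner_Integration.integral_cong refl)
    fix y
    define u where "u = - ?c + y"
    have y: "y = u + ?c" by (simp add: u_def)
    have xy: "x - y = (t / (t + s)) *\<^sub>R x - u"
      unfolding y st[symmetric] by (simp add: scaleR_diff_left)
    have "(x - y) \<bullet> y = t * s / (t + s)\<^sup>2 * (norm x)\<^sup>2 + e * (x \<bullet> u) - (norm u)\<^sup>2"
    proof -
      have e: "e = t / (t + s) - s / (t + s)" by (simp add: e_def diff_divide_distrib)
      show ?thesis
        unfolding xy unfolding y power2_norm_eq_inner e inner_diff_left inner_add_right inner_scaleR_left inner_scaleR_right
        by (simp add: inner_commute power2_eq_square left_diff_distrib right_diff_distrib diff_divide_distrib)
    qed
    moreover have "heat_grad t (x - y) \<bullet> heat_grad s y = 4 / (t * s) * (heat t (x - y) * heat s y) * ((x - y) \<bullet> y)"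
      by (simp add: heat_grad_def mult_ac)
    moreover have "heat t (x - y) * heat s y = heat (t + s) x * heat r u"
      unfolding heat_mult_heat[OF assms] r_def u_def by simp
    ultimately have "heat_grad t (x - y) \<bullet> heat_grad s y = 4 / (t * s) * (heat (t + s) x * heat r u) *
        (t * s / (t + s)\<^sup>2 * (norm x)\<^sup>2 + e * (x \<bullet> u) - (norm u)\<^sup>2)"
      by simp
    also have "\<dots> = ?F u" by (simp add: distrib_left right_diff_distrib mult_ac)
    finally show "heat_grad t (x - y) \<bullet> heat_grad s y = ?F (- ?c + y)"
      unfolding u_def .
  qed
  also have "\<dots> = (\<integral>u. ?F u \<partial>lborel)"
    by (rule integral_lborel_translate) measurable
  also have "\<dots> = ?k * (\<integral>u. (t * s / (t + s)\<^sup>2 * (norm x)\<^sup>2) * heat r u + e * (x \<bullet> (heat r u *\<^sub>R u)) - (norm u)\<^sup>2 * heat r u \<partial>lborel)"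
    by (rule integral_mult_right_zero)
  also have "(\<integral>u. (t * s / (t + s)\<^sup>2 * (norm x)\<^sup>2) * heat r u + e * (x \<bullet> (heat r u *\<^sub>R u)) - (norm u)\<^sup>2 * heat r u \<partial>lborel)
      = t * s / (t + s)\<^sup>2 * (norm x)\<^sup>2 - real DIM('a) * r / 2"
  proof -
    note I = integrable_heat[OF r, where 'a='a] integrable_heat_scaleR[OF r, where 'a='a] integrable_norm_sq_heat[OF r, where 'a='a]
    have i2: "integrable lborel (\<lambda>u. x \<bullet> (heat r u *\<^sub>R u))" using I(2) by (rule integrable_inner_right)
    have "(\<integral>u. x \<bullet> (heat r u *\<^sub>R u) \<partial>lborel) = x \<bullet> (\<integral>u. heat r u *\<^sub>R u \<partial>lborel)"
      using I(2) by (intro integral_inner_right) auto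
    then have z: "(\<integral>u. x \<bullet> (heat r u *\<^sub>R u) \<partial>lborel) = 0" by (simp add: integral_odd_heat)
    have "(\<integral>u. (t * s / (t + s)\<^sup>2 * (norm x)\<^sup>2) * heat r u + e * (x \<bullet> (heat r u *\<^sub>R u)) - (norm u)\<^sup>2 * heat r u \<partial>lborel)
      = (\<integral>u. (t * s / (t + s)\<^sup>2 * (norm x)\<^sup>2) * heat r u + e * (x \<bullet> (heat r u *\<^sub>R u)) \<partial>lborel) - (\<integral>u. (norm u)\<^sup>2 * heat r (u::'a) \<partial>lborel)"
      using I i2 by (intro Bochner_Integration.integral_diff Bochner_Integration.integrable_add integrable_mult_right) auto
    also have "(\<integral>u. (t * s / (t + s)\<^sup>2 * (norm x)\<^sup>2) * heat r u + e * (x \<bullet> (heat r u *\<^sub>R u)) \<partial>lborel) =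
      (\<integral>u. (t * s / (t + s)\<^sup>2 * (norm x)\<^sup>2) * heat r (u::'a) \<partial>lborel) + (\<integral>u. e * (x \<bullet> (heat r u *\<^sub>R u)) \<partial>lborel)"
      using I i2 by (intro Bochner_Integration.integral_add integrable_mult_right) auto
    also have "(\<integral>u. (t * s / (t + s)\<^sup>2 * (norm x)\<^sup>2) * heat r (u::'a) \<partial>lborel) = t * s / (t + s)\<^sup>2 * (norm x)\<^sup>2"
      by (simp only: integral_mult_right_zero integral_heat[OF r])
    also have "(\<integral>u. e * (x \<bullet> (heat r u *\<^sub>R u)) \<partial>lborel) = 0"
      by (simp only: integral_mult_right_zero z)
    finally show ?thesis by (simp add: integral_norm_sq_heat[OF r])
  qed
  also have "?k * (t * s / (t + s)\<^sup>2 * (norm x)\<^sup>2 - real DIM('a) * r / 2) = 4 * heat_dt (t + s) x"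
  proof -
    have "4 / (t * s) * (t * s / (t + s)\<^sup>2 * (norm x)\<^sup>2 - real DIM('a) * r / 2) = 4 * ((norm x)\<^sup>2 / (t + s)\<^sup>2 - real DIM('a) / (2 * (t + s)))"
      unfolding r_def right_diff_distrib using assms by simp
    moreover have "?k * (t * s / (t + s)\<^sup>2 * (norm x)\<^sup>2 - real DIM('a) * r / 2) =
        4 / (t * s) * (t * s / (t + s)\<^sup>2 * (norm x)\<^sup>2 - real DIM('a) * r / 2) * heat (t + s) x"
      by (simp only: mult.assoc mult.commute[of "heat (t + s) x"])
    ultimately show ?thesis unfolding heat_dt_def by (simp only: mult.assoc)
  qed
  finally show ?thesis .
qed

section \<open>Riemann--Liouville weights\<close>

text \<open>The unnormalised Riemann--Liouville weights. The Dirac mass for \<open>b = 0\<close> makes the classical divergence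
  \<open>\<alpha> = 1\<close> the case \<open>b = (1 - \<alpha>) / 2 = 0\<close> of the general formulas.\<close>
definition rl :: "real \<Rightarrow> real measure" where
  "rl b = (if b = 0 then distr (count_space {()}) borel (\<lambda>_. 0)
           else density lborel (\<lambda>t. ennreal (indicator {0<..} t * t powr (b - 1))))"

lemma sets_rl [simp, measurable_cong]: "sets (rl b) = sets borel"
  by (simp add: rl_def)

lemma space_rl [simp]: "space (rl b) = UNIV"
  by (simp add: rl_def)

lemma nn_integral_rl_0: "F \<in> borel_measurable borel \<Longrightarrow> (\<integral>\<^sup>+t. F t \<partial>rl 0) = F 0"
  by (simp add: rl_def nn_integral_distr nn_integral_count_space_finite)

lemma nn_integral_rl:
  "b \<noteq> 0 \<Longrightarrow> F \<in> borel_measurable borel \<Longrightarrow>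
    (\<integral>\<^sup>+t. F t \<partial>rl b) = (\<integral>\<^sup>+t. ennreal (indicator {0<..} t * t powr (b - 1)) * F t \<partial>lborel)"
  by (simp add: rl_def nn_integral_density)

lemma sigma_finite_rl: "sigma_finite_measure (rl b)"
proof (cases "b = 0")
  case True
  interpret finite_measure "rl b"
    by (rule finite_measureI) (simp add: True rl_def emeasure_distr)
  show ?thesis by unfold_locales
next
  case False
  then show ?thesis
    unfolding rl_def by (auto simp: sigma_finite_measure.sigma_finite_iff_density_finite[OF sigma_finite_lborel])
qed

interpretation rl: sigma_finite_measure "rl b" by (rule sigma_finite_rl)
interpretation rl_lborel: pair_sigma_finite "rl b" lborel ..
interpretation lborel_rl: pair_sigma_finite lborel "rl b" ..
interpretation rl_rl: pair_sigma_finite "rl a" "rl b" ..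

lemma AE_rl_nonneg: "AE t in rl b. 0 \<le> t"
proof (cases "b = 0")
  case True
  then show ?thesis unfolding rl_def by (simp add: AE_distr_iff AE_count_space)
next
  case False
  then show ?thesis unfolding rl_def by (auto simp: AE_density indicator_def)
qed

lemma AE_rl_pos: "b > 0 \<Longrightarrow> AE t in rl b. 0 < t"
  unfolding rl_def by (auto simp: AE_density indicator_def)

section \<open>Power integrals against the weights\<close>

lemma nn_integral_powr_from_0:
  assumes "a > 0" "c \<ge> 0"
  shows "(\<integral>\<^sup>+t. ennreal (indicator {0..c} t * t powr (a - 1)) \<partial>lborel) = ennreal (c powr a / a)"
  using nn_integral_has_integral_lebesgue[OF _ has_integral_powr_from_0[of "a - 1" c]] assms by simp

lemma nn_integral_powr_to_inf:
  assumes "\<nu> > 0" "c > 0"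
  shows "(\<integral>\<^sup>+t. ennreal (indicator {c..} t * t powr (- \<nu> - 1)) \<partial>lborel) = ennreal (c powr (- \<nu>) / \<nu>)"
  using nn_integral_has_integral_lebesgue[OF _ has_integral_powr_to_inf[of "- \<nu> - 1" c]] assms by simp

text \<open>Pattern for the integrals over a time parameter: a power near 0 that stays integrable
  against the weight, and decay at infinity that beats the weight by \<open>l\<close>. The bound is
  explicit and linear in \<open>C\<close> and \<open>D\<close>, which later carry the variation and
  the norm of \<open>f\<close>.\<close>

lemma nn_integral_rl_split:
  assumes "b > 0" "0 < b + k" "0 < l" "c > 0" "C \<ge> 0" "D \<ge> 0"
    and [measurable]: "F \<in> borel_measurable borel"
    and 1: "\<And>t. 0 < t \<Longrightarrow> t < c \<Longrightarrow> F t \<le> ennreal (C * t powr k)"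
    and 2: "\<And>t. c \<le> t \<Longrightarrow> F t \<le> ennreal (D * t powr (- b - l))"
  shows "(\<integral>\<^sup>+t. F t \<partial>rl b) \<le> ennreal (C * (c powr (b + k) / (b + k)) + D * (c powr (- l) / l))"
proof -
  have "(\<integral>\<^sup>+t. F t \<partial>rl b) = (\<integral>\<^sup>+t. ennreal (indicator {0<..} t * t powr (b - 1)) * F t \<partial>lborel)"
    using assms by (intro nn_integral_rl) auto
  also have "\<dots> \<le> (\<integral>\<^sup>+t. ennreal C * ennreal (indicator {0..c} t * t powr ((b + k) - 1)) +
      ennreal D * ennreal (indicator {c..} t * t powr (- l - 1)) \<partial>lborel)"
  proof (intro nn_integral_mono)
    fix t :: real
    consider "t \<le> 0" | "0 < t" "t < c" | "c \<le> t" by linarith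
    then show "ennreal (indicator {0<..} t * t powr (b - 1)) * F t \<le> ennreal C * ennreal (indicator {0..c} t * t powr ((b + k) - 1)) +
      ennreal D * ennreal (indicator {c..} t * t powr (- l - 1))"
    proof cases
      case 2
      have "ennreal (indicator {0<..} t * t powr (b - 1)) * F t \<le> ennreal (t powr (b - 1)) * ennreal (C * t powr k)"
        using 2 assms(8)[of t] by (intro mult_mono) auto
      also have "\<dots> = ennreal (C * t powr (b + k - 1))"
        using assms(5) by (simp flip: ennreal_mult powr_add add: mult.left_commute algebra_simps)
      finally show ?thesis using 2 assms(4,5) by (simp add: ennreal_mult)
    next
      case 3
      have "ennreal (indicator {0<..} t * t powr (b - 1)) * F t \<le> ennreal (t powr (b - 1)) * ennreal (D * t powr (- b - l))"
        using 3 assms(4) assms(9)[of t] by (intro mult_mono) auto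
      also have "\<dots> = ennreal (D * t powr (- l - 1))"
        using assms(6) by (simp flip: ennreal_mult powr_add add: mult.left_commute minus_diff_commute)
      also have "\<dots> = ennreal D * ennreal (indicator {c..} t * t powr (- l - 1))"
        using 3 assms(6) by (simp add: ennreal_mult)
      finally show ?thesis by (simp add: add_increasing)
    qed simp
  qed
  also have "\<dots> = ennreal C * ennreal (c powr (b + k) / (b + k)) + ennreal D * ennreal (c powr (- l) / l)"
    using assms(1-4) by (simp add: nn_integral_add nn_integral_cmult nn_integral_powr_from_0 nn_integral_powr_to_inf)
  also have "\<dots> = ennreal (C * (c powr (b + k) / (b + k)) + D * (c powr (- l) / l))"
    using assms by (simp flip: ennreal_mult ennreal_plus)
  finally show ?thesis .
qed

text \<open>Fractional integration of order \<open>b\<close> costs the factor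
  \<open>s powr b\<close>, with a constant that does not depend on \<open>s\<close>. Cutting at
  \<open>t = s\<close>, the integrand is at most \<open>s powr (- \<nu>)\<close> below and at most
  \<open>t powr (- \<nu>)\<close> above; the latter is integrable at infinity because
  \<open>b < \<nu>\<close>.\<close>

lemma rl_shift_bound:
  assumes "0 \<le> b" "b < \<nu>"
  obtains C where "C \<ge> 0" "\<And>s. s > 0 \<Longrightarrow> (\<integral>\<^sup>+t. ennreal ((t + s) powr (- \<nu>)) \<partial>rl b) \<le> ennreal (C * s powr (b - \<nu>))"
proof (cases "b = 0")
  case True
  show ?thesis by (rule that[of 1]) (auto simp: True nn_integral_rl_0)
next
  case False
  then have b: "b > 0" using assms by simp
  show ?thesis
  proof (rule that[of "1 / b + 1 / (\<nu> - b)"])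
    fix s :: real assume s: "s > 0"
    have "(\<integral>\<^sup>+t. ennreal ((t + s) powr (- \<nu>)) \<partial>rl b) \<le> ennreal (s powr (- \<nu>) * (s powr (b + 0) / (b + 0)) + 1 * (s powr (- (\<nu> - b)) / (\<nu> - b)))"
    proof (rule nn_integral_rl_split)
      fix t assume "0 < t" "t < s"
      then have "(t + s) powr (- \<nu>) \<le> s powr (- \<nu>) * t powr 0"
        using assms b by (auto intro!: powr_mono2')
      then show "ennreal ((t + s) powr (- \<nu>)) \<le> ennreal (s powr (- \<nu>) * t powr 0)" by (rule ennreal_leI)
    next
      fix t assume "s \<le> t"
      then have "(t + s) powr (- \<nu>) \<le> 1 * t powr (- b - (\<nu> - b))"
        using assms b s by (auto intro!: powr_mono2')
      then show "ennreal ((t + s) powr (- \<nu>)) \<le> ennreal (1 * t powr (- b - (\<nu> - b)))" by (rule ennreal_leI)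
    qed (use b assms s in auto)
    also have "s powr (- \<nu>) * (s powr (b + 0) / (b + 0)) + 1 * (s powr (- (\<nu> - b)) / (\<nu> - b)) = (1 / b + 1 / (\<nu> - b)) * s powr (b - \<nu>)"
      by (simp add: distrib_right flip: powr_add)
    finally show "(\<integral>\<^sup>+t. ennreal ((t + s) powr (- \<nu>)) \<partial>rl b) \<le> ennreal ((1 / b + 1 / (\<nu> - b)) * s powr (b - \<nu>))" .
  qed (use b assms in auto)
qed

text \<open>The factor in the semigroup law of the unnormalised weights. For \<open>b = 0\<close>
  the weight is the Dirac mass, the unit of convolution, whereas the Beta integral diverges
  there.\<close>

definition rl_beta :: "real \<Rightarrow> real \<Rightarrow> real" where
  "rl_beta a b = (if b = 0 then 1 else Beta a b)"

lemma rl_beta_pos: "a > 0 \<Longrightarrow> b \<ge> 0 \<Longrightarrow> rl_beta a b > 0"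
  by (auto simp: rl_beta_def Beta_def intro!: divide_pos_pos mult_pos_pos Gamma_real_pos)

lemma nn_integral_beta_scaled:
  assumes ab: "a > 0" "b > 0" and \<tau>: "\<tau> > 0"
  shows "(\<integral>\<^sup>+s. ennreal (indicator {0<..} s * s powr (a - 1)) * ennreal (indicator {0<..} (\<tau> - s) * (\<tau> - s) powr (b - 1)) \<partial>lborel)
    = ennreal (Beta a b * \<tau> powr (a + b - 1))"
proof -
  have beta: "(\<integral>\<^sup>+u. ennreal (indicator {0..1} u * (u powr (a - 1) * (1 - u) powr (b - 1))) \<partial>lborel) = ennreal (Beta a b)"
    using nn_integral_has_integral_lebesgue[OF _ has_integral_Beta_real[OF ab]] by simp
  have "(\<integral>\<^sup>+s. ennreal (indicator {0<..} s * s powr (a - 1)) * ennreal (indicator {0<..} (\<tau> - s) * (\<tau> - s) powr (b - 1)) \<partial>lborel)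
    = ennreal \<tau> * (\<integral>\<^sup>+u. ennreal (indicator {0<..} (\<tau> * u) * (\<tau> * u) powr (a - 1)) * ennreal (indicator {0<..} (\<tau> - \<tau> * u) * (\<tau> - \<tau> * u) powr (b - 1)) \<partial>lborel)"
    using \<tau> by (subst nn_integral_real_affine[where c = \<tau> and t = 0]) auto
  also have "\<dots> = ennreal \<tau> * (\<integral>\<^sup>+u. ennreal (\<tau> powr (a + b - 2)) * ennreal (indicator {0..1} u * (u powr (a - 1) * (1 - u) powr (b - 1))) \<partial>lborel)"
  proof (rule arg_cong2[where f = "(*)", OF refl nn_integral_cong])
    fix u :: real
    show "ennreal (indicator {0<..} (\<tau> * u) * (\<tau> * u) powr (a - 1)) * ennreal (indicator {0<..} (\<tau> - \<tau> * u) * (\<tau> - \<tau> * u) powr (b - 1))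
      = ennreal (\<tau> powr (a + b - 2)) * ennreal (indicator {0..1} u * (u powr (a - 1) * (1 - u) powr (b - 1)))"
    proof (cases "0 < u \<and> u < 1")
      case True
      have "\<tau> - \<tau> * u = \<tau> * (1 - u)" by (simp add: algebra_simps)
      then have "(\<tau> * u) powr (a - 1) * (\<tau> - \<tau> * u) powr (b - 1) = (\<tau> powr (a - 1) * \<tau> powr (b - 1)) * (u powr (a - 1) * (1 - u) powr (b - 1))"
        using True \<tau> by (simp add: powr_mult)
      also have "\<tau> powr (a - 1) * \<tau> powr (b - 1) = \<tau> powr (a + b - 2)"
        by (simp flip: powr_add add: algebra_simps)
      finally show ?thesis using True \<tau> by (simp flip: ennreal_mult)
    next
      case False
      then have "u \<le> 0 \<or> 1 \<le> u" by auto
      moreover have "\<tau> * u < \<tau> \<longleftrightarrow> u < 1" using \<tau> by simp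
      ultimately show ?thesis using \<tau> False
        by (cases "u = 0"; cases "u = 1") (auto simp: indicator_def zero_less_mult_iff)
    qed
  qed
  also have "\<dots> = ennreal \<tau> * (ennreal (\<tau> powr (a + b - 2)) * ennreal (Beta a b))"
    by (simp add: nn_integral_cmult beta)
  also have "\<dots> = ennreal (Beta a b * (\<tau> powr 1 * \<tau> powr (a + b - 2)))"
    using \<tau> by (simp flip: ennreal_mult'' ennreal_mult' add: mult_ac)
  also have "\<tau> powr 1 * \<tau> powr (a + b - 2) = \<tau> powr (a + b - 1)" 
    unfolding powr_add[symmetric] by (simp add: algebra_simps)
  finally show ?thesis .
qed

text \<open>Translation and Tonelli turn the double integral into one over the convolution of the
  two densities, which the Beta integral evaluates.\<close>

lemma nn_integral_rl_rl:
  assumes a: "a > 0" and b: "b \<ge> 0" and [measurable]: "F \<in> borel_measurable borel"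
  shows "(\<integral>\<^sup>+s. (\<integral>\<^sup>+t. F (s + t) \<partial>rl b) \<partial>rl a) = ennreal (rl_beta a b) * (\<integral>\<^sup>+\<tau>. F \<tau> \<partial>rl (a + b))"
proof (cases "b = 0")
  case True
  then show ?thesis by (simp add: nn_integral_rl_0 rl_beta_def)
next
  case False
  then have b: "b > 0" using assms by simp
  let ?w = "\<lambda>a s. ennreal (indicator {0<..} s * s powr (a - 1)) :: ennreal"
  have "(\<integral>\<^sup>+s. (\<integral>\<^sup>+t. F (s + t) \<partial>rl b) \<partial>rl a) = (\<integral>\<^sup>+s. ?w a s * (\<integral>\<^sup>+t. ?w b t * F (s + t) \<partial>lborel) \<partial>lborel)"
    using a b by (simp add: nn_integral_rl)
  \<comment> \<open>The second density absorbs the shift, so that \<open>F\<close> depends on \<tau>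
    = s + t alone and can be taken out of the integral over \<open>s\<close>.\<close>
  also have "\<dots> = (\<integral>\<^sup>+s. (\<integral>\<^sup>+t. (\<lambda>\<tau>. ?w a s * (?w b (\<tau> - s) * F \<tau>)) (s + t) \<partial>lborel) \<partial>lborel)"
    by (simp add: nn_integral_cmult)
  also have "\<dots> = (\<integral>\<^sup>+s. (\<integral>\<^sup>+\<tau>. ?w a s * (?w b (\<tau> - s) * F \<tau>) \<partial>lborel) \<partial>lborel)"
    by (subst nn_integral_lborel_translate) auto
  also have "\<dots> = (\<integral>\<^sup>+\<tau>. (\<integral>\<^sup>+s. ?w a s * (?w b (\<tau> - s) * F \<tau>) \<partial>lborel) \<partial>lborel)"
    by (rule lborel_pair.Fubini') measurable
  also have "\<dots> = (\<integral>\<^sup>+\<tau>. (\<integral>\<^sup>+s. ?w a s * ?w b (\<tau> - s) \<partial>lborel) * F \<tau> \<partial>lborel)"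
    by (simp add: nn_integral_multc flip: mult.assoc)
  also have "\<dots> = (\<integral>\<^sup>+\<tau>. ennreal (rl_beta a b) * (?w (a + b) \<tau> * F \<tau>) \<partial>lborel)"
  proof (intro nn_integral_cong)
    fix \<tau> :: real
    have "(\<integral>\<^sup>+s. ?w a s * ?w b (\<tau> - s) \<partial>lborel) = ennreal (rl_beta a b) * ?w (a + b) \<tau>"
    proof (cases "\<tau> > 0")
      case True
      then show ?thesis using nn_integral_beta_scaled[OF a b True] False rl_beta_pos[OF a, of b] b
        by (simp add: rl_beta_def ennreal_mult)
    next
      case False
      then have "?w a s * ?w b (\<tau> - s) = 0" for s by (auto simp: indicator_def)
      then show ?thesis using False by (simp only: nn_integral_const mult_zero_left) simp
    qed
    then show "(\<integral>\<^sup>+s. ?w a s * ?w b (\<tau> - s) \<partial>lborel) * F \<tau> = ennreal (rl_beta a b) * (?w (a + b) \<tau> * F \<tau>)"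
      by (simp only: mult.assoc)
  qed
  also have "\<dots> = ennreal (rl_beta a b) * (\<integral>\<^sup>+\<tau>. F \<tau> \<partial>rl (a + b))"
    using a b by (simp add: nn_integral_rl nn_integral_cmult)
  finally show ?thesis .
qed

text \<open>Restating the law as an equality of measures transfers it from non-negative to
  integrable functions in one step; see \<open>integral_rl_rl\<close>.\<close>

lemma distr_rl_rl:
  assumes "a > 0" "b \<ge> 0"
  shows "distr (rl a \<Otimes>\<^sub>M rl b) borel (\<lambda>(s, t). s + t) = density (rl (a + b)) (\<lambda>_. ennreal (rl_beta a b))"
proof (rule measure_eqI)
  fix A assume "A \<in> sets (distr (rl a \<Otimes>\<^sub>M rl b) borel (\<lambda>(s, t). s + t))"
  then have A[measurable]: "A \<in> sets borel" by simp
  have "emeasure (distr (rl a \<Otimes>\<^sub>M rl b) borel (\<lambda>(s, t). s + t)) A = (\<integral>\<^sup>+\<tau>. indicator A \<tau> \<partial>distr (rl a \<Otimes>\<^sub>M rl b) borel (\<lambda>(s, t). s + t))"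
    by simp
  also have "\<dots> = (\<integral>\<^sup>+p. indicator A (fst p + snd p) \<partial>(rl a \<Otimes>\<^sub>M rl b))"
    by (subst nn_integral_distr) (auto simp: split_beta')
  also have "\<dots> = (\<integral>\<^sup>+s. (\<integral>\<^sup>+t. indicator A (s + t) \<partial>rl b) \<partial>rl a)"
    by (subst rl.nn_integral_fst[symmetric]) auto
  also have "\<dots> = ennreal (rl_beta a b) * (\<integral>\<^sup>+\<tau>. indicator A \<tau> \<partial>rl (a + b))"
    by (rule nn_integral_rl_rl[OF assms]) simp
  also have "\<dots> = emeasure (density (rl (a + b)) (\<lambda>_. ennreal (rl_beta a b))) A"
    by (simp add: emeasure_density nn_integral_cmult)
  finally show "emeasure (distr (rl a \<Otimes>\<^sub>M rl b) borel (\<lambda>(s, t). s + t)) A = emeasure (density (rl (a + b)) (\<lambda>_. ennreal (rl_beta a b))) A" .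
qed simp

lemma integral_rl_rl:
  fixes F :: "real \<Rightarrow> real"
  assumes ab: "a > 0" "b \<ge> 0" and F: "integrable (rl (a + b)) F"
  shows "integrable (rl a \<Otimes>\<^sub>M rl b) (\<lambda>(s, t). F (s + t))"
    and "(\<integral>s. (\<integral>t. F (s + t) \<partial>rl b) \<partial>rl a) = rl_beta a b * (\<integral>\<tau>. F \<tau> \<partial>rl (a + b))"
proof -
  have Fm[measurable]: "F \<in> borel_measurable borel" using borel_measurable_integrable[OF F] by simp
  have i: "integrable (density (rl (a + b)) (\<lambda>_. ennreal (rl_beta a b))) F"
    using F rl_beta_pos[OF ab] by (subst integrable_density) auto
  then have "integrable (distr (rl a \<Otimes>\<^sub>M rl b) borel (\<lambda>(s, t). s + t)) F" unfolding distr_rl_rl[OF ab] .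
  then show 1: "integrable (rl a \<Otimes>\<^sub>M rl b) (\<lambda>(s, t). F (s + t))"
    by (subst (asm) integrable_distr_eq) (auto simp: split_beta')
  have "(\<integral>s. (\<integral>t. F (s + t) \<partial>rl b) \<partial>rl a) = (\<integral>p. (case p of (s, t) \<Rightarrow> F (s + t)) \<partial>(rl a \<Otimes>\<^sub>M rl b))"
    using rl_rl.integral_fst'[OF 1] by simp
  also have "\<dots> = (\<integral>\<tau>. F \<tau> \<partial>distr (rl a \<Otimes>\<^sub>M rl b) borel (\<lambda>(s, t). s + t))"
    by (subst integral_distr) (auto simp: split_beta')
  also have "\<dots> = rl_beta a b * (\<integral>\<tau>. F \<tau> \<partial>rl (a + b))"
    unfolding distr_rl_rl[OF ab] using rl_beta_pos[OF ab] by (subst integral_density) auto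
  finally show "(\<integral>s. (\<integral>t. F (s + t) \<partial>rl b) \<partial>rl a) = rl_beta a b * (\<integral>\<tau>. F \<tau> \<partial>rl (a + b))" .
qed

text \<open>Substituting \<open>t = r * u\<close> extracts the power of \<open>r\<close>. The
  constant is Gamma(\<nu> - b), but only its positivity and finiteness matter.\<close>

lemma rl_gamma:
  assumes b: "b > 0" and \<nu>: "b < \<nu>"
  obtains C where "C > 0" "\<And>r. r > 0 \<Longrightarrow> (\<integral>\<^sup>+t. ennreal (t powr (- \<nu>) * exp (- r / t)) \<partial>rl b) = ennreal (C * r powr (b - \<nu>))"
proof -
  define I where "I = (\<integral>\<^sup>+t. ennreal (t powr (- \<nu>) * exp (- 1 / t)) \<partial>rl b)"
  \<comment> \<open>An integer exponent that is at least \<nu>, so that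
    \<open>t powr (- \<nu>)\<close> is at most \<open>real k ^ k * exp (1 / t)\<close> for
    \<open>t < 1\<close>; this cancels against the exponential factor near 0.\<close>
  obtain k :: nat where k: "real k \<ge> \<nu>" using real_arch_simple by blast
  then have k0: "k > 0" using assms by (cases k) auto
  have "I \<le> ennreal (real k ^ k * (1 powr (b + 0) / (b + 0)) + 1 * (1 powr (- (\<nu> - b)) / (\<nu> - b)))"
    unfolding I_def
  proof (rule nn_integral_rl_split)
    fix t :: real assume t: "0 < t" "t < 1"
    have "(1 / (t * k)) ^ k \<le> exp (1 / (t * k)) ^ k"
      using t k0 exp_ge_add_one_self[of "1 / (t * k)"] by (intro power_mono) (linarith, simp)
    also have "\<dots> = exp (1 / t)" using k0 by (simp flip: exp_of_nat_mult)
    finally have 1: "(1 / t) ^ k \<le> real k ^ k * exp (1 / t)"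
      using t k0 by (simp add: power_divide power_mult_distrib field_simps)
    have "t powr (- \<nu>) \<le> t powr (- real k)" using t k by (intro powr_mono') auto
    also have "\<dots> = (1 / t) ^ k" using t by (simp add: powr_minus_divide powr_realpow power_divide)
    finally have "t powr (- \<nu>) \<le> real k ^ k * exp (1 / t)" using 1 by simp
    then have "t powr (- \<nu>) * exp (- 1 / t) \<le> (real k ^ k * exp (1 / t)) * exp (- 1 / t)"
      by (rule mult_right_mono) simp
    also have "\<dots> = real k ^ k" by (simp add: mult.assoc flip: exp_add)
    finally show "ennreal (t powr (- \<nu>) * exp (- 1 / t)) \<le> ennreal (real k ^ k * t powr 0)"
      using t by (intro ennreal_leI) simp
  next
    fix t :: real assume t: "1 \<le> t"
    then show "ennreal (t powr (- \<nu>) * exp (- 1 / t)) \<le> ennreal (1 * t powr (- b - (\<nu> - b)))"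
      by (intro ennreal_leI) (simp add: mult_left_le)
  qed (use assms in auto)
  then have fin: "I < \<infinity>" by (simp add: le_less_trans)
  \<comment> \<open>If the integral vanished, the integrand would vanish almost everywhere on (0,1),
    where it is positive.\<close>
  have "I \<noteq> 0"
  proof
    assume "I = 0"
    then have "AE t in lborel. t \<notin> {0<..<1::real}"
      unfolding I_def using b by (simp add: nn_integral_rl nn_integral_0_iff_AE)
        (auto simp: indicator_def ennreal_eq_0_iff mult_le_0_iff elim!: eventually_mono)
    then have "{0<..<1::real} \<in> null_sets lborel" by (subst (asm) AE_iff_null_sets[symmetric]) auto
    then show False by (simp add: null_sets_def)
  qed
  obtain C where C: "I = ennreal C" "C > 0"
    using fin \<open>I \<noteq> 0\<close> by (cases I) (auto simp: less_le)
  show ?thesis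
  proof (rule that[OF C(2)])
    fix r :: real assume r: "r > 0"
    have "(\<integral>\<^sup>+t. ennreal (t powr (- \<nu>) * exp (- r / t)) \<partial>rl b) = (\<integral>\<^sup>+t. ennreal (indicator {0<..} t * t powr (b - 1)) * ennreal (t powr (- \<nu>) * exp (- r / t)) \<partial>lborel)"
      using b by (simp add: nn_integral_rl)
    also have "\<dots> = ennreal r * (\<integral>\<^sup>+u. ennreal (indicator {0<..} (r * u) * (r * u) powr (b - 1)) * ennreal ((r * u) powr (- \<nu>) * exp (- r / (r * u))) \<partial>lborel)"
      using r by (subst nn_integral_real_affine[where c = r and t = 0]) auto
    also have "\<dots> = ennreal r * (\<integral>\<^sup>+u. ennreal (r powr (b - \<nu> - 1)) * (ennreal (indicator {0<..} u * u powr (b - 1)) * ennreal (u powr (- \<nu>) * exp (- 1 / u))) \<partial>lborel)"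
    proof (rule arg_cong2[where f = "(*)", OF refl nn_integral_cong])
      fix u :: real
      show "ennreal (indicator {0<..} (r * u) * (r * u) powr (b - 1)) * ennreal ((r * u) powr (- \<nu>) * exp (- r / (r * u))) =
        ennreal (r powr (b - \<nu> - 1)) * (ennreal (indicator {0<..} u * u powr (b - 1)) * ennreal (u powr (- \<nu>) * exp (- 1 / u)))"
      proof (cases "u > 0")
        case True
        have "(r * u) powr (b - 1) * ((r * u) powr (- \<nu>) * exp (- r / (r * u))) = (r powr (b - 1) * r powr (- \<nu>)) * (u powr (b - 1) * (u powr (- \<nu>) * exp (- 1 / u)))"
          using True r by (simp add: powr_mult)
        also have "r powr (b - 1) * r powr (- \<nu>) = r powr (b - \<nu> - 1)" by (simp flip: powr_add add: algebra_simps)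
        finally show ?thesis using True r by (simp flip: ennreal_mult)
      next
        case False
        then show ?thesis using r by (simp add: indicator_def zero_less_mult_iff)
      qed
    qed
    also have "\<dots> = ennreal r * (ennreal (r powr (b - \<nu> - 1)) * I)"
      unfolding I_def using b by (simp add: nn_integral_rl nn_integral_cmult)
    also have "\<dots> = ennreal (C * (r powr 1 * r powr (b - \<nu> - 1)))"
      unfolding C(1) using r C(2) by (simp flip: ennreal_mult add: mult_ac)
    also have "r powr 1 * r powr (b - \<nu> - 1) = r powr (b - \<nu>)" unfolding powr_add[symmetric] by simp
    finally show "(\<integral>\<^sup>+t. ennreal (t powr (- \<nu>) * exp (- r / t)) \<partial>rl b) = ennreal (C * r powr (b - \<nu>))" .
  qed
qed

section \<open>Duality and convolution in Lebesgue spaces\<close>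

text \<open>Young's inequality with the conjugate exponent hidden: the second factor is a power with
  exponent \<open>q - 1\<close>, so the value q = 1, whose conjugate is infinite, is
  included.\<close>

lemma young_powr:
  fixes a b q :: real
  assumes "q \<ge> 1" "a \<ge> 0" "b \<ge> 0"
  shows "a * b powr (q - 1) \<le> a powr q / q + (1 - 1 / q) * b powr q"
proof (cases "a = 0 \<or> b = 0")
  case True
  then show ?thesis using assms by auto
next
  case False
  then have ab: "a > 0" "b > 0" using assms by auto
  have "(a powr q) powr (1 / q) * (b powr q) powr (1 - 1 / q) \<le> 1 / q * a powr q + (1 - 1 / q) * b powr q"
    using assms ab by (intro Youngs_inequality_0) auto
  moreover have "q * (1 - 1 / q) = q - 1" using assms by (simp add: field_simps)
  ultimately show ?thesis using assms ab by (simp add: powr_powr)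
qed

lemma holder_powr:
  fixes F G :: "'a \<Rightarrow> real"
  assumes q: "q \<ge> 1" and C: "C \<ge> 0" and D: "D > 0"
    and [measurable]: "F \<in> borel_measurable M" "G \<in> borel_measurable M"
    and pos: "\<And>x. 0 \<le> F x" "\<And>x. 0 \<le> G x"
    and F: "(\<integral>\<^sup>+x. ennreal (F x powr q) \<partial>M) \<le> ennreal (C powr q)"
    and G: "(\<integral>\<^sup>+x. ennreal (G x powr q) \<partial>M) \<le> ennreal (D powr q)"
  shows "(\<integral>\<^sup>+x. ennreal (F x * G x powr (q - 1)) \<partial>M) \<le> ennreal (C * D powr (q - 1))"
\<comment> \<open>The scaling below divides by \<open>C\<close>. For \<open>C = 0\<close> the
  function \<open>F\<close> vanishes almost everywhere.\<close>
proof (cases "C = 0")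
  case True
  then have "(\<integral>\<^sup>+x. ennreal (F x powr q) \<partial>M) = 0" using F by simp
  then have "AE x in M. F x = 0"
    by (subst (asm) nn_integral_0_iff_AE) (auto elim!: eventually_mono)
  then have "(\<integral>\<^sup>+x. ennreal (F x * G x powr (q - 1)) \<partial>M) = 0"
    by (subst nn_integral_0_iff_AE) (auto elim!: eventually_mono)
  then show ?thesis by simp
next
  case False
  then have C: "C > 0" using C by simp
  let ?c = "C * D powr (q - 1)"
  have "(\<integral>\<^sup>+x. ennreal (F x * G x powr (q - 1)) \<partial>M) \<le>
     (\<integral>\<^sup>+x. ennreal (?c / q / C powr q) * ennreal (F x powr q) + ennreal (?c * (1 - 1 / q) / D powr q) * ennreal (G x powr q) \<partial>M)"
  proof (intro nn_integral_mono)
    fix x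
    have "F x * G x powr (q - 1) = ?c * (F x / C * (G x / D) powr (q - 1))"
      using C D pos(2)[of x] by (simp add: powr_divide)
    also have "\<dots> \<le> ?c * ((F x / C) powr q / q + (1 - 1 / q) * (G x / D) powr q)"
      using C D pos[of x] q by (intro mult_left_mono young_powr) auto
    also have "\<dots> = (?c / q / C powr q) * F x powr q + (?c * (1 - 1 / q) / D powr q) * G x powr q"
      using C D pos[of x] by (simp add: powr_divide algebra_simps)
    finally show "ennreal (F x * G x powr (q - 1)) \<le> ennreal (?c / q / C powr q) * ennreal (F x powr q) + ennreal (?c * (1 - 1 / q) / D powr q) * ennreal (G x powr q)"
      using C D pos[of x] q by (simp flip: ennreal_mult ennreal_plus)
  qed
  also have "\<dots> = ennreal (?c / q / C powr q) * (\<integral>\<^sup>+x. ennreal (F x powr q) \<partial>M) + ennreal (?c * (1 - 1 / q) / D powr q) * (\<integral>\<^sup>+x. ennreal (G x powr q) \<partial>M)"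
    by (simp add: nn_integral_add nn_integral_cmult)
  also have "\<dots> \<le> ennreal (?c / q / C powr q) * ennreal (C powr q) + ennreal (?c * (1 - 1 / q) / D powr q) * ennreal (D powr q)"
    by (intro add_mono mult_left_mono F G) auto
  also have "\<dots> = ennreal ?c"
  proof -
    have "?c / q / C powr q * C powr q + ?c * (1 - 1 / q) / D powr q * D powr q = ?c"
      using C D q by (simp add: right_diff_distrib)
    moreover have "0 \<le> ?c / q / C powr q" "0 \<le> ?c * (1 - 1 / q) / D powr q" using C D q by auto
    ultimately show ?thesis by (metis ennreal_mult ennreal_plus mult_nonneg_nonneg powr_ge_zero)
  qed
  finally show ?thesis .
qed

text \<open>For \<open>q > 1\<close> this is the unit ball of \<open>L\<^bsup>q'\<^esup>\<close> (take \<open>G = |\<phi>|\<^bsup>1/(q-1)\<^esup>\<close>), for \<open>q = 1\<close> that of \<open>L\<^sup>\<infinity>\<close>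
  up to the (harmless) condition that \<open>\<phi>\<close> vanishes where \<open>G\<close> does.\<close>
definition dual_unit :: "real \<Rightarrow> ('a::euclidean_space \<Rightarrow> 'b::euclidean_space) \<Rightarrow> bool" where
  "dual_unit q \<phi> \<longleftrightarrow> \<phi> \<in> borel_measurable borel \<and> (\<exists>B. \<forall>x. norm (\<phi> x) \<le> B) \<and>
    (\<exists>R. \<forall>x. R < norm x \<longrightarrow> \<phi> x = 0) \<and>
    (\<exists>G\<in>borel_measurable borel. (\<forall>x. 0 \<le> G x \<and> norm (\<phi> x) \<le> G x powr (q - 1)) \<and>
       (\<integral>\<^sup>+x. ennreal (G x powr q) \<partial>lborel) \<le> 1)"

lemma dual_unit_pairing:
  fixes F :: "'a::euclidean_space \<Rightarrow> real" and \<phi> :: "'a \<Rightarrow> 'b::euclidean_space"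
  assumes "dual_unit q \<phi>" "q \<ge> 1" "C \<ge> 0" and [measurable]: "F \<in> borel_measurable borel"
    and F: "(\<integral>\<^sup>+x. ennreal (\<bar>F x\<bar> powr q) \<partial>lborel) \<le> ennreal (C powr q)"
  shows "(\<integral>\<^sup>+x. ennreal (\<bar>F x\<bar> * norm (\<phi> x)) \<partial>lborel) \<le> ennreal C"
proof -
  obtain G where [measurable]: "G \<in> borel_measurable borel" and G: "\<And>x. 0 \<le> G x" "\<And>x. norm (\<phi> x) \<le> G x powr (q - 1)"
    and GI: "(\<integral>\<^sup>+x. ennreal (G x powr q) \<partial>lborel) \<le> 1"
    using assms(1) unfolding dual_unit_def by blast
  have "(\<integral>\<^sup>+x. ennreal (\<bar>F x\<bar> * norm (\<phi> x)) \<partial>lborel) \<le> (\<integral>\<^sup>+x. ennreal (\<bar>F x\<bar> * G x powr (q - 1)) \<partial>lborel)"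
    using G by (intro nn_integral_mono ennreal_leI mult_left_mono) auto
  also have "\<dots> \<le> ennreal (C * 1 powr (q - 1))"
    using assms G GI by (intro holder_powr) auto
  finally show ?thesis by simp
qed

text \<open>The extremal field for \<open>g\<close> is \<open>g\<close> times
  \<open>norm g powr (q - 2)\<close>, normalised. It is cut down to the sets \<open>E k\<close>, on
  which \<open>g\<close> and the argument are bounded, so that its integral is finite and it is an
  admissible dual field; monotone convergence removes the cut.\<close>

lemma converse_holder:
  fixes g :: "'a::euclidean_space \<Rightarrow> 'b::euclidean_space"
  assumes q: "q \<ge> 1" and K: "K \<ge> 0" and [measurable]: "g \<in> borel_measurable borel"
    and dual: "\<And>\<phi>. dual_unit q \<phi> \<Longrightarrow> (\<integral>x. g x \<bullet> \<phi> x \<partial>lborel) \<le> K"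
  shows "(\<integral>\<^sup>+x. ennreal (norm (g x) powr q) \<partial>lborel) \<le> ennreal (K powr q)"
proof -
  define E where "E k = {x. norm x \<le> real k \<and> norm (g x) \<le> real k}" for k :: nat
  have [measurable]: "E k \<in> sets borel" for k unfolding E_def by measurable
  define u where "u k x = ennreal (indicator (E k) x * norm (g x) powr q)" for k x
  have [measurable]: "u k \<in> borel_measurable borel" for k unfolding u_def by measurable
  have bd: "(\<integral>\<^sup>+x. u k x \<partial>lborel) \<le> ennreal (K powr q)" for k
  proof -
    have "(\<integral>\<^sup>+x. u k x \<partial>lborel) \<le> (\<integral>\<^sup>+x. ennreal (real k powr q) * indicator (cball (0::'a) (real k)) x \<partial>lborel)"
      unfolding u_def using q by (intro nn_integral_mono) (auto simp: E_def indicator_def intro!: ennreal_leI powr_mono2)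
    also have "\<dots> < \<infinity>"
      using emeasure_bounded_finite[of "cball (0::'a) (real k)"] by (simp add: nn_integral_cmult_indicator ennreal_mult_less_top)
    finally obtain i where i: "(\<integral>\<^sup>+x. u k x \<partial>lborel) = ennreal i" "i \<ge> 0"
      by (cases "\<integral>\<^sup>+x. u k x \<partial>lborel") auto
    show ?thesis
    proof (cases "i = 0")
      case True
      then show ?thesis using i by simp
    next
      case False
      then have ip: "i > 0" using i by simp
      \<comment> \<open>The L^q norm of the truncated field. Dividing by it gives the
        \<open>q\<close>-th power of \<open>G\<close> the integral 1.\<close>
      define D where "D = i powr (1 / q)"
      have D: "D > 0" using ip by (simp add: D_def)
      have Dq: "D powr q = i" using ip q by (simp add: D_def powr_powr)
      define \<phi> where "\<phi> x = (indicator (E k) x * norm (g x) powr (q - 2) / D powr (q - 1)) *\<^sub>R g x" for x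
      define G where "G x = indicator (E k) x * norm (g x) / D" for x
      have Gm: "G \<in> borel_measurable borel" "\<phi> \<in> borel_measurable borel" unfolding G_def \<phi>_def by measurable
      have gq: "norm (g x) powr (q - 2) * norm (g x) = norm (g x) powr (q - 1)" if "g x \<noteq> 0" for x
      proof -
        have "norm (g x) powr (q - 2) * norm (g x) powr 1 = norm (g x) powr (q - 2 + 1)" by (simp only: powr_add)
        then show ?thesis using that by simp
      qed
      have n\<phi>: "norm (\<phi> x) \<le> G x powr (q - 1)" for x
      proof (cases "x \<in> E k \<and> g x \<noteq> 0")
        case True
        then show ?thesis using gq[of x] D by (simp add: \<phi>_def G_def powr_divide)
      next
        case False
        then show ?thesis by (auto simp: \<phi>_def)
      qed
      have G0: "0 \<le> G x" for x using D by (simp add: G_def)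
      have "(\<integral>\<^sup>+x. ennreal (G x powr q) \<partial>lborel) = (\<integral>\<^sup>+x. ennreal (1 / i) * u k x \<partial>lborel)"
      proof (intro nn_integral_cong)
        fix x
        have "G x powr q = 1 / i * (indicator (E k) x * norm (g x) powr q)"
          using D Dq q by (auto simp: G_def powr_divide indicator_def)
        then show "ennreal (G x powr q) = ennreal (1 / i) * u k x" unfolding u_def using ip by (simp flip: ennreal_mult)
      qed
      also have "\<dots> = 1" using ip i by (simp add: nn_integral_cmult flip: ennreal_mult)
      finally have GI: "(\<integral>\<^sup>+x. ennreal (G x powr q) \<partial>lborel) = 1" .
      have Gk: "G x \<le> real k / D" for x using D by (auto simp: G_def E_def indicator_def divide_right_mono)
      have "dual_unit q \<phi>"
      proof -
        have "norm (\<phi> x) \<le> (real k / D) powr (q - 1)" for x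
          using n\<phi>[of x] powr_mono2[OF _ G0[of x] Gk[of x], of "q - 1"] q by simp
        moreover have "real k < norm x \<Longrightarrow> \<phi> x = 0" for x by (simp add: \<phi>_def E_def)
        ultimately show ?thesis
          unfolding dual_unit_def using Gm n\<phi> G0 GI by (intro conjI bexI[of _ G] exI allI) auto
      qed
      from dual[OF this] have "(\<integral>x. g x \<bullet> \<phi> x \<partial>lborel) \<le> K" .
      moreover have "(\<integral>x. g x \<bullet> \<phi> x \<partial>lborel) = (\<integral>x. (1 / D powr (q - 1)) * enn2real (u k x) \<partial>lborel)"
      proof (intro Bochner_Integration.integral_cong refl)
        fix x
        have "norm (g x) powr (q - 2) * (g x \<bullet> g x) = norm (g x) powr q"
        proof (cases "g x = 0")
          case False
          have "norm (g x) powr (q - 2) * norm (g x) powr 2 = norm (g x) powr q" unfolding powr_add[symmetric] by simp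
          moreover have "norm (g x) powr 2 = g x \<bullet> g x" by (simp add: dot_square_norm)
          ultimately show ?thesis by (simp only:)
        qed (use q in auto)
        then show "g x \<bullet> \<phi> x = (1 / D powr (q - 1)) * enn2real (u k x)"
          by (simp add: \<phi>_def u_def)
      qed
      moreover have "(\<integral>x. enn2real (u k x) \<partial>lborel) = i"
      proof -
        have "(\<integral>x. enn2real (u k x) \<partial>lborel) = enn2real (\<integral>\<^sup>+x. ennreal (enn2real (u k x)) \<partial>lborel)"
          by (rule integral_eq_nn_integral) auto
        also have "(\<integral>\<^sup>+x. ennreal (enn2real (u k x)) \<partial>lborel) = (\<integral>\<^sup>+x. u k x \<partial>lborel)"
          by (simp add: u_def)
        finally show ?thesis using i by simp
      qed
      \<comment> \<open>The left-hand side is \<open>D\<close> itself, because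
        \<open>D powr q = i\<close>; the dual bound thus controls the truncated norm by
        \<open>K\<close>, uniformly in \<open>k\<close>.\<close>
      ultimately have "i / D powr (q - 1) \<le> K" by simp
      moreover have "i / D powr (q - 1) = D"
        unfolding Dq[symmetric] using D by (simp flip: powr_diff)
      ultimately have "D \<le> K" by simp
      then have "D powr q \<le> K powr q" using D q by (intro powr_mono2) auto
      then show ?thesis unfolding i Dq by (rule ennreal_leI)
    qed
  qed
  have "(\<lambda>k. (\<integral>\<^sup>+x. u k x \<partial>lborel)) \<longlonglongrightarrow> (\<integral>\<^sup>+x. ennreal (norm (g x) powr q) \<partial>lborel)"
  proof (rule nn_integral_LIMSEQ)
    show "incseq u"
      by (auto simp: incseq_def le_fun_def u_def E_def indicator_def intro!: ennreal_leI)
    show "(\<lambda>k. u k x) \<longlonglongrightarrow> ennreal (norm (g x) powr q)" for x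
    proof (rule tendsto_eventually)
      obtain m :: nat where m: "max (norm x) (norm (g x)) \<le> real m" using real_arch_simple by blast
      show "\<forall>\<^sub>F k in sequentially. u k x = ennreal (norm (g x) powr q)"
        using eventually_ge_at_top[of m] by eventually_elim (use m in \<open>auto simp: u_def E_def\<close>)
    qed
  qed simp
  then show ?thesis by (rule LIMSEQ_le_const2) (use bd in auto)
qed

text \<open>The space L^1 intersected with L^\<infinity>. It lies in every conjugate space, so its
  members pair with L^p functions for each \<open>p\<close> at once, and convolution with an L^1
  kernel preserves it.\<close>

definition bdd_int :: "('a::euclidean_space \<Rightarrow> 'b::euclidean_space) \<Rightarrow> bool" where
  "bdd_int w \<longleftrightarrow> integrable lborel w \<and> (\<exists>C. \<forall>x. norm (w x) \<le> C)"

lemma bdd_intD: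
  assumes "bdd_int w"
  shows "integrable lborel w" "w \<in> borel_measurable borel"
  using assms borel_measurable_integrable[of lborel w] by (auto simp: bdd_int_def)

lemma bdd_int_bound:
  assumes "bdd_int w" obtains C where "C > 0" "\<And>x. norm (w x) \<le> C"
proof -
  obtain C where "\<forall>x. norm (w x) \<le> C" using assms by (auto simp: bdd_int_def)
  then show thesis by (intro that[of "max 1 C"]) (auto simp: le_max_iff_disj)
qed

lemma bdd_int_norm: "bdd_int w \<Longrightarrow> bdd_int (\<lambda>x. norm (w x))"
  by (auto simp: bdd_int_def)

lemma bdd_int_dominated:
  fixes w :: "'a::euclidean_space \<Rightarrow> real" and v :: "'a \<Rightarrow> 'b::euclidean_space"
  assumes "bdd_int w" "v \<in> borel_measurable borel" "\<And>x. norm (v x) \<le> w x"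
  shows "bdd_int v"
  unfolding bdd_int_def
proof
  show "integrable lborel v"
    by (rule Bochner_Integration.integrable_bound[OF bdd_intD(1)[OF assms(1)]])
       (use assms in \<open>auto intro!: AE_I2 intro: order_trans[OF _ abs_ge_self]\<close>)
  obtain C where C: "\<And>x. norm (w x) \<le> C" using bdd_int_bound[OF assms(1)] by metis
  have "norm (v x) \<le> C" for x using C[of x] assms(3)[of x] by simp
  then show "\<exists>C. \<forall>x. norm (v x) \<le> C" by blast
qed

lemma bdd_int_add: "bdd_int v \<Longrightarrow> bdd_int w \<Longrightarrow> bdd_int (\<lambda>x. v x + w x)"
proof -
  assume v: "bdd_int v" and w: "bdd_int w"
  obtain C D where "\<And>x. norm (v x) \<le> C" "\<And>x. norm (w x) \<le> D" using bdd_int_bound[OF v] bdd_int_bound[OF w] by metis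
  then have "norm (v x + w x) \<le> C + D" for x by (intro norm_triangle_le add_mono)
  then show ?thesis using v w unfolding bdd_int_def by auto
qed

lemma bdd_int_cmult: "bdd_int (w :: _ \<Rightarrow> real) \<Longrightarrow> bdd_int (\<lambda>x. c * w x)"
proof -
  assume w: "bdd_int w"
  obtain C where "\<And>x. norm (w x) \<le> C" using bdd_int_bound[OF w] by metis
  then have "norm (c * w x) \<le> \<bar>c\<bar> * C" for x by (simp add: abs_mult mult_left_mono)
  then show ?thesis using w unfolding bdd_int_def by auto
qed

lemma bdd_int_heat: "t > 0 \<Longrightarrow> bdd_int (heat t)"
  unfolding bdd_int_def using heat_le_sup[of t] integrable_heat[of t] by auto

lemma dual_unit_bdd_int: assumes "dual_unit q \<phi>" shows "bdd_int \<phi>"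
proof -
  obtain B R where BR: "\<And>x. norm (\<phi> x) \<le> B" "\<And>x. R < norm x \<Longrightarrow> \<phi> x = 0" "\<phi> \<in> borel_measurable borel"
    using assms unfolding dual_unit_def by blast
  have "integrable lborel (\<lambda>x::'a. B * indicator (cball 0 R) x)"
    using emeasure_bounded_finite[of "cball (0::'a) R"] by auto
  then have "integrable lborel \<phi>"
    by (rule Bochner_Integration.integrable_bound)
       (use BR in \<open>auto intro!: AE_I2 simp: indicator_def not_le intro: order_trans[OF _ abs_ge_self]\<close>)
  then show ?thesis using BR unfolding bdd_int_def by blast
qed

section \<open>Convolution with integrable kernels\<close>

lemma nn_integral_conv:
  fixes K w :: "'a::euclidean_space \<Rightarrow> ennreal"
  assumes [measurable]: "K \<in> borel_measurable borel" "w \<in> borel_measurable borel"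
  shows "(\<integral>\<^sup>+x. (\<integral>\<^sup>+y. K (x - y) * w y \<partial>lborel) \<partial>lborel) = (\<integral>\<^sup>+x. K x \<partial>lborel) * (\<integral>\<^sup>+y. w y \<partial>lborel)"
proof -
  have "(\<integral>\<^sup>+x. (\<integral>\<^sup>+y. K (x - y) * w y \<partial>lborel) \<partial>lborel) = (\<integral>\<^sup>+y. (\<integral>\<^sup>+x. K (x - y) * w y \<partial>lborel) \<partial>lborel)"
    by (rule lborel_pair.Fubini') measurable
  also have "\<dots> = (\<integral>\<^sup>+y. (\<integral>\<^sup>+x. K (- y + x) \<partial>lborel) * w y \<partial>lborel)"
    by (simp add: nn_integral_multc)
  also have "\<dots> = (\<integral>\<^sup>+y. (\<integral>\<^sup>+x. K x \<partial>lborel) * w y \<partial>lborel)"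
    by (subst nn_integral_lborel_translate) auto
  also have "\<dots> = (\<integral>\<^sup>+x. K x \<partial>lborel) * (\<integral>\<^sup>+y. w y \<partial>lborel)"
    by (simp add: nn_integral_cmult)
  finally show ?thesis .
qed

text \<open>Young's inequality for L^1 against L^1 and for L^1 against L^\<infinity>. It is stated
  for any \<open>h\<close> majorised by a convolution integrand, so that it covers inner products,
  scalar multiples and vector kernels alike.\<close>

lemma conv_dominated:
  fixes K w :: "'a::euclidean_space \<Rightarrow> real" and h :: "'a \<Rightarrow> 'a \<Rightarrow> 'b::euclidean_space"
  assumes K: "integrable lborel K" and w: "bdd_int w"
    and hm: "(\<lambda>(x, y). h x y) \<in> borel_measurable (borel \<Otimes>\<^sub>M borel)"
    and h: "\<And>x y. norm (h x y) \<le> K (x - y) * w y"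
  shows "integrable lborel (h x)" and "bdd_int (\<lambda>x. \<integral>y. h x y \<partial>lborel)"
proof -
  note [measurable] = hm bdd_intD(2)[OF w] borel_measurable_integrable[OF K, simplified]
  obtain C where C: "C > 0" "\<And>x. norm (w x) \<le> C" using bdd_int_bound[OF w] by metis
  have hK: "norm (h x y) \<le> \<bar>K (x - y)\<bar> * \<bar>w y\<bar>" for x y
    using order_trans[OF h[of x y] abs_ge_self] by (simp add: abs_mult)
  have Kn: "(\<integral>\<^sup>+x. ennreal \<bar>K x\<bar> \<partial>lborel) = ennreal (\<integral>x. \<bar>K x\<bar> \<partial>lborel)"
    using K by (intro nn_integral_eq_integral) auto
  have b: "(\<integral>\<^sup>+y. ennreal (norm (h x y)) \<partial>lborel) \<le> ennreal ((\<integral>x. \<bar>K x\<bar> \<partial>lborel) * C)" for x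
  proof -
    have "(\<integral>\<^sup>+y. ennreal (norm (h x y)) \<partial>lborel) \<le> (\<integral>\<^sup>+y. ennreal \<bar>K (x - y)\<bar> * ennreal C \<partial>lborel)"
    proof (intro nn_integral_mono)
      fix y have "norm (h x y) \<le> \<bar>K (x - y)\<bar> * C"
        using C(2)[of y] by (intro order_trans[OF hK] mult_left_mono) auto
      then show "ennreal (norm (h x y)) \<le> ennreal \<bar>K (x - y)\<bar> * ennreal C"
        using C by (simp flip: ennreal_mult)
    qed
    also have "\<dots> = (\<integral>\<^sup>+y. ennreal \<bar>K y\<bar> \<partial>lborel) * ennreal C"
      using nn_integral_lborel_reflect[of "\<lambda>y. ennreal \<bar>K y\<bar>" x] by (simp add: nn_integral_multc)
    finally show ?thesis unfolding Kn using C by (simp add: ennreal_mult)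
  qed
  show i: "integrable lborel (h x)" for x
    using b[of x] by (intro integrableI_bounded) (auto intro: le_less_trans)
  have "norm (\<integral>y. h x y \<partial>lborel) \<le> (\<integral>x. \<bar>K x\<bar> \<partial>lborel) * C" for x
  proof -
    have "ennreal (norm (\<integral>y. h x y \<partial>lborel)) \<le> (\<integral>\<^sup>+y. ennreal (norm (h x y)) \<partial>lborel)"
      by (rule integral_norm_bound_ennreal[OF i])
    then have "ennreal (norm (\<integral>y. h x y \<partial>lborel)) \<le> ennreal ((\<integral>x. \<bar>K x\<bar> \<partial>lborel) * C)" using b[of x] by order
    then show ?thesis using C by (subst (asm) ennreal_le_iff) auto
  qed
  moreover have "integrable lborel (\<lambda>x. \<integral>y. h x y \<partial>lborel)"
  proof (rule integrableI_bounded)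
    have "(\<integral>\<^sup>+x. ennreal (norm (\<integral>y. h x y \<partial>lborel)) \<partial>lborel) \<le> (\<integral>\<^sup>+x. (\<integral>\<^sup>+y. ennreal \<bar>K (x - y)\<bar> * ennreal \<bar>w y\<bar> \<partial>lborel) \<partial>lborel)"
    proof (intro nn_integral_mono)
      fix x
      have "ennreal (norm (\<integral>y. h x y \<partial>lborel)) \<le> (\<integral>\<^sup>+y. ennreal (norm (h x y)) \<partial>lborel)"
        by (rule integral_norm_bound_ennreal[OF i])
      also have "\<dots> \<le> (\<integral>\<^sup>+y. ennreal \<bar>K (x - y)\<bar> * ennreal \<bar>w y\<bar> \<partial>lborel)"
        using hK by (intro nn_integral_mono) (simp flip: ennreal_mult)
      finally show "ennreal (norm (\<integral>y. h x y \<partial>lborel)) \<le> (\<integral>\<^sup>+y. ennreal \<bar>K (x - y)\<bar> * ennreal \<bar>w y\<bar> \<partial>lborel)" .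
    qed
    also have "\<dots> = (\<integral>\<^sup>+x. ennreal \<bar>K x\<bar> \<partial>lborel) * (\<integral>\<^sup>+y. ennreal \<bar>w y\<bar> \<partial>lborel)"
      by (rule nn_integral_conv) auto
    also have "\<dots> < \<infinity>"
      using bdd_intD(1)[OF w] K by (auto simp: integrable_iff_bounded ennreal_mult_less_top)
    finally show "(\<integral>\<^sup>+x. ennreal (norm (\<integral>y. h x y \<partial>lborel)) \<partial>lborel) < \<infinity>" .
  qed measurable
  ultimately show "bdd_int (\<lambda>x. \<integral>y. h x y \<partial>lborel)" unfolding bdd_int_def by blast
qed

text \<open>A norm bound with a real constant, for a Borel function over \<open>lborel\<close>. It
  bypasses the infinite values and the Lebesgue-measurable representatives that come with
  \<open>lp_norm\<close>; the two notions are matched only at the end.\<close>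

definition Lp_bound :: "real \<Rightarrow> ('a::euclidean_space \<Rightarrow> 'b::euclidean_space) \<Rightarrow> real \<Rightarrow> bool" where
  "Lp_bound p f N \<longleftrightarrow> 0 \<le> N \<and> f \<in> borel_measurable borel \<and>
     (\<integral>\<^sup>+x. ennreal (norm (f x) powr p) \<partial>lborel) \<le> ennreal (N powr p)"

text \<open>No conjugate exponent occurs: where \<open>\<bar>f x\<bar> \<le> 1\<close> the product
  is at most \<open>\<bar>w x\<bar>\<close>, elsewhere it is at most
  \<open>C * \<bar>f x\<bar> powr p\<close>.\<close>

lemma integrable_Lp_mult:
  fixes f w :: "'a::euclidean_space \<Rightarrow> real"
  assumes p: "p \<ge> 1" and f: "Lp_bound p f N" and w: "bdd_int w"
  shows "integrable lborel (\<lambda>x. f x * w x)"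
proof -
  have [measurable]: "f \<in> borel_measurable borel" using f by (simp add: Lp_bound_def)
  obtain C where C: "C > 0" "\<And>x. norm (w x) \<le> C" using bdd_int_bound[OF w] by metis
  have "integrable lborel (\<lambda>x. \<bar>f x\<bar> powr p)"
    using f by (intro integrableI_bounded) (auto simp: Lp_bound_def intro: le_less_trans)
  then have "integrable lborel (\<lambda>x. \<bar>w x\<bar> + C * \<bar>f x\<bar> powr p)"
    using bdd_intD(1)[OF w] by auto
  then show ?thesis
  proof (rule Bochner_Integration.integrable_bound)
    show "(\<lambda>x. f x * w x) \<in> borel_measurable lborel" using bdd_intD(2)[OF w] by simp
    have "\<bar>f x\<bar> * \<bar>w x\<bar> \<le> \<bar>w x\<bar> + C * \<bar>f x\<bar> powr p" for x
    proof (cases "\<bar>f x\<bar> \<le> 1")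
      case True
      then have "\<bar>f x\<bar> * \<bar>w x\<bar> \<le> \<bar>w x\<bar>" by (simp add: mult_left_le_one_le)
      then show ?thesis using C by (simp add: add_increasing2)
    next
      case False
      then have "\<bar>f x\<bar> powr 1 \<le> \<bar>f x\<bar> powr p" using p by (intro powr_mono) auto
      then have "\<bar>f x\<bar> * \<bar>w x\<bar> \<le> \<bar>f x\<bar> powr p * C" using False C(2)[of x] by (intro mult_mono) auto
      then show ?thesis by (simp add: mult.commute add_increasing)
    qed
    then show "AE x in lborel. norm (f x * w x) \<le> norm (\<bar>w x\<bar> + C * \<bar>f x\<bar> powr p)"
      by (intro AE_I2) (simp add: abs_mult order_trans[OF _ abs_ge_self])
  qed
qed

text \<open>Joint absolute integrability, the hypothesis of Fubini when integration against
  \<open>f\<close> is moved through a convolution.\<close>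

lemma integrable_Lp_conv:
  fixes K w f :: "'a::euclidean_space \<Rightarrow> real" and h :: "'a \<Rightarrow> 'a \<Rightarrow> 'b::euclidean_space"
  assumes p: "p \<ge> 1" and f: "Lp_bound p f N"
    and K: "integrable lborel K" and w: "bdd_int w"
    and hm: "(\<lambda>(x, y). h x y) \<in> borel_measurable (borel \<Otimes>\<^sub>M borel)"
    and h: "\<And>x y. norm (h x y) \<le> K (x - y) * w y"
  shows "integrable (lborel \<Otimes>\<^sub>M lborel) (\<lambda>(x, y). f x *\<^sub>R h x y)"
proof -
  have [measurable]: "f \<in> borel_measurable borel" using f by (simp add: Lp_bound_def)
  note [measurable] = hm bdd_intD(2)[OF w] borel_measurable_integrable[OF K, simplified]
  have hm': "(\<lambda>(x, y). norm (h x y)) \<in> borel_measurable (borel \<Otimes>\<^sub>M borel)"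
    by (simp add: split_beta')
  have h': "norm (norm (h x y)) \<le> K (x - y) * w y" for x y using h by simp
  have i: "integrable lborel (h x)" for x by (rule conv_dominated(1)[OF K w hm h])
  have 1: "bdd_int (\<lambda>x. \<integral>y. norm (h x y) \<partial>lborel)" by (rule conv_dominated(2)[OF K w hm' h'])
  show ?thesis
  proof (rule integrableI_bounded)
    show "(\<lambda>(x, y). f x *\<^sub>R h x y) \<in> borel_measurable (lborel \<Otimes>\<^sub>M lborel)" by (simp add: split_beta')
    have "(\<integral>\<^sup>+z. ennreal (norm (case z of (x, y) \<Rightarrow> f x *\<^sub>R h x y)) \<partial>(lborel \<Otimes>\<^sub>M lborel)) = (\<integral>\<^sup>+x. (\<integral>\<^sup>+y. ennreal (norm (f x *\<^sub>R h x y)) \<partial>lborel) \<partial>lborel)"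
      by (subst lborel.nn_integral_fst[symmetric]) (auto simp: split_beta')
    also have "\<dots> = (\<integral>\<^sup>+x. ennreal (norm (f x * (\<integral>y. norm (h x y) \<partial>lborel))) \<partial>lborel)"
    proof (intro nn_integral_cong)
      fix x
      have "(\<integral>\<^sup>+y. ennreal (norm (f x *\<^sub>R h x y)) \<partial>lborel) = ennreal \<bar>f x\<bar> * (\<integral>\<^sup>+y. ennreal (norm (h x y)) \<partial>lborel)"
        by (simp add: ennreal_mult nn_integral_cmult)
      also have "(\<integral>\<^sup>+y. ennreal (norm (h x y)) \<partial>lborel) = ennreal (\<integral>y. norm (h x y) \<partial>lborel)"
        using i[of x] by (intro nn_integral_eq_integral) auto
      finally show "(\<integral>\<^sup>+y. ennreal (norm (f x *\<^sub>R h x y)) \<partial>lborel) = ennreal (norm (f x * (\<integral>y. norm (h x y) \<partial>lborel)))"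
        by (simp add: abs_mult flip: ennreal_mult)
    qed
    also have "\<dots> < \<infinity>"
      using integrable_Lp_mult[OF p f 1] by (simp add: integrable_iff_bounded)
    finally show "(\<integral>\<^sup>+z. ennreal (norm (case z of (x, y) \<Rightarrow> f x *\<^sub>R h x y)) \<partial>(lborel \<Otimes>\<^sub>M lborel)) < \<infinity>" .
  qed
qed

section \<open>Smooth fields and convolution\<close>

lemma smooth_iff_differentiable:
  "smooth f \<longleftrightarrow> (\<forall>ds. set ds \<subseteq> Basis \<longrightarrow> (\<forall>x. dirderiv ds f differentiable (at x)))"
  unfolding smooth_def
  by (auto intro!: differentiable_imp_continuous_on simp: differentiable_on_def differentiable_at_withinI)

lemma smooth_differentiable: "smooth f \<Longrightarrow> set ds \<subseteq> Basis \<Longrightarrow> dirderiv ds f differentiable (at x)"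
  by (simp add: smooth_iff_differentiable)

lemma smooth_continuous: "smooth f \<Longrightarrow> set ds \<subseteq> Basis \<Longrightarrow> continuous_on UNIV (dirderiv ds f)"
  by (simp add: smooth_def)

text \<open>A set of functions that is closed under partial derivatives is easier to exhibit than
  formulas for all higher derivatives.\<close>

lemma smooth_if_closed_under_derivative:
  assumes "f \<in> S" and d: "\<And>f x. f \<in> S \<Longrightarrow> f differentiable (at x)"
    and c: "\<And>f d. f \<in> S \<Longrightarrow> d \<in> Basis \<Longrightarrow> (\<lambda>x. frechet_derivative f (at x) d) \<in> S"
  shows "smooth f"
proof -
  have "dirderiv ds f \<in> S" if "set ds \<subseteq> Basis" for ds
    using that by (induction ds) (auto simp: assms(1) intro: c)
  then show ?thesis by (auto simp: smooth_iff_differentiable intro: d)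
qed

text \<open>The complement of a closed ball is open, so vanishing there is inherited by derivatives.
  This keeps all derivatives of a compactly supported function in one ball, hence bounded.\<close>

lemma dirderiv_vanishes:
  fixes f :: "'a::euclidean_space \<Rightarrow> 'b::real_normed_vector"
  assumes "\<And>x. R < norm x \<Longrightarrow> f x = 0"
  shows "R < norm x \<Longrightarrow> dirderiv ds f x = 0"
proof (induction ds arbitrary: x)
  case (Cons d ds)
  have "open {y::'a. R < norm y}" by (intro open_Collect_less continuous_intros)
  then have "(dirderiv ds f has_derivative (\<lambda>h. 0)) (at x)"
    using Cons by (intro has_derivative_transform_within_open[OF has_derivative_const[of 0]]) auto
  from frechet_derivative_at[OF this, symmetric] show ?case by simp
qed (use assms in auto)

lemma frechet_derivative_expand:
  fixes f :: "'a::euclidean_space \<Rightarrow> 'b::real_normed_vector"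
  assumes "f differentiable (at x)"
  shows "frechet_derivative f (at x) h = (\<Sum>b\<in>Basis. (h \<bullet> b) *\<^sub>R frechet_derivative f (at x) b)"
proof -
  interpret linear "frechet_derivative f (at x)" by (rule linear_frechet_derivative[OF assms])
  have "frechet_derivative f (at x) h = frechet_derivative f (at x) (\<Sum>b\<in>Basis. (h \<bullet> b) *\<^sub>R b)"
    by (simp add: euclidean_representation)
  also have "\<dots> = (\<Sum>b\<in>Basis. (h \<bullet> b) *\<^sub>R frechet_derivative f (at x) b)"
    by (simp only: sum scaleR)
  finally show ?thesis .
qed

lemma smooth_dirderiv_bounded:
  fixes f :: "'a::euclidean_space \<Rightarrow> 'b::real_normed_vector"
  assumes f: "smooth f" and R: "\<And>x. R < norm x \<Longrightarrow> f x = 0" and ds: "set ds \<subseteq> Basis"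
  obtains B where "B \<ge> 0" "\<And>x. norm (dirderiv ds f x) \<le> B"
proof -
  have "compact (dirderiv ds f ` cball 0 R)"
    using smooth_continuous[OF f ds] by (intro compact_continuous_image) (auto intro: continuous_on_subset)
  then obtain B where "\<forall>y\<in>dirderiv ds f ` cball 0 R. norm y \<le> B"
    using compact_imp_bounded bounded_iff by metis
  then have B: "\<And>x. norm x \<le> R \<Longrightarrow> norm (dirderiv ds f x) \<le> B" by simp
  have "norm (dirderiv ds f x) \<le> max 0 B" for x
  proof (cases "R < norm x")
    case True
    then have "dirderiv ds f x = 0" using dirderiv_vanishes[of R f x ds] R by blast
    then show ?thesis by simp
  next
    case False
    then show ?thesis using B[of x] by simp
  qed
  then show thesis using that[of "max 0 B"] by simp
qed

lemma smooth_derivative_bounded: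
  fixes f :: "'a::euclidean_space \<Rightarrow> 'b::real_normed_vector"
  assumes f: "smooth f" and R: "\<And>x. R < norm x \<Longrightarrow> f x = 0" and ds: "set ds \<subseteq> Basis"
  obtains L where "L \<ge> 0" "\<And>x h. norm (frechet_derivative (dirderiv ds f) (at x) h) \<le> L * norm h"
proof -
  have "\<forall>b\<in>Basis. \<exists>B\<ge>0. \<forall>x. norm (dirderiv (b # ds) f x) \<le> B"
    using smooth_dirderiv_bounded[OF f R] ds by (metis insert_subset list.simps(15))
  then obtain B where B: "\<And>b. b \<in> Basis \<Longrightarrow> B b \<ge> 0" "\<And>b x. b \<in> Basis \<Longrightarrow> norm (dirderiv (b # ds) f x) \<le> B b"
    by metis
  show thesis
  proof (rule that[of "sum B Basis"])
    fix x h
    have "norm (frechet_derivative (dirderiv ds f) (at x) h) \<le> (\<Sum>b\<in>Basis. norm ((h \<bullet> b) *\<^sub>R frechet_derivative (dirderiv ds f) (at x) b))"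
      unfolding frechet_derivative_expand[OF smooth_differentiable[OF f ds], of x h] by (rule norm_sum)
    also have "\<dots> \<le> (\<Sum>b\<in>Basis. norm h * B b)"
    proof (intro sum_mono)
      fix b :: 'a assume b: "b \<in> Basis"
      then have "\<bar>h \<bullet> b\<bar> \<le> norm h" by (rule Basis_le_norm)
      then show "norm ((h \<bullet> b) *\<^sub>R frechet_derivative (dirderiv ds f) (at x) b) \<le> norm h * B b"
        using B(2)[OF b, of x] by (auto intro!: mult_mono)
    qed
    finally show "norm (frechet_derivative (dirderiv ds f) (at x) h) \<le> sum B Basis * norm h"
      by (simp add: sum_distrib_left mult.commute)
  qed (use B in \<open>auto intro: sum_nonneg\<close>)
qed

lemma lipschitz_of_derivative_bound:
  fixes f :: "'a::euclidean_space \<Rightarrow> 'b::real_normed_vector"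
  assumes "convex S" "x \<in> S" "y \<in> S"
    and "\<And>x. x \<in> S \<Longrightarrow> f differentiable (at x)"
    and "\<And>x h. x \<in> S \<Longrightarrow> norm (frechet_derivative f (at x) h) \<le> L * norm h"
  shows "norm (f x - f y) \<le> L * norm (x - y)"
proof (rule differentiable_bound[OF assms(1) _ _ assms(2,3), where f' = "\<lambda>x. frechet_derivative f (at x)"])
  fix z assume z: "z \<in> S"
  show "(f has_derivative frechet_derivative f (at z)) (at z within S)"
    using assms(4)[OF z] frechet_derivative_works has_derivative_at_withinI by blast
  show "onorm (frechet_derivative f (at z)) \<le> L"
    using assms(5)[OF z] by (rule onorm_le)
qed

lemma smooth_scaleR: 
  assumes "smooth (f :: 'a::euclidean_space \<Rightarrow> 'b::real_normed_vector)" shows "smooth (\<lambda>x. c *\<^sub>R f x)"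
proof -
  have eq: "dirderiv ds (\<lambda>x. c *\<^sub>R f x) = (\<lambda>x. c *\<^sub>R dirderiv ds f x)" if "set ds \<subseteq> Basis" for ds
    using that
  proof (induction ds)
    case (Cons d ds)
    have "((\<lambda>x. c *\<^sub>R dirderiv ds f x) has_derivative (\<lambda>h. c *\<^sub>R frechet_derivative (dirderiv ds f) (at x) h)) (at x)" for x
      using smooth_differentiable[OF assms, of ds x] Cons
      by (intro has_derivative_scaleR_right) (simp add: frechet_derivative_works)
    from frechet_derivative_at[OF this] Cons show ?case by (auto simp: fun_eq_iff) (metis)
  qed simp
  show ?thesis
    unfolding smooth_iff_differentiable using eq smooth_differentiable[OF assms] by (auto intro: differentiable_scaleR)
qed

section \<open>Differentiating a convolution\<close>

definition conv_field :: "('a::euclidean_space \<Rightarrow> real) \<Rightarrow> ('a \<Rightarrow> 'b::euclidean_space) \<Rightarrow> 'a \<Rightarrow> 'b" where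
  "conv_field \<eta> \<phi> x = (\<integral>y. \<eta> (x - y) *\<^sub>R \<phi> y \<partial>lborel)"

lemma integrable_conv_field:
  fixes \<phi> :: "'a::euclidean_space \<Rightarrow> 'b::euclidean_space"
  assumes "integrable lborel \<phi>" "\<eta> \<in> borel_measurable borel" "\<And>x. \<bar>\<eta> x\<bar> \<le> B"
  shows "integrable lborel (\<lambda>y. \<eta> (x - y) *\<^sub>R \<phi> y)"
proof -
  have "integrable lborel (\<lambda>y. B *\<^sub>R \<phi> y)" using assms by simp
  then show ?thesis
  proof (rule Bochner_Integration.integrable_bound)
    show "(\<lambda>y. \<eta> (x - y) *\<^sub>R \<phi> y) \<in> borel_measurable lborel"
      using assms(2) borel_measurable_integrable[OF assms(1)] by simp
    show "AE y in lborel. norm (\<eta> (x - y) *\<^sub>R \<phi> y) \<le> norm (B *\<^sub>R \<phi> y)"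
    proof (intro AE_I2)
      fix y
      have "\<bar>\<eta> (x - y)\<bar> * norm (\<phi> y) \<le> \<bar>B\<bar> * norm (\<phi> y)"
        using assms(3)[of "x - y"] by (intro mult_right_mono) auto
      then show "norm (\<eta> (x - y) *\<^sub>R \<phi> y) \<le> norm (B *\<^sub>R \<phi> y)" by simp
    qed
  qed
qed

text \<open>Only the kernel is differentiated, so \<phi> need merely be integrable. The remainders
  are dominated by \<open>2 * L * norm (\<phi> y)\<close>, one \<open>L\<close> from the Lipschitz
  bound and one from the derivative; sequences \<open>H\<close> appear because dominated convergence
  is sequential.\<close>

lemma conv_field_has_derivative:
  fixes \<phi> :: "'a::euclidean_space \<Rightarrow> 'b::euclidean_space"
  assumes \<phi>: "integrable lborel \<phi>" and B: "\<And>x. \<bar>\<eta> x\<bar> \<le> B" and diff: "\<And>x. \<eta> differentiable (at x)"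
    and L: "L \<ge> 0" "\<And>x h. norm (frechet_derivative \<eta> (at x) h) \<le> L * norm h"
    and meas[measurable]: "\<And>h. (\<lambda>x. frechet_derivative \<eta> (at x) h) \<in> borel_measurable borel"
  shows "(conv_field \<eta> \<phi> has_derivative (\<lambda>h. conv_field (\<lambda>x. frechet_derivative \<eta> (at x) h) \<phi> x)) (at x)"
proof -
  have [measurable]: "\<phi> \<in> borel_measurable borel" using borel_measurable_integrable[OF \<phi>] by simp
  have cont: "continuous_on UNIV \<eta>" using diff by (auto intro!: differentiable_imp_continuous_on simp: differentiable_on_def differentiable_at_withinI)
  then have [measurable]: "\<eta> \<in> borel_measurable borel" by (rule borel_measurable_continuous_onI)
  have i0: "integrable lborel (\<lambda>y. \<eta> (x - y) *\<^sub>R \<phi> y)" for x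
    by (rule integrable_conv_field[OF \<phi> _ B]) simp
  have i1: "integrable lborel (\<lambda>y. frechet_derivative \<eta> (at (x - y)) h *\<^sub>R \<phi> y)" for x h
    by (rule integrable_conv_field[OF \<phi> meas, of h "L * norm h"]) (use L(2) in auto)
  have lin: "linear (frechet_derivative \<eta> (at z))" for z by (rule linear_frechet_derivative[OF diff])
  have lip: "norm (\<eta> u - \<eta> v) \<le> L * norm (u - v)" for u v
    by (rule lipschitz_of_derivative_bound[of UNIV]) (use diff L in auto)
  let ?D = "\<lambda>h. conv_field (\<lambda>x. frechet_derivative \<eta> (at x) h) \<phi> x"
  have bl: "bounded_linear ?D"
  proof (rule bounded_linear_intro[where K = "L * (\<integral>y. norm (\<phi> y) \<partial>lborel)"])
    show "?D (h + k) = ?D h + ?D k" for h k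
      unfolding conv_field_def linear_add[OF lin] scaleR_add_left using i1
      by (intro Bochner_Integration.integral_add) auto
    show "?D (r *\<^sub>R h) = r *\<^sub>R ?D h" for r h
      unfolding conv_field_def linear_scale[OF lin] by (simp only: real_scaleR_def scaleR_scaleR[symmetric] integral_scaleR_right)
    show "norm (?D h) \<le> norm h * (L * (\<integral>y. norm (\<phi> y) \<partial>lborel))" for h
    proof -
      have "norm (?D h) \<le> (\<integral>y. norm (frechet_derivative \<eta> (at (x - y)) h *\<^sub>R \<phi> y) \<partial>lborel)"
        unfolding conv_field_def by (rule integral_norm_bound)
      also have "\<dots> \<le> (\<integral>y. (L * norm h) * norm (\<phi> y) \<partial>lborel)"
      proof (rule integral_mono)
        show "norm (frechet_derivative \<eta> (at (x - y)) h *\<^sub>R \<phi> y) \<le> (L * norm h) * norm (\<phi> y)" for y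
          unfolding norm_scaleR by (rule mult_right_mono) (use L(2)[of "x - y" h] in auto)
        show "integrable lborel (\<lambda>y. norm (frechet_derivative \<eta> (at (x - y)) h *\<^sub>R \<phi> y))"
          by (rule integrable_norm[OF i1])
        show "integrable lborel (\<lambda>y. (L * norm h) * norm (\<phi> y))" using \<phi> by auto
      qed
      finally show ?thesis by (simp add: mult_ac)
    qed
  qed
  have "((\<lambda>h. norm (conv_field \<eta> \<phi> (x + h) - conv_field \<eta> \<phi> x - ?D h) / norm h) \<longlongrightarrow> 0) (at 0)"
    unfolding tendsto_at_iff_sequentially comp_def
  proof (intro allI impI)
    fix H :: "nat \<Rightarrow> 'a" assume H: "\<forall>i. H i \<in> UNIV - {0}" "H \<longlonglongrightarrow> 0"
    \<comment> \<open>The integrand of the difference quotient minus the derivative. It tends to 0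
      pointwise by differentiability of the kernel.\<close>
    define Q where "Q i y = ((\<eta> (x - y + H i) - \<eta> (x - y) - frechet_derivative \<eta> (at (x - y)) (H i)) / norm (H i)) *\<^sub>R \<phi> y" for i y
    have eq: "conv_field \<eta> \<phi> (x + H i) - conv_field \<eta> \<phi> x - ?D (H i) = norm (H i) *\<^sub>R (\<integral>y. Q i y \<partial>lborel)" for i
    proof -
      have "norm (H i) *\<^sub>R (\<integral>y. Q i y \<partial>lborel) = (\<integral>y. norm (H i) *\<^sub>R Q i y \<partial>lborel)" by simp
      also have "\<dots> = (\<integral>y. (\<eta> (x + H i - y) *\<^sub>R \<phi> y - \<eta> (x - y) *\<^sub>R \<phi> y) - frechet_derivative \<eta> (at (x - y)) (H i) *\<^sub>R \<phi> y \<partial>lborel)"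
      proof (intro Bochner_Integration.integral_cong refl)
        fix y
        have e: "x - y + H i = x + H i - y" by simp
        have "norm (H i) *\<^sub>R Q i y = (\<eta> (x - y + H i) - \<eta> (x - y) - frechet_derivative \<eta> (at (x - y)) (H i)) *\<^sub>R \<phi> y"
          unfolding Q_def using H(1) by simp
        then show "norm (H i) *\<^sub>R Q i y = (\<eta> (x + H i - y) *\<^sub>R \<phi> y - \<eta> (x - y) *\<^sub>R \<phi> y) - frechet_derivative \<eta> (at (x - y)) (H i) *\<^sub>R \<phi> y"
          unfolding e by (simp add: scaleR_diff_left)
      qed
      also have "\<dots> = conv_field \<eta> \<phi> (x + H i) - conv_field \<eta> \<phi> x - ?D (H i)"
        unfolding conv_field_def
        by (simp only: Bochner_Integration.integral_diff[OF i0 i0] Bochner_Integration.integral_diff[OF Bochner_Integration.integrable_diff[OF i0 i0] i1])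
      finally show ?thesis by simp
    qed
    have "(\<lambda>i. \<integral>y. Q i y \<partial>lborel) \<longlonglongrightarrow> (\<integral>y. 0 \<partial>(lborel::'a measure))"
    proof (rule integral_dominated_convergence)
      show "integrable lborel (\<lambda>y. (2 * L) * norm (\<phi> y))" using \<phi> by auto
      show "AE y in lborel. norm (Q i y) \<le> (2 * L) * norm (\<phi> y)" for i
      proof (intro AE_I2)
        fix y
        have "\<bar>\<eta> (x - y + H i) - \<eta> (x - y) - frechet_derivative \<eta> (at (x - y)) (H i)\<bar> \<le> (2 * L) * norm (H i)"
          using lip[of "x - y + H i" "x - y"] L(2)[of "x - y" "H i"] by simp
        then have "\<bar>(\<eta> (x - y + H i) - \<eta> (x - y) - frechet_derivative \<eta> (at (x - y)) (H i)) / norm (H i)\<bar> \<le> 2 * L"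
          using H(1) by (simp add: divide_le_eq)
        then show "norm (Q i y) \<le> (2 * L) * norm (\<phi> y)" unfolding Q_def norm_scaleR by (intro mult_right_mono) auto
      qed
      show "AE y in lborel. (\<lambda>i. Q i y) \<longlonglongrightarrow> 0"
      proof (intro AE_I2)
        fix y
        have "(\<eta> has_derivative frechet_derivative \<eta> (at (x - y))) (at (x - y))"
          using diff frechet_derivative_works by blast
        then have "((\<lambda>h. norm (\<eta> (x - y + h) - \<eta> (x - y) - frechet_derivative \<eta> (at (x - y)) h) / norm h) \<longlongrightarrow> 0) (at 0)"
          by (rule has_derivative_at[THEN iffD1, THEN conjunct2])
        then have "(\<lambda>i. norm (\<eta> (x - y + H i) - \<eta> (x - y) - frechet_derivative \<eta> (at (x - y)) (H i)) / norm (H i)) \<longlonglongrightarrow> 0"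
          by (rule filterlim_compose) (use H in \<open>simp add: filterlim_at\<close>)
        then have "(\<lambda>i. (\<eta> (x - y + H i) - \<eta> (x - y) - frechet_derivative \<eta> (at (x - y)) (H i)) / norm (H i)) \<longlonglongrightarrow> 0"
          by (subst tendsto_norm_zero_iff[symmetric]) (simp add: abs_divide)
        from tendsto_scaleR[OF this tendsto_const[of "\<phi> y"]] show "(\<lambda>i. Q i y) \<longlonglongrightarrow> 0" unfolding Q_def by simp
      qed
      show "Q i \<in> borel_measurable lborel" for i unfolding Q_def by measurable
    qed simp
    then have "(\<lambda>i. \<integral>y. Q i y \<partial>lborel) \<longlonglongrightarrow> 0" by simp
    then have "(\<lambda>i. norm (\<integral>y. Q i y \<partial>lborel)) \<longlonglongrightarrow> 0" by (rule tendsto_norm_zero)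
    moreover have "(\<lambda>i. norm (conv_field \<eta> \<phi> (x + H i) - conv_field \<eta> \<phi> x - ?D (H i)) / norm (H i)) = (\<lambda>i. norm (\<integral>y. Q i y \<partial>lborel))"
    proof
      fix i
      have "norm (H i) > 0" using H(1) by simp
      then show "norm (conv_field \<eta> \<phi> (x + H i) - conv_field \<eta> \<phi> x - ?D (H i)) / norm (H i) = norm (\<integral>y. Q i y \<partial>lborel)"
        by (simp only: eq norm_scaleR abs_norm_cancel) (simp only: nonzero_mult_div_cancel_left less_imp_neq[symmetric] not_False_eq_True)
    qed
    ultimately show "(\<lambda>i. norm (conv_field \<eta> \<phi> (x + H i) - conv_field \<eta> \<phi> x - ?D (H i)) / norm (H i)) \<longlonglongrightarrow> 0"
      by (rule ssubst[rotated])
  qed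
  then show ?thesis by (rule has_derivative_at[THEN iffD2, OF conjI[OF bl]])
qed

lemma smooth_partial_measurable:
  fixes f :: "'a::euclidean_space \<Rightarrow> 'b::euclidean_space"
  assumes f: "smooth f" and ds: "set ds \<subseteq> Basis"
  shows "(\<lambda>x. frechet_derivative (dirderiv ds f) (at x) h) \<in> borel_measurable borel"
proof -
  have "continuous_on UNIV (dirderiv (b # ds) f)" if "b \<in> Basis" for b
    using that ds by (intro smooth_continuous[OF f]) auto
  then have [measurable]: "(\<lambda>x. frechet_derivative (dirderiv ds f) (at x) b) \<in> borel_measurable borel" if "b \<in> Basis" for b
    using that by (auto intro: borel_measurable_continuous_onI)
  show ?thesis
    unfolding frechet_derivative_expand[OF smooth_differentiable[OF f ds], of _ h] by measurable
qed

text \<open>The previous derivative formula is iterated on the kernel. All derivatives of the kernel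
  satisfy its boundedness hypotheses because their supports stay in one ball.\<close>

lemma conv_field_smooth:
  fixes \<phi> :: "'a::euclidean_space \<Rightarrow> 'b::euclidean_space"
  assumes \<eta>: "smooth \<eta>" and R: "\<And>x. R < norm x \<Longrightarrow> \<eta> x = 0" and \<phi>: "integrable lborel \<phi>"
  shows "\<And>x h. frechet_derivative (conv_field \<eta> \<phi>) (at x) h = conv_field (\<lambda>x. frechet_derivative \<eta> (at x) h) \<phi> x"
    and "smooth (conv_field \<eta> \<phi>)"
proof -
  have D: "(conv_field (dirderiv ds \<eta>) \<phi> has_derivative (\<lambda>h. conv_field (\<lambda>x. frechet_derivative (dirderiv ds \<eta>) (at x) h) \<phi> x)) (at x)"
    if ds: "set ds \<subseteq> Basis" for ds x
  proof -
    obtain B where B: "\<And>x. norm (dirderiv ds \<eta> x) \<le> B" using smooth_dirderiv_bounded[OF \<eta> R ds] by metis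
    obtain L where L: "L \<ge> 0" "\<And>x h. norm (frechet_derivative (dirderiv ds \<eta>) (at x) h) \<le> L * norm h"
      using smooth_derivative_bounded[OF \<eta> R ds] by metis
    show ?thesis
      by (rule conv_field_has_derivative[OF \<phi> _ _ L]) (use B smooth_differentiable[OF \<eta> ds] smooth_partial_measurable[OF \<eta> ds] in auto)
  qed
  show "frechet_derivative (conv_field \<eta> \<phi>) (at x) h = conv_field (\<lambda>x. frechet_derivative \<eta> (at x) h) \<phi> x" for x h
    using frechet_derivative_at[OF D[of "[]" x]] by (simp add: fun_eq_iff)
  have eq: "dirderiv ds (conv_field \<eta> \<phi>) = conv_field (dirderiv ds \<eta>) \<phi>" if "set ds \<subseteq> Basis" for ds
    using that
  proof (induction ds)
    case (Cons d ds)
    then have ds: "set ds \<subseteq> Basis" "dirderiv ds (conv_field \<eta> \<phi>) = conv_field (dirderiv ds \<eta>) \<phi>" by auto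
    have "frechet_derivative (conv_field (dirderiv ds \<eta>) \<phi>) (at x) d = conv_field (\<lambda>x. frechet_derivative (dirderiv ds \<eta>) (at x) d) \<phi> x" for x
      using frechet_derivative_at[OF D[OF ds(1), of x]] by (simp add: fun_eq_iff)
    then show ?case using ds by auto
  qed simp
  show "smooth (conv_field \<eta> \<phi>)"
    unfolding smooth_iff_differentiable using eq D by (auto simp: differentiable_def)
qed

lemma conv_field_test_field:
  fixes \<phi> :: "'a::euclidean_space \<Rightarrow> 'a"
  assumes \<eta>: "smooth \<eta>" and R: "\<And>x. R < norm x \<Longrightarrow> \<eta> x = 0" and \<phi>: "integrable lborel \<phi>"
    and R': "\<And>x. R' < norm x \<Longrightarrow> \<phi> x = 0"
  shows "conv_field \<eta> \<phi> \<in> test_fields"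
proof -
  have "conv_field \<eta> \<phi> x = 0" if "R + R' < norm x" for x
  proof -
    have "\<eta> (x - y) *\<^sub>R \<phi> y = 0" for y
      using R[of "x - y"] R'[of y] norm_triangle_sub[of x y] that by fastforce
    then show ?thesis unfolding conv_field_def by (simp only: Bochner_Integration.integral_zero)
  qed
  then have "{x. conv_field \<eta> \<phi> x \<noteq> 0} \<subseteq> cball 0 (R + R')" by (auto simp: not_less[symmetric])
  then have "bounded {x. conv_field \<eta> \<phi> x \<noteq> 0}" using bounded_cball bounded_subset by blast
  then show ?thesis
    unfolding test_fields_def using conv_field_smooth(2)[OF \<eta> R \<phi>] by (simp add: compact_closure)
qed

section \<open>Uniform bounds for test fields\<close>

lemma test_field_bounds:
  fixes \<phi> :: "'a::euclidean_space \<Rightarrow> 'a"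
  assumes "\<phi> \<in> test_fields"
  obtains R B L where "\<And>x. R < norm x \<Longrightarrow> \<phi> x = 0" "B \<ge> 0" "\<And>x. norm (\<phi> x) \<le> B" "L \<ge> 0" "\<And>x y. norm (\<phi> x - \<phi> y) \<le> L * norm (x - y)"
proof -
  have sm: "smooth \<phi>" and "bounded {x. \<phi> x \<noteq> 0}"
    using assms by (auto simp: test_fields_def compact_closure)
  then obtain R where "\<forall>x\<in>{x. \<phi> x \<noteq> 0}. norm x \<le> R" unfolding bounded_iff by blast
  then have R: "\<And>x. R < norm x \<Longrightarrow> \<phi> x = 0" by (auto simp: not_le[symmetric])
  obtain B where B: "B \<ge> 0" "\<And>x. norm (\<phi> x) \<le> B"
    using smooth_dirderiv_bounded[OF sm R, where ds = "[]"] by auto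
  obtain L where L: "L \<ge> 0" "\<And>x h. norm (frechet_derivative \<phi> (at x) h) \<le> L * norm h"
    using smooth_derivative_bounded[OF sm R, where ds = "[]"] by auto
  have "norm (\<phi> x - \<phi> y) \<le> L * norm (x - y)" for x y
    by (rule lipschitz_of_derivative_bound[of UNIV]) (use L smooth_differentiable[OF sm, of "[]"] in auto)
  then show thesis using that[OF R B L(1)] by simp
qed

lemma test_field_scaleR: "\<phi> \<in> test_fields \<Longrightarrow> (\<lambda>x. c *\<^sub>R \<phi> x) \<in> test_fields"
proof -
  assume \<phi>: "\<phi> \<in> test_fields"
  have "{x. c *\<^sub>R \<phi> x \<noteq> 0} \<subseteq> {x. \<phi> x \<noteq> 0}" by auto
  moreover have "bounded {x. \<phi> x \<noteq> 0}" "smooth \<phi>" using \<phi> by (simp_all add: test_fields_def compact_closure)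
  ultimately have "bounded {x. c *\<^sub>R \<phi> x \<noteq> 0}" "smooth (\<lambda>x. c *\<^sub>R \<phi> x)"
    by (blast intro: bounded_subset, simp add: smooth_scaleR)
  then show ?thesis unfolding test_fields_def mem_Collect_eq compact_closure by (intro conjI)
qed

section \<open>Compactly supported approximations of the heat kernel\<close>

text \<open>The index \<open>j\<close> makes the family closed under differentiation: a derivative
  is a combination of the members \<open>j + 2\<close> and \<open>j + 1\<close>. Every member is
  flat at 0, and \<open>j = 0\<close> is the standard smooth cut-off profile.\<close>

definition bump :: "nat \<Rightarrow> real \<Rightarrow> real" where
  "bump j u = (if u > 0 then exp (- 1 / u) / u ^ j else 0)"

text \<open>This is \<open>(x / k) ^ k \<le> exp x\<close> at \<open>x = 1 / t\<close>: near 0 the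
  exponential beats every negative power of \<open>t\<close>.\<close>

lemma exp_minus_inverse_le:
  fixes t :: real
  assumes t: "t > 0" and k0: "k > 0"
  shows "exp (- 1 / t) \<le> real k ^ k * t ^ k"
proof -
  have "(1 / (t * k)) ^ k \<le> exp (1 / (t * k)) ^ k"
    using t k0 exp_ge_add_one_self[of "1 / (t * k)"] by (intro power_mono) (linarith, simp)
  also have "\<dots> = exp (1 / t)" using k0 by (simp flip: exp_of_nat_mult)
  finally have "1 / exp (1 / t) \<le> 1 / (1 / (t * k)) ^ k"
    using t k0 by (intro divide_left_mono) auto
  also have "\<dots> = real k ^ k * t ^ k" using t k0 by (simp add: power_divide power_mult_distrib)
  finally show ?thesis by (simp add: exp_minus divide_inverse)
qed

lemma bump_nonneg: "bump j u \<ge> 0" by (simp add: bump_def)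

lemma bump_0_le: "u \<le> 1 \<Longrightarrow> bump 0 u \<le> exp (- 1)"
  by (auto simp: bump_def field_simps)

lemma bump_2_le: "bump 2 u \<le> 4"
  using exp_minus_inverse_le[of u 2] by (auto simp: bump_def field_simps)

lemma bump_has_derivative:
  "(bump j has_real_derivative (bump (j + 2) u - real j * bump (j + 1) u)) (at u)"
proof -
  consider "u > 0" | "u < 0" | "u = 0" by linarith
  then show ?thesis
  proof cases
    case 1
    have "((\<lambda>u. exp (- 1 / u) / u ^ j) has_real_derivative (bump (j + 2) u - real j * bump (j + 1) u)) (at u)"
    proof (cases j)
      case 0
      have "((\<lambda>u. exp (- 1 / u)) has_real_derivative exp (- 1 / u) * (1 / u ^ 2)) (at u)"
        using 1 by (auto intro!: derivative_eq_intros simp: power2_eq_square)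
      then show ?thesis using 0 1 by (simp add: bump_def power2_eq_square)
    next
      case (Suc i)
      have d1: "((\<lambda>u. exp (- 1 / u)) has_real_derivative exp (- 1 / u) * (1 / u ^ 2)) (at u)"
        using 1 by (auto intro!: derivative_eq_intros simp: power2_eq_square)
      have d2: "((\<lambda>u. u ^ j) has_real_derivative real j * u ^ i) (at u)"
        using DERIV_pow[of j u UNIV] Suc by simp
      show ?thesis
        by (rule DERIV_cong[OF DERIV_divide[OF d1 d2]])
           (use 1 Suc in \<open>simp_all add: bump_def power2_eq_square divide_simps, simp add: algebra_simps\<close>)
    qed
    then show ?thesis
      by (rule has_field_derivative_transform_within_open[where S = "{0<..}"]) (use 1 in \<open>auto simp: bump_def\<close>)
  next
    case 2
    have "((\<lambda>_. 0) has_real_derivative (bump (j + 2) u - real j * bump (j + 1) u)) (at u)"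
      using 2 by (simp add: bump_def)
    then show ?thesis
      by (rule has_field_derivative_transform_within_open[where S = "{..<0}"]) (use 2 in \<open>auto simp: bump_def\<close>)
  next
    case 3
    \<comment> \<open>A quadratic bound at 0, which forces the difference quotient there to 0. It is
      the exponential estimate with exponent \<open>j + 2\<close>, of which \<open>j\<close> powers
      are spent on the denominator.\<close>
    have b: "bump j h \<le> real (j + 2) ^ (j + 2) * h\<^sup>2" for h
    proof (cases "h > 0")
      case True
      define K where "K = real (j + 2) ^ (j + 2)"
      have "exp (- 1 / h) \<le> K * h ^ (j + 2)"
        unfolding K_def by (rule exp_minus_inverse_le) (use True in auto)
      then have "bump j h \<le> (K * h ^ (j + 2)) / h ^ j"
        using True divide_right_mono[of "exp (- 1 / h)" "K * h ^ (j + 2)" "h ^ j"] by (simp only: bump_def if_True) simp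
      also have "\<dots> = K * h\<^sup>2" using True by (simp add: power_add power2_eq_square)
      finally show ?thesis unfolding K_def .
    qed (simp add: bump_def)
    have "((\<lambda>h. (bump j (0 + h) - bump j 0) / h) \<longlongrightarrow> 0) (at 0)"
    proof (rule tendsto_rabs_zero_cancel, rule tendsto_sandwich[OF _ _ tendsto_const])
      show "\<forall>\<^sub>F h in at 0. 0 \<le> \<bar>(bump j (0 + h) - bump j 0) / h\<bar>" by simp
      show "\<forall>\<^sub>F h in at 0. \<bar>(bump j (0 + h) - bump j 0) / h\<bar> \<le> real (j + 2) ^ (j + 2) * \<bar>h\<bar>"
      proof (rule eventually_at_filter[THEN iffD2, OF always_eventually], intro allI impI)
        fix h :: real assume h: "h \<noteq> 0"
        have "\<bar>(bump j (0 + h) - bump j 0) / h\<bar> = bump j h / \<bar>h\<bar>"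
          by (simp add: bump_nonneg abs_of_nonneg) (simp add: bump_def)
        also have "\<dots> \<le> (real (j + 2) ^ (j + 2) * h\<^sup>2) / \<bar>h\<bar>"
          using b[of h] h by (intro divide_right_mono) auto
        also have "\<dots> = real (j + 2) ^ (j + 2) * \<bar>h\<bar>"
        proof -
          have "h\<^sup>2 / \<bar>h\<bar> = \<bar>h\<bar>" using h by (simp add: power2_eq_square abs_if)
          then show ?thesis by (simp only: times_divide_eq_right[symmetric])
        qed
        finally show "\<bar>(bump j (0 + h) - bump j 0) / h\<bar> \<le> real (j + 2) ^ (j + 2) * \<bar>h\<bar>" .
      qed
      show "((\<lambda>h. real (j + 2) ^ (j + 2) * \<bar>h\<bar>) \<longlongrightarrow> 0) (at 0)"
        by (rule tendsto_mult_right_zero) (auto intro!: tendsto_eq_intros)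
    qed
    then show ?thesis unfolding 3 by (simp add: DERIV_def bump_def)
  qed
qed

text \<open>An algebra that contains the cut-off Gaussians and is closed under partial derivatives,
  hence consists of smooth functions. The parameters \<open>s\<close> and \<open>k\<close> are
  fixed, since differentiation never changes them.\<close>

inductive_set heat_alg :: "real \<Rightarrow> real \<Rightarrow> ('a::euclidean_space \<Rightarrow> real) set" for s k where
  heat_alg_const: "(\<lambda>_. c) \<in> heat_alg s k"
| heat_alg_inner: "(\<lambda>x. x \<bullet> b) \<in> heat_alg s k"
| heat_alg_bump: "(\<lambda>x. bump j (1 - (x \<bullet> x) / k\<^sup>2)) \<in> heat_alg s k"
| heat_alg_exp: "(\<lambda>x. exp (- (x \<bullet> x) / s)) \<in> heat_alg s k"
| heat_alg_add: "f \<in> heat_alg s k \<Longrightarrow> g \<in> heat_alg s k \<Longrightarrow> (\<lambda>x. f x + g x) \<in> heat_alg s k"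
| heat_alg_mult: "f \<in> heat_alg s k \<Longrightarrow> g \<in> heat_alg s k \<Longrightarrow> (\<lambda>x. f x * g x) \<in> heat_alg s k"

lemma bump_comp_has_derivative:
  "((\<lambda>x::'a::euclidean_space. bump j (1 - (x \<bullet> x) / k\<^sup>2)) has_derivative
    (\<lambda>h. (bump (j + 2) (1 - (x \<bullet> x) / k\<^sup>2) - real j * bump (j + 1) (1 - (x \<bullet> x) / k\<^sup>2)) * (- 2 / k\<^sup>2 * (x \<bullet> h)))) (at x)"
proof -
  have 1: "((\<lambda>x::'a. 1 - (x \<bullet> x) / k\<^sup>2) has_derivative (\<lambda>h. - 2 / k\<^sup>2 * (x \<bullet> h))) (at x)"
  proof -
    have "((\<lambda>x::'a. 1 - inverse (k\<^sup>2) * (x \<bullet> x)) has_derivative (\<lambda>h. - (inverse (k\<^sup>2) * (x \<bullet> h + h \<bullet> x)))) (at x)"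
      by (auto intro!: derivative_eq_intros)
    moreover have "- (inverse (k\<^sup>2) * (x \<bullet> h + h \<bullet> x)) = - 2 / k\<^sup>2 * (x \<bullet> h)" for h
      by (simp add: inner_commute divide_inverse)
    ultimately show ?thesis by (simp add: divide_inverse mult.commute)
  qed
  show ?thesis
    by (rule has_derivative_eq_rhs[OF has_derivative_compose[OF 1 bump_has_derivative[unfolded has_field_derivative_def]]])
       (auto simp: fun_eq_iff)
qed

lemma exp_comp_has_derivative:
  "((\<lambda>x::'a::euclidean_space. exp (- (x \<bullet> x) / s)) has_derivative (\<lambda>h. exp (- (x \<bullet> x) / s) * (- 2 / s * (x \<bullet> h)))) (at x)"
proof -
  have 1: "((\<lambda>x::'a. - (x \<bullet> x) / s) has_derivative (\<lambda>h. - 2 / s * (x \<bullet> h))) (at x)"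
    by (auto intro!: derivative_eq_intros simp: inner_commute divide_inverse)
  show ?thesis
    by (rule has_derivative_eq_rhs[OF has_derivative_compose[OF 1 DERIV_exp[unfolded has_field_derivative_def]]])
       (auto simp: fun_eq_iff)
qed

lemma heat_alg_derivative:
  fixes f :: "'a::euclidean_space \<Rightarrow> real"
  assumes "f \<in> heat_alg s k"
  shows "\<exists>f'. (\<forall>x. (f has_derivative f' x) (at x)) \<and> (\<forall>d. (\<lambda>x. f' x d) \<in> heat_alg s k)"
  using assms
proof induction
  case (heat_alg_const c)
  show ?case by (rule exI[of _ "\<lambda>x h. 0"]) (auto intro: heat_alg.heat_alg_const)
next
  case (heat_alg_inner b)
  show ?case
    by (rule exI[of _ "\<lambda>x h. h \<bullet> b"]) (auto intro: heat_alg.heat_alg_const intro!: derivative_eq_intros)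
next
  case (heat_alg_bump j)
  have "(\<lambda>x::'a. (bump (j + 2) (1 - (x \<bullet> x) / k\<^sup>2) + - real j * bump (j + 1) (1 - (x \<bullet> x) / k\<^sup>2)) * (- 2 / k\<^sup>2 * (x \<bullet> d))) \<in> heat_alg s k" for d
    by (intro heat_alg.intros)
  then show ?case
    by (intro exI[of _ "\<lambda>x h. (bump (j + 2) (1 - (x \<bullet> x) / k\<^sup>2) - real j * bump (j + 1) (1 - (x \<bullet> x) / k\<^sup>2)) * (- 2 / k\<^sup>2 * (x \<bullet> h))"] conjI allI bump_comp_has_derivative)
       simp
next
  case heat_alg_exp
  have "(\<lambda>x::'a. exp (- (x \<bullet> x) / s) * (- 2 / s * (x \<bullet> d))) \<in> heat_alg s k" for d
    by (intro heat_alg.intros)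
  then show ?case
    by (intro exI[of _ "\<lambda>x h. exp (- (x \<bullet> x) / s) * (- 2 / s * (x \<bullet> h))"] conjI allI exp_comp_has_derivative)
next
  case (heat_alg_add f g)
  then obtain f' g' where fg: "\<And>x. (f has_derivative f' x) (at x)" "\<And>x. (g has_derivative g' x) (at x)"
     "\<And>d. (\<lambda>x. f' x d) \<in> heat_alg s k" "\<And>d. (\<lambda>x. g' x d) \<in> heat_alg s k" by blast
  show ?case
    by (rule exI[of _ "\<lambda>x h. f' x h + g' x h"]) (use fg in \<open>auto intro!: has_derivative_add heat_alg.heat_alg_add\<close>)
next
  case (heat_alg_mult f g)
  then obtain f' g' where fg: "\<And>x. (f has_derivative f' x) (at x)" "\<And>x. (g has_derivative g' x) (at x)"
     "\<And>d. (\<lambda>x. f' x d) \<in> heat_alg s k" "\<And>d. (\<lambda>x. g' x d) \<in> heat_alg s k" by blast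
  show ?case
    by (rule exI[of _ "\<lambda>x h. f x * g' x h + f' x h * g x"])
       (use fg heat_alg_mult in \<open>auto intro!: has_derivative_mult heat_alg.heat_alg_add heat_alg.heat_alg_mult\<close>)
qed

lemma heat_alg_smooth: "f \<in> heat_alg s k \<Longrightarrow> smooth f"
proof (erule smooth_if_closed_under_derivative)
  fix f :: "'a \<Rightarrow> real" and x d assume "f \<in> heat_alg s k"
  then obtain f' where f': "\<And>x. (f has_derivative f' x) (at x)" "\<And>d. (\<lambda>x. f' x d) \<in> heat_alg s k"
    using heat_alg_derivative by blast
  show "f differentiable (at x)" using f'(1) unfolding differentiable_def by blast
  have "frechet_derivative f (at x) = f' x" for x using frechet_derivative_at[OF f'(1)] by simp
  then show "(\<lambda>x. frechet_derivative f (at x) d) \<in> heat_alg s k" using f'(2) by simp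
qed

text \<open>The factor \<open>exp 1\<close> gives the cut-off the value 1 at the origin, so that the
  cut kernel lies below \<open>heat s\<close> and tends to it as \<open>k\<close> grows.\<close>

definition cut_heat :: "real \<Rightarrow> real \<Rightarrow> 'a::euclidean_space \<Rightarrow> real" where
  "cut_heat s k x = exp 1 * bump 0 (1 - (x \<bullet> x) / k\<^sup>2) * heat s x"

lemma heat_inner: "heat s x = s powr (- real DIM('a) / 2) / gauss_mass TYPE('a) * exp (- (x \<bullet> x) / s)"
  for x :: "'a::euclidean_space"
  unfolding heat_def by (simp add: power2_norm_eq_inner)

lemma cut_heat_smooth: "smooth (cut_heat s k :: 'a::euclidean_space \<Rightarrow> real)"
  unfolding cut_heat_def[abs_def] heat_inner by (rule heat_alg_smooth[of _ s k]) (intro heat_alg.intros)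

lemma cut_heat_vanishes: assumes "k > 0" "k < norm x" shows "cut_heat s k x = 0"
proof -
  have "k\<^sup>2 < (norm x)\<^sup>2" using assms by (intro power_strict_mono) auto
  then have "1 - (x \<bullet> x) / k\<^sup>2 \<le> 0" using assms by (simp add: power2_norm_eq_inner)
  then show ?thesis by (simp add: cut_heat_def bump_def)
qed

lemma cut_heat_bounds: "0 \<le> cut_heat s k x" "cut_heat s k x \<le> heat s x"
proof -
  show "0 \<le> cut_heat s k x" unfolding cut_heat_def using bump_nonneg by simp
  have "exp 1 * bump 0 (1 - (x \<bullet> x) / k\<^sup>2) \<le> exp 1 * exp (- 1)"
    by (intro mult_left_mono bump_0_le) auto
  then have "exp 1 * bump 0 (1 - (x \<bullet> x) / k\<^sup>2) \<le> 1" by (simp flip: exp_add)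
  then show "cut_heat s k x \<le> heat s x" unfolding cut_heat_def using mult_right_mono[of _ 1 "heat s x"] by fastforce
qed

lemma cut_heat_derivative:
  fixes x :: "'a::euclidean_space"
  shows "frechet_derivative (cut_heat s k) (at x) h =
    exp 1 * bump 0 (1 - (x \<bullet> x) / k\<^sup>2) * (heat_grad s x \<bullet> h) + exp 1 * (bump 2 (1 - (x \<bullet> x) / k\<^sup>2) * (- 2 / k\<^sup>2 * (x \<bullet> h))) * heat s x"
proof -
  let ?c = "s powr (- real DIM('a) / 2) / gauss_mass TYPE('a)"
  have 1: "((\<lambda>x::'a. heat s x) has_derivative (\<lambda>h. ?c * (exp (- (x \<bullet> x) / s) * (- 2 / s * (x \<bullet> h))))) (at x)"
    unfolding heat_inner by (rule has_derivative_mult_right[OF exp_comp_has_derivative])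
  have e: "?c * (exp (- (x \<bullet> x) / s) * (- 2 / s * (x \<bullet> h))) = heat_grad s x \<bullet> h" for h
    unfolding heat_grad_def heat_inner by (simp add: mult_ac)
  have 2: "((\<lambda>x::'a. exp 1 * bump 0 (1 - (x \<bullet> x) / k\<^sup>2)) has_derivative (\<lambda>h. exp 1 * (bump 2 (1 - (x \<bullet> x) / k\<^sup>2) * (- 2 / k\<^sup>2 * (x \<bullet> h))))) (at x)"
    using has_derivative_mult_right[OF bump_comp_has_derivative[of 0 k x], of "exp 1"] by (simp add: numeral_2_eq_2)
  from frechet_derivative_at[OF has_derivative_mult[OF 2 1[unfolded e]]]
  show ?thesis unfolding cut_heat_def[abs_def] by (simp only: fun_eq_iff)
qed

text \<open>The bound does not depend on \<open>k \<ge> 1\<close>, which is what a common majorant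
  requires. Differentiating the kernel gives the term with \<open>s powr (-1/2)\<close>,
  differentiating the cut-off the term with \<open>sqrt s\<close>.\<close>

lemma cut_heat_derivative_bound:
  fixes x :: "'a::euclidean_space"
  assumes s: "s > 0" and k: "k \<ge> 1"
  shows "\<bar>frechet_derivative (cut_heat s k) (at x) h\<bar> \<le> (2 * s powr (-1/2) + 24 * sqrt s) * heat_const TYPE('a) * heat (2 * s) x * norm h"
proof -
  let ?e = "exp 1 * bump 0 (1 - (x \<bullet> x) / k\<^sup>2)"
  have "?e \<le> exp 1 * exp (- 1)" by (intro mult_left_mono bump_0_le) auto
  then have e: "0 \<le> ?e" "?e \<le> 1" by (auto simp: bump_nonneg simp flip: exp_add)
  have "\<bar>?e * (heat_grad s x \<bullet> h)\<bar> = ?e * \<bar>heat_grad s x \<bullet> h\<bar>" using abs_mult[of ?e "heat_grad s x \<bullet> h"] e(1) by (simp only: abs_of_nonneg)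
  also have "\<dots> \<le> 1 * (norm (heat_grad s x) * norm h)"
    using e by (intro mult_mono Cauchy_Schwarz_ineq2) auto
  also have "\<dots> \<le> (2 * heat_const TYPE('a) * s powr (-1/2) * heat (2 * s) x) * norm h"
    using norm_heat_grad_le[OF s, of x] by (simp add: mult_right_mono)
  finally have 1: "\<bar>?e * (heat_grad s x \<bullet> h)\<bar> \<le> (2 * heat_const TYPE('a) * s powr (-1/2) * heat (2 * s) x) * norm h" .
  have k2: "0 \<le> 2 / k\<^sup>2" "2 / k\<^sup>2 \<le> 2" using k by (auto simp: divide_le_eq)
  have "\<bar>exp 1 * (bump 2 (1 - (x \<bullet> x) / k\<^sup>2) * (- 2 / k\<^sup>2 * (x \<bullet> h))) * heat s x\<bar> =
     exp 1 * (bump 2 (1 - (x \<bullet> x) / k\<^sup>2) * (2 / k\<^sup>2 * \<bar>x \<bullet> h\<bar>)) * heat s x"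
    by (simp add: abs_mult bump_nonneg)
  \<comment> \<open>The factors are \<open>exp 1 \<le> 3\<close>, \<open>bump 2 \<le> 4\<close> and
    \<open>2 / k\<^sup>2 \<le> 2\<close>; their product is the 24 of the statement.\<close>
  also have "\<dots> \<le> 3 * (4 * (2 * (norm x * norm h))) * heat s x"
    using exp_le k2 by (intro mult_right_mono mult_mono bump_2_le Cauchy_Schwarz_ineq2) (auto simp: bump_nonneg)
  also have "\<dots> = 24 * norm h * (norm x * heat s x)" by simp
  also have "\<dots> \<le> 24 * norm h * (heat_const TYPE('a) * sqrt s * heat (2 * s) x)"
    using norm_heat_le[OF s, of x] by (intro mult_left_mono) auto
  finally have 2: "\<bar>exp 1 * (bump 2 (1 - (x \<bullet> x) / k\<^sup>2) * (- 2 / k\<^sup>2 * (x \<bullet> h))) * heat s x\<bar> \<le> 24 * norm h * (heat_const TYPE('a) * sqrt s * heat (2 * s) x)" .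
  have "\<bar>frechet_derivative (cut_heat s k) (at x) h\<bar> \<le> (2 * heat_const TYPE('a) * s powr (-1/2) * heat (2 * s) x) * norm h + 24 * norm h * (heat_const TYPE('a) * sqrt s * heat (2 * s) x)"
    unfolding cut_heat_derivative using 1 2 by linarith
  then show ?thesis by (simp add: algebra_simps)
qed

text \<open>A weighted modulus of continuity. The factor \<open>min 1 (norm z)\<close> tames the
  singularity of the kernel in \<open>frac_div\<close> at 0 without growing at infinity, and the
  weight, in L^1 and L^\<infinity>, bounds the result as a function of \<open>x\<close>. A weight
  shared by a sequence of fields permits dominated convergence.\<close>

definition modulus_dom :: "('a::euclidean_space \<Rightarrow> 'b::euclidean_space) \<Rightarrow> ('a \<Rightarrow> real) \<Rightarrow> bool" where
  "modulus_dom \<Phi> w \<longleftrightarrow> (\<forall>x. 0 \<le> w x) \<and> bdd_int w \<and> (\<forall>x z. norm (\<Phi> (x + z) - \<Phi> x) \<le> min 1 (norm z) * (w (x + z) + w x))"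

text \<open>A Harnack-type comparison: moving the argument by at most 1 costs another doubling of
  the time and a factor depending on \<open>s\<close>, since
  \<open>(norm x)\<^sup>2 \<le> 2 * (norm \<xi>)\<^sup>2 + 2\<close>.\<close>

lemma heat_local_le:
  fixes x \<xi> :: "'a::euclidean_space"
  assumes s: "s > 0" and d: "norm (x - \<xi>) \<le> 1"
  shows "heat (2 * s) \<xi> \<le> exp (1 / (2 * s)) * heat_const TYPE('a) * heat (4 * s) x"
proof -
  have "(norm x)\<^sup>2 \<le> (norm \<xi> + 1)\<^sup>2"
    using d norm_triangle_sub[of x \<xi>] by (intro power_mono) auto
  also have "\<dots> \<le> 2 * (norm \<xi>)\<^sup>2 + 2"
    using zero_le_power2[of "norm \<xi> - 1"] by (simp add: power2_sum power2_diff)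
  finally have "- (norm \<xi>)\<^sup>2 / (2 * s) \<le> 1 / (2 * s) + - (norm x)\<^sup>2 / (4 * s)"
    using s by (simp add: field_simps)
  then have "exp (- (norm \<xi>)\<^sup>2 / (2 * s)) \<le> exp (1 / (2 * s)) * exp (- (norm x)\<^sup>2 / (4 * s))"
    unfolding exp_add[symmetric] by simp
  then have "heat (2 * s) \<xi> \<le> (2 * s) powr (- real DIM('a) / 2) * (exp (1 / (2 * s)) * exp (- (norm x)\<^sup>2 / (4 * s))) / gauss_mass TYPE('a)"
    unfolding heat_def using gauss_mass_pos[where 'a='a] by (intro divide_right_mono mult_left_mono) auto
  also have "(2 * s) powr (- real DIM('a) / 2) = heat_const TYPE('a) * (4 * s) powr (- real DIM('a) / 2)"
  proof -
    have "(4 * s) powr (- real DIM('a) / 2) = (2 * (2 * s)) powr (- real DIM('a) / 2)" by simp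
    also have "\<dots> = 2 powr (- real DIM('a) / 2) * (2 * s) powr (- real DIM('a) / 2)"
      using s by (subst powr_mult) auto
    finally show ?thesis unfolding heat_const_def by (simp flip: powr_add mult.assoc)
  qed
  finally show ?thesis unfolding heat_def by (simp add: mult_ac)
qed

text \<open>One weight, a multiple of \<open>heat (4 * s)\<close>, serves all
  \<open>k \<ge> 1\<close>. For \<open>norm z \<le> 1\<close> the derivative bound along the segment
  is moved to its end point by \<open>heat_local_le\<close>; for larger \<open>z\<close> the two
  values are estimated separately.\<close>

lemma cut_heat_modulus:
  fixes s :: real assumes s: "s > 0"
  obtains w :: "'a::euclidean_space \<Rightarrow> real" where "\<And>k. k \<ge> 1 \<Longrightarrow> modulus_dom (cut_heat s k) w"
    "\<And>k x h. k \<ge> 1 \<Longrightarrow> \<bar>frechet_derivative (cut_heat s k) (at x) h\<bar> \<le> w x * norm h"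
proof -
  define L where "L = (2 * s powr (-1/2) + 24 * sqrt s) * heat_const TYPE('a)"
  define E where "E = exp (1 / (2 * s)) * heat_const TYPE('a)"
  have L: "L \<ge> 0" and E: "E \<ge> 1"
    unfolding L_def E_def using s heat_const_pos[where 'a='a] mult_mono[of 1 "exp (1 / (2 * s))" 1 "heat_const TYPE('a)"] by auto
  define C where "C = (L + heat_const TYPE('a)) * E"
  have C: "C \<ge> 0" "L * E \<le> C" "heat_const TYPE('a) * E \<le> C"
    unfolding C_def using L E heat_const_pos[where 'a='a] by (auto simp: distrib_right)
  define w where "w x = C * heat (4 * s) x" for x :: 'a
  have w0: "w x \<ge> 0" for x unfolding w_def using C by simp
  have wn: "bdd_int w" unfolding w_def using s by (intro bdd_int_cmult bdd_int_heat) auto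
  have h2: "L * heat (2 * s) \<xi> \<le> w x" if "norm (x - \<xi>) \<le> 1" for x \<xi> :: 'a
  proof -
    have "L * heat (2 * s) \<xi> \<le> L * (E * heat (4 * s) x)"
      using heat_local_le[OF s that] L unfolding E_def by (intro mult_left_mono) auto
    also have "\<dots> \<le> w x" unfolding w_def using C(2) by (simp add: mult_right_mono flip: mult.assoc)
    finally show ?thesis .
  qed
  have hw: "heat s x \<le> w x" for x
  proof -
    have "heat s x \<le> heat_const TYPE('a) * heat (2 * s) x" by (rule heat_le_double[OF s])
    also have "\<dots> \<le> heat_const TYPE('a) * (E * heat (4 * s) x)"
      using heat_local_le[OF s, of x x] heat_const_pos[where 'a='a] unfolding E_def by (intro mult_left_mono) auto
    also have "\<dots> \<le> w x" unfolding w_def using C(3) by (simp add: mult_right_mono flip: mult.assoc)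
    finally show ?thesis .
  qed
  show thesis
  proof (rule that[of w])
    fix k :: real assume k: "k \<ge> 1"
    have db: "\<bar>frechet_derivative (cut_heat s k) (at x) h\<bar> \<le> L * heat (2 * s) x * norm h" for x h :: 'a
      using cut_heat_derivative_bound[OF s k, of x h] unfolding L_def .
    show "\<bar>frechet_derivative (cut_heat s k) (at x) h\<bar> \<le> w x * norm h" for x h :: 'a
      using order_trans[OF db mult_right_mono[OF h2[of x x]]] by simp
    have "\<bar>cut_heat s k (x + z) - cut_heat s k x\<bar> \<le> min 1 (norm z) * (w (x + z) + w x)" for x z :: 'a
    proof (cases "norm z \<le> 1")
      case True
      have "norm (cut_heat s k (x + z) - cut_heat s k x) \<le> w x * norm (x + z - x)"
      proof (rule lipschitz_of_derivative_bound[of "closed_segment x (x + z)"])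
        show "cut_heat s k differentiable (at \<xi>)" for \<xi> :: 'a
          using smooth_differentiable[OF cut_heat_smooth, of "[]"] by simp
        fix \<xi> h :: 'a assume "\<xi> \<in> closed_segment x (x + z)"
        then have "norm (x - \<xi>) \<le> 1" using True segment_bound(1)[of \<xi> x "x + z"] by (simp add: norm_minus_commute)
        then show "norm (frechet_derivative (cut_heat s k) (at \<xi>) h) \<le> w x * norm h"
          using order_trans[OF db mult_right_mono[OF h2[of x \<xi>]]] by simp
      qed auto
      also have "\<dots> \<le> norm z * (w (x + z) + w x)" using w0[of "x + z"] by (simp add: mult.commute mult_left_mono)
      finally show ?thesis using True by simp
    next
      case False
      have "\<bar>cut_heat s k (x + z) - cut_heat s k x\<bar> \<le> heat s (x + z) + heat s x"
        using cut_heat_bounds[of s k "x + z"] cut_heat_bounds[of s k x] heat_nonneg[of s x] heat_nonneg[of s "x + z"] by linarith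
      also have "\<dots> \<le> w (x + z) + w x" using hw by (intro add_mono)
      finally show ?thesis using False by simp
    qed
    then show "modulus_dom (cut_heat s k) w" unfolding modulus_dom_def using w0 wn by simp
  qed
qed

text \<open>The derivative of the cut-off carries the factor \<open>1 / k\<^sup>2\<close> and
  disappears in the limit.\<close>

lemma cut_heat_tendsto:
  fixes x :: "'a::euclidean_space"
  shows "(\<lambda>k. cut_heat s (real k) x) \<longlonglongrightarrow> heat s x"
    and "(\<lambda>k. frechet_derivative (cut_heat s (real k)) (at x) h) \<longlonglongrightarrow> heat_grad s x \<bullet> h"
proof -
  have k: "(\<lambda>k. (x \<bullet> x) / (real k)\<^sup>2) \<longlonglongrightarrow> 0" "(\<lambda>k. - 2 / (real k)\<^sup>2) \<longlonglongrightarrow> 0"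
    by (intro real_tendsto_divide_at_top[OF tendsto_const] filterlim_pow_at_top filterlim_real_sequentially; simp)+
  have "isCont (bump j) u" for j u using bump_has_derivative DERIV_isCont by blast
  then have b: "(\<lambda>k. bump j (1 - (x \<bullet> x) / (real k)\<^sup>2)) \<longlonglongrightarrow> bump j (1 - 0)" for j
    by (rule isCont_tendsto_compose) (intro tendsto_intros k)
  have e: "exp 1 * bump 0 (1 - 0) = 1" by (simp add: bump_def flip: exp_add)
  have "(\<lambda>k. cut_heat s (real k) x) \<longlonglongrightarrow> exp 1 * bump 0 (1 - 0) * heat s x"
    unfolding cut_heat_def by (intro tendsto_intros b)
  then show "(\<lambda>k. cut_heat s (real k) x) \<longlonglongrightarrow> heat s x" unfolding e by simp
  have "(\<lambda>k. frechet_derivative (cut_heat s (real k)) (at x) h) \<longlonglongrightarrow> exp 1 * bump 0 (1 - 0) * (heat_grad s x \<bullet> h) + exp 1 * (bump 2 (1 - 0) * (0 * (x \<bullet> h))) * heat s x"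
    unfolding cut_heat_derivative by (intro tendsto_intros b k)
  then show "(\<lambda>k. frechet_derivative (cut_heat s (real k)) (at x) h) \<longlonglongrightarrow> heat_grad s x \<bullet> h" unfolding e by simp
qed

section \<open>Heat representation of the fractional divergence\<close>

text \<open>With \<open>r = (norm z)\<^sup>2\<close> and \<nu> = n/2 + 1, \<open>rl_gamma\<close>
  gives the exponent 2 (b - \<nu>) = - (n + \<gamma> + 1), so the singular kernel is a superposition
  of Gaussians. This is where the weight (1 - \<gamma>)/2 comes from.\<close>

lemma heat_mixture:
  assumes \<gamma>: "0 < \<gamma>" "\<gamma> < 1"
  obtains c where "c > 0" "\<And>z::'a::euclidean_space. z \<noteq> 0 \<Longrightarrow>
    (\<integral>\<^sup>+t. ennreal (heat t z / t) \<partial>rl ((1 - \<gamma>) / 2)) = ennreal (c * norm z powr (- (real DIM('a) + \<gamma> + 1)))"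
proof -
  define b where "b = (1 - \<gamma>) / 2"
  define \<nu> where "\<nu> = real DIM('a) / 2 + 1"
  let ?g = "gauss_mass TYPE('a)"
  have b: "b > 0" "b < \<nu>" using \<gamma> by (auto simp: b_def \<nu>_def add.commute intro: add_pos_nonneg)
  obtain C where C: "C > 0" "\<And>r. r > 0 \<Longrightarrow> (\<integral>\<^sup>+t. ennreal (t powr (- \<nu>) * exp (- r / t)) \<partial>rl b) = ennreal (C * r powr (b - \<nu>))"
    using rl_gamma[OF b] by metis
  show thesis
  proof (rule that[of "C / ?g"])
    fix z :: 'a assume z: "z \<noteq> 0"
    have "(\<integral>\<^sup>+t. ennreal (heat t z / t) \<partial>rl b) = (\<integral>\<^sup>+t. ennreal (1 / ?g) * ennreal (t powr (- \<nu>) * exp (- (norm z)\<^sup>2 / t)) \<partial>rl b)"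
    proof (rule nn_integral_cong_AE, use AE_rl_pos[OF b(1)] in eventually_elim)
      fix t :: real assume t: "0 < t"
      have "t powr (- \<nu>) = t powr (- real DIM('a) / 2) / t powr 1"
        unfolding \<nu>_def powr_diff[symmetric] by simp
      then have p: "t powr (- \<nu>) = t powr (- real DIM('a) / 2) / t" using t by simp
      have "heat t z / t = 1 / ?g * (t powr (- \<nu>) * exp (- (norm z)\<^sup>2 / t))"
        unfolding heat_def p by (simp add: mult_ac)
      then show "ennreal (heat t z / t) = ennreal (1 / ?g) * ennreal (t powr (- \<nu>) * exp (- (norm z)\<^sup>2 / t))"
        using gauss_mass_pos[where 'a='a] by (simp flip: ennreal_mult)
    qed
    also have "\<dots> = ennreal (1 / ?g) * ennreal (C * (norm z)\<^sup>2 powr (b - \<nu>))"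
      using C(2)[of "(norm z)\<^sup>2"] z by (simp add: nn_integral_cmult)
    also have "(norm z)\<^sup>2 powr (b - \<nu>) = norm z powr (- (real DIM('a) + \<gamma> + 1))"
    proof -
      have "(norm z)\<^sup>2 powr (b - \<nu>) = (norm z powr 2) powr (b - \<nu>)" by simp
      also have "\<dots> = norm z powr (2 * (b - \<nu>))" by (rule powr_powr)
      also have "2 * (b - \<nu>) = - (real DIM('a) + \<gamma> + 1)" by (simp add: b_def \<nu>_def field_simps)
      finally show ?thesis .
    qed
    finally show "(\<integral>\<^sup>+t. ennreal (heat t z / t) \<partial>rl ((1 - \<gamma>) / 2)) = ennreal (C / ?g * norm z powr (- (real DIM('a) + \<gamma> + 1)))"
      using C(1) gauss_mass_pos[where 'a='a] unfolding b_def[symmetric] by (simp flip: ennreal_mult)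
  qed (use C(1) gauss_mass_pos[where 'a='a] in auto)
qed

text \<open>What is left of \<open>norm z powr (- (n + \<gamma> + 1))\<close> once the inner product
  has contributed one \<open>norm z\<close> and \<open>modulus_dom\<close> the factor
  \<open>min 1 (norm z)\<close>.\<close>

definition frac_ker :: "real \<Rightarrow> 'a::euclidean_space \<Rightarrow> real" where
  "frac_ker \<gamma> z = min 1 (norm z) * norm z powr (- (real DIM('a) + \<gamma>))"

lemma frac_ker_nonneg [simp]: "0 \<le> frac_ker \<gamma> z" by (simp add: frac_ker_def)

lemma frac_ker_minus [simp]: "frac_ker \<gamma> (- z) = frac_ker \<gamma> z" by (simp add: frac_ker_def)

lemma measurable_frac_ker [measurable]: "frac_ker \<gamma> \<in> borel_measurable borel"
  unfolding frac_ker_def by measurable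

lemma norm_mult_powr: "norm z * norm z powr (- (d + 1)) = norm z powr (- d)"
proof -
  have "norm z powr 1 * norm z powr (- (d + 1)) = norm z powr (1 + - (d + 1))" by (simp only: powr_add)
  then show ?thesis by (cases "norm z = 0") auto
qed

text \<open>The Gaussian mixture replaces polar coordinates: after Tonelli, the second moment of the
  heat kernel handles small \<open>t\<close> and the first moment large \<open>t\<close>.\<close>

lemma integrable_frac_ker:
  assumes \<gamma>: "0 < \<gamma>" "\<gamma> < 1"
  shows "integrable lborel (frac_ker \<gamma> :: 'a::euclidean_space \<Rightarrow> real)"
proof -
  define b where "b = (1 - \<gamma>) / 2"
  have b: "b > 0" using \<gamma> by (simp add: b_def)
  let ?h = "heat_const TYPE('a)"
  obtain c where c: "c > 0" "\<And>z::'a. z \<noteq> 0 \<Longrightarrow>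
      (\<integral>\<^sup>+t. ennreal (heat t z / t) \<partial>rl b) = ennreal (c * norm z powr (- (real DIM('a) + \<gamma> + 1)))"
    using heat_mixture[OF \<gamma>] unfolding b_def by metis
  have "ennreal c * (\<integral>\<^sup>+z. ennreal (frac_ker \<gamma> z) \<partial>(lborel :: 'a measure)) = (\<integral>\<^sup>+z. ennreal c * ennreal (frac_ker \<gamma> z) \<partial>(lborel :: 'a measure))"
    by (simp add: nn_integral_cmult)
  also have "\<dots> \<le> (\<integral>\<^sup>+z. (\<integral>\<^sup>+t. ennreal (min 1 (norm z) * norm z) * ennreal (heat t z / t) \<partial>rl b) \<partial>(lborel :: 'a measure))"
  proof (intro nn_integral_mono)
    fix z :: 'a
    show "ennreal c * ennreal (frac_ker \<gamma> z) \<le> (\<integral>\<^sup>+t. ennreal (min 1 (norm z) * norm z) * ennreal (heat t z / t) \<partial>rl b)"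
    proof (cases "z = 0")
      case False
      have "(\<integral>\<^sup>+t. ennreal (min 1 (norm z) * norm z) * ennreal (heat t z / t) \<partial>rl b) = ennreal (min 1 (norm z) * norm z) * ennreal (c * norm z powr (- (real DIM('a) + \<gamma> + 1)))"
        using c(2)[OF False] by (simp add: nn_integral_cmult)
      also have "\<dots> = ennreal (min 1 (norm z) * norm z * (c * norm z powr (- (real DIM('a) + \<gamma> + 1))))"
        using c(1) by (intro ennreal_mult[symmetric]) auto
      also have "min 1 (norm z) * norm z * (c * norm z powr (- (real DIM('a) + \<gamma> + 1))) = c * (min 1 (norm z) * (norm z * norm z powr (- (real DIM('a) + \<gamma> + 1))))"
        by (simp only: mult_ac)
      also have "\<dots> = c * frac_ker \<gamma> z" unfolding norm_mult_powr frac_ker_def ..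
      finally show ?thesis using c(1) by (simp add: ennreal_mult)
    qed (simp add: frac_ker_def)
  qed
  also have "\<dots> = (\<integral>\<^sup>+t. (\<integral>\<^sup>+z. ennreal (min 1 (norm z) * norm z) * ennreal (heat t z / t) \<partial>(lborel :: 'a measure)) \<partial>rl b)"
    by (rule rl_lborel.Fubini') measurable
  also have "\<dots> \<le> ennreal (2 * ?h * (1 powr (b + 0) / (b + 0)) + ?h * (1 powr (- (\<gamma> / 2)) / (\<gamma> / 2)))"
  proof (rule nn_integral_rl_split)
    have ub: "(\<integral>\<^sup>+z. ennreal (min 1 (norm z) * norm z) * ennreal (heat t z / t) \<partial>(lborel :: 'a measure)) \<le> ennreal C"
      if t: "t > 0" and C: "C \<ge> 0" and le: "\<And>z::'a. min 1 (norm z) * norm z * heat t z \<le> C * t * heat (2 * t) z" for t C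
    proof -
      have "(\<integral>\<^sup>+z. ennreal (min 1 (norm z) * norm z) * ennreal (heat t z / t) \<partial>(lborel :: 'a measure)) \<le> (\<integral>\<^sup>+z. ennreal C * ennreal (heat (2 * t) z) \<partial>(lborel :: 'a measure))"
      proof (intro nn_integral_mono)
        fix z :: 'a
        have "min 1 (norm z) * norm z * (heat t z / t) \<le> C * heat (2 * t) z"
          using divide_right_mono[OF le[of z], of t] t by simp
        then show "ennreal (min 1 (norm z) * norm z) * ennreal (heat t z / t) \<le> ennreal C * ennreal (heat (2 * t) z)"
          using t C by (simp flip: ennreal_mult)
      qed
      also have "\<dots> = ennreal C" using t by (simp add: nn_integral_cmult nn_integral_heat)
      finally show ?thesis .
    qed
    fix t :: real
    { assume t: "0 < t" "t < 1"
      have "min 1 (norm z) * norm z * heat t z \<le> (2 * ?h) * t * heat (2 * t) z" for z :: 'a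
      proof -
        have "min 1 (norm z) * norm z * heat t z \<le> (norm z)\<^sup>2 * heat t z"
          by (intro mult_right_mono) (auto simp: power2_eq_square intro: mult_right_mono)
        then show ?thesis using norm_sq_heat_le[OF t(1), of z] by linarith
      qed
      from ub[OF t(1) _ this] show "(\<integral>\<^sup>+z. ennreal (min 1 (norm z) * norm z) * ennreal (heat t z / t) \<partial>(lborel :: 'a measure)) \<le> ennreal (2 * ?h * t powr 0)"
        using t heat_const_pos[where 'a='a] by simp }
    { assume "1 \<le> t"
      then have t: "t > 0" by simp
      \<comment> \<open>Here b + \<gamma>/2 = 1/2, so the first moment, of order
        \<open>sqrt t\<close>, divided by \<open>t\<close> has exactly the decay that the splitting
        asks for.\<close>
      have e: "t powr (- b - \<gamma> / 2) * t = sqrt t"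
      proof -
        have "t powr (- b - \<gamma> / 2) * t powr 1 = t powr (1 / 2)" unfolding powr_add[symmetric] by (simp add: b_def field_simps)
        then show ?thesis using t by (simp add: powr_half_sqrt)
      qed
      have "min 1 (norm z) * norm z * heat t z \<le> (?h * t powr (- b - \<gamma> / 2)) * t * heat (2 * t) z" for z :: 'a
      proof -
        have "min 1 (norm z) * norm z * heat t z \<le> norm z * heat t z"
          by (intro mult_right_mono) (auto simp: mult_left_le_one_le)
        also have "\<dots> \<le> ?h * sqrt t * heat (2 * t) z" by (rule norm_heat_le[OF t])
        also have "\<dots> = (?h * t powr (- b - \<gamma> / 2)) * t * heat (2 * t) z" unfolding e[symmetric] by simp
        finally show ?thesis .
      qed
      from ub[OF t _ this] show "(\<integral>\<^sup>+z. ennreal (min 1 (norm z) * norm z) * ennreal (heat t z / t) \<partial>(lborel :: 'a measure)) \<le> ennreal (?h * t powr (- b - \<gamma> / 2))"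
        using t heat_const_pos[where 'a='a] by simp }
  qed (use b \<gamma> heat_const_pos[where 'a='a] in auto)
  finally have "ennreal c * (\<integral>\<^sup>+z. ennreal (frac_ker \<gamma> z) \<partial>(lborel :: 'a measure)) < \<infinity>"
    by (simp add: le_less_trans)
  then have "(\<integral>\<^sup>+z. ennreal (frac_ker \<gamma> z) \<partial>(lborel :: 'a measure)) < \<infinity>"
    using c(1) by (auto simp: ennreal_mult_less_top)
  then show ?thesis by (intro integrableI_bounded) auto
qed

text \<open>The integral of \<open>frac_ker \<gamma> z * (w (x + z) + w x)\<close> over
  \<open>z\<close>, written as a convolution plus a multiple of \<open>w\<close>; in this form it is
  visibly in L^1 and L^\<infinity> when \<open>w\<close> is.\<close>

definition frac_dom :: "real \<Rightarrow> ('a::euclidean_space \<Rightarrow> real) \<Rightarrow> 'a \<Rightarrow> real" where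
  "frac_dom \<gamma> w x = (\<integral>y. frac_ker \<gamma> (x - y) * w y \<partial>lborel) + (\<integral>z. frac_ker \<gamma> z \<partial>(lborel :: 'a measure)) * w x"

lemma
  fixes w :: "'a::euclidean_space \<Rightarrow> real"
  assumes \<gamma>: "0 < \<gamma>" "\<gamma> < 1" and w: "bdd_int w" "\<And>x. 0 \<le> w x"
  shows bdd_int_frac_dom: "bdd_int (frac_dom \<gamma> w)"
    and integrable_frac_dom: "integrable lborel (\<lambda>z. frac_ker \<gamma> z * (w (x + z) + w x))"
    and integral_frac_dom: "(\<integral>z. frac_ker \<gamma> z * (w (x + z) + w x) \<partial>lborel) = frac_dom \<gamma> w x"
proof -
  note [measurable] = bdd_intD(2)[OF w(1)]
  note K = integrable_frac_ker[OF \<gamma>, where 'a='a]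
  have hm: "(\<lambda>(x, y). frac_ker \<gamma> (x - y) * w y) \<in> borel_measurable (borel \<Otimes>\<^sub>M borel)" by measurable
  have h: "norm (frac_ker \<gamma> (x - y) * w y) \<le> frac_ker \<gamma> (x - y) * w y" for x y using w(2)[of y] by simp
  note cd = conv_dominated[OF K w(1) hm h]
  show "bdd_int (frac_dom \<gamma> w)"
    unfolding frac_dom_def by (intro bdd_int_add bdd_int_cmult w cd(2))
  have i1: "integrable lborel (\<lambda>z. frac_ker \<gamma> z * w (x + z))"
    using integrable_lborel_translate[OF cd(1)[of x], of x] by simp
  show "integrable lborel (\<lambda>z. frac_ker \<gamma> z * (w (x + z) + w x))"
    unfolding distrib_left using i1 K by (intro Bochner_Integration.integrable_add) auto
  have "(\<integral>z. frac_ker \<gamma> z * (w (x + z) + w x) \<partial>lborel) = (\<integral>z. frac_ker \<gamma> z * w (x + z) \<partial>lborel) + (\<integral>z. frac_ker \<gamma> (z::'a) * w x \<partial>lborel)"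
    unfolding distrib_left using i1 K by (intro Bochner_Integration.integral_add) auto
  also have "(\<integral>z. frac_ker \<gamma> z * w (x + z) \<partial>lborel) = (\<integral>y. frac_ker \<gamma> (x - y) * w y \<partial>lborel)"
    using integral_lborel_translate[of "\<lambda>y. frac_ker \<gamma> (x - y) * w y" x] by simp
  finally show "(\<integral>z. frac_ker \<gamma> z * (w (x + z) + w x) \<partial>lborel) = frac_dom \<gamma> w x"
    unfolding frac_dom_def by simp
qed

text \<open>The integrand of \<open>frac_div\<close> after the substitution
  \<open>y = x + z\<close>, which fixes the singularity at 0.\<close>

definition frac_int :: "real \<Rightarrow> ('a::euclidean_space \<Rightarrow> 'a) \<Rightarrow> 'a \<Rightarrow> 'a \<Rightarrow> real" where
  "frac_int \<gamma> \<Phi> x z = (z \<bullet> (\<Phi> (x + z) - \<Phi> x)) * norm z powr (- (real DIM('a) + \<gamma> + 1))"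

lemma frac_int_le:
  fixes \<Phi> :: "'a::euclidean_space \<Rightarrow> 'a"
  assumes "modulus_dom \<Phi> w"
  shows "\<bar>z \<bullet> (\<Phi> (x + z) - \<Phi> x)\<bar> * norm z powr (- (real DIM('a) + \<gamma> + 1)) \<le> frac_ker \<gamma> z * (w (x + z) + w x)"
proof -
  have "\<bar>z \<bullet> (\<Phi> (x + z) - \<Phi> x)\<bar> \<le> norm z * norm (\<Phi> (x + z) - \<Phi> x)" by (rule Cauchy_Schwarz_ineq2)
  also have "\<dots> \<le> norm z * (min 1 (norm z) * (w (x + z) + w x))"
    using assms by (intro mult_left_mono) (auto simp: modulus_dom_def)
  finally have "\<bar>z \<bullet> (\<Phi> (x + z) - \<Phi> x)\<bar> * norm z powr (- (real DIM('a) + \<gamma> + 1)) \<le> (norm z * (min 1 (norm z) * (w (x + z) + w x))) * norm z powr (- (real DIM('a) + \<gamma> + 1))"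
    by (rule mult_right_mono) simp
  also have "\<dots> = min 1 (norm z) * (norm z * norm z powr (- (real DIM('a) + \<gamma> + 1))) * (w (x + z) + w x)"
    by (simp only: mult_ac)
  also have "\<dots> = frac_ker \<gamma> z * (w (x + z) + w x)" unfolding norm_mult_powr frac_ker_def ..
  finally show ?thesis .
qed

lemma
  fixes \<Phi> :: "'a::euclidean_space \<Rightarrow> 'a"
  assumes \<gamma>: "0 < \<gamma>" "\<gamma> < 1" and md: "modulus_dom \<Phi> w" and [measurable]: "\<Phi> \<in> borel_measurable borel"
  shows integrable_frac_int: "integrable lborel (frac_int \<gamma> \<Phi> x)"
    and frac_div_eq: "frac_div \<gamma> \<Phi> x = mu_const DIM('a) \<gamma> * (\<integral>z. frac_int \<gamma> \<Phi> x z \<partial>lborel)"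
    and abs_frac_div_le: "\<bar>frac_div \<gamma> \<Phi> x\<bar> \<le> \<bar>mu_const DIM('a) \<gamma>\<bar> * frac_dom \<gamma> w x"
proof -
  have w: "bdd_int w" "\<And>x. 0 \<le> w x" using md by (auto simp: modulus_dom_def)
  have [measurable]: "frac_int \<gamma> \<Phi> x \<in> borel_measurable borel" unfolding frac_int_def by measurable
  have le: "\<bar>frac_int \<gamma> \<Phi> x z\<bar> \<le> frac_ker \<gamma> z * (w (x + z) + w x)" for z
    using frac_int_le[OF md, of z x \<gamma>] by (simp add: frac_int_def abs_mult)
  show i: "integrable lborel (frac_int \<gamma> \<Phi> x)"
    by (rule Bochner_Integration.integrable_bound[OF integrable_frac_dom[OF \<gamma> w, of x]])
       (auto intro!: AE_I2 order_trans[OF le abs_ge_self])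
  have "frac_div \<gamma> \<Phi> x = mu_const DIM('a) \<gamma> * (\<integral>y. ((y - x) \<bullet> (\<Phi> y - \<Phi> x)) / norm (y - x) powr (real DIM('a) + \<gamma> + 1) \<partial>lborel)"
    using \<gamma> by (simp add: frac_div_def)
  also have "(\<integral>y. ((y - x) \<bullet> (\<Phi> y - \<Phi> x)) / norm (y - x) powr (real DIM('a) + \<gamma> + 1) \<partial>lborel) = (\<integral>z. frac_int \<gamma> \<Phi> x z \<partial>lborel)"
    using integral_lborel_translate[of "\<lambda>y. ((y - x) \<bullet> (\<Phi> y - \<Phi> x)) / norm (y - x) powr (real DIM('a) + \<gamma> + 1)" x, symmetric]
    unfolding frac_int_def powr_minus by (simp add: divide_inverse)
  finally show eq: "frac_div \<gamma> \<Phi> x = mu_const DIM('a) \<gamma> * (\<integral>z. frac_int \<gamma> \<Phi> x z \<partial>lborel)" .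
  have "\<bar>\<integral>z. frac_int \<gamma> \<Phi> x z \<partial>lborel\<bar> \<le> (\<integral>z. frac_ker \<gamma> z * (w (x + z) + w x) \<partial>lborel)"
    by (rule order_trans[OF integral_abs_bound integral_mono[OF integrable_abs[OF i] integrable_frac_dom[OF \<gamma> w, of x] le]])
  then show "\<bar>frac_div \<gamma> \<Phi> x\<bar> \<le> \<bar>mu_const DIM('a) \<gamma>\<bar> * frac_dom \<gamma> w x"
    unfolding eq abs_mult integral_frac_dom[OF \<gamma> w] by (intro mult_left_mono) auto
qed

text \<open>The divergence of the convolution of \<open>heat t\<close> with \<Phi>, with the
  derivative placed on the kernel.\<close>

definition grad_conv :: "real \<Rightarrow> ('a::euclidean_space \<Rightarrow> 'a) \<Rightarrow> 'a \<Rightarrow> real" where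
  "grad_conv t \<Phi> x = (\<integral>y. heat_grad t (x - y) \<bullet> \<Phi> y \<partial>lborel)"

lemma mu_const_pos: "0 < \<gamma> \<Longrightarrow> \<gamma> < 1 \<Longrightarrow> mu_const n \<gamma> > 0"
  unfolding mu_const_def by (intro divide_pos_pos mult_pos_pos Gamma_real_pos) auto

lemma integrable_inner_bounded:
  fixes k \<Phi> :: "'a::euclidean_space \<Rightarrow> 'b::euclidean_space"
  assumes k: "integrable lborel k" and \<Phi>: "bdd_int \<Phi>"
  shows "integrable lborel (\<lambda>y. k y \<bullet> \<Phi> (x + y))" "integrable lborel (\<lambda>y. k y \<bullet> \<Phi> (x - y))"
proof -
  obtain C where C: "C > 0" "\<And>x. norm (\<Phi> x) \<le> C" using bdd_int_bound[OF \<Phi>] by metis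
  note [measurable] = bdd_intD(2)[OF \<Phi>] borel_measurable_integrable[OF k, simplified]
  have i: "integrable lborel (\<lambda>y. C * norm (k y))" using k by auto
  have le: "norm (k y \<bullet> \<Phi> u) \<le> norm (C * norm (k y))" for y u
    using Cauchy_Schwarz_ineq2[of "k y" "\<Phi> u"] mult_left_mono[OF C(2)[of u], of "norm (k y)"] C(1) by (simp add: mult.commute)
  show "integrable lborel (\<lambda>y. k y \<bullet> \<Phi> (x + y))"
    by (rule Bochner_Integration.integrable_bound[OF i]) (use le in auto)
  show "integrable lborel (\<lambda>y. k y \<bullet> \<Phi> (x - y))"
    by (rule Bochner_Integration.integrable_bound[OF i]) (use le in auto)
qed

text \<open>The kernel times \<open>z\<close> is odd, so subtracting \<open>\<Phi> x\<close> changes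
  nothing; the factor 1/2 comes from the 2 in \<open>heat_grad\<close>.\<close>

lemma grad_conv_eq:
  fixes \<Phi> :: "'a::euclidean_space \<Rightarrow> 'a"
  assumes t: "t > 0" and \<Phi>: "bdd_int \<Phi>"
  shows "(\<integral>z. heat t z / t * (z \<bullet> (\<Phi> (x + z) - \<Phi> x)) \<partial>lborel) = grad_conv t \<Phi> x / 2"
proof -
  note [measurable] = bdd_intD(2)[OF \<Phi>]
  have k: "integrable lborel (\<lambda>z::'a. (heat t z / t) *\<^sub>R z)"
    using integrable_scaleR_right[OF integrable_heat_scaleR[OF t, where 'a='a], of "1 / t"] by simp
  have i1: "integrable lborel (\<lambda>z. (heat t z / t) *\<^sub>R z \<bullet> \<Phi> (x + z))" by (rule integrable_inner_bounded(1)[OF k \<Phi>])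
  have i2: "integrable lborel (\<lambda>z. (heat t z / t) *\<^sub>R z \<bullet> \<Phi> x)" using k by (intro integrable_inner_left)
  have "(\<integral>z. heat t z / t * (z \<bullet> (\<Phi> (x + z) - \<Phi> x)) \<partial>lborel) = (\<integral>z. (heat t z / t) *\<^sub>R z \<bullet> \<Phi> (x + z) - (heat t z / t) *\<^sub>R z \<bullet> \<Phi> x \<partial>lborel)"
    by (simp add: inner_diff_right right_diff_distrib)
  also have "\<dots> = (\<integral>z. (heat t z / t) *\<^sub>R z \<bullet> \<Phi> (x + z) \<partial>lborel) - (\<integral>z. (heat t z / t) *\<^sub>R z \<bullet> \<Phi> x \<partial>lborel)"
    using i1 i2 by (rule Bochner_Integration.integral_diff)
  also have "(\<integral>z. (heat t z / t) *\<^sub>R z \<bullet> \<Phi> x \<partial>lborel) = (\<integral>z. (1 / t) *\<^sub>R (heat t z *\<^sub>R z) \<partial>lborel) \<bullet> \<Phi> x"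
    using k by (subst integral_inner_left[symmetric]) auto
  also have "\<dots> = 0" by (simp only: integral_scaleR_right integral_odd_heat) simp
  also have "(\<integral>z. (heat t z / t) *\<^sub>R z \<bullet> \<Phi> (x + z) \<partial>lborel) = (\<integral>z. (\<lambda>y. heat_grad t (x - y) \<bullet> \<Phi> y / 2) (x + z) \<partial>lborel)"
    by (simp add: heat_grad_def)
  also have "\<dots> = (\<integral>y. heat_grad t (x - y) \<bullet> \<Phi> y / 2 \<partial>lborel)"
    by (rule integral_lborel_translate) measurable
  finally show ?thesis by (simp add: grad_conv_def)
qed

text \<open>The Gaussian mixture is inserted for the singular kernel and the integrals are
  exchanged. The third conclusion, an absolute bound whose majorant in \<open>x\<close> lies in L^1
  and L^\<infinity>, is what later makes the exchange with integration against \<open>f\<close>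
  legitimate.\<close>

lemma frac_div_heat_representation:
  assumes \<gamma>: "0 < \<gamma>" "\<gamma> < 1"
  obtains C D where "C > 0" "D > 0"
    "\<And>(\<Phi> :: 'a::euclidean_space \<Rightarrow> 'a) w x. bdd_int \<Phi> \<Longrightarrow> modulus_dom \<Phi> w \<Longrightarrow>
       integrable (rl ((1 - \<gamma>) / 2)) (\<lambda>t. grad_conv t \<Phi> x) \<and>
       frac_div \<gamma> \<Phi> x = C * (\<integral>t. grad_conv t \<Phi> x \<partial>rl ((1 - \<gamma>) / 2)) \<and>
       (\<integral>\<^sup>+t. ennreal \<bar>grad_conv t \<Phi> x\<bar> \<partial>rl ((1 - \<gamma>) / 2)) \<le> ennreal (D * frac_dom \<gamma> w x)"
proof -
  define b where "b = (1 - \<gamma>) / 2"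
  have b: "b > 0" using \<gamma> by (simp add: b_def)
  obtain c where c: "c > 0" "\<And>z::'a. z \<noteq> 0 \<Longrightarrow>
      (\<integral>\<^sup>+t. ennreal (heat t z / t) \<partial>rl b) = ennreal (c * norm z powr (- (real DIM('a) + \<gamma> + 1)))"
    using heat_mixture[OF \<gamma>] unfolding b_def by metis
  let ?mu = "mu_const DIM('a) \<gamma>"
  show thesis
  proof (rule that[of "?mu / (2 * c)" "2 * c"])
    fix \<Phi> :: "'a \<Rightarrow> 'a" and w x assume \<Phi>: "bdd_int \<Phi>" and md: "modulus_dom \<Phi> w"
    note [measurable] = bdd_intD(2)[OF \<Phi>]
    have w: "bdd_int w" "\<And>x. 0 \<le> w x" using md by (auto simp: modulus_dom_def)
    define k where "k z t = heat t z / t * (z \<bullet> (\<Phi> (x + z) - \<Phi> x))" for z t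
    have km[measurable]: "(\<lambda>(z, t). k z t) \<in> borel_measurable (borel \<Otimes>\<^sub>M borel)" unfolding k_def by measurable
    have kt: "(\<integral>\<^sup>+t. ennreal (norm (k z t)) \<partial>rl b) = ennreal (c * \<bar>frac_int \<gamma> \<Phi> x z\<bar>)" for z
    proof (cases "z = 0")
      case False
      have "(\<integral>\<^sup>+t. ennreal (norm (k z t)) \<partial>rl b) = (\<integral>\<^sup>+t. ennreal \<bar>z \<bullet> (\<Phi> (x + z) - \<Phi> x)\<bar> * ennreal (heat t z / t) \<partial>rl b)"
        by (rule nn_integral_cong_AE, use AE_rl_pos[OF b] in eventually_elim) (simp add: k_def abs_mult mult.commute flip: ennreal_mult)
      also have "\<dots> = ennreal \<bar>z \<bullet> (\<Phi> (x + z) - \<Phi> x)\<bar> * ennreal (c * norm z powr (- (real DIM('a) + \<gamma> + 1)))"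
        using c(2)[OF False] by (simp add: nn_integral_cmult)
      finally show ?thesis using c(1) by (simp add: frac_int_def abs_mult mult_ac flip: ennreal_mult)
    qed (simp add: k_def frac_int_def)
    have ki: "(\<integral>t. k z t \<partial>rl b) = c * frac_int \<gamma> \<Phi> x z" for z
    proof (cases "z = 0")
      case False
      have "(\<integral>t. k z t \<partial>rl b) = (\<integral>t. heat t z / t \<partial>rl b) * (z \<bullet> (\<Phi> (x + z) - \<Phi> x))" unfolding k_def by (rule integral_mult_left_zero)
      also have "(\<integral>t. heat t z / t \<partial>rl b) = enn2real (\<integral>\<^sup>+t. ennreal (heat t z / t) \<partial>rl b)"
        by (rule integral_eq_nn_integral) (use AE_rl_pos[OF b] in \<open>auto elim: eventually_mono\<close>)
      also have "\<dots> = c * norm z powr (- (real DIM('a) + \<gamma> + 1))" using c(1) c(2)[OF False] by simp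
      finally show ?thesis by (simp add: frac_int_def)
    qed (simp add: k_def frac_int_def)
    note fi = integrable_frac_int[OF \<gamma> md bdd_intD(2)[OF \<Phi>], of x]
    have int: "integrable (lborel \<Otimes>\<^sub>M rl b) (\<lambda>(z, t). k z t)"
    proof (rule integrableI_bounded)
      have "(\<integral>\<^sup>+p. ennreal (norm (case p of (z, t) \<Rightarrow> k z t)) \<partial>(lborel \<Otimes>\<^sub>M rl b)) = (\<integral>\<^sup>+z. (\<integral>\<^sup>+t. ennreal (norm (k z t)) \<partial>rl b) \<partial>lborel)"
        by (subst rl.nn_integral_fst[symmetric]) (auto simp: split_beta')
      also have "\<dots> = (\<integral>\<^sup>+z. ennreal (norm (c * frac_int \<gamma> \<Phi> x z)) \<partial>lborel)"
        unfolding kt using c(1) by (simp add: abs_mult)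
      also have "\<dots> < \<infinity>" 
        using integrable_mult_right[of c lborel "frac_int \<gamma> \<Phi> x"] fi unfolding integrable_iff_bounded by blast
      finally show "(\<integral>\<^sup>+p. ennreal (norm (case p of (z, t) \<Rightarrow> k z t)) \<partial>(lborel \<Otimes>\<^sub>M rl b)) < \<infinity>" .
    qed (use km in \<open>simp add: split_beta'\<close>)
    have g: "AE t in rl b. (\<integral>z. k z t \<partial>lborel) = grad_conv t \<Phi> x / 2"
      using AE_rl_pos[OF b] by eventually_elim (unfold k_def, rule grad_conv_eq[OF _ \<Phi>])
    have gm[measurable]: "(\<lambda>t. grad_conv t \<Phi> x) \<in> borel_measurable (rl b)" unfolding grad_conv_def by measurable
    have "integrable (rl b) (\<lambda>t. \<integral>z. k z t \<partial>lborel)"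
      using lborel_rl.integrable_snd[OF int] .
    then have "integrable (rl b) (\<lambda>t. grad_conv t \<Phi> x / 2)"
      by (rule integrable_cong_AE_imp) (use g in \<open>auto elim: eventually_mono\<close>)
    then have 1: "integrable (rl b) (\<lambda>t. grad_conv t \<Phi> x)"
      using integrable_mult_right[of 2 "rl b" "\<lambda>t. grad_conv t \<Phi> x / 2"] by simp
    have "(\<integral>t. (\<integral>z. k z t \<partial>lborel) \<partial>rl b) = (\<integral>z. (\<integral>t. k z t \<partial>rl b) \<partial>lborel)"
      using lborel_rl.Fubini_integral[OF int] .
    also have "(\<integral>t. (\<integral>z. k z t \<partial>lborel) \<partial>rl b) = (\<integral>t. grad_conv t \<Phi> x / 2 \<partial>rl b)"
      by (rule integral_cong_AE) (use g in auto)
    finally have eq: "(\<integral>t. grad_conv t \<Phi> x \<partial>rl b) = 2 * c * (\<integral>z. frac_int \<gamma> \<Phi> x z \<partial>lborel)"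
      unfolding ki by simp
    have 2: "frac_div \<gamma> \<Phi> x = ?mu / (2 * c) * (\<integral>t. grad_conv t \<Phi> x \<partial>rl b)"
      unfolding eq frac_div_eq[OF \<gamma> md bdd_intD(2)[OF \<Phi>]] using c(1) by simp
    have "(\<integral>\<^sup>+t. ennreal \<bar>grad_conv t \<Phi> x\<bar> \<partial>rl b) \<le> (\<integral>\<^sup>+t. (\<integral>\<^sup>+z. ennreal 2 * ennreal (norm (k z t)) \<partial>lborel) \<partial>rl b)"
    proof (rule nn_integral_mono_AE, use g in eventually_elim)
      fix t assume t: "(\<integral>z. k z t \<partial>lborel) = grad_conv t \<Phi> x / 2"
      have "ennreal \<bar>\<integral>z. k z t \<partial>lborel\<bar> \<le> (\<integral>\<^sup>+z. ennreal (norm (k z t)) \<partial>lborel)"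
      \<comment> \<open>Where integrability in \<open>z\<close> fails, the Bochner integral is 0 by
        convention, so the estimate holds there as well.\<close>
      proof (cases "integrable lborel (\<lambda>z. k z t)")
        case True
        then show ?thesis using integral_norm_bound_ennreal[OF True] by simp
      qed (simp add: not_integrable_integral_eq)
      then have "ennreal 2 * ennreal \<bar>\<integral>z. k z t \<partial>lborel\<bar> \<le> ennreal 2 * (\<integral>\<^sup>+z. ennreal (norm (k z t)) \<partial>lborel)"
        by (rule mult_left_mono) simp
      then show "ennreal \<bar>grad_conv t \<Phi> x\<bar> \<le> (\<integral>\<^sup>+z. ennreal 2 * ennreal (norm (k z t)) \<partial>lborel)"
      proof -
        have "ennreal 2 * ennreal \<bar>grad_conv t \<Phi> x / 2\<bar> = ennreal (2 * \<bar>grad_conv t \<Phi> x / 2\<bar>)"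
          by (rule ennreal_mult[symmetric]) auto
        moreover have "(\<integral>\<^sup>+z. ennreal 2 * ennreal (norm (k z t)) \<partial>lborel) = ennreal 2 * (\<integral>\<^sup>+z. ennreal (norm (k z t)) \<partial>lborel)"
          by (rule nn_integral_cmult) measurable
        ultimately show ?thesis
          using \<open>ennreal 2 * ennreal \<bar>\<integral>z. k z t \<partial>lborel\<bar> \<le> _\<close> unfolding t by (simp only: ) simp
      qed
    qed
    also have "\<dots> = (\<integral>\<^sup>+z. (\<integral>\<^sup>+t. ennreal 2 * ennreal (norm (k z t)) \<partial>rl b) \<partial>lborel)"
      by (rule lborel_rl.Fubini') measurable
    also have "\<dots> = (\<integral>\<^sup>+z. ennreal 2 * ennreal (c * \<bar>frac_int \<gamma> \<Phi> x z\<bar>) \<partial>lborel)"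
    proof (intro nn_integral_cong)
      fix z
      have "(\<integral>\<^sup>+t. ennreal 2 * ennreal (norm (k z t)) \<partial>rl b) = ennreal 2 * (\<integral>\<^sup>+t. ennreal (norm (k z t)) \<partial>rl b)"
        by (rule nn_integral_cmult) measurable
      then show "(\<integral>\<^sup>+t. ennreal 2 * ennreal (norm (k z t)) \<partial>rl b) = ennreal 2 * ennreal (c * \<bar>frac_int \<gamma> \<Phi> x z\<bar>)"
        unfolding kt .
    qed
    also have "\<dots> \<le> (\<integral>\<^sup>+z. ennreal (2 * c * (frac_ker \<gamma> z * (w (x + z) + w x))) \<partial>lborel)"
    proof (intro nn_integral_mono)
      fix z
      have "\<bar>frac_int \<gamma> \<Phi> x z\<bar> \<le> frac_ker \<gamma> z * (w (x + z) + w x)"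
        using frac_int_le[OF md, of z x \<gamma>] by (simp add: frac_int_def abs_mult)
      then have "2 * (c * \<bar>frac_int \<gamma> \<Phi> x z\<bar>) \<le> 2 * c * (frac_ker \<gamma> z * (w (x + z) + w x))"
        using c(1) by simp
      moreover have "ennreal 2 * ennreal (c * \<bar>frac_int \<gamma> \<Phi> x z\<bar>) = ennreal (2 * (c * \<bar>frac_int \<gamma> \<Phi> x z\<bar>))"
        using c(1) by (intro ennreal_mult[symmetric]) auto
      ultimately show "ennreal 2 * ennreal (c * \<bar>frac_int \<gamma> \<Phi> x z\<bar>) \<le> ennreal (2 * c * (frac_ker \<gamma> z * (w (x + z) + w x)))"
        by (metis ennreal_leI)
    qed
    also have "\<dots> = ennreal (\<integral>z. 2 * c * (frac_ker \<gamma> z * (w (x + z) + w x)) \<partial>lborel)"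
      using integrable_frac_dom[OF \<gamma> w, of x] c(1) w(2) by (intro nn_integral_eq_integral) auto
    also have "(\<integral>z. 2 * c * (frac_ker \<gamma> z * (w (x + z) + w x)) \<partial>lborel) = 2 * c * frac_dom \<gamma> w x"
      using integral_frac_dom[OF \<gamma> w, of x] by simp
    finally show "integrable (rl ((1 - \<gamma>) / 2)) (\<lambda>t. grad_conv t \<Phi> x) \<and>
       frac_div \<gamma> \<Phi> x = ?mu / (2 * c) * (\<integral>t. grad_conv t \<Phi> x \<partial>rl ((1 - \<gamma>) / 2)) \<and>
       (\<integral>\<^sup>+t. ennreal \<bar>grad_conv t \<Phi> x\<bar> \<partial>rl ((1 - \<gamma>) / 2)) \<le> ennreal (2 * c * frac_dom \<gamma> w x)"
      using 1 2 unfolding b_def by blast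
  qed (use c(1) mu_const_pos[OF \<gamma>] in auto)
qed

section \<open>Kernels of the fractional divergence after smoothing\<close>

lemma bochner_integral_norm_bound:
  fixes f :: "'a \<Rightarrow> 'b::euclidean_space"
  assumes "integrable M f" "integrable M g" "AE x in M. norm (f x) \<le> g x"
  shows "norm (\<integral>x. f x \<partial>M) \<le> (\<integral>x. g x \<partial>M)"
  by (rule order_trans[OF integral_norm_bound integral_mono_AE]) (use assms in auto)

text \<open>For b = (1 - \<alpha>)/2 this is, up to a constant, the kernel that maps \<phi> to the
  divergence of order \<alpha> of its heat smoothing at time \<open>s\<close>; the shift by
  \<open>s\<close> removes the singularity at \<open>t = 0\<close>. For \<open>b = 0\<close> it is
  \<open>heat_grad s\<close>.\<close>

definition frac_heat_grad :: "real \<Rightarrow> real \<Rightarrow> 'a::euclidean_space \<Rightarrow> 'a" where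
  "frac_heat_grad b s x = (\<integral>t. heat_grad (t + s) x \<partial>rl b)"

definition frac_grad_conv :: "real \<Rightarrow> real \<Rightarrow> ('a::euclidean_space \<Rightarrow> 'a) \<Rightarrow> 'a \<Rightarrow> real" where
  "frac_grad_conv b s \<Phi> x = (\<integral>y. frac_heat_grad b s (x - y) \<bullet> \<Phi> y \<partial>lborel)"

text \<open>The right-hand side of \<open>norm_heat_grad_le\<close> as a function of the time
  variable; for \<open>s > 0\<close> the absolute values disappear on the support of
  \<open>rl b\<close>.\<close>

definition heat_dom :: "real \<Rightarrow> 'a::euclidean_space \<Rightarrow> real \<Rightarrow> real" where
  "heat_dom s x t = 2 * heat_const TYPE('a) * \<bar>t + s\<bar> powr (-1/2) * heat (2 * \<bar>t + s\<bar>) x"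

definition frac_heat_dom :: "real \<Rightarrow> real \<Rightarrow> 'a::euclidean_space \<Rightarrow> real" where
  "frac_heat_dom b s x = (\<integral>t. heat_dom s x t \<partial>rl b)"

lemma heat_dom_nonneg: "0 \<le> heat_dom s x t"
  unfolding heat_dom_def by (simp add: heat_const_def)

lemma measurable_heat_dom [measurable (raw)]:
  fixes f :: "'b \<Rightarrow> 'a::euclidean_space"
  assumes [measurable]: "g \<in> borel_measurable N" "f \<in> borel_measurable N" "h \<in> borel_measurable N"
  shows "(\<lambda>x. heat_dom (g x) (f x) (h x)) \<in> borel_measurable N"
  unfolding heat_dom_def by measurable

lemma norm_heat_grad_le_dom: "0 \<le> t \<Longrightarrow> 0 < s \<Longrightarrow> norm (heat_grad (t + s) x) \<le> heat_dom s x t"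
  unfolding heat_dom_def using norm_heat_grad_le[of "t + s" x] by simp

lemma measurable_frac_heat_grad [measurable (raw)]:
  fixes f :: "'b \<Rightarrow> 'a::euclidean_space"
  assumes [measurable]: "g \<in> borel_measurable N" "f \<in> borel_measurable N"
  shows "(\<lambda>x. frac_heat_grad b (g x) (f x)) \<in> borel_measurable N"
  unfolding frac_heat_grad_def by measurable

lemma measurable_frac_heat_dom [measurable (raw)]:
  fixes f :: "'b \<Rightarrow> 'a::euclidean_space"
  assumes [measurable]: "g \<in> borel_measurable N" "f \<in> borel_measurable N"
  shows "(\<lambda>x. frac_heat_dom b (g x) (f x)) \<in> borel_measurable N"
  unfolding frac_heat_dom_def by measurable

text \<open>A sup bound in \<open>x\<close> from the value of the kernel at the origin. Together
  with the L^1 bound it places \<open>frac_heat_dom\<close> in L^1 and L^\<infinity>.\<close>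

lemma heat_dom_sup:
  assumes b: "0 \<le> b" "b < 1/2" and s: "s > 0"
  obtains C where "C \<ge> 0" "\<And>x::'a::euclidean_space. (\<integral>\<^sup>+t. ennreal (heat_dom s x t) \<partial>rl b) \<le> ennreal C"
proof -
  let ?\<nu> = "(1 + real DIM('a)) / 2"
  define k where "k = 2 * heat_const TYPE('a) / gauss_mass TYPE('a)"
  have k: "k \<ge> 0" using gauss_mass_pos[where 'a='a] by (simp add: heat_const_def k_def)
  have "b < ?\<nu>" using b by (simp add: field_simps)
  then obtain C where C: "C \<ge> 0" "\<And>s. s > 0 \<Longrightarrow> (\<integral>\<^sup>+t. ennreal ((t + s) powr (- ?\<nu>)) \<partial>rl b) \<le> ennreal (C * s powr (b - ?\<nu>))"
    using rl_shift_bound[OF b(1)] by metis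
  show thesis
  proof (rule that[of "k * (C * s powr (b - ?\<nu>))"])
    fix x :: 'a
    have "(\<integral>\<^sup>+t. ennreal (heat_dom s x t) \<partial>rl b) \<le> (\<integral>\<^sup>+t. ennreal k * ennreal ((t + s) powr (- ?\<nu>)) \<partial>rl b)"
    proof (rule nn_integral_mono_AE, use AE_rl_nonneg[of b] in eventually_elim)
      fix t :: real assume "0 \<le> t"
      then have t: "t + s > 0" using s by simp
      have "heat (2 * (t + s)) x \<le> (2 * (t + s)) powr (- real DIM('a) / 2) / gauss_mass TYPE('a)"
        using t by (intro heat_le_sup) auto
      also have "\<dots> \<le> (t + s) powr (- real DIM('a) / 2) / gauss_mass TYPE('a)"
        using t gauss_mass_pos[where 'a='a] by (intro divide_right_mono powr_mono2') auto
      finally have "heat_dom s x t \<le> 2 * heat_const TYPE('a) * (t + s) powr (-1/2) * ((t + s) powr (- real DIM('a) / 2) / gauss_mass TYPE('a))"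
        unfolding heat_dom_def using t by (intro mult_mono) (auto simp: heat_const_def)
      also have "\<dots> = k * ((t + s) powr (-1/2) * (t + s) powr (- real DIM('a) / 2))" by (simp add: k_def)
      also have "(t + s) powr (-1/2) * (t + s) powr (- real DIM('a) / 2) = (t + s) powr (- ?\<nu>)"
      proof -
        have "-1/2 + - real DIM('a) / 2 = - ?\<nu>" by (simp add: field_simps)
        then show ?thesis unfolding powr_add[symmetric] by (simp only:)
      qed
      finally show "ennreal (heat_dom s x t) \<le> ennreal k * ennreal ((t + s) powr (- ?\<nu>))"
        using k by (simp flip: ennreal_mult)
    qed
    also have "\<dots> = ennreal k * (\<integral>\<^sup>+t. ennreal ((t + s) powr (- ?\<nu>)) \<partial>rl b)" by (simp add: nn_integral_cmult)
    also have "\<dots> \<le> ennreal k * ennreal (C * s powr (b - ?\<nu>))" using C(2)[OF s] by (rule mult_left_mono) simp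
    finally show "(\<integral>\<^sup>+t. ennreal (heat_dom s x t) \<partial>rl b) \<le> ennreal (k * (C * s powr (b - ?\<nu>)))"
      using k C(1) by (simp flip: ennreal_mult)
  qed (use k C(1) in simp)
qed

lemma
  fixes x :: "'a::euclidean_space"
  assumes b: "0 \<le> b" "b < 1/2" and s: "s > 0"
  shows integrable_heat_dom: "integrable (rl b) (heat_dom s x)"
    and nn_integral_heat_dom: "(\<integral>\<^sup>+t. ennreal (heat_dom s x t) \<partial>rl b) = ennreal (frac_heat_dom b s x)"
    and integrable_heat_grad_shift: "integrable (rl b) (\<lambda>t. heat_grad (t + s) x)"
    and norm_frac_heat_grad_le: "norm (frac_heat_grad b s x) \<le> frac_heat_dom b s x"
    and frac_heat_dom_nonneg: "0 \<le> frac_heat_dom b s x"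
proof -
  obtain C where "\<And>x::'a. (\<integral>\<^sup>+t. ennreal (heat_dom s x t) \<partial>rl b) \<le> ennreal C"
    using heat_dom_sup[OF assms] by metis
  then have f: "(\<integral>\<^sup>+t. ennreal (heat_dom s x t) \<partial>rl b) < \<infinity>" by (rule le_less_trans) simp
  then show 1: "integrable (rl b) (heat_dom s x)"
    by (intro integrableI_bounded) (auto simp: abs_of_nonneg[OF heat_dom_nonneg])
  then show 2: "(\<integral>\<^sup>+t. ennreal (heat_dom s x t) \<partial>rl b) = ennreal (frac_heat_dom b s x)"
    unfolding frac_heat_dom_def using heat_dom_nonneg by (intro nn_integral_eq_integral) auto
  have ae: "AE t in rl b. norm (heat_grad (t + s) x) \<le> heat_dom s x t"
    using AE_rl_nonneg by eventually_elim (rule norm_heat_grad_le_dom[OF _ s])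
  show 3: "integrable (rl b) (\<lambda>t. heat_grad (t + s) x)"
    by (rule Bochner_Integration.integrable_bound[OF 1]) (use ae in \<open>auto elim!: eventually_mono intro: order_trans[OF _ abs_ge_self]\<close>)
  show "norm (frac_heat_grad b s x) \<le> frac_heat_dom b s x"
    unfolding frac_heat_grad_def frac_heat_dom_def
    by (rule bochner_integral_norm_bound[OF 3 1 ae])
  show "0 \<le> frac_heat_dom b s x" unfolding frac_heat_dom_def by (simp add: heat_dom_nonneg)
qed

text \<open>Heat kernels have mass 1, so only the time integral of
  \<open>(t + s) powr (-1/2)\<close> remains. Its decay \<open>s powr (b - 1/2)\<close> controls
  large smoothing times; for b = (1 - \<alpha>)/2 the condition \<open>b < 1/2\<close> is \<alpha> >
  0.\<close>

lemma frac_heat_dom_L1: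
  assumes b: "0 \<le> b" "b < 1/2"
  obtains C where "C \<ge> 0" "\<And>s. s > 0 \<Longrightarrow> (\<integral>\<^sup>+x. ennreal (frac_heat_dom b s x) \<partial>(lborel :: 'a::euclidean_space measure)) \<le> ennreal (C * s powr (b - 1/2))"
proof -
  obtain C where C: "C \<ge> 0" "\<And>s. s > 0 \<Longrightarrow> (\<integral>\<^sup>+t. ennreal ((t + s) powr (- (1/2))) \<partial>rl b) \<le> ennreal (C * s powr (b - 1/2))"
    using rl_shift_bound[OF b] by metis
  let ?k = "2 * heat_const TYPE('a)"
  have k: "?k \<ge> 0" by (simp add: heat_const_def)
  show thesis
  proof (rule that[of "?k * C"])
    fix s :: real assume s: "s > 0"
    have "(\<integral>\<^sup>+x. ennreal (frac_heat_dom b s x) \<partial>(lborel :: 'a measure)) = (\<integral>\<^sup>+x. (\<integral>\<^sup>+t. ennreal (heat_dom s x t) \<partial>rl b) \<partial>(lborel :: 'a measure))"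
      by (simp add: nn_integral_heat_dom[OF b s])
    also have "\<dots> = (\<integral>\<^sup>+t. (\<integral>\<^sup>+x. ennreal (heat_dom s x t) \<partial>(lborel :: 'a measure)) \<partial>rl b)"
      by (rule rl_lborel.Fubini') measurable
    also have "\<dots> = (\<integral>\<^sup>+t. ennreal ?k * ennreal ((t + s) powr (- (1/2))) \<partial>rl b)"
    proof (rule nn_integral_cong_AE, use AE_rl_nonneg[of b] in eventually_elim)
      fix t :: real assume "0 \<le> t"
      then have t: "t + s > 0" using s by simp
      have "(\<integral>\<^sup>+x. ennreal (heat_dom s x t) \<partial>(lborel :: 'a measure)) = (\<integral>\<^sup>+x. ennreal (?k * (t + s) powr (- (1/2))) * ennreal (heat (2 * (t + s)) x) \<partial>(lborel :: 'a measure))"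
        unfolding heat_dom_def using t k by (intro nn_integral_cong) (simp flip: ennreal_mult)
      also have "\<dots> = ennreal (?k * (t + s) powr (- (1/2)))" using t by (simp add: nn_integral_cmult nn_integral_heat)
      finally show "(\<integral>\<^sup>+x. ennreal (heat_dom s x t) \<partial>(lborel :: 'a measure)) = ennreal ?k * ennreal ((t + s) powr (- (1/2)))"
        using k by (simp add: ennreal_mult)
    qed
    also have "\<dots> = ennreal ?k * (\<integral>\<^sup>+t. ennreal ((t + s) powr (- (1/2))) \<partial>rl b)" by (simp add: nn_integral_cmult)
    also have "\<dots> \<le> ennreal ?k * ennreal (C * s powr (b - 1/2))" using C(2)[OF s] by (rule mult_left_mono) simp
    finally show "(\<integral>\<^sup>+x. ennreal (frac_heat_dom b s x) \<partial>(lborel :: 'a measure)) \<le> ennreal (?k * C * s powr (b - 1/2))"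
      using k C(1) by (simp add: mult.assoc flip: ennreal_mult)
  qed (use k C(1) in simp)
qed

lemma bdd_int_frac_heat_dom:
  assumes b: "0 \<le> b" "b < 1/2" and s: "s > 0"
  shows "bdd_int (frac_heat_dom b s :: 'a::euclidean_space \<Rightarrow> real)"
  unfolding bdd_int_def
proof
  obtain C where C: "\<And>s. s > 0 \<Longrightarrow> (\<integral>\<^sup>+x. ennreal (frac_heat_dom b s x) \<partial>(lborel :: 'a measure)) \<le> ennreal (C * s powr (b - 1/2))"
    using frac_heat_dom_L1[OF b] by metis
  then have "(\<integral>\<^sup>+x. ennreal (frac_heat_dom b s x) \<partial>(lborel :: 'a measure)) < \<infinity>" using le_less_trans[OF C[OF s]] by simp
  then show "integrable (lborel :: 'a measure) (frac_heat_dom b s)"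
    by (intro integrableI_bounded) (auto simp: abs_of_nonneg[OF frac_heat_dom_nonneg[OF b s]])
  obtain D where D: "D \<ge> 0" "\<And>x::'a. (\<integral>\<^sup>+t. ennreal (heat_dom s x t) \<partial>rl b) \<le> ennreal D"
    using heat_dom_sup[OF assms] by metis
  then have "frac_heat_dom b s x \<le> D" for x :: 'a
    unfolding nn_integral_heat_dom[OF assms] by simp
  then have "norm (frac_heat_dom b s x) \<le> D" for x :: 'a
    by (simp add: abs_of_nonneg[OF frac_heat_dom_nonneg[OF b s]])
  then show "\<exists>C. \<forall>x::'a. norm (frac_heat_dom b s x) \<le> C" by blast
qed

text \<open>Two readings of one quantity: a convolution with an averaged kernel, or an average over
  \<open>t\<close> of heat convolutions. The first gives bounds, the second the link to
  \<open>grad_conv\<close>.\<close>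

lemma
  fixes \<Phi> :: "'a::euclidean_space \<Rightarrow> 'a"
  assumes b: "0 \<le> b" "b < 1/2" and s: "s > 0" and \<Phi>: "bdd_int \<Phi>"
  shows frac_grad_conv_dominated: "norm (frac_heat_grad b s (x - y) \<bullet> \<Phi> y) \<le> frac_heat_dom b s (x - y) * norm (\<Phi> y)"
    and bdd_int_frac_grad_conv: "bdd_int (frac_grad_conv b s \<Phi>)"
    and integrable_frac_grad_conv: "integrable lborel (\<lambda>y. frac_heat_grad b s (x - y) \<bullet> \<Phi> y)"
    and frac_grad_conv_eq: "frac_grad_conv b s \<Phi> x = (\<integral>t. grad_conv (t + s) \<Phi> x \<partial>rl b)"
    and integrable_grad_conv_shift: "integrable (rl b) (\<lambda>t. grad_conv (t + s) \<Phi> x)"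
proof -
  note [measurable] = bdd_intD(2)[OF \<Phi>]
  have K: "integrable lborel (frac_heat_dom b s :: 'a \<Rightarrow> real)" by (rule bdd_intD(1)[OF bdd_int_frac_heat_dom[OF b s]])
  show h: "norm (frac_heat_grad b s (x - y) \<bullet> \<Phi> y) \<le> frac_heat_dom b s (x - y) * norm (\<Phi> y)" for x y
    using Cauchy_Schwarz_ineq2[of "frac_heat_grad b s (x - y)" "\<Phi> y"]
      mult_right_mono[OF norm_frac_heat_grad_le[OF b s, of "x - y"], of "norm (\<Phi> y)"] by simp
  have hm: "(\<lambda>(x, y). frac_heat_grad b s (x - y) \<bullet> \<Phi> y) \<in> borel_measurable (borel \<Otimes>\<^sub>M borel)" by measurable
  note cd = conv_dominated[OF K bdd_int_norm[OF \<Phi>] hm h]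
  show "bdd_int (frac_grad_conv b s \<Phi>)" unfolding frac_grad_conv_def by (rule cd(2))
  show "integrable lborel (\<lambda>y. frac_heat_grad b s (x - y) \<bullet> \<Phi> y)" by (rule cd(1))
  have int: "integrable (lborel \<Otimes>\<^sub>M rl b) (\<lambda>(y, t). heat_grad (t + s) (x - y) \<bullet> \<Phi> y)"
  proof (rule integrableI_bounded)
    have "(\<integral>\<^sup>+p. ennreal (norm (case p of (y, t) \<Rightarrow> heat_grad (t + s) (x - y) \<bullet> \<Phi> y)) \<partial>(lborel \<Otimes>\<^sub>M rl b)) = (\<integral>\<^sup>+y. (\<integral>\<^sup>+t. ennreal (norm (heat_grad (t + s) (x - y) \<bullet> \<Phi> y)) \<partial>rl b) \<partial>lborel)"
      by (subst rl.nn_integral_fst[symmetric]) (auto simp: split_beta')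
    also have "\<dots> \<le> (\<integral>\<^sup>+y. ennreal (norm (frac_heat_dom b s (x - y) * norm (\<Phi> y))) \<partial>lborel)"
    proof (intro nn_integral_mono)
      fix y
      have "(\<integral>\<^sup>+t. ennreal (norm (heat_grad (t + s) (x - y) \<bullet> \<Phi> y)) \<partial>rl b) \<le> (\<integral>\<^sup>+t. ennreal (norm (\<Phi> y)) * ennreal (heat_dom s (x - y) t) \<partial>rl b)"
      proof (rule nn_integral_mono_AE, use AE_rl_nonneg[of b] in eventually_elim)
        fix t :: real assume t: "0 \<le> t"
        have "norm (heat_grad (t + s) (x - y) \<bullet> \<Phi> y) \<le> heat_dom s (x - y) t * norm (\<Phi> y)"
          using Cauchy_Schwarz_ineq2[of "heat_grad (t + s) (x - y)" "\<Phi> y"]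
            mult_right_mono[OF norm_heat_grad_le_dom[OF t s, of "x - y"], of "norm (\<Phi> y)"] by simp
        then show "ennreal (norm (heat_grad (t + s) (x - y) \<bullet> \<Phi> y)) \<le> ennreal (norm (\<Phi> y)) * ennreal (heat_dom s (x - y) t)"
          using heat_dom_nonneg[of s "x - y" t] by (simp add: mult.commute flip: ennreal_mult)
      qed
      also have "\<dots> = ennreal (norm (\<Phi> y)) * ennreal (frac_heat_dom b s (x - y))"
        by (simp add: nn_integral_cmult nn_integral_heat_dom[OF b s])
      finally show "(\<integral>\<^sup>+t. ennreal (norm (heat_grad (t + s) (x - y) \<bullet> \<Phi> y)) \<partial>rl b) \<le> ennreal (norm (frac_heat_dom b s (x - y) * norm (\<Phi> y)))"
        using frac_heat_dom_nonneg[OF b s, of "x - y"] by (simp add: mult.commute abs_mult flip: ennreal_mult)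
    qed
    also have "\<dots> < \<infinity>"
    proof -
      have hm': "(\<lambda>(x, y). frac_heat_dom b s (x - y) * norm (\<Phi> y)) \<in> borel_measurable (borel \<Otimes>\<^sub>M borel)" by measurable
      have "integrable lborel (\<lambda>y. frac_heat_dom b s (x - y) * norm (\<Phi> y))"
        by (rule conv_dominated(1)[OF K bdd_int_norm[OF \<Phi>] hm']) (simp add: abs_mult frac_heat_dom_nonneg[OF b s])
      then show ?thesis unfolding integrable_iff_bounded by blast
    qed
    finally show "(\<integral>\<^sup>+p. ennreal (norm (case p of (y, t) \<Rightarrow> heat_grad (t + s) (x - y) \<bullet> \<Phi> y)) \<partial>(lborel \<Otimes>\<^sub>M rl b)) < \<infinity>" .
  qed (simp add: split_beta')
  show "integrable (rl b) (\<lambda>t. grad_conv (t + s) \<Phi> x)"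
    unfolding grad_conv_def using lborel_rl.integrable_snd[OF int] .
  have "frac_grad_conv b s \<Phi> x = (\<integral>y. (\<integral>t. heat_grad (t + s) (x - y) \<bullet> \<Phi> y \<partial>rl b) \<partial>lborel)"
    unfolding frac_grad_conv_def frac_heat_grad_def
    by (intro Bochner_Integration.integral_cong refl integral_inner_left[symmetric] integrable_heat_grad_shift[OF b s])
  also have "\<dots> = (\<integral>t. (\<integral>y. heat_grad (t + s) (x - y) \<bullet> \<Phi> y \<partial>lborel) \<partial>rl b)"
    using lborel_rl.Fubini_integral[OF int, symmetric] .
  finally show "frac_grad_conv b s \<Phi> x = (\<integral>t. grad_conv (t + s) \<Phi> x \<partial>rl b)" unfolding grad_conv_def .
qed

section \<open>Smoothing a field by the heat kernel or its cut-offs\<close>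

lemma integral_rl_0: "F \<in> borel_measurable borel \<Longrightarrow> (\<integral>t. F t \<partial>rl 0) = (F 0 :: real)"
  by (simp add: rl_def integral_distr lebesgue_integral_count_space_finite)

lemma measurable_grad_conv [measurable (raw)]:
  fixes \<Phi> :: "'a::euclidean_space \<Rightarrow> 'a"
  assumes [measurable]: "g \<in> borel_measurable N" "f \<in> borel_measurable N" "\<Phi> \<in> borel_measurable borel"
  shows "(\<lambda>x. grad_conv (g x) \<Phi> (f x)) \<in> borel_measurable N"
  unfolding grad_conv_def by measurable

text \<open>The hypotheses are inequalities against \<open>heat s\<close> and \<phi>, so that the
  exact smoothing and all its cut-off versions are covered with one majorant.\<close>

lemma bdd_int_conv_field:
  fixes \<psi> :: "'a::euclidean_space \<Rightarrow> 'a"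
  assumes s: "s > 0" and [measurable]: "\<eta> \<in> borel_measurable borel" and \<eta>: "\<And>x. 0 \<le> \<eta> x" "\<And>x. \<eta> x \<le> heat s x"
    and \<phi>: "bdd_int \<phi>" and [measurable]: "\<psi> \<in> borel_measurable borel" and \<psi>: "\<And>y. norm (\<psi> y) \<le> norm (\<phi> y)"
  shows "bdd_int (conv_field \<eta> \<psi>)" and "integrable lborel (\<lambda>y. \<eta> (x - y) *\<^sub>R \<psi> y)"
proof -
  have hm: "(\<lambda>(x, y). \<eta> (x - y) *\<^sub>R \<psi> y) \<in> borel_measurable (borel \<Otimes>\<^sub>M borel)" by measurable
  have h: "norm (\<eta> (x - y) *\<^sub>R \<psi> y) \<le> heat s (x - y) * norm (\<phi> y)" for x y
    unfolding norm_scaleR using \<eta>[of "x - y"] \<psi>[of y] by (intro mult_mono) auto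
  note cd = conv_dominated[OF integrable_heat[OF s] bdd_int_norm[OF \<phi>] hm h]
  show "bdd_int (conv_field \<eta> \<psi>)" unfolding conv_field_def by (rule cd(2))
  show "integrable lborel (\<lambda>y. \<eta> (x - y) *\<^sub>R \<psi> y)" by (rule cd(1))
qed

text \<open>The semigroup law at the level of fields: smoothing at time \<open>s\<close> shifts the
  time in \<open>grad_conv\<close> by \<open>s\<close>. The fractional divergence of a smoothed
  field is therefore an average of \<open>grad_conv (t + s)\<close>.\<close>

lemma grad_conv_conv_field:
  fixes \<phi> :: "'a::euclidean_space \<Rightarrow> 'a"
  assumes t: "t > 0" and s: "s > 0" and \<phi>: "bdd_int \<phi>"
  shows "grad_conv t (conv_field (heat s) \<phi>) x = grad_conv (t + s) \<phi> x"
proof -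
  note [measurable] = bdd_intD(2)[OF \<phi>]
  obtain C where C: "C > 0" "\<And>x. norm (\<phi> x) \<le> C" using bdd_int_bound[OF \<phi>] by metis
  have int: "integrable (lborel \<Otimes>\<^sub>M lborel) (\<lambda>(y, v). heat_grad t (x - y) \<bullet> (heat s (y - v) *\<^sub>R \<phi> v))"
  proof (rule integrableI_bounded)
    have "(\<integral>\<^sup>+p. ennreal (norm (case p of (y, v) \<Rightarrow> heat_grad t (x - y) \<bullet> (heat s (y - v) *\<^sub>R \<phi> v))) \<partial>(lborel \<Otimes>\<^sub>M lborel)) = (\<integral>\<^sup>+y. (\<integral>\<^sup>+v. ennreal (norm (heat_grad t (x - y) \<bullet> (heat s (y - v) *\<^sub>R \<phi> v))) \<partial>lborel) \<partial>lborel)"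
      by (subst lborel.nn_integral_fst[symmetric]) (auto simp: split_beta')
    also have "\<dots> \<le> (\<integral>\<^sup>+y. ennreal (C * norm (heat_grad t (x - y))) \<partial>lborel)"
    proof (intro nn_integral_mono)
      fix y
      have "(\<integral>\<^sup>+v. ennreal (norm (heat_grad t (x - y) \<bullet> (heat s (y - v) *\<^sub>R \<phi> v))) \<partial>lborel) \<le> (\<integral>\<^sup>+v. ennreal (C * norm (heat_grad t (x - y))) * ennreal (heat s (y - v)) \<partial>lborel)"
      proof (intro nn_integral_mono)
        fix v
        have "norm (heat_grad t (x - y) \<bullet> (heat s (y - v) *\<^sub>R \<phi> v)) \<le> norm (heat_grad t (x - y)) * norm (heat s (y - v) *\<^sub>R \<phi> v)"
          unfolding real_norm_def by (rule Cauchy_Schwarz_ineq2)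
        also have "\<dots> \<le> norm (heat_grad t (x - y)) * (heat s (y - v) * C)"
          unfolding norm_scaleR using C(2)[of v] by (intro mult_left_mono) (auto intro!: mult_left_mono)
        finally show "ennreal (norm (heat_grad t (x - y) \<bullet> (heat s (y - v) *\<^sub>R \<phi> v))) \<le> ennreal (C * norm (heat_grad t (x - y))) * ennreal (heat s (y - v))"
          using C(1) by (simp add: mult_ac flip: ennreal_mult)
      qed
      also have "\<dots> = ennreal (C * norm (heat_grad t (x - y)))" using s by (simp add: nn_integral_cmult)
      finally show "(\<integral>\<^sup>+v. ennreal (norm (heat_grad t (x - y) \<bullet> (heat s (y - v) *\<^sub>R \<phi> v))) \<partial>lborel) \<le> ennreal (C * norm (heat_grad t (x - y)))" .
    qed
    also have "\<dots> < \<infinity>"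
    proof -
      have "integrable lborel (\<lambda>y. C * norm (heat_grad t (x - y)))"
        using integrable_lborel_reflect[OF integrable_heat_grad[OF t, where 'a='a], of x] by auto
      then show ?thesis using C(1) unfolding integrable_iff_bounded by simp
    qed
    finally show "(\<integral>\<^sup>+p. ennreal (norm (case p of (y, v) \<Rightarrow> heat_grad t (x - y) \<bullet> (heat s (y - v) *\<^sub>R \<phi> v))) \<partial>(lborel \<Otimes>\<^sub>M lborel)) < \<infinity>" .
  qed (simp add: split_beta')
  have cf: "integrable lborel (\<lambda>v. heat s (y - v) *\<^sub>R \<phi> v)" for y
    by (rule bdd_int_conv_field(2)[OF s _ _ _ \<phi>]) auto
  have "grad_conv t (conv_field (heat s) \<phi>) x = (\<integral>y. (\<integral>v. heat_grad t (x - y) \<bullet> (heat s (y - v) *\<^sub>R \<phi> v) \<partial>lborel) \<partial>lborel)"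
    unfolding grad_conv_def conv_field_def
    by (intro Bochner_Integration.integral_cong refl integral_inner_right[symmetric] cf)
  also have "\<dots> = (\<integral>v. (\<integral>y. heat_grad t (x - y) \<bullet> (heat s (y - v) *\<^sub>R \<phi> v) \<partial>lborel) \<partial>lborel)"
    using lborel_pair.Fubini_integral[OF int, symmetric] .
  also have "\<dots> = (\<integral>v. heat_grad (t + s) (x - v) \<bullet> \<phi> v \<partial>lborel)"
  proof (intro Bochner_Integration.integral_cong refl)
    fix v
    have i: "integrable lborel (\<lambda>u. heat s u *\<^sub>R heat_grad t (x - v - u))"
    proof -
      obtain D where D: "\<And>z::'a. norm (heat s z) \<le> D" using bdd_int_bound[OF bdd_int_heat[OF s]] by metis
      have "integrable lborel (\<lambda>u. D * norm (heat_grad t (x - v - u)))"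
        using integrable_lborel_reflect[OF integrable_heat_grad[OF t, where 'a='a], of "x - v"] by auto
      then show ?thesis
        by (rule Bochner_Integration.integrable_bound)
           (use D in \<open>auto intro!: AE_I2 mult_right_mono simp: abs_mult intro: order_trans[OF _ abs_ge_self]\<close>)
    qed
    have "(\<integral>y. heat_grad t (x - y) \<bullet> (heat s (y - v) *\<^sub>R \<phi> v) \<partial>lborel) = (\<integral>u. heat_grad t (x - (v + u)) \<bullet> (heat s (v + u - v) *\<^sub>R \<phi> v) \<partial>lborel)"
      by (rule integral_lborel_translate[symmetric]) measurable
    also have "\<dots> = (\<integral>u. (heat s u *\<^sub>R heat_grad t (x - v - u)) \<bullet> \<phi> v \<partial>lborel)"
      by (simp add: diff_diff_add)
    also have "\<dots> = (\<integral>u. heat s u *\<^sub>R heat_grad t (x - v - u) \<partial>lborel) \<bullet> \<phi> v"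
      using i by (intro integral_inner_left)
    finally show "(\<integral>y. heat_grad t (x - y) \<bullet> (heat s (y - v) *\<^sub>R \<phi> v) \<partial>lborel) = heat_grad (t + s) (x - v) \<bullet> \<phi> v"
      unfolding heat_grad_conv_heat[OF t s] .
  qed
  finally show ?thesis unfolding grad_conv_def .
qed

text \<open>The weight is built from \<phi> and not from the truncated \<psi>, so it is common to
  all approximations of one smoothed field.\<close>

lemma modulus_dom_conv_field:
  fixes \<psi> :: "'a::euclidean_space \<Rightarrow> 'a"
  assumes s: "s > 0" and \<eta>m[measurable]: "\<eta> \<in> borel_measurable borel" and \<eta>: "\<And>x. 0 \<le> \<eta> x" "\<And>x. \<eta> x \<le> heat s x"
    and \<phi>: "bdd_int \<phi>" and \<psi>m[measurable]: "\<psi> \<in> borel_measurable borel" and \<psi>: "\<And>y. norm (\<psi> y) \<le> norm (\<phi> y)"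
    and md: "modulus_dom \<eta> w"
  shows "modulus_dom (conv_field \<eta> \<psi>) (\<lambda>x. \<integral>y. w (x - y) * norm (\<phi> y) \<partial>lborel)"
proof -
  have w: "bdd_int w" "\<And>x. 0 \<le> w x" "\<And>x z. norm (\<eta> (x + z) - \<eta> x) \<le> min 1 (norm z) * (w (x + z) + w x)"
    using md by (auto simp: modulus_dom_def)
  note [measurable] = bdd_intD(2)[OF w(1)] bdd_intD(2)[OF \<phi>]
  have hm: "(\<lambda>(x, y). w (x - y) * norm (\<phi> y)) \<in> borel_measurable (borel \<Otimes>\<^sub>M borel)" by measurable
  have h: "norm (w (x - y) * norm (\<phi> y)) \<le> w (x - y) * norm (\<phi> y)" for x y using w(2)[of "x - y"] by (simp add: abs_mult)
  note cd = conv_dominated[OF bdd_intD(1)[OF w(1)] bdd_int_norm[OF \<phi>] hm h]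
  note bc = bdd_int_conv_field[OF s \<eta>m \<eta> \<phi> \<psi>m \<psi>]
  show ?thesis
    unfolding modulus_dom_def
  proof (intro conjI allI)
    show "0 \<le> (\<integral>y. w (x - y) * norm (\<phi> y) \<partial>lborel)" for x using w(2) by (intro Bochner_Integration.integral_nonneg) auto
    show "bdd_int (\<lambda>x. \<integral>y. w (x - y) * norm (\<phi> y) \<partial>lborel)" by (rule cd(2))
    fix x z
    have "norm (conv_field \<eta> \<psi> (x + z) - conv_field \<eta> \<psi> x) = norm (\<integral>y. \<eta> (x + z - y) *\<^sub>R \<psi> y - \<eta> (x - y) *\<^sub>R \<psi> y \<partial>lborel)"
      unfolding conv_field_def using bc(2) by (subst Bochner_Integration.integral_diff) auto
    also have "\<dots> \<le> (\<integral>y. min 1 (norm z) * (w (x + z - y) * norm (\<phi> y) + w (x - y) * norm (\<phi> y)) \<partial>lborel)"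
    proof (rule bochner_integral_norm_bound)
      show "integrable lborel (\<lambda>y. \<eta> (x + z - y) *\<^sub>R \<psi> y - \<eta> (x - y) *\<^sub>R \<psi> y)" using bc(2) by (intro Bochner_Integration.integrable_diff)
      show "integrable lborel (\<lambda>y. min 1 (norm z) * (w (x + z - y) * norm (\<phi> y) + w (x - y) * norm (\<phi> y)))"
        using cd(1) by (intro integrable_mult_right Bochner_Integration.integrable_add)
      have "norm (\<eta> (x + z - y) *\<^sub>R \<psi> y - \<eta> (x - y) *\<^sub>R \<psi> y) \<le> min 1 (norm z) * (w (x + z - y) * norm (\<phi> y) + w (x - y) * norm (\<phi> y))" for y
      proof -
      have "norm (\<eta> (x + z - y) *\<^sub>R \<psi> y - \<eta> (x - y) *\<^sub>R \<psi> y) = norm (\<eta> (x - y + z) - \<eta> (x - y)) * norm (\<psi> y)"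
        by (simp add: diff_add_eq flip: scaleR_diff_left)
      also have "\<dots> \<le> (min 1 (norm z) * (w (x - y + z) + w (x - y))) * norm (\<phi> y)"
        using w(2)[of "x - y + z"] w(2)[of "x - y"] by (intro mult_mono w(3) \<psi>) auto
      finally show ?thesis
        by (simp add: diff_add_eq distrib_right mult.assoc)
      qed
      then show "AE y in lborel. norm (\<eta> (x + z - y) *\<^sub>R \<psi> y - \<eta> (x - y) *\<^sub>R \<psi> y) \<le> min 1 (norm z) * (w (x + z - y) * norm (\<phi> y) + w (x - y) * norm (\<phi> y))"
        by (intro AE_I2)
    qed
    also have "\<dots> = min 1 (norm z) * ((\<integral>y. w (x + z - y) * norm (\<phi> y) \<partial>lborel) + (\<integral>y. w (x - y) * norm (\<phi> y) \<partial>lborel))"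
      using cd(1) by (simp only: integral_mult_right_zero Bochner_Integration.integral_add)
    finally show "norm (conv_field \<eta> \<psi> (x + z) - conv_field \<eta> \<psi> x) \<le> min 1 (norm z) * ((\<integral>y. w (x + z - y) * norm (\<phi> y) \<partial>lborel) + (\<integral>y. w (x - y) * norm (\<phi> y) \<partial>lborel))" .
  qed
qed

section \<open>Pairing with functions of bounded fractional variation\<close>

text \<open>The bound is one-sided because the supremum in \<open>frac_var\<close> is; applying it
  to negative multiples of a test field yields absolute values.\<close>

definition var_bound :: "real \<Rightarrow> ('a::euclidean_space \<Rightarrow> real) \<Rightarrow> real \<Rightarrow> bool" where
  "var_bound \<alpha> f V \<longleftrightarrow> 0 \<le> V \<and>
    (\<forall>\<phi>\<in>test_fields. (\<forall>x. norm (\<phi> x) \<le> 1) \<longrightarrow> (\<integral>x. f x * frac_div \<alpha> \<phi> x \<partial>lborel) \<le> V)"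

lemma frac_div_scaleR:
  fixes \<phi> :: "'a::euclidean_space \<Rightarrow> 'a"
  assumes "\<phi> \<in> test_fields"
  shows "frac_div \<gamma> (\<lambda>x. c *\<^sub>R \<phi> x) x = c * frac_div \<gamma> \<phi> x"
proof (cases "\<gamma> = 1")
  case True
  have "smooth \<phi>" using assms by (simp add: test_fields_def)
  then have "\<phi> differentiable (at x)" using smooth_differentiable[of \<phi> "[]"] by simp
  then have "((\<lambda>x. c *\<^sub>R \<phi> x) has_derivative (\<lambda>h. c *\<^sub>R frechet_derivative \<phi> (at x) h)) (at x)"
    by (intro has_derivative_scaleR_right) (simp add: frechet_derivative_works)
  from frechet_derivative_at[OF this, symmetric] show ?thesis
    using True by (simp add: frac_div_def sum_distrib_left)
next
  case False
  have e: "((y - x) \<bullet> (c *\<^sub>R \<phi> y - c *\<^sub>R \<phi> x)) / norm (y - x) powr (real DIM('a) + \<gamma> + 1) =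
      c * (((y - x) \<bullet> (\<phi> y - \<phi> x)) / norm (y - x) powr (real DIM('a) + \<gamma> + 1))" for y
    by (simp flip: scaleR_diff_right)
  show ?thesis unfolding frac_div_def using False by (simp only: e if_False integral_mult_right_zero mult.left_commute)
qed

text \<open>\<open>frac_div\<close> is homogeneous, so the unit-ball bound is used at
  \<open>\<phi>\<close> scaled by \<open>1 / S\<close> and by \<open>- 1 / S\<close>.\<close>

lemma var_bound_scaled:
  fixes \<phi> :: "'a::euclidean_space \<Rightarrow> 'a"
  assumes V: "var_bound \<alpha> f V" and \<phi>: "\<phi> \<in> test_fields" and S: "S > 0" "\<And>x. norm (\<phi> x) \<le> S"
  shows "\<bar>\<integral>x. f x * frac_div \<alpha> \<phi> x \<partial>lborel\<bar> \<le> V * S"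
proof -
  have *: "c * (\<integral>x. f x * frac_div \<alpha> \<phi> x \<partial>lborel) \<le> V" if "\<bar>c\<bar> = 1 / S" for c
  proof -
    have "norm (c *\<^sub>R \<phi> x) \<le> 1" for x unfolding norm_scaleR that using S(1) S(2)[of x] by (simp add: divide_le_eq)
    then have "(\<integral>x. f x * frac_div \<alpha> (\<lambda>x. c *\<^sub>R \<phi> x) x \<partial>lborel) \<le> V"
      by (intro V[unfolded var_bound_def, THEN conjunct2, rule_format] test_field_scaleR[OF \<phi>])
    then show ?thesis unfolding frac_div_scaleR[OF \<phi>] mult.left_commute[of _ c] by simp
  qed
  have "(1 / S) * (\<integral>x. f x * frac_div \<alpha> \<phi> x \<partial>lborel) \<le> V" "(- 1 / S) * (\<integral>x. f x * frac_div \<alpha> \<phi> x \<partial>lborel) \<le> V"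
    using S(1) by (intro *; simp)+
  then show ?thesis using S(1) by (auto simp: field_simps abs_le_iff)
qed

lemma modulus_dom_limit:
  assumes "\<And>k. modulus_dom (\<Phi> k) w" "\<And>x. (\<lambda>k::nat. \<Phi> k x) \<longlonglongrightarrow> \<Phi>' x"
  shows "modulus_dom \<Phi>' w"
  unfolding modulus_dom_def
proof (intro conjI allI)
  show "norm (\<Phi>' (x + z) - \<Phi>' x) \<le> min 1 (norm z) * (w (x + z) + w x)" for x z
    by (rule LIMSEQ_le_const2[OF tendsto_norm[OF tendsto_diff[OF assms(2) assms(2)]]])
       (use assms(1) in \<open>auto simp: modulus_dom_def\<close>)
qed (use assms(1) in \<open>auto simp: modulus_dom_def\<close>)

text \<open>Both the kernel and the field are truncated, which makes the convolution smooth and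
  compactly supported. The radius \<open>Suc k\<close> keeps the kernel within the range
  \<open>k \<ge> 1\<close> of the uniform bounds.\<close>

definition heat_approx :: "real \<Rightarrow> ('a::euclidean_space \<Rightarrow> 'a) \<Rightarrow> nat \<Rightarrow> 'a \<Rightarrow> 'a" where
  "heat_approx s \<phi> k = conv_field (cut_heat s (real (Suc k))) (\<lambda>y. indicator (cball 0 (real k)) y *\<^sub>R \<phi> y)"

context
  fixes s :: real and \<phi> :: "'a::euclidean_space \<Rightarrow> 'a"
  assumes s: "s > 0" and \<phi>: "bdd_int \<phi>"
begin

private abbreviation \<eta> where "\<eta> k \<equiv> cut_heat s (real (Suc k))"
private abbreviation \<psi> where "\<psi> k \<equiv> (\<lambda>y. indicator (cball 0 (real k)) y *\<^sub>R \<phi> y)"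

lemma approx_measurable:
  shows "\<phi> \<in> borel_measurable borel" "\<eta> k \<in> borel_measurable borel" "\<psi> k \<in> borel_measurable borel"
proof -
  have [measurable]: "\<phi> \<in> borel_measurable borel" "cball (0::'a) (real k) \<in> sets borel" using bdd_intD(2)[OF \<phi>] by auto
  show "\<phi> \<in> borel_measurable borel" by fact
  show "\<eta> k \<in> borel_measurable borel"
    using smooth_continuous[OF cut_heat_smooth, of "[]"] by (auto intro: borel_measurable_continuous_onI)
  show "\<psi> k \<in> borel_measurable borel" by measurable
qed

lemma abs_cut_heat_le: "\<bar>\<eta> k x\<bar> \<le> heat s x"
  using cut_heat_bounds[of s "real (Suc k)" x] by simp

lemma approx_le: "norm (\<psi> k y) \<le> norm (\<phi> y)"
  by (simp add: indicator_def)

lemma integrable_\<psi>: "integrable lborel (\<psi> k)"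
  by (rule Bochner_Integration.integrable_bound[OF bdd_intD(1)[OF \<phi>]]) (use approx_measurable approx_le in auto)

lemma heat_approx_test_field: "heat_approx s \<phi> k \<in> test_fields"
  unfolding heat_approx_def
  by (rule conv_field_test_field[OF cut_heat_smooth _ integrable_\<psi>, where R = "real (Suc k)" and R' = "real k"])
     (auto simp: cut_heat_vanishes)

lemma norm_heat_approx_le:
  assumes "S \<ge> 0" "\<And>x. (\<integral>\<^sup>+y. ennreal (heat s (x - y) * norm (\<phi> y)) \<partial>lborel) \<le> ennreal S"
  shows "norm (heat_approx s \<phi> k x) \<le> S"
proof -
  note [measurable] = approx_measurable
  have "ennreal (norm (heat_approx s \<phi> k x)) \<le> (\<integral>\<^sup>+y. ennreal (norm (\<eta> k (x - y) *\<^sub>R \<psi> k y)) \<partial>lborel)"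
    unfolding heat_approx_def conv_field_def
    by (intro integral_norm_bound_ennreal bdd_int_conv_field(2)[OF s _ _ _ \<phi>]) (use cut_heat_bounds approx_le approx_measurable in auto)
  also have "\<dots> \<le> (\<integral>\<^sup>+y. ennreal (heat s (x - y) * norm (\<phi> y)) \<partial>lborel)"
    unfolding norm_scaleR
    by (intro nn_integral_mono ennreal_leI mult_mono approx_le[unfolded norm_scaleR] abs_cut_heat_le) auto
  also have "\<dots> \<le> ennreal S" by (rule assms(2))
  finally show ?thesis using assms(1) by (simp add: ennreal_le_iff)
qed

text \<open>Stated for general kernels \<open>G\<close>, so that it applies both to the cut kernels
  and to their partial derivatives.\<close>

lemma approx_tendsto:
  assumes [measurable]: "\<And>k. G k \<in> borel_measurable borel" "H \<in> borel_measurable borel"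
    and w: "bdd_int (w :: 'a \<Rightarrow> real)"
    and G: "\<And>k z. \<bar>G k z\<bar> \<le> w z" "\<And>z. (\<lambda>k. G k z) \<longlonglongrightarrow> H z"
  shows "(\<lambda>k. conv_field (G k) (\<psi> k) x) \<longlonglongrightarrow> conv_field H \<phi> x"
  unfolding conv_field_def
proof (rule integral_dominated_convergence)
  note [measurable] = approx_measurable bdd_intD(2)[OF w]
  have hm: "(\<lambda>(x, y). w (x - y) * norm (\<phi> y)) \<in> borel_measurable (borel \<Otimes>\<^sub>M borel)" by measurable
  have w0: "0 \<le> w z" for z using G(1)[of 0 z] by linarith
  show "integrable lborel (\<lambda>y. w (x - y) * norm (\<phi> y))"
    by (rule conv_dominated(1)[OF bdd_intD(1)[OF w] bdd_int_norm[OF \<phi>] hm]) (simp add: abs_mult w0)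
  show "AE y in lborel. norm (G k (x - y) *\<^sub>R \<psi> k y) \<le> w (x - y) * norm (\<phi> y)" for k
    unfolding norm_scaleR using w0 G(1)
    by (intro AE_I2 mult_mono approx_le[unfolded norm_scaleR]) auto
  show "AE y in lborel. (\<lambda>k. G k (x - y) *\<^sub>R \<psi> k y) \<longlonglongrightarrow> H (x - y) *\<^sub>R \<phi> y"
  proof (intro AE_I2 tendsto_scaleR G(2))
    fix y :: 'a
    obtain m :: nat where m: "norm y \<le> real m" using real_arch_simple by blast
    show "(\<lambda>k. \<psi> k y) \<longlonglongrightarrow> \<phi> y"
      by (rule tendsto_eventually, rule eventually_mono[OF eventually_ge_at_top[of m]]) (use m in auto)
  qed
  show "(\<lambda>y. G k (x - y) *\<^sub>R \<psi> k y) \<in> borel_measurable lborel" for k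
    using approx_measurable(3)[of k] by measurable
qed (use approx_measurable in simp)

lemma heat_approx_tendsto: "(\<lambda>k. heat_approx s \<phi> k x) \<longlonglongrightarrow> conv_field (heat s) \<phi> x"
  unfolding heat_approx_def
  by (rule approx_tendsto[OF _ _ bdd_int_heat[OF s]])
     (use approx_measurable abs_cut_heat_le LIMSEQ_Suc[OF cut_heat_tendsto(1)] in \<open>auto simp del: of_nat_Suc\<close>)

text \<open>A modulus common to all \<open>k\<close> gives the majorant through
  \<open>frac_dom\<close>, and convergence of the fields passes to their fractional divergences. The
  representation formula is applied only to the limit, where the semigroup law is exact.\<close>

lemma heat_approx_frac_div_lt_1:
  assumes \<alpha>: "0 < \<alpha>" "\<alpha> < 1"
    and rep: "\<And>(\<Phi> :: 'a \<Rightarrow> 'a) w x. bdd_int \<Phi> \<Longrightarrow> modulus_dom \<Phi> w \<Longrightarrow>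
       frac_div \<alpha> \<Phi> x = C * (\<integral>t. grad_conv t \<Phi> x \<partial>rl ((1 - \<alpha>) / 2))"
  obtains D where "bdd_int D" "\<And>k x. \<bar>frac_div \<alpha> (heat_approx s \<phi> k) x\<bar> \<le> D x"
    "\<And>x. (\<lambda>k. frac_div \<alpha> (heat_approx s \<phi> k) x) \<longlonglongrightarrow> C * frac_grad_conv ((1 - \<alpha>) / 2) s \<phi> x"
    "\<And>k. frac_div \<alpha> (heat_approx s \<phi> k) \<in> borel_measurable borel"
proof -
  obtain w :: "'a \<Rightarrow> real" where w: "\<And>k. k \<ge> 1 \<Longrightarrow> modulus_dom (cut_heat s k) w"
    using cut_heat_modulus[OF s, where 'a='a] by metis
  define w' where "w' x = (\<integral>y. w (x - y) * norm (\<phi> y) \<partial>lborel)" for x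
  note [measurable] = approx_measurable
  have md: "modulus_dom (heat_approx s \<phi> k) w'" for k
    unfolding heat_approx_def w'_def[abs_def]
    by (rule modulus_dom_conv_field[OF s approx_measurable(2) cut_heat_bounds \<phi> approx_measurable(3) approx_le w]) simp
  have b: "bdd_int (heat_approx s \<phi> k)" for k
    unfolding heat_approx_def by (rule bdd_int_conv_field(1)[OF s approx_measurable(2) cut_heat_bounds \<phi> approx_measurable(3) approx_le])
  note [measurable] = bdd_intD(2)[OF b]
  have w': "bdd_int w'" "\<And>x. 0 \<le> w' x" using md[of 0] by (auto simp: modulus_dom_def)
  define \<Phi> where "\<Phi> = conv_field (heat s) \<phi>"
  have mdL: "modulus_dom \<Phi> w'" unfolding \<Phi>_def by (rule modulus_dom_limit[OF md heat_approx_tendsto])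
  have bL: "bdd_int \<Phi>" unfolding \<Phi>_def by (rule bdd_int_conv_field(1)[OF s _ _ _ \<phi>]) auto
  note [measurable] = bdd_intD(2)[OF bL]
  note fe = frac_div_eq[OF \<alpha> md bdd_intD(2)[OF b]]
  have le: "\<bar>frac_int \<alpha> (heat_approx s \<phi> k) x z\<bar> \<le> frac_ker \<alpha> z * (w' (x + z) + w' x)" for k x z
    using frac_int_le[OF md, of z k x \<alpha>] by (simp add: frac_int_def abs_mult)
  have "(\<lambda>k. \<integral>z. frac_int \<alpha> (heat_approx s \<phi> k) x z \<partial>lborel) \<longlonglongrightarrow> (\<integral>z. frac_int \<alpha> \<Phi> x z \<partial>lborel)" for x
  proof (rule integral_dominated_convergence[OF _ _ integrable_frac_dom[OF \<alpha> w', of x]])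
    show "AE z in lborel. (\<lambda>k. frac_int \<alpha> (heat_approx s \<phi> k) x z) \<longlonglongrightarrow> frac_int \<alpha> \<Phi> x z"
      unfolding frac_int_def \<Phi>_def by (intro AE_I2 tendsto_intros heat_approx_tendsto)
    show "AE z in lborel. norm (frac_int \<alpha> (heat_approx s \<phi> k) x z) \<le> frac_ker \<alpha> z * (w' (x + z) + w' x)" for k
      using le by (intro AE_I2) simp
  qed (auto simp: frac_int_def)
  then have 1: "(\<lambda>k. frac_div \<alpha> (heat_approx s \<phi> k) x) \<longlonglongrightarrow> frac_div \<alpha> \<Phi> x" for x
    unfolding fe frac_div_eq[OF \<alpha> mdL bdd_intD(2)[OF bL]] by (intro tendsto_mult_left)
  have 2: "frac_div \<alpha> \<Phi> x = C * frac_grad_conv ((1 - \<alpha>) / 2) s \<phi> x" for x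
  proof -
    have b': "0 \<le> (1 - \<alpha>) / 2" "(1 - \<alpha>) / 2 < 1/2" "0 < (1 - \<alpha>) / 2" using \<alpha> by auto
    have "frac_div \<alpha> \<Phi> x = C * (\<integral>t. grad_conv t \<Phi> x \<partial>rl ((1 - \<alpha>) / 2))" by (rule rep[OF bL mdL])
    also have "(\<integral>t. grad_conv t \<Phi> x \<partial>rl ((1 - \<alpha>) / 2)) = (\<integral>t. grad_conv (t + s) \<phi> x \<partial>rl ((1 - \<alpha>) / 2))"
      by (rule integral_cong_AE) (use AE_rl_pos[OF b'(3)] grad_conv_conv_field[OF _ s \<phi>] in \<open>auto simp: \<Phi>_def[symmetric] elim!: eventually_mono\<close>)
    finally show ?thesis using frac_grad_conv_eq[OF b'(1,2) s \<phi>] by simp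
  qed
  show thesis
  proof (rule that)
    show "bdd_int (\<lambda>x. \<bar>mu_const DIM('a) \<alpha>\<bar> * frac_dom \<alpha> w' x)" by (intro bdd_int_cmult bdd_int_frac_dom[OF \<alpha> w'])
    show "\<bar>frac_div \<alpha> (heat_approx s \<phi> k) x\<bar> \<le> \<bar>mu_const DIM('a) \<alpha>\<bar> * frac_dom \<alpha> w' x" for k x
      by (rule abs_frac_div_le[OF \<alpha> md bdd_intD(2)[OF b]])
    show "(\<lambda>k. frac_div \<alpha> (heat_approx s \<phi> k) x) \<longlonglongrightarrow> C * frac_grad_conv ((1 - \<alpha>) / 2) s \<phi> x" for x
      using 1[of x] unfolding 2 .
    show "frac_div \<alpha> (heat_approx s \<phi> k) \<in> borel_measurable borel" for k
      unfolding fe[abs_def] frac_int_def by measurable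
  qed
qed

text \<open>For order 1 the divergence is local and the derivatives fall on the cut kernel. The
  limit is again a \<open>frac_grad_conv\<close>, with \<open>b = 0\<close>, so both cases end in
  the same form.\<close>

lemma heat_approx_frac_div_1:
  obtains D where "bdd_int D" "\<And>k x. \<bar>frac_div 1 (heat_approx s \<phi> k) x\<bar> \<le> D x"
    "\<And>x. (\<lambda>k. frac_div 1 (heat_approx s \<phi> k) x) \<longlonglongrightarrow> frac_grad_conv 0 s \<phi> x"
    "\<And>k. frac_div 1 (heat_approx s \<phi> k) \<in> borel_measurable borel"
proof -
  obtain w :: "'a \<Rightarrow> real" where w: "\<And>k. k \<ge> 1 \<Longrightarrow> modulus_dom (cut_heat s k) w"
    "\<And>k x h. k \<ge> 1 \<Longrightarrow> \<bar>frechet_derivative (cut_heat s k) (at x) h\<bar> \<le> w x * norm h"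
    using cut_heat_modulus[OF s, where 'a='a] by metis
  have wn: "bdd_int w" "\<And>x. 0 \<le> w x" using w(1)[of 1] by (auto simp: modulus_dom_def)
  define w' where "w' x = (\<integral>y. w (x - y) * norm (\<phi> y) \<partial>lborel)" for x
  note [measurable] = approx_measurable bdd_intD(2)[OF wn(1)]
  define G where "G k b z = frechet_derivative (\<eta> k) (at z) b" for k and b z :: 'a
  have Gm[measurable]: "G k b \<in> borel_measurable borel" for k b
    unfolding G_def using smooth_partial_measurable[OF cut_heat_smooth, of "[]"] by simp
  have Gle: "\<bar>G k b z\<bar> \<le> w z" if "b \<in> Basis" for k b z
    using w(2)[of "real (Suc k)" z b] that unfolding G_def by simp
  have hm: "(\<lambda>(x, y). w (x - y) * norm (\<phi> y)) \<in> borel_measurable (borel \<Otimes>\<^sub>M borel)" by measurable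
  have h: "norm (w (x - y) * norm (\<phi> y)) \<le> w (x - y) * norm (\<phi> y)" for x y using wn(2)[of "x - y"] by (simp add: abs_mult)
  note cd = conv_dominated[OF bdd_intD(1)[OF wn(1)] bdd_int_norm[OF \<phi>] hm h]
  have fd: "frac_div 1 (heat_approx s \<phi> k) x = (\<Sum>b\<in>Basis. conv_field (G k b) (\<psi> k) x \<bullet> b)" for k x
    unfolding frac_div_def heat_approx_def G_def
    by (simp add: conv_field_smooth(1)[OF cut_heat_smooth _ integrable_\<psi>, where R = "real (Suc k)"] cut_heat_vanishes)
  have i: "integrable lborel (\<lambda>y. G k b (x - y) *\<^sub>R \<psi> k y)" if "b \<in> Basis" for k b x
  proof (rule Bochner_Integration.integrable_bound[OF cd(1)[of x]])
    show "(\<lambda>y. G k b (x - y) *\<^sub>R \<psi> k y) \<in> borel_measurable lborel" using approx_measurable(3)[of k] by measurable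
    have "norm (G k b (x - y) *\<^sub>R \<psi> k y) \<le> norm (w (x - y) * norm (\<phi> y))" for y
    proof -
      have "\<bar>G k b (x - y)\<bar> * norm (\<psi> k y) \<le> w (x - y) * norm (\<phi> y)"
        by (rule mult_mono[OF Gle[OF that] approx_le wn(2) norm_ge_zero])
      then show ?thesis unfolding norm_scaleR real_norm_def[of "w (x - y) * norm (\<phi> y)"] by (rule order_trans[OF _ abs_ge_self])
    qed
    then show "AE y in lborel. norm (G k b (x - y) *\<^sub>R \<psi> k y) \<le> norm (w (x - y) * norm (\<phi> y))" by simp
  qed
  show thesis
  proof (rule that)
    show "bdd_int (\<lambda>x. real DIM('a) * w' x)" unfolding w'_def by (intro bdd_int_cmult cd(2))
    show "\<bar>frac_div 1 (heat_approx s \<phi> k) x\<bar> \<le> real DIM('a) * w' x" for k x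
    proof -
      have "\<bar>frac_div 1 (heat_approx s \<phi> k) x\<bar> \<le> (\<Sum>b\<in>Basis. \<bar>conv_field (G k b) (\<psi> k) x \<bullet> b\<bar>)"
        unfolding fd by (rule sum_abs)
      also have "\<dots> \<le> (\<Sum>b\<in>(Basis::'a set). w' x)"
      proof (rule sum_mono)
        fix b :: 'a assume b: "b \<in> Basis"
        have "\<bar>conv_field (G k b) (\<psi> k) x \<bullet> b\<bar> \<le> norm (conv_field (G k b) (\<psi> k) x)"
          using Basis_le_norm[OF b] by blast
        also have "\<dots> \<le> w' x" unfolding conv_field_def w'_def
        proof (rule bochner_integral_norm_bound[OF i[OF b] cd(1)])
          show "AE y in lborel. norm (G k b (x - y) *\<^sub>R \<psi> k y) \<le> w (x - y) * norm (\<phi> y)"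
            unfolding norm_scaleR using Gle[OF b] wn(2) by (intro AE_I2 mult_mono approx_le[unfolded norm_scaleR]) auto
        qed
        finally show "\<bar>conv_field (G k b) (\<psi> k) x \<bullet> b\<bar> \<le> w' x" .
      qed
      finally show ?thesis by simp
    qed
    show "(\<lambda>k. frac_div 1 (heat_approx s \<phi> k) x) \<longlonglongrightarrow> frac_grad_conv 0 s \<phi> x" for x
    proof -
      have "(\<lambda>k. conv_field (G k b) (\<psi> k) x) \<longlonglongrightarrow> conv_field (\<lambda>z. heat_grad s z \<bullet> b) \<phi> x" if "b \<in> Basis" for b
        by (rule approx_tendsto[OF Gm _ wn(1)])
           (use Gle[OF that] LIMSEQ_Suc[OF cut_heat_tendsto(2)] in \<open>auto simp: G_def\<close>)
      then have "(\<lambda>k. frac_div 1 (heat_approx s \<phi> k) x) \<longlonglongrightarrow> (\<Sum>b\<in>Basis. conv_field (\<lambda>z. heat_grad s z \<bullet> b) \<phi> x \<bullet> b)"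
        unfolding fd by (intro tendsto_intros)
      also have "(\<Sum>b\<in>Basis. conv_field (\<lambda>z. heat_grad s z \<bullet> b) \<phi> x \<bullet> b) = grad_conv s \<phi> x"
      proof -
        have i: "integrable lborel (\<lambda>y. (heat_grad s (x - y) \<bullet> b) *\<^sub>R \<phi> y)" for b :: 'a
        proof -
          obtain B where B: "\<And>x. norm (\<phi> x) \<le> B" using bdd_int_bound[OF \<phi>] by metis
          have "integrable lborel (\<lambda>y. B * norm (heat_grad s (x - y) \<bullet> b))"
            using integrable_lborel_reflect[OF integrable_heat_grad[OF s, where 'a='a], of x] by auto
          then show ?thesis
          proof (rule Bochner_Integration.integrable_bound)
            have "norm ((heat_grad s (x - y) \<bullet> b) *\<^sub>R \<phi> y) \<le> norm (B * norm (heat_grad s (x - y) \<bullet> b))" for y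
            proof -
              have "norm ((heat_grad s (x - y) \<bullet> b) *\<^sub>R \<phi> y) \<le> norm (heat_grad s (x - y) \<bullet> b) * B"
                unfolding norm_scaleR real_norm_def by (rule mult_left_mono[OF B abs_ge_zero])
              also have "\<dots> = B * norm (heat_grad s (x - y) \<bullet> b)" by (rule mult.commute)
              also have "\<dots> \<le> norm (B * norm (heat_grad s (x - y) \<bullet> b))" unfolding real_norm_def by (rule abs_ge_self)
              finally show ?thesis .
            qed
            then show "AE y in lborel. norm ((heat_grad s (x - y) \<bullet> b) *\<^sub>R \<phi> y) \<le> norm (B * norm (heat_grad s (x - y) \<bullet> b))"
              by (intro AE_I2)
          qed measurable
        qed
        have "(\<Sum>b\<in>Basis. conv_field (\<lambda>z. heat_grad s z \<bullet> b) \<phi> x \<bullet> b) = (\<Sum>b\<in>Basis. \<integral>y. ((heat_grad s (x - y) \<bullet> b) *\<^sub>R \<phi> y) \<bullet> b \<partial>lborel)"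
          unfolding conv_field_def by (intro sum.cong refl integral_inner_left[symmetric] i)
        also have "\<dots> = (\<integral>y. (\<Sum>b\<in>Basis. ((heat_grad s (x - y) \<bullet> b) *\<^sub>R \<phi> y) \<bullet> b) \<partial>lborel)"
          by (rule Bochner_Integration.integral_sum[symmetric]) (intro integrable_inner_left i)
        also have "\<dots> = grad_conv s \<phi> x"
          unfolding grad_conv_def
        proof (rule Bochner_Integration.integral_cong[OF refl])
          fix y
          have "heat_grad s (x - y) \<bullet> \<phi> y = (\<Sum>b\<in>Basis. (heat_grad s (x - y) \<bullet> b) * (\<phi> y \<bullet> b))" by (rule euclidean_inner)
          then show "(\<Sum>b\<in>Basis. ((heat_grad s (x - y) \<bullet> b) *\<^sub>R \<phi> y) \<bullet> b) = heat_grad s (x - y) \<bullet> \<phi> y"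
            by (simp only: inner_scaleR_left)
        qed
        finally show ?thesis .
      qed
      also have "grad_conv s \<phi> x = frac_grad_conv 0 s \<phi> x"
        by (subst frac_grad_conv_eq[OF _ _ s \<phi>]) (auto simp: integral_rl_0)
      finally show ?thesis .
    qed
    show "frac_div 1 (heat_approx s \<phi> k) \<in> borel_measurable borel" for k
      unfolding fd[abs_def] conv_field_def by measurable
  qed
qed

end

text \<open>The point where the variation enters. \<open>S\<close> bounds the sup norm of the
  smoothed field, and the estimate \<open>V * S\<close> survives the limit along
  \<open>heat_approx\<close>; the L^p bound on \<open>f\<close> serves to justify that limit. The
  constant is the reciprocal of the one in the representation of the divergence.\<close>

lemma var_bound_heat_pairing:
  assumes \<alpha>: "0 < \<alpha>" "\<alpha> \<le> 1"
  obtains C where "C \<ge> 0"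
    "\<And>(f :: 'a::euclidean_space \<Rightarrow> real) p N V s \<phi> S. p \<ge> 1 \<Longrightarrow> Lp_bound p f N \<Longrightarrow> var_bound \<alpha> f V \<Longrightarrow> s > 0 \<Longrightarrow>
      bdd_int \<phi> \<Longrightarrow> S > 0 \<Longrightarrow> (\<And>x. (\<integral>\<^sup>+y. ennreal (heat s (x - y) * norm (\<phi> y)) \<partial>lborel) \<le> ennreal S) \<Longrightarrow>
      \<bar>\<integral>x. f x * frac_grad_conv ((1 - \<alpha>) / 2) s \<phi> x \<partial>lborel\<bar> \<le> C * V * S"
proof -
  \<comment> \<open>One statement for both cases: the constant is 1 for \<alpha> = 1 and otherwise
    comes from \<open>frac_div_heat_representation\<close>.\<close>
  have "\<exists>C>0. \<forall>s (\<phi> :: 'a \<Rightarrow> 'a). s > 0 \<longrightarrow> bdd_int \<phi> \<longrightarrow> (\<exists>D. bdd_int D \<and> (\<forall>k x. \<bar>frac_div \<alpha> (heat_approx s \<phi> k) x\<bar> \<le> D x) \<and>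
      (\<forall>x. (\<lambda>k. frac_div \<alpha> (heat_approx s \<phi> k) x) \<longlonglongrightarrow> C * frac_grad_conv ((1 - \<alpha>) / 2) s \<phi> x) \<and>
      (\<forall>k. frac_div \<alpha> (heat_approx s \<phi> k) \<in> borel_measurable borel))"
  proof (cases "\<alpha> = 1")
    case True
    show ?thesis
    proof (intro exI[of _ 1] conjI allI impI)
      fix s :: real and \<phi> :: "'a \<Rightarrow> 'a" assume s: "s > 0" and \<phi>: "bdd_int \<phi>"
      show "\<exists>D. bdd_int D \<and> (\<forall>k x. \<bar>frac_div \<alpha> (heat_approx s \<phi> k) x\<bar> \<le> D x) \<and>
        (\<forall>x. (\<lambda>k. frac_div \<alpha> (heat_approx s \<phi> k) x) \<longlonglongrightarrow> 1 * frac_grad_conv ((1 - \<alpha>) / 2) s \<phi> x) \<and>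
        (\<forall>k. frac_div \<alpha> (heat_approx s \<phi> k) \<in> borel_measurable borel)"
        by (rule heat_approx_frac_div_1[OF s \<phi>]) (auto simp: True)
    qed simp
  next
    case False
    then have \<alpha>': "\<alpha> < 1" using \<alpha> by simp
    obtain C where C: "C > 0" "\<And>(\<Phi> :: 'a \<Rightarrow> 'a) w x. bdd_int \<Phi> \<Longrightarrow> modulus_dom \<Phi> w \<Longrightarrow>
       frac_div \<alpha> \<Phi> x = C * (\<integral>t. grad_conv t \<Phi> x \<partial>rl ((1 - \<alpha>) / 2))"
    proof (rule frac_div_heat_representation[OF \<alpha>(1) \<alpha>', where 'a='a])
      fix C D :: real
      assume C: "0 < C" and *: "\<And>(\<Phi> :: 'a \<Rightarrow> 'a) w x. bdd_int \<Phi> \<Longrightarrow> modulus_dom \<Phi> w \<Longrightarrow>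
          integrable (rl ((1 - \<alpha>) / 2)) (\<lambda>t. grad_conv t \<Phi> x) \<and>
          frac_div \<alpha> \<Phi> x = C * (\<integral>t. grad_conv t \<Phi> x \<partial>rl ((1 - \<alpha>) / 2)) \<and>
          (\<integral>\<^sup>+t. ennreal \<bar>grad_conv t \<Phi> x\<bar> \<partial>rl ((1 - \<alpha>) / 2)) \<le> ennreal (D * frac_dom \<alpha> w x)"
      show thesis by (rule that[OF C]) (use * in blast)
    qed
    show ?thesis
    proof (intro exI[of _ C] conjI allI impI C(1))
      fix s :: real and \<phi> :: "'a \<Rightarrow> 'a" assume s: "s > 0" and \<phi>: "bdd_int \<phi>"
      show "\<exists>D. bdd_int D \<and> (\<forall>k x. \<bar>frac_div \<alpha> (heat_approx s \<phi> k) x\<bar> \<le> D x) \<and>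
        (\<forall>x. (\<lambda>k. frac_div \<alpha> (heat_approx s \<phi> k) x) \<longlonglongrightarrow> C * frac_grad_conv ((1 - \<alpha>) / 2) s \<phi> x) \<and>
        (\<forall>k. frac_div \<alpha> (heat_approx s \<phi> k) \<in> borel_measurable borel)"
        by (rule heat_approx_frac_div_lt_1[OF s \<phi> \<alpha>(1) \<alpha>' C(2)]) auto
    qed
  qed
  then obtain C where C: "C > 0" and *: "\<And>s (\<phi> :: 'a \<Rightarrow> 'a). s > 0 \<Longrightarrow> bdd_int \<phi> \<Longrightarrow> \<exists>D. bdd_int D \<and> (\<forall>k x. \<bar>frac_div \<alpha> (heat_approx s \<phi> k) x\<bar> \<le> D x) \<and>
      (\<forall>x. (\<lambda>k. frac_div \<alpha> (heat_approx s \<phi> k) x) \<longlonglongrightarrow> C * frac_grad_conv ((1 - \<alpha>) / 2) s \<phi> x) \<and>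
      (\<forall>k. frac_div \<alpha> (heat_approx s \<phi> k) \<in> borel_measurable borel)" by blast
  show thesis
  proof (rule that[of "1 / C"])
    fix f :: "'a \<Rightarrow> real" and p N V s and \<phi> :: "'a \<Rightarrow> 'a" and S
    assume p: "p \<ge> 1" and f: "Lp_bound p f N" and V: "var_bound \<alpha> f V" and s: "s > 0" and \<phi>: "bdd_int \<phi>"
      and S: "S > 0" and S': "\<And>x. (\<integral>\<^sup>+y. ennreal (heat s (x - y) * norm (\<phi> y)) \<partial>lborel) \<le> ennreal S"
    have [measurable]: "f \<in> borel_measurable borel" using f by (simp add: Lp_bound_def)
    obtain D where D: "bdd_int D" "\<And>k x. \<bar>frac_div \<alpha> (heat_approx s \<phi> k) x\<bar> \<le> D x"
      and lim: "\<And>x. (\<lambda>k. frac_div \<alpha> (heat_approx s \<phi> k) x) \<longlonglongrightarrow> C * frac_grad_conv ((1 - \<alpha>) / 2) s \<phi> x"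
      and m[measurable]: "\<And>k. frac_div \<alpha> (heat_approx s \<phi> k) \<in> borel_measurable borel"
      using *[OF s \<phi>] by blast
    have b: "0 \<le> (1 - \<alpha>) / 2" "(1 - \<alpha>) / 2 < 1/2" using \<alpha> by auto
    have [measurable]: "frac_grad_conv ((1 - \<alpha>) / 2) s \<phi> \<in> borel_measurable borel"
      by (rule bdd_intD(2)[OF bdd_int_frac_grad_conv[OF b s \<phi>]])
    have "(\<lambda>k. \<integral>x. f x * frac_div \<alpha> (heat_approx s \<phi> k) x \<partial>lborel) \<longlonglongrightarrow> (\<integral>x. f x * (C * frac_grad_conv ((1 - \<alpha>) / 2) s \<phi> x) \<partial>lborel)"
    proof (rule integral_dominated_convergence)
      show "integrable lborel (\<lambda>x. \<bar>f x * D x\<bar>)" using integrable_Lp_mult[OF p f D(1)] by auto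
      show "AE x in lborel. (\<lambda>k. f x * frac_div \<alpha> (heat_approx s \<phi> k) x) \<longlonglongrightarrow> f x * (C * frac_grad_conv ((1 - \<alpha>) / 2) s \<phi> x)"
        by (intro AE_I2 tendsto_mult_left lim)
      show "AE x in lborel. norm (f x * frac_div \<alpha> (heat_approx s \<phi> k) x) \<le> \<bar>f x * D x\<bar>" for k
      proof (rule AE_I2)
        fix x
        have "\<bar>f x\<bar> * \<bar>frac_div \<alpha> (heat_approx s \<phi> k) x\<bar> \<le> \<bar>f x\<bar> * \<bar>D x\<bar>"
          by (rule mult_left_mono[OF order_trans[OF D(2) abs_ge_self] abs_ge_zero])
        then show "norm (f x * frac_div \<alpha> (heat_approx s \<phi> k) x) \<le> \<bar>f x * D x\<bar>" by (simp only: real_norm_def abs_mult)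
      qed
    qed auto
    then have "(\<lambda>k. \<bar>\<integral>x. f x * frac_div \<alpha> (heat_approx s \<phi> k) x \<partial>lborel\<bar>) \<longlonglongrightarrow> \<bar>\<integral>x. f x * (C * frac_grad_conv ((1 - \<alpha>) / 2) s \<phi> x) \<partial>lborel\<bar>"
      by (rule tendsto_rabs)
    moreover have "\<bar>\<integral>x. f x * frac_div \<alpha> (heat_approx s \<phi> k) x \<partial>lborel\<bar> \<le> V * S" for k
      using S by (intro var_bound_scaled[OF V heat_approx_test_field[OF s \<phi>] S] norm_heat_approx_le[OF s \<phi> _ S']) auto
    ultimately have "\<bar>\<integral>x. f x * (C * frac_grad_conv ((1 - \<alpha>) / 2) s \<phi> x) \<partial>lborel\<bar> \<le> V * S"
      by (intro LIMSEQ_le_const2) auto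
    then have "C * \<bar>\<integral>x. f x * frac_grad_conv ((1 - \<alpha>) / 2) s \<phi> x \<partial>lborel\<bar> \<le> V * S"
      unfolding mult.left_commute[of _ C] using C by (simp add: abs_mult)
    then show "\<bar>\<integral>x. f x * frac_grad_conv ((1 - \<alpha>) / 2) s \<phi> x \<partial>lborel\<bar> \<le> 1 / C * V * S"
      using C by (simp add: field_simps)
  qed (use C in simp)
qed

section \<open>Two-scale representation and bounds by duality\<close>

lemma measurable_frac_grad_conv [measurable (raw)]:
  fixes \<Phi> :: "'a::euclidean_space \<Rightarrow> 'a"
  assumes [measurable]: "g \<in> borel_measurable N" "f \<in> borel_measurable N" "\<Phi> \<in> borel_measurable borel"
  shows "(\<lambda>x. frac_grad_conv b (g x) \<Phi> (f x)) \<in> borel_measurable N"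
  unfolding frac_grad_conv_def by measurable

text \<open>The second conclusion bounds the outer integral absolutely by a majorant in
  \<open>x\<close>; with it the identity can be integrated against \<open>f\<close>. For \<alpha> =
  1 the inner weight is the Dirac mass, which is why \<open>rl_beta\<close> has its exceptional
  value.\<close>

lemma frac_div_two_scale:
  assumes ab: "0 < \<beta>" "\<beta> < \<alpha>" "\<alpha> \<le> 1"
  obtains C D where "C > 0" "D > 0"
    "\<And>(\<Phi> :: 'a::euclidean_space \<Rightarrow> 'a) w x. bdd_int \<Phi> \<Longrightarrow> modulus_dom \<Phi> w \<Longrightarrow>
       frac_div \<beta> \<Phi> x = C * (\<integral>s. frac_grad_conv ((1 - \<alpha>) / 2) s \<Phi> x \<partial>rl ((\<alpha> - \<beta>) / 2)) \<and>
       (\<integral>\<^sup>+s. ennreal \<bar>frac_grad_conv ((1 - \<alpha>) / 2) s \<Phi> x\<bar> \<partial>rl ((\<alpha> - \<beta>) / 2)) \<le> ennreal (D * frac_dom \<beta> w x)"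
proof -
  define a where "a = (\<alpha> - \<beta>) / 2"
  define b where "b = (1 - \<alpha>) / 2"
  have a: "a > 0" and b: "0 \<le> b" "b < 1/2" using ab by (auto simp: a_def b_def)
  have sum: "(1 - \<beta>) / 2 = a + b" by (simp add: a_def b_def field_simps)
  have \<beta>: "0 < \<beta>" "\<beta> < 1" using ab by auto
  show thesis
  proof (rule frac_div_heat_representation[OF \<beta>, where 'a='a], unfold sum)
    fix C D :: real
    assume C: "0 < C" and D: "0 < D" and *: "\<And>(\<Phi> :: 'a \<Rightarrow> 'a) w x. bdd_int \<Phi> \<Longrightarrow> modulus_dom \<Phi> w \<Longrightarrow>
          integrable (rl (a + b)) (\<lambda>t. grad_conv t \<Phi> x) \<and>
          frac_div \<beta> \<Phi> x = C * (\<integral>t. grad_conv t \<Phi> x \<partial>rl (a + b)) \<and>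
          (\<integral>\<^sup>+t. ennreal \<bar>grad_conv t \<Phi> x\<bar> \<partial>rl (a + b)) \<le> ennreal (D * frac_dom \<beta> w x)"
    note B = rl_beta_pos[OF a b(1)]
    show thesis
    proof (rule that[of "C / rl_beta a b" "rl_beta a b * D"])
      fix \<Phi> :: "'a \<Rightarrow> 'a" and w x assume \<Phi>: "bdd_int \<Phi>" and md: "modulus_dom \<Phi> w"
      note [measurable] = bdd_intD(2)[OF \<Phi>]
      have I: "integrable (rl (a + b)) (\<lambda>t. grad_conv t \<Phi> x)"
        and fd: "frac_div \<beta> \<Phi> x = C * (\<integral>t. grad_conv t \<Phi> x \<partial>rl (a + b))"
        and nn: "(\<integral>\<^sup>+t. ennreal \<bar>grad_conv t \<Phi> x\<bar> \<partial>rl (a + b)) \<le> ennreal (D * frac_dom \<beta> w x)"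
        using *[OF \<Phi> md] by auto
      have eq: "AE s in rl a. (\<integral>t. grad_conv (s + t) \<Phi> x \<partial>rl b) = frac_grad_conv b s \<Phi> x"
        using AE_rl_pos[OF a] by eventually_elim (simp add: frac_grad_conv_eq[OF b _ \<Phi>] add.commute)
      have "(\<integral>s. frac_grad_conv b s \<Phi> x \<partial>rl a) = (\<integral>s. (\<integral>t. grad_conv (s + t) \<Phi> x \<partial>rl b) \<partial>rl a)"
        by (rule integral_cong_AE) (use eq in \<open>auto elim: eventually_mono\<close>)
      also have "\<dots> = rl_beta a b * (\<integral>t. grad_conv t \<Phi> x \<partial>rl (a + b))"
        by (rule integral_rl_rl(2)[OF a b(1) I])
      finally have 1: "frac_div \<beta> \<Phi> x = C / rl_beta a b * (\<integral>s. frac_grad_conv b s \<Phi> x \<partial>rl a)"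
        using fd B by simp
      have "(\<integral>\<^sup>+s. ennreal \<bar>frac_grad_conv b s \<Phi> x\<bar> \<partial>rl a) \<le> (\<integral>\<^sup>+s. (\<integral>\<^sup>+t. ennreal \<bar>grad_conv (s + t) \<Phi> x\<bar> \<partial>rl b) \<partial>rl a)"
      proof (rule nn_integral_mono_AE, use eq AE_rl_pos[OF a] in eventually_elim)
        fix s :: real assume s: "(\<integral>t. grad_conv (s + t) \<Phi> x \<partial>rl b) = frac_grad_conv b s \<Phi> x" "0 < s"
        have "integrable (rl b) (\<lambda>t. grad_conv (s + t) \<Phi> x)"
          using integrable_grad_conv_shift[OF b s(2) \<Phi>, of x] by (simp add: add.commute)
        from integral_norm_bound_ennreal[OF this]
        show "ennreal \<bar>frac_grad_conv b s \<Phi> x\<bar> \<le> (\<integral>\<^sup>+t. ennreal \<bar>grad_conv (s + t) \<Phi> x\<bar> \<partial>rl b)"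
          unfolding s(1) by simp
      qed
      also have "\<dots> = ennreal (rl_beta a b) * (\<integral>\<^sup>+t. ennreal \<bar>grad_conv t \<Phi> x\<bar> \<partial>rl (a + b))"
        by (rule nn_integral_rl_rl[OF a b(1)]) measurable
      also have "\<dots> \<le> ennreal (rl_beta a b) * ennreal (D * frac_dom \<beta> w x)" using nn by (rule mult_left_mono) simp
      also have "\<dots> = ennreal (rl_beta a b * D * frac_dom \<beta> w x)" using B by (simp add: mult.assoc ennreal_mult')
      finally show "frac_div \<beta> \<Phi> x = C / rl_beta a b * (\<integral>s. frac_grad_conv ((1 - \<alpha>) / 2) s \<Phi> x \<partial>rl ((\<alpha> - \<beta>) / 2)) \<and>
       (\<integral>\<^sup>+s. ennreal \<bar>frac_grad_conv ((1 - \<alpha>) / 2) s \<Phi> x\<bar> \<partial>rl ((\<alpha> - \<beta>) / 2)) \<le> ennreal (rl_beta a b * D * frac_dom \<beta> w x)"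
        using 1 unfolding a_def b_def by blast
    qed (use B C D in auto)
  qed
qed

text \<open>The weight is constant on a ball that contains the support. If both points lie outside,
  the difference vanishes; otherwise one of the two weights equals \<open>2 * B + L\<close>, which
  dominates both the Lipschitz bound and the sup bound.\<close>

lemma test_field_modulus_dom:
  fixes \<phi> :: "'a::euclidean_space \<Rightarrow> 'a"
  assumes "\<phi> \<in> test_fields"
  obtains w where "bdd_int \<phi>" "modulus_dom \<phi> w"
proof -
  obtain R B L where R: "\<And>x. R < norm x \<Longrightarrow> \<phi> x = 0" and B: "B \<ge> 0" "\<And>x. norm (\<phi> x) \<le> B"
    and L: "L \<ge> 0" "\<And>x y. norm (\<phi> x - \<phi> y) \<le> L * norm (x - y)"
    using test_field_bounds[OF assms] by metis
  have "smooth \<phi>" using assms by (simp add: test_fields_def)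
  then have \<phi>m: "\<phi> \<in> borel_measurable borel"
    using smooth_continuous[of \<phi> "[]"] by (auto intro: borel_measurable_continuous_onI)
  define w where "w x = (2 * B + L) * indicator (cball 0 R) x" for x :: 'a
  have "integrable lborel (\<lambda>x::'a. indicator (cball 0 R) x :: real)"
    using emeasure_bounded_finite[of "cball (0::'a) R"] by auto
  then have wi: "integrable lborel w" unfolding w_def by auto
  have "norm (w x) \<le> 2 * B + L" for x using B L by (simp add: w_def indicator_def)
  then have wb: "bdd_int w" using wi unfolding bdd_int_def by blast
  have w0: "0 \<le> w x" for x using B L by (simp add: w_def)
  have "norm (\<phi> x) \<le> w x" for x
    using R[of x] B(2)[of x] B(1) L(1) by (cases "R < norm x") (auto simp: w_def indicator_def)
  then have 1: "bdd_int \<phi>" by (rule bdd_int_dominated[OF wb \<phi>m])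
  have "norm (\<phi> (x + z) - \<phi> x) \<le> min 1 (norm z) * (w (x + z) + w x)" for x z
  proof (cases "R < norm (x + z) \<and> R < norm x")
    case True
    then show ?thesis using R w0[of x] w0[of "x + z"] by simp
  next
    case False
    then have w1: "2 * B + L \<le> w (x + z) + w x" using B L w0[of x] w0[of "x + z"] by (auto simp: w_def indicator_def)
    have "norm (\<phi> (x + z) - \<phi> x) \<le> L * norm z" using L(2)[of "x + z" x] by simp
    moreover have "norm (\<phi> (x + z) - \<phi> x) \<le> 2 * B" using norm_triangle_ineq4[of "\<phi> (x + z)" "\<phi> x"] B(2)[of x] B(2)[of "x + z"] by linarith
    ultimately have "norm (\<phi> (x + z) - \<phi> x) \<le> min 1 (norm z) * (2 * B + L)"
      using B L by (cases "norm z \<le> 1") (auto simp: min_def distrib_left mult.commute intro: order_trans)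
    also have "\<dots> \<le> min 1 (norm z) * (w (x + z) + w x)" using w1 by (intro mult_left_mono) auto
    finally show ?thesis .
  qed
  then have "modulus_dom \<phi> w" unfolding modulus_dom_def using w0 wb by simp
  with 1 show thesis by (rule that)
qed

text \<open>The L^q norm of \<open>heat s\<close> by interpolation: its \<open>q\<close>-th power is
  at most the supremum to the power \<open>q - 1\<close> times the kernel, whose mass is 1. This is
  the origin of the exponent n (1 - 1/q)/2.\<close>

lemma heat_dual_bound:
  assumes q: "q \<ge> 1"
  obtains C where "C > 0" "\<And>s \<phi> (x::'a::euclidean_space). s > 0 \<Longrightarrow> dual_unit q (\<phi> :: 'a \<Rightarrow> 'b::euclidean_space) \<Longrightarrow>
    (\<integral>\<^sup>+y. ennreal (heat s (x - y) * norm (\<phi> y)) \<partial>lborel) \<le> ennreal (C * s powr (- (real DIM('a) * (1 - 1/q) / 2)))"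
proof -
  let ?n = "real DIM('a)"
  let ?g = "gauss_mass TYPE('a)"
  define C where "C = (1 / ?g) powr (1 - 1/q)"
  have C: "C > 0" unfolding C_def using gauss_mass_pos[where 'a='a] by simp
  have q1: "q * (1 - 1/q) = q - 1" using q by (simp add: field_simps)
  show thesis
  proof (rule that[OF C])
    fix s :: real and \<phi> :: "'a \<Rightarrow> 'b" and x :: 'a assume s: "s > 0" and \<phi>: "dual_unit q \<phi>"
    let ?S = "C * s powr (- (?n * (1 - 1/q) / 2))"
    have S: "?S powr q = (s powr (- ?n / 2) / ?g) powr (q - 1)"
    proof -
      have "?S powr q = ((1 / ?g) powr (1 - 1/q)) powr q * (s powr (- (?n * (1 - 1/q) / 2))) powr q"
        unfolding C_def using gauss_mass_pos[where 'a='a] by (intro powr_mult)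
      also have "\<dots> = (1 / ?g) powr (q - 1) * (s powr (- ?n / 2)) powr (q - 1)"
      proof -
        have "(1 - 1/q) * q = q - 1" "- (?n * (1 - 1/q) / 2) * q = (- ?n / 2) * (q - 1)"
          using q by (simp_all add: field_simps)
        then show ?thesis by (simp only: powr_powr)
      qed
      finally show ?thesis using gauss_mass_pos[where 'a='a] by (simp add: powr_divide)
    qed
    have "(\<integral>\<^sup>+y. ennreal (\<bar>heat s (x - y)\<bar> * norm (\<phi> y)) \<partial>lborel) \<le> ennreal ?S"
    proof (rule dual_unit_pairing[OF \<phi> q])
      have "(\<integral>\<^sup>+y. ennreal (\<bar>heat s (x - y)\<bar> powr q) \<partial>lborel) \<le> (\<integral>\<^sup>+y. ennreal (?S powr q) * ennreal (heat s (x - y)) \<partial>lborel)"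
      proof (intro nn_integral_mono)
        fix y
        have "heat s (x - y) powr q = heat s (x - y) powr (q - 1) * heat s (x - y)"
        proof -
          have "heat s (x - y) powr (q - 1 + 1) = heat s (x - y) powr (q - 1) * heat s (x - y) powr 1" by (rule powr_add)
          then show ?thesis by simp
        qed
        also have "\<dots> \<le> ?S powr q * heat s (x - y)"
          unfolding S using q heat_le_sup[OF s] by (intro mult_right_mono powr_mono2) auto
        finally show "ennreal (\<bar>heat s (x - y)\<bar> powr q) \<le> ennreal (?S powr q) * ennreal (heat s (x - y))"
          by (simp flip: ennreal_mult)
      qed
      also have "\<dots> = ennreal (?S powr q)" using s by (simp add: nn_integral_cmult)
      finally show "(\<integral>\<^sup>+y. ennreal (\<bar>heat s (x - y)\<bar> powr q) \<partial>lborel) \<le> ennreal (?S powr q)" .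
    qed (use C in auto)
    then show "(\<integral>\<^sup>+y. ennreal (heat s (x - y) * norm (\<phi> y)) \<partial>lborel) \<le> ennreal ?S" by simp
  qed
qed

text \<open>Young's inequality in dual form: with the difference \<open>z = x - y\<close> held
  fixed, the integral over \<open>y\<close> pairs \<phi> with a translate of \<open>f\<close>, and
  translation does not change the L^q norm.\<close>

lemma young_dual:
  fixes f K :: "'a::euclidean_space \<Rightarrow> real" and \<phi> :: "'a \<Rightarrow> 'b::euclidean_space"
  assumes q: "q \<ge> 1" and f: "Lp_bound q f N" and \<phi>: "dual_unit q \<phi>" and K0: "\<And>x. 0 \<le> K x"
    and [measurable]: "K \<in> borel_measurable borel"
  shows "(\<integral>\<^sup>+x. (\<integral>\<^sup>+y. ennreal (\<bar>f x\<bar> * (K (x - y) * norm (\<phi> y))) \<partial>lborel) \<partial>lborel) \<le> (\<integral>\<^sup>+z. ennreal (K z) \<partial>lborel) * ennreal N"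
proof -
  have [measurable]: "f \<in> borel_measurable borel" and N: "N \<ge> 0" using f by (auto simp: Lp_bound_def)
  note [measurable] = bdd_intD(2)[OF dual_unit_bdd_int[OF \<phi>]]
  have "(\<integral>\<^sup>+x. (\<integral>\<^sup>+y. ennreal (\<bar>f x\<bar> * (K (x - y) * norm (\<phi> y))) \<partial>lborel) \<partial>lborel) = (\<integral>\<^sup>+y. (\<integral>\<^sup>+x. ennreal (\<bar>f x\<bar> * (K (x - y) * norm (\<phi> y))) \<partial>lborel) \<partial>lborel)"
    by (rule lborel_pair.Fubini') measurable
  also have "\<dots> = (\<integral>\<^sup>+y. (\<integral>\<^sup>+z. ennreal (\<bar>f (y + z)\<bar> * (K (y + z - y) * norm (\<phi> y))) \<partial>lborel) \<partial>lborel)"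
    by (intro nn_integral_cong nn_integral_lborel_translate[symmetric]) measurable
  also have "\<dots> = (\<integral>\<^sup>+y. (\<integral>\<^sup>+z. ennreal (K z) * ennreal (\<bar>f (z + y)\<bar> * norm (\<phi> y)) \<partial>lborel) \<partial>lborel)"
    using K0 by (intro nn_integral_cong) (simp add: ac_simps flip: ennreal_mult)
  also have "\<dots> = (\<integral>\<^sup>+z. (\<integral>\<^sup>+y. ennreal (K z) * ennreal (\<bar>f (z + y)\<bar> * norm (\<phi> y)) \<partial>lborel) \<partial>lborel)"
    by (rule lborel_pair.Fubini') measurable
  also have "\<dots> \<le> (\<integral>\<^sup>+z. ennreal (K z) * ennreal N \<partial>lborel)"
  proof (intro nn_integral_mono)
    fix z
    have "(\<integral>\<^sup>+y. ennreal (\<bar>f (z + y)\<bar> * norm (\<phi> y)) \<partial>lborel) \<le> ennreal N"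
      using f nn_integral_lborel_translate[of "\<lambda>y. ennreal (\<bar>f y\<bar> powr q)" z]
      by (intro dual_unit_pairing[OF \<phi> q N]) (auto simp: Lp_bound_def)
    then show "(\<integral>\<^sup>+y. ennreal (K z) * ennreal (\<bar>f (z + y)\<bar> * norm (\<phi> y)) \<partial>lborel) \<le> ennreal (K z) * ennreal N"
      by (simp add: nn_integral_cmult mult_left_mono)
  qed
  also have "\<dots> = (\<integral>\<^sup>+z. ennreal (K z) \<partial>lborel) * ennreal N" by (simp add: nn_integral_multc)
  finally show ?thesis .
qed

text \<open>Normalised sign fields on a ball: pairing with one of them measures the L^1 norm over
  that ball. The constant does not depend on the field, so one \<open>c\<close> works for a whole
  family.\<close>

lemma indicator_dual_unit:
  fixes v :: "'a::euclidean_space \<Rightarrow> 'b::euclidean_space"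
  assumes q: "q \<ge> 1" and R: "R > 0"
  obtains c where "c > 0"
    "\<And>v :: 'a \<Rightarrow> 'b. v \<in> borel_measurable borel \<Longrightarrow> dual_unit q (\<lambda>y. (c * indicator (cball 0 R) y) *\<^sub>R sgn (v y))"
proof -
  define m where "m = measure lborel (cball (0::'a) R)"
  have em: "emeasure lborel (cball (0::'a) R) = ennreal m"
    unfolding m_def using emeasure_bounded_finite[of "cball (0::'a) R"] by (intro emeasure_eq_ennreal_measure) auto
  have m: "m > 0" unfolding m_def using R content_cball_pos[of R 0] by simp
  define c where "c = (m powr (- (1 / q))) powr (q - 1)"
  have c: "c > 0" using m by (simp add: c_def)
  show thesis
  proof (rule that[OF c])
    fix v :: "'a \<Rightarrow> 'b" assume [measurable]: "v \<in> borel_measurable borel"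
    let ?\<phi> = "\<lambda>y. (c * indicator (cball 0 R) y) *\<^sub>R sgn (v y)"
    define G where "G y = m powr (- (1 / q)) * indicator (cball (0::'a) R) y" for y
    have [measurable]: "cball (0::'a) R \<in> sets borel" by simp
    have Gm: "G \<in> borel_measurable borel" unfolding G_def by measurable
    have \<phi>m: "?\<phi> \<in> borel_measurable borel" unfolding sgn_div_norm by measurable
    have nv: "norm (sgn (v y)) \<le> 1" for y by (simp add: norm_sgn)
    have 1: "norm (?\<phi> y) \<le> c" for y
      using c nv[of y] by (auto simp: indicator_def intro!: mult_left_le)
    have 2: "norm (?\<phi> y) \<le> G y powr (q - 1)" for y
      using c nv[of y] by (auto simp: indicator_def G_def c_def[symmetric] intro!: mult_left_le)
    have 3: "(\<integral>\<^sup>+y. ennreal (G y powr q) \<partial>lborel) \<le> 1"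
    proof -
      have "(m powr (- (1 / q))) powr q = 1 / m" unfolding powr_powr using m q by (simp add: powr_minus_divide)
      then have "(\<integral>\<^sup>+y. ennreal (G y powr q) \<partial>lborel) = (\<integral>\<^sup>+y. ennreal (1 / m) * indicator (cball (0::'a) R) y \<partial>lborel)"
        by (intro nn_integral_cong) (simp add: G_def indicator_def)
      also have "\<dots> = ennreal (1 / m) * ennreal m" by (simp add: nn_integral_cmult_indicator em)
      also have "\<dots> = 1" using m by (simp flip: ennreal_mult)
      finally show ?thesis by simp
    qed
    show "dual_unit q ?\<phi>"
      unfolding dual_unit_def
    proof (intro conjI)
      show "\<exists>B. \<forall>x. norm (?\<phi> x) \<le> B" using 1 by blast
      show "\<exists>R'. \<forall>x. R' < norm x \<longrightarrow> ?\<phi> x = 0" by (rule exI[of _ R]) simp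
      show "\<exists>G\<in>borel_measurable borel. (\<forall>x. 0 \<le> G x \<and> norm (?\<phi> x) \<le> G x powr (q - 1)) \<and> (\<integral>\<^sup>+x. ennreal (G x powr q) \<partial>lborel) \<le> 1"
        using Gm 2 3 by (intro bexI[of _ G]) (auto simp: G_def)
    qed (rule \<phi>m)
  qed
qed

section \<open>Existence of the fractional gradient\<close>

lemma bdd_int_translate:
  fixes w :: "'a::euclidean_space \<Rightarrow> 'b::euclidean_space"
  assumes "bdd_int w" shows "bdd_int (\<lambda>x. w (x - y))"
proof -
  obtain C where C: "\<And>x. norm (w x) \<le> C" using bdd_int_bound[OF assms] by metis
  have "integrable lborel (\<lambda>x. w (x - y))"
    using integrable_lborel_translate[OF bdd_intD(1)[OF assms], of "- y"] by simp
  then show ?thesis using C unfolding bdd_int_def by blast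
qed

text \<open>The adjoint of \<open>frac_grad_conv\<close>, with the sign of the weak gradient. For b
  = (1 - \<alpha>)/2 it is, up to a constant, the gradient of order \<alpha> of \<open>f\<close>
  smoothed at time \<open>s\<close>.\<close>

definition heat_transform :: "real \<Rightarrow> ('a::euclidean_space \<Rightarrow> real) \<Rightarrow> real \<Rightarrow> 'a \<Rightarrow> 'a" where
  "heat_transform b f s y = - (\<integral>x. f x *\<^sub>R frac_heat_grad b s (x - y) \<partial>lborel)"

lemma measurable_heat_transform [measurable (raw)]:
  fixes h :: "'b \<Rightarrow> 'a::euclidean_space"
  assumes [measurable]: "f \<in> borel_measurable borel" "g \<in> borel_measurable N" "h \<in> borel_measurable N"
  shows "(\<lambda>x. heat_transform b f (g x) (h x)) \<in> borel_measurable N"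
  unfolding heat_transform_def by measurable

lemma integrable_heat_transform:
  fixes f :: "'a::euclidean_space \<Rightarrow> real"
  assumes q: "q \<ge> 1" and f: "Lp_bound q f N" and b: "0 \<le> b" "b < 1/2" and s: "s > 0"
  shows "integrable lborel (\<lambda>x. f x *\<^sub>R frac_heat_grad b s (x - y))"
proof (rule Bochner_Integration.integrable_bound)
  have [measurable]: "f \<in> borel_measurable borel" using f by (simp add: Lp_bound_def)
  show "integrable lborel (\<lambda>x. f x * frac_heat_dom b s (x - y))"
    by (rule integrable_Lp_mult[OF q f bdd_int_translate[OF bdd_int_frac_heat_dom[OF b s]]])
  have "norm (f x *\<^sub>R frac_heat_grad b s (x - y)) \<le> norm (f x * frac_heat_dom b s (x - y))" for x
    unfolding norm_scaleR real_norm_def abs_mult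
    by (intro mult_left_mono order_trans[OF norm_frac_heat_grad_le[OF b s] abs_ge_self]) simp
  then show "AE x in lborel. norm (f x *\<^sub>R frac_heat_grad b s (x - y)) \<le> norm (f x * frac_heat_dom b s (x - y))" by (intro AE_I2)
  show "(\<lambda>x. f x *\<^sub>R frac_heat_grad b s (x - y)) \<in> borel_measurable lborel" by measurable
qed

lemma heat_transform_pairing:
  fixes f :: "'a::euclidean_space \<Rightarrow> real"
  assumes q: "q \<ge> 1" and f: "Lp_bound q f N" and b: "0 \<le> b" "b < 1/2" and s: "s > 0" and \<phi>: "bdd_int \<phi>"
  shows "(\<integral>y. heat_transform b f s y \<bullet> \<phi> y \<partial>lborel) = - (\<integral>x. f x * frac_grad_conv b s \<phi> x \<partial>lborel)"
proof -
  have fm[measurable]: "f \<in> borel_measurable borel" using f by (simp add: Lp_bound_def)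
  note [measurable] = bdd_intD(2)[OF \<phi>]
  note i = integrable_heat_transform[OF q f b s]
  have hm: "(\<lambda>(x, y). frac_heat_grad b s (x - y) \<bullet> \<phi> y) \<in> borel_measurable (borel \<Otimes>\<^sub>M borel)" by measurable
  have int: "integrable (lborel \<Otimes>\<^sub>M lborel) (\<lambda>(x, y). f x *\<^sub>R (frac_heat_grad b s (x - y) \<bullet> \<phi> y))"
    by (rule integrable_Lp_conv[OF q f bdd_intD(1)[OF bdd_int_frac_heat_dom[OF b s]] bdd_int_norm[OF \<phi>] hm frac_grad_conv_dominated[OF b s \<phi>]])
  have "(\<integral>x. f x * frac_grad_conv b s \<phi> x \<partial>lborel) = (\<integral>x. (\<integral>y. f x *\<^sub>R (frac_heat_grad b s (x - y) \<bullet> \<phi> y) \<partial>lborel) \<partial>lborel)"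
    unfolding frac_grad_conv_def by simp
  also have "\<dots> = (\<integral>y. (\<integral>x. f x *\<^sub>R (frac_heat_grad b s (x - y) \<bullet> \<phi> y) \<partial>lborel) \<partial>lborel)"
    using lborel_pair.Fubini_integral[OF int, symmetric] .
  also have "\<dots> = (\<integral>y. - (heat_transform b f s y \<bullet> \<phi> y) \<partial>lborel)"
  proof (rule Bochner_Integration.integral_cong[OF refl])
    fix y
    have "(\<integral>x. f x *\<^sub>R (frac_heat_grad b s (x - y) \<bullet> \<phi> y) \<partial>lborel) = (\<integral>x. (f x *\<^sub>R frac_heat_grad b s (x - y)) \<bullet> \<phi> y \<partial>lborel)" by simp
    also have "\<dots> = (\<integral>x. f x *\<^sub>R frac_heat_grad b s (x - y) \<partial>lborel) \<bullet> \<phi> y" by (rule integral_inner_left[OF i])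
    finally show "(\<integral>x. f x *\<^sub>R (frac_heat_grad b s (x - y) \<bullet> \<phi> y) \<partial>lborel) = - (heat_transform b f s y \<bullet> \<phi> y)"
      by (simp add: heat_transform_def)
  qed
  finally show ?thesis by simp
qed

text \<open>The estimate for large smoothing times: it combines the L^q norm of \<open>f\<close>
  with the L^1 norm of the kernel, through \<open>young_dual\<close>.\<close>

lemma frac_grad_pairing_L1:
  assumes q: "q \<ge> 1" and b: "0 \<le> b" "b < 1/2"
  obtains C where "C \<ge> 0" "\<And>(f :: 'a::euclidean_space \<Rightarrow> real) N s \<phi>. Lp_bound q f N \<Longrightarrow> s > 0 \<Longrightarrow> dual_unit q \<phi> \<Longrightarrow>
      \<bar>\<integral>x. f x * frac_grad_conv b s \<phi> x \<partial>lborel\<bar> \<le> C * N * s powr (b - 1/2)"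
proof -
  obtain C where C: "C \<ge> 0" "\<And>s. s > 0 \<Longrightarrow> (\<integral>\<^sup>+x. ennreal (frac_heat_dom b s x) \<partial>(lborel :: 'a measure)) \<le> ennreal (C * s powr (b - 1/2))"
    using frac_heat_dom_L1[OF b, where 'a='a] by metis
  show thesis
  proof (rule that[OF C(1)])
    fix f :: "'a \<Rightarrow> real" and N s :: real and \<phi> :: "'a \<Rightarrow> 'a"
    assume f: "Lp_bound q f N" and s: "s > 0" and \<phi>: "dual_unit q \<phi>"
    have [measurable]: "f \<in> borel_measurable borel" and N: "N \<ge> 0" using f by (auto simp: Lp_bound_def)
    note \<phi>b = dual_unit_bdd_int[OF \<phi>]
    note [measurable] = bdd_intD(2)[OF \<phi>b]
    have "ennreal \<bar>\<integral>x. f x * frac_grad_conv b s \<phi> x \<partial>lborel\<bar> \<le> (\<integral>\<^sup>+x. ennreal (norm (f x * frac_grad_conv b s \<phi> x)) \<partial>lborel)"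
      using integral_norm_bound_ennreal[OF integrable_Lp_mult[OF q f bdd_int_frac_grad_conv[OF b s \<phi>b]]] by simp
    also have "\<dots> \<le> (\<integral>\<^sup>+x. (\<integral>\<^sup>+y. ennreal (\<bar>f x\<bar> * (frac_heat_dom b s (x - y) * norm (\<phi> y))) \<partial>lborel) \<partial>lborel)"
    proof (intro nn_integral_mono)
      fix x
      have "ennreal \<bar>frac_grad_conv b s \<phi> x\<bar> \<le> (\<integral>\<^sup>+y. ennreal (norm (frac_heat_grad b s (x - y) \<bullet> \<phi> y)) \<partial>lborel)"
        unfolding frac_grad_conv_def using integral_norm_bound_ennreal[OF integrable_frac_grad_conv[OF b s \<phi>b, of x]] by simp
      also have "\<dots> \<le> (\<integral>\<^sup>+y. ennreal (frac_heat_dom b s (x - y) * norm (\<phi> y)) \<partial>lborel)"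
        by (intro nn_integral_mono ennreal_leI frac_grad_conv_dominated[OF b s \<phi>b])
      finally have "ennreal \<bar>f x\<bar> * ennreal \<bar>frac_grad_conv b s \<phi> x\<bar> \<le> ennreal \<bar>f x\<bar> * (\<integral>\<^sup>+y. ennreal (frac_heat_dom b s (x - y) * norm (\<phi> y)) \<partial>lborel)"
        by (rule mult_left_mono) simp
      also have "\<dots> = (\<integral>\<^sup>+y. ennreal \<bar>f x\<bar> * ennreal (frac_heat_dom b s (x - y) * norm (\<phi> y)) \<partial>lborel)"
        by (rule nn_integral_cmult[symmetric]) measurable
      also have "\<dots> = (\<integral>\<^sup>+y. ennreal (\<bar>f x\<bar> * (frac_heat_dom b s (x - y) * norm (\<phi> y))) \<partial>lborel)"
        by (intro nn_integral_cong ennreal_mult[symmetric] mult_nonneg_nonneg frac_heat_dom_nonneg[OF b s]) auto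
      finally show "ennreal (norm (f x * frac_grad_conv b s \<phi> x)) \<le> (\<integral>\<^sup>+y. ennreal (\<bar>f x\<bar> * (frac_heat_dom b s (x - y) * norm (\<phi> y))) \<partial>lborel)"
        by (simp add: abs_mult ennreal_mult)
    qed
    also have "\<dots> \<le> (\<integral>\<^sup>+z. ennreal (frac_heat_dom b s z) \<partial>(lborel :: 'a measure)) * ennreal N"
      by (rule young_dual[OF q f \<phi> frac_heat_dom_nonneg[OF b s]]) measurable
    also have "\<dots> \<le> ennreal (C * s powr (b - 1/2)) * ennreal N" by (rule mult_right_mono[OF C(2)[OF s]]) simp
    also have "\<dots> = ennreal (C * N * s powr (b - 1/2))" using C(1) N by (simp add: mult_ac flip: ennreal_mult)
    finally show "\<bar>\<integral>x. f x * frac_grad_conv b s \<phi> x \<partial>lborel\<bar> \<le> C * N * s powr (b - 1/2)"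
      using C(1) N by (subst (asm) ennreal_le_iff) auto
  qed
qed

text \<open>The envelope \<open>B\<close> is the same for all dual fields, which makes it an
  integrable bound for the whole family. Below \<open>s = 1\<close> it comes from the variation,
  from there on from the norm of \<open>f\<close>.\<close>

lemma frac_grad_pairing_bound:
  assumes ab: "0 < \<beta>" "\<beta> < \<alpha>" "\<alpha> \<le> 1" and q: "q \<ge> 1"
    and sub: "real DIM('a::euclidean_space) * (1 - 1/q) < \<alpha> - \<beta>"
  obtains C where "C \<ge> 0" "\<And>(f :: 'a \<Rightarrow> real) N V. Lp_bound q f N \<Longrightarrow> var_bound \<alpha> f V \<Longrightarrow>
      \<exists>B. B \<in> borel_measurable borel \<and> (\<forall>s. 0 \<le> B s) \<and>
        (\<integral>\<^sup>+s. ennreal (B s) \<partial>rl ((\<alpha> - \<beta>) / 2)) \<le> ennreal (C * (N + V)) \<and>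
        (\<forall>s>0. \<forall>\<phi>. dual_unit q \<phi> \<longrightarrow> \<bar>\<integral>x. f x * frac_grad_conv ((1 - \<alpha>) / 2) s \<phi> x \<partial>lborel\<bar> \<le> B s)"
proof -
  define a where "a = (\<alpha> - \<beta>) / 2"
  define b where "b = (1 - \<alpha>) / 2"
  \<comment> \<open>Near 0 the pairing has order \<open>s powr (- \<kappa>)\<close>; the hypothesis
    \<open>sub\<close> says precisely \<open>\<kappa> < a\<close>.\<close>
  define \<kappa> where "\<kappa> = real DIM('a) * (1 - 1/q) / 2"
  have a: "a > 0" "0 < a + - \<kappa>" and b: "0 \<le> b" "b < 1/2" using ab sub by (auto simp: a_def b_def \<kappa>_def)
  obtain C1 where C1: "C1 \<ge> 0"
    "\<And>(f :: 'a \<Rightarrow> real) p N V s \<phi> S. p \<ge> 1 \<Longrightarrow> Lp_bound p f N \<Longrightarrow> var_bound \<alpha> f V \<Longrightarrow> s > 0 \<Longrightarrow>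
      bdd_int \<phi> \<Longrightarrow> S > 0 \<Longrightarrow> (\<And>x. (\<integral>\<^sup>+y. ennreal (heat s (x - y) * norm (\<phi> y)) \<partial>lborel) \<le> ennreal S) \<Longrightarrow>
      \<bar>\<integral>x. f x * frac_grad_conv b s \<phi> x \<partial>lborel\<bar> \<le> C1 * V * S"
    using ab unfolding b_def by (rule_tac var_bound_heat_pairing[where 'a='a and \<alpha>=\<alpha>]) auto
  obtain C2 where C2: "C2 > 0" "\<And>s \<phi> (x::'a). s > 0 \<Longrightarrow> dual_unit q (\<phi> :: 'a \<Rightarrow> 'a) \<Longrightarrow>
    (\<integral>\<^sup>+y. ennreal (heat s (x - y) * norm (\<phi> y)) \<partial>lborel) \<le> ennreal (C2 * s powr (- \<kappa>))"
    unfolding \<kappa>_def by (rule heat_dual_bound[OF q, where 'a='a and 'b='a]) blast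
  obtain C3 where C3: "C3 \<ge> 0" "\<And>(f :: 'a \<Rightarrow> real) N s \<phi>. Lp_bound q f N \<Longrightarrow> s > 0 \<Longrightarrow> dual_unit q \<phi> \<Longrightarrow>
      \<bar>\<integral>x. f x * frac_grad_conv b s \<phi> x \<partial>lborel\<bar> \<le> C3 * N * s powr (b - 1/2)"
    by (rule frac_grad_pairing_L1[OF q b, where 'a='a]) blast
  define C where "C = C1 * C2 / (a - \<kappa>) + C3 / (\<beta> / 2)"
  have k1: "0 \<le> C1 * C2 / (a - \<kappa>)" and k2: "0 \<le> C3 / (\<beta> / 2)"
    using C1(1) C2(1) C3(1) a ab(1) by auto
  have C: "C \<ge> 0" unfolding C_def using k1 k2 by simp
  show thesis
  proof (rule that[OF C])
    fix f :: "'a \<Rightarrow> real" and N V assume f: "Lp_bound q f N" and V: "var_bound \<alpha> f V"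
    have N0: "N \<ge> 0" and V0: "V \<ge> 0" using f V by (auto simp: Lp_bound_def var_bound_def)
    define B where "B s = (if s < 1 then C1 * V * C2 * s powr (- \<kappa>) else C3 * N * s powr (b - 1/2))" for s :: real
    have Bm: "B \<in> borel_measurable borel" unfolding B_def by measurable
    have B0: "0 \<le> B s" for s using C1 C2 C3 N0 V0 by (simp add: B_def)
    have "(\<integral>\<^sup>+s. ennreal (B s) \<partial>rl a) \<le> ennreal (C1 * V * C2 * (1 powr (a + - \<kappa>) / (a + - \<kappa>)) + C3 * N * (1 powr (- (\<beta> / 2)) / (\<beta> / 2)))"
    proof (rule nn_integral_rl_split)
      \<comment> \<open>At infinity the decay beats the weight by \<beta>/2, so convergence there
        rests on \<beta> > 0.\<close>
      have "b - 1/2 = - a - \<beta> / 2" by (simp add: a_def b_def field_simps)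
      then show "1 \<le> s \<Longrightarrow> ennreal (B s) \<le> ennreal (C3 * N * s powr (- a - \<beta> / 2))" for s by (simp add: B_def)
      show "0 < s \<Longrightarrow> s < 1 \<Longrightarrow> ennreal (B s) \<le> ennreal (C1 * V * C2 * s powr (- \<kappa>))" for s by (simp add: B_def)
    qed (use a ab C1(1) C2(1) C3(1) N0 V0 Bm in auto)
    also have "\<dots> = ennreal (C1 * C2 / (a - \<kappa>) * V + C3 / (\<beta> / 2) * N)" by (simp add: mult_ac)
    also have "\<dots> \<le> ennreal (C * (N + V))"
    proof (rule ennreal_leI)
      have "0 \<le> C1 * C2 / (a - \<kappa>) * N" "0 \<le> C3 / (\<beta> / 2) * V" using mult_nonneg_nonneg[OF k1 N0] mult_nonneg_nonneg[OF k2 V0] by blast+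
      then show "C1 * C2 / (a - \<kappa>) * V + C3 / (\<beta> / 2) * N \<le> C * (N + V)" unfolding C_def distrib_left distrib_right by linarith
    qed
    finally have BI: "(\<integral>\<^sup>+s. ennreal (B s) \<partial>rl a) \<le> ennreal (C * (N + V))" .
    have "\<bar>\<integral>x. f x * frac_grad_conv b s \<phi> x \<partial>lborel\<bar> \<le> B s" if s: "s > 0" and \<phi>: "dual_unit q \<phi>" for s \<phi>
    proof (cases "s < 1")
      case True
      have "\<bar>\<integral>x. f x * frac_grad_conv b s \<phi> x \<partial>lborel\<bar> \<le> C1 * V * (C2 * s powr (- \<kappa>))"
        using C2 s by (intro C1(2)[OF q f V s dual_unit_bdd_int[OF \<phi>]] C2(2)[OF s \<phi>]) auto
      then show ?thesis using True by (simp add: B_def mult_ac)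
    next
      case False
      then show ?thesis using C3(2)[OF f s \<phi>] by (simp add: B_def)
    qed
    then show "\<exists>B. B \<in> borel_measurable borel \<and> (\<forall>s. 0 \<le> B s) \<and>
        (\<integral>\<^sup>+s. ennreal (B s) \<partial>rl ((\<alpha> - \<beta>) / 2)) \<le> ennreal (C * (N + V)) \<and>
        (\<forall>s>0. \<forall>\<phi>. dual_unit q \<phi> \<longrightarrow> \<bar>\<integral>x. f x * frac_grad_conv ((1 - \<alpha>) / 2) s \<phi> x \<partial>lborel\<bar> \<le> B s)"
      using Bm B0 BI unfolding a_def b_def by blast
  qed
qed

text \<open>The bounds \<open>B s\<close> concern signed pairings, whereas Fubini needs absolute
  integrals. For each \<open>s\<close> the pairing is tested with the normalised sign of the
  transform on a ball, which bounds its L^1 norm there by \<open>B s / c\<close>. This is integrable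
  in \<open>s\<close>, and \<phi> is supported in such a ball.\<close>

lemma heat_transform_fubini:
  fixes f :: "'a::euclidean_space \<Rightarrow> real"
  assumes q: "q \<ge> 1" and f: "Lp_bound q f N" and a: "a > 0" and b: "0 \<le> b" "b < 1/2"
    and Bm: "B \<in> borel_measurable borel" and BI: "(\<integral>\<^sup>+s. ennreal (B s) \<partial>rl a) < \<infinity>"
    and B: "\<And>s \<phi>. s > 0 \<Longrightarrow> dual_unit q \<phi> \<Longrightarrow> \<bar>\<integral>x. f x * frac_grad_conv b s \<phi> x \<partial>lborel\<bar> \<le> B s"
    and \<phi>m: "\<phi> \<in> borel_measurable borel" and \<phi>B: "\<And>x. norm (\<phi> x) \<le> M" and \<phi>R: "\<And>x. R < norm x \<Longrightarrow> \<phi> x = 0"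
  shows "(\<integral>y. (\<integral>s. heat_transform b f s y \<partial>rl a) \<bullet> \<phi> y \<partial>lborel) = (\<integral>s. (\<integral>y. heat_transform b f s y \<bullet> \<phi> y \<partial>lborel) \<partial>rl a)"
proof -
  let ?T = "heat_transform b f"
  have [measurable]: "f \<in> borel_measurable borel" using f by (simp add: Lp_bound_def)
  note [measurable] = \<phi>m Bm
  have ball: "integrable (lborel \<Otimes>\<^sub>M rl a) (\<lambda>(y, s). indicator (cball 0 r) y *\<^sub>R ?T s y)" if r: "r > 0" for r
  proof (rule integrableI_bounded)
    have [measurable]: "cball (0::'a) r \<in> sets borel" by simp
    obtain c where c: "c > 0" "\<And>v :: 'a \<Rightarrow> 'a. v \<in> borel_measurable borel \<Longrightarrow> dual_unit q (\<lambda>y. (c * indicator (cball 0 r) y) *\<^sub>R sgn (v y))"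
      using indicator_dual_unit[OF q r, where 'a='a and 'b='a] by metis
    show "(\<lambda>(y, s). indicator (cball 0 r) y *\<^sub>R ?T s y) \<in> borel_measurable (lborel \<Otimes>\<^sub>M rl a)" by measurable
    have "(\<integral>\<^sup>+p. ennreal (norm (case p of (y, s) \<Rightarrow> indicator (cball 0 r) y *\<^sub>R ?T s y)) \<partial>(lborel \<Otimes>\<^sub>M rl a)) = (\<integral>\<^sup>+y. (\<integral>\<^sup>+s. ennreal (norm (indicator (cball 0 r) y *\<^sub>R ?T s y)) \<partial>rl a) \<partial>lborel)"
      by (subst rl.nn_integral_fst[symmetric]) (auto simp: split_beta')
    also have "\<dots> = (\<integral>\<^sup>+s. (\<integral>\<^sup>+y. ennreal (norm (indicator (cball 0 r) y *\<^sub>R ?T s y)) \<partial>lborel) \<partial>rl a)"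
      by (rule rl_lborel.Fubini') measurable
    also have "\<dots> \<le> (\<integral>\<^sup>+s. ennreal (1 / c) * ennreal (B s) \<partial>rl a)"
    proof (rule nn_integral_mono_AE, use AE_rl_pos[OF a] in eventually_elim)
      fix s :: real assume s: "s > 0"
      \<comment> \<open>The test field may depend on \<open>s\<close>; the constant \<open>c\<close>
        does not.\<close>
      define \<psi> where "\<psi> y = (c * indicator (cball 0 r) y) *\<^sub>R sgn (?T s y)" for y
      have \<psi>: "dual_unit q \<psi>" unfolding \<psi>_def by (rule c(2)) measurable
      have eq: "?T s y \<bullet> \<psi> y = c * norm (indicator (cball 0 r) y *\<^sub>R ?T s y)" for y
        by (cases "?T s y = 0") (auto simp: \<psi>_def sgn_div_norm dot_square_norm power2_eq_square)
      have Tp: "(\<integral>y. ?T s y \<bullet> \<psi> y \<partial>lborel) \<le> B s"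
        unfolding heat_transform_pairing[OF q f b s dual_unit_bdd_int[OF \<psi>]] using B[OF s \<psi>] by linarith
      \<comment> \<open>Integrability is established on its own, because the pairing may be read as
        an absolute integral only for an integrable integrand.\<close>
      have "integrable lborel (\<lambda>y. ?T s y \<bullet> \<psi> y)"
      proof -
        note \<psi>b = dual_unit_bdd_int[OF \<psi>]
        note [measurable] = bdd_intD(2)[OF \<psi>b]
        have hm: "(\<lambda>(x, y). frac_heat_grad b s (x - y) \<bullet> \<psi> y) \<in> borel_measurable (borel \<Otimes>\<^sub>M borel)" by measurable
        have "integrable (lborel \<Otimes>\<^sub>M lborel) (\<lambda>(x, y). f x *\<^sub>R (frac_heat_grad b s (x - y) \<bullet> \<psi> y))"
          by (rule integrable_Lp_conv[OF q f bdd_intD(1)[OF bdd_int_frac_heat_dom[OF b s]] bdd_int_norm[OF \<psi>b] hm frac_grad_conv_dominated[OF b s \<psi>b]])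
        from lborel_pair.integrable_snd[OF this]
        have i: "integrable lborel (\<lambda>y. \<integral>x. (f x *\<^sub>R frac_heat_grad b s (x - y)) \<bullet> \<psi> y \<partial>lborel)" by simp
        note i2 = integrable_heat_transform[OF q f b s]
        have "(\<integral>x. (f x *\<^sub>R frac_heat_grad b s (x - y)) \<bullet> \<psi> y \<partial>lborel) = - (?T s y \<bullet> \<psi> y)" for y
          unfolding heat_transform_def integral_inner_left[OF i2] by simp
        then show ?thesis using i by simp
      qed
      then have "(\<integral>\<^sup>+y. ennreal (c * norm (indicator (cball 0 r) y *\<^sub>R ?T s y)) \<partial>lborel) = ennreal (\<integral>y. ?T s y \<bullet> \<psi> y \<partial>lborel)"
        unfolding eq using c(1) by (intro nn_integral_eq_integral) auto
      also have "\<dots> \<le> ennreal (B s)" using Tp by (rule ennreal_leI)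
      finally have le: "ennreal (1 / c) * (\<integral>\<^sup>+y. ennreal (c * norm (indicator (cball 0 r) y *\<^sub>R ?T s y)) \<partial>lborel) \<le> ennreal (1 / c) * ennreal (B s)"
        by (rule mult_left_mono) simp
      have "ennreal (1 / c) * (\<integral>\<^sup>+y. ennreal (c * norm (indicator (cball 0 r) y *\<^sub>R ?T s y)) \<partial>lborel) = (\<integral>\<^sup>+y. ennreal (1 / c) * ennreal (c * norm (indicator (cball 0 r) y *\<^sub>R ?T s y)) \<partial>lborel)"
        by (rule nn_integral_cmult[symmetric]) measurable
      also have "\<dots> = (\<integral>\<^sup>+y. ennreal (norm (indicator (cball 0 r) y *\<^sub>R ?T s y)) \<partial>lborel)"
        using c(1) by (intro nn_integral_cong) (simp flip: ennreal_mult)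
      finally show "(\<integral>\<^sup>+y. ennreal (norm (indicator (cball 0 r) y *\<^sub>R ?T s y)) \<partial>lborel) \<le> ennreal (1 / c) * ennreal (B s)"
        using le by simp
    qed
    also have "\<dots> = ennreal (1 / c) * (\<integral>\<^sup>+s. ennreal (B s) \<partial>rl a)" by (rule nn_integral_cmult) measurable
    also have "\<dots> < \<infinity>" using BI by (simp add: ennreal_mult_less_top)
    finally show "(\<integral>\<^sup>+p. ennreal (norm (case p of (y, s) \<Rightarrow> indicator (cball 0 r) y *\<^sub>R ?T s y)) \<partial>(lborel \<Otimes>\<^sub>M rl a)) < \<infinity>" .
  qed
  define r where "r = max 1 R"
  have r: "r > 0" "R \<le> r" by (auto simp: r_def)
  note br = ball[OF r(1)]
  have int: "integrable (lborel \<Otimes>\<^sub>M rl a) (\<lambda>(y, s). ?T s y \<bullet> \<phi> y)"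
  proof -
    have "integrable (lborel \<Otimes>\<^sub>M rl a) (\<lambda>p. M * norm (case p of (y, s) \<Rightarrow> indicator (cball 0 r) y *\<^sub>R ?T s y))"
      by (intro integrable_mult_right integrable_norm br)
    then show ?thesis
    proof (rule Bochner_Integration.integrable_bound)
      have "norm (?T s y \<bullet> \<phi> y) \<le> norm (M * norm (indicator (cball 0 r) y *\<^sub>R ?T s y))" for y s
      proof (cases "R < norm y")
        case False
        then have "y \<in> cball 0 r" using r by simp
        moreover have "\<bar>?T s y \<bullet> \<phi> y\<bar> \<le> norm (?T s y) * M"
          by (rule order_trans[OF Cauchy_Schwarz_ineq2 mult_left_mono[OF \<phi>B norm_ge_zero]])
        ultimately show ?thesis using order_trans[OF _ abs_ge_self, of _ "M * norm (?T s y)"] by (simp add: mult.commute)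
      qed (simp add: \<phi>R)
      then show "AE p in lborel \<Otimes>\<^sub>M rl a. norm (case p of (y, s) \<Rightarrow> ?T s y \<bullet> \<phi> y) \<le> norm (M * norm (case p of (y, s) \<Rightarrow> indicator (cball 0 r) y *\<^sub>R ?T s y))"
        by (intro AE_I2) (simp only: split_beta')
    qed measurable
  qed
  \<comment> \<open>The pointwise integral over \<open>s\<close> exists for almost every
    \<open>y\<close> in the ball, and outside of it \<phi> vanishes.\<close>
  have ae: "AE y in lborel. integrable (rl a) (\<lambda>s. indicator (cball 0 r) y *\<^sub>R ?T s y)"
    using lborel_rl.AE_integrable_fst[OF br] by simp
  have "(\<integral>y. (\<integral>s. ?T s y \<partial>rl a) \<bullet> \<phi> y \<partial>lborel) = (\<integral>y. (\<integral>s. ?T s y \<bullet> \<phi> y \<partial>rl a) \<partial>lborel)"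
  proof (rule integral_cong_AE, measurable, use ae in eventually_elim)
    fix y assume i: "integrable (rl a) (\<lambda>s. indicator (cball 0 r) y *\<^sub>R ?T s y)"
    show "(\<integral>s. ?T s y \<partial>rl a) \<bullet> \<phi> y = (\<integral>s. ?T s y \<bullet> \<phi> y \<partial>rl a)"
    proof (cases "R < norm y")
      case False
      then have "y \<in> cball 0 r" using r by simp
      then have "integrable (rl a) (\<lambda>s. ?T s y)" using i by simp
      then show ?thesis by (intro integral_inner_left[symmetric])
    qed (simp add: \<phi>R)
  qed
  also have "\<dots> = (\<integral>s. (\<integral>y. ?T s y \<bullet> \<phi> y \<partial>lborel) \<partial>rl a)"
    using lborel_rl.Fubini_integral[OF int, symmetric] .
  finally show ?thesis .
qed

text \<open>The gradient is the pointwise superposition of \<open>heat_transform\<close> over the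
  smoothing time, so no weak limit is extracted. \<open>converse_holder\<close> places it in L^q,
  since every dual field pairs with it by at most a multiple of the integral of the
  envelope.\<close>

lemma frac_gradient_exists:
  assumes ab: "0 < \<beta>" "\<beta> < \<alpha>" "\<alpha> \<le> 1" and q: "q \<ge> 1"
    and sub: "real DIM('a::euclidean_space) * (1 - 1/q) < \<alpha> - \<beta>"
  obtains C where "C \<ge> 0" "\<And>(f :: 'a \<Rightarrow> real) N V. Lp_bound q f N \<Longrightarrow> var_bound \<alpha> f V \<Longrightarrow>
      \<exists>g. Lp_bound q g (C * (N + V)) \<and>
        (\<forall>\<phi>\<in>test_fields. frac_div \<beta> \<phi> \<in> borel_measurable borel \<and> (\<integral>x. f x * frac_div \<beta> \<phi> x \<partial>lborel) = - (\<integral>x. g x \<bullet> \<phi> x \<partial>lborel))"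
proof -
  define a where "a = (\<alpha> - \<beta>) / 2"
  define b where "b = (1 - \<alpha>) / 2"
  have a: "a > 0" and b: "0 \<le> b" "b < 1/2" using ab by (auto simp: a_def b_def)
  have \<beta>: "0 < \<beta>" "\<beta> < 1" using ab by auto
  obtain C D where C: "C > 0" and D: "D > 0" and rep:
    "\<And>(\<Phi> :: 'a \<Rightarrow> 'a) w x. bdd_int \<Phi> \<Longrightarrow> modulus_dom \<Phi> w \<Longrightarrow>
       frac_div \<beta> \<Phi> x = C * (\<integral>s. frac_grad_conv b s \<Phi> x \<partial>rl a) \<and>
       (\<integral>\<^sup>+s. ennreal \<bar>frac_grad_conv b s \<Phi> x\<bar> \<partial>rl a) \<le> ennreal (D * frac_dom \<beta> w x)"
    unfolding a_def b_def by (rule frac_div_two_scale[OF ab, where 'a='a]) blast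
  obtain E where E: "E \<ge> 0" and EB: "\<And>(f :: 'a \<Rightarrow> real) N V. Lp_bound q f N \<Longrightarrow> var_bound \<alpha> f V \<Longrightarrow>
      \<exists>B. B \<in> borel_measurable borel \<and> (\<forall>s. 0 \<le> B s) \<and>
        (\<integral>\<^sup>+s. ennreal (B s) \<partial>rl a) \<le> ennreal (E * (N + V)) \<and>
        (\<forall>s>0. \<forall>\<phi>. dual_unit q \<phi> \<longrightarrow> \<bar>\<integral>x. f x * frac_grad_conv b s \<phi> x \<partial>lborel\<bar> \<le> B s)"
    unfolding a_def b_def by (rule frac_grad_pairing_bound[OF ab q sub]) blast
  show thesis
  proof (rule that[of "C * E"])
    show "C * E \<ge> 0" using C E by simp
    fix f :: "'a \<Rightarrow> real" and N V assume f: "Lp_bound q f N" and V: "var_bound \<alpha> f V"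
    have N0: "N \<ge> 0" and V0: "V \<ge> 0" and fm[measurable]: "f \<in> borel_measurable borel" using f V by (auto simp: Lp_bound_def var_bound_def)
    obtain B where Bm[measurable]: "B \<in> borel_measurable borel" and B0: "\<And>s. 0 \<le> B s"
      and BI: "(\<integral>\<^sup>+s. ennreal (B s) \<partial>rl a) \<le> ennreal (E * (N + V))"
      and B: "\<And>s \<phi>. s > 0 \<Longrightarrow> dual_unit q \<phi> \<Longrightarrow> \<bar>\<integral>x. f x * frac_grad_conv b s \<phi> x \<partial>lborel\<bar> \<le> B s"
      using EB[OF f V] by blast
    have BI': "(\<integral>\<^sup>+s. ennreal (B s) \<partial>rl a) < \<infinity>" using BI by (rule le_less_trans) simp
    have Bi: "integrable (rl a) B" using BI' B0 by (intro integrableI_bounded) auto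
    have BI2: "(\<integral>s. B s \<partial>rl a) \<le> E * (N + V)"
    proof -
      have "(\<integral>\<^sup>+s. ennreal (B s) \<partial>rl a) = ennreal (\<integral>s. B s \<partial>rl a)" using Bi B0 by (intro nn_integral_eq_integral) auto
      then show ?thesis using BI E N0 V0 by (simp add: ennreal_le_iff)
    qed
    let ?T = "heat_transform b f"
    define g where "g y = C *\<^sub>R (\<integral>s. ?T s y \<partial>rl a)" for y
    have gm: "g \<in> borel_measurable borel" unfolding g_def by measurable
    have fub: "(\<integral>y. g y \<bullet> \<phi> y \<partial>lborel) = C * (\<integral>s. (\<integral>y. ?T s y \<bullet> \<phi> y \<partial>lborel) \<partial>rl a)"
      if "\<phi> \<in> borel_measurable borel" "\<And>x. norm (\<phi> x) \<le> M" "\<And>x. R < norm x \<Longrightarrow> \<phi> x = 0" for \<phi> M R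
      unfolding g_def inner_scaleR_left using heat_transform_fubini[OF q f a b Bm BI' B that] by simp
    have "(\<integral>\<^sup>+x. ennreal (norm (g x) powr q) \<partial>lborel) \<le> ennreal ((C * E * (N + V)) powr q)"
    proof (rule converse_holder[OF q _ gm])
      fix \<phi> :: "'a \<Rightarrow> 'a" assume \<phi>: "dual_unit q \<phi>"
      obtain M R where \<phi>': "\<phi> \<in> borel_measurable borel" "\<And>x. norm (\<phi> x) \<le> M" "\<And>x. R < norm x \<Longrightarrow> \<phi> x = 0"
        using \<phi> unfolding dual_unit_def by blast
      note [measurable] = \<phi>'(1)
      have le: "AE s in rl a. \<bar>\<integral>y. ?T s y \<bullet> \<phi> y \<partial>lborel\<bar> \<le> B s"
        using AE_rl_pos[OF a] by eventually_elim (simp add: heat_transform_pairing[OF q f b _ dual_unit_bdd_int[OF \<phi>]] B[OF _ \<phi>])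
      have "(\<integral>s. (\<integral>y. ?T s y \<bullet> \<phi> y \<partial>lborel) \<partial>rl a) \<le> (\<integral>s. B s \<partial>rl a)"
      proof (rule integral_mono_AE[OF _ Bi])
        show "integrable (rl a) (\<lambda>s. \<integral>y. ?T s y \<bullet> \<phi> y \<partial>lborel)"
          by (rule Bochner_Integration.integrable_bound[OF Bi]) (measurable, use le B0 in \<open>auto elim!: eventually_mono\<close>)
        show "AE s in rl a. (\<integral>y. ?T s y \<bullet> \<phi> y \<partial>lborel) \<le> B s" using le by eventually_elim linarith
      qed
      then have "C * (\<integral>s. (\<integral>y. ?T s y \<bullet> \<phi> y \<partial>lborel) \<partial>rl a) \<le> C * (E * (N + V))"
        using BI2 C by (intro mult_left_mono) auto
      moreover have "(\<integral>x. g x \<bullet> \<phi> x \<partial>lborel) = C * (\<integral>s. (\<integral>y. ?T s y \<bullet> \<phi> y \<partial>lborel) \<partial>rl a)"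
        by (rule fub[OF \<phi>'])
      ultimately show "(\<integral>x. g x \<bullet> \<phi> x \<partial>lborel) \<le> C * E * (N + V)" by (simp only: mult.assoc)
    qed (use C E N0 V0 in auto)
    then have gL: "Lp_bound q g (C * E * (N + V))" unfolding Lp_bound_def using gm C E N0 V0 by simp
    have "frac_div \<beta> \<phi> \<in> borel_measurable borel \<and> (\<integral>x. f x * frac_div \<beta> \<phi> x \<partial>lborel) = - (\<integral>x. g x \<bullet> \<phi> x \<partial>lborel)" if \<phi>: "\<phi> \<in> test_fields" for \<phi>
    proof -
      obtain w where \<phi>b: "bdd_int \<phi>" and md: "modulus_dom \<phi> w" using test_field_modulus_dom[OF \<phi>] by metis
      have w: "bdd_int w" "\<And>x. 0 \<le> w x" using md by (auto simp: modulus_dom_def)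
      note [measurable] = bdd_intD(2)[OF \<phi>b] bdd_intD(2)[OF bdd_int_frac_dom[OF \<beta> w]]
      have fd: "frac_div \<beta> \<phi> x = C * (\<integral>s. frac_grad_conv b s \<phi> x \<partial>rl a)"
        and nn: "(\<integral>\<^sup>+s. ennreal \<bar>frac_grad_conv b s \<phi> x\<bar> \<partial>rl a) \<le> ennreal (D * frac_dom \<beta> w x)" for x
        using rep[OF \<phi>b md, of x] by auto
      have fdm: "frac_div \<beta> \<phi> \<in> borel_measurable borel" unfolding fd[abs_def] by measurable
      \<comment> \<open>Absolute integrability for a fixed test field comes from the majorant
        \<open>frac_dom\<close>, which lies in L^1 and L^\<infinity> and therefore pairs with
        \<open>f\<close>.\<close>
      have int: "integrable (lborel \<Otimes>\<^sub>M rl a) (\<lambda>(x, s). f x * frac_grad_conv b s \<phi> x)"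
      proof (rule integrableI_bounded)
        show "(\<lambda>(x, s). f x * frac_grad_conv b s \<phi> x) \<in> borel_measurable (lborel \<Otimes>\<^sub>M rl a)" by measurable
        have "(\<integral>\<^sup>+p. ennreal (norm (case p of (x, s) \<Rightarrow> f x * frac_grad_conv b s \<phi> x)) \<partial>(lborel \<Otimes>\<^sub>M rl a)) = (\<integral>\<^sup>+x. (\<integral>\<^sup>+s. ennreal (norm (f x * frac_grad_conv b s \<phi> x)) \<partial>rl a) \<partial>lborel)"
          by (subst rl.nn_integral_fst[symmetric]) (auto simp: split_beta')
        also have "\<dots> \<le> (\<integral>\<^sup>+x. ennreal (norm (f x * (D * frac_dom \<beta> w x))) \<partial>lborel)"
        proof (intro nn_integral_mono)
          fix x
          have "(\<integral>\<^sup>+s. ennreal (norm (f x * frac_grad_conv b s \<phi> x)) \<partial>rl a) = (\<integral>\<^sup>+s. ennreal \<bar>f x\<bar> * ennreal \<bar>frac_grad_conv b s \<phi> x\<bar> \<partial>rl a)"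
            by (simp add: abs_mult ennreal_mult)
          also have "\<dots> = ennreal \<bar>f x\<bar> * (\<integral>\<^sup>+s. ennreal \<bar>frac_grad_conv b s \<phi> x\<bar> \<partial>rl a)"
            by (rule nn_integral_cmult) measurable
          also have "\<dots> \<le> ennreal \<bar>f x\<bar> * ennreal (norm (D * frac_dom \<beta> w x))"
            by (rule mult_left_mono[OF order_trans[OF nn ennreal_leI]]) auto
          also have "\<dots> = ennreal (norm (f x * (D * frac_dom \<beta> w x)))" by (simp add: abs_mult flip: ennreal_mult)
          finally show "(\<integral>\<^sup>+s. ennreal (norm (f x * frac_grad_conv b s \<phi> x)) \<partial>rl a) \<le> ennreal (norm (f x * (D * frac_dom \<beta> w x)))" .
        qed
        also have "\<dots> < \<infinity>"
          using integrable_Lp_mult[OF q f bdd_int_cmult[OF bdd_int_frac_dom[OF \<beta> w], of D]] unfolding integrable_iff_bounded by blast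
        finally show "(\<integral>\<^sup>+p. ennreal (norm (case p of (x, s) \<Rightarrow> f x * frac_grad_conv b s \<phi> x)) \<partial>(lborel \<Otimes>\<^sub>M rl a)) < \<infinity>" .
      qed
      have "(\<integral>x. f x * frac_div \<beta> \<phi> x \<partial>lborel) = (\<integral>x. C * (\<integral>s. f x * frac_grad_conv b s \<phi> x \<partial>rl a) \<partial>lborel)"
        unfolding fd by (simp add: mult.left_commute)
      also have "\<dots> = C * (\<integral>x. (\<integral>s. f x * frac_grad_conv b s \<phi> x \<partial>rl a) \<partial>lborel)" by (rule integral_mult_right_zero)
      also have "(\<integral>x. (\<integral>s. f x * frac_grad_conv b s \<phi> x \<partial>rl a) \<partial>lborel) = (\<integral>s. (\<integral>x. f x * frac_grad_conv b s \<phi> x \<partial>lborel) \<partial>rl a)"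
        using lborel_rl.Fubini_integral[OF int, symmetric] .
      also have "\<dots> = (\<integral>s. - (\<integral>y. ?T s y \<bullet> \<phi> y \<partial>lborel) \<partial>rl a)"
      proof (rule integral_cong_AE, measurable, use AE_rl_pos[OF a] in eventually_elim)
        fix s :: real assume "0 < s"
        from heat_transform_pairing[OF q f b this \<phi>b]
        show "(\<integral>x. f x * frac_grad_conv b s \<phi> x \<partial>lborel) = - (\<integral>y. ?T s y \<bullet> \<phi> y \<partial>lborel)" by simp
      qed
      also have "\<dots> = - (\<integral>s. (\<integral>y. ?T s y \<bullet> \<phi> y \<partial>lborel) \<partial>rl a)" by (rule Bochner_Integration.integral_minus)
      finally have e: "(\<integral>x. f x * frac_div \<beta> \<phi> x \<partial>lborel) = - (C * (\<integral>s. (\<integral>y. ?T s y \<bullet> \<phi> y \<partial>lborel) \<partial>rl a))" by simp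
      obtain R M L where R: "\<And>x. R < norm x \<Longrightarrow> \<phi> x = 0" and M: "\<And>x. norm (\<phi> x) \<le> M"
        using test_field_bounds[OF \<phi>] by metis
      show ?thesis using fdm e fub[OF bdd_intD(2)[OF \<phi>b] M R] by simp
    qed
    then show "\<exists>g. Lp_bound q g (C * E * (N + V)) \<and>
        (\<forall>\<phi>\<in>test_fields. frac_div \<beta> \<phi> \<in> borel_measurable borel \<and> (\<integral>x. f x * frac_div \<beta> \<phi> x \<partial>lborel) = - (\<integral>x. g x \<bullet> \<phi> x \<partial>lborel))"
      using gL by blast
  qed
qed

section \<open>Higher integrability\<close>

text \<open>Smoothing from L^p to L^q, in dual form. By Jensen the \<open>p\<close>-th power of the
  heat average \<open>H\<close> of |f| is at most the heat average \<open>P\<close> of |f|^p.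
  \<open>P\<close> has both a sup bound and an L^1 bound, and q/p = e + 1 interpolates between
  them.\<close>

lemma heat_conv_pairing:
  fixes p q :: real
  assumes p: "1 \<le> p" and pq: "p < q"
  obtains C where "C \<ge> 0" "\<And>(f :: 'a::euclidean_space \<Rightarrow> real) N \<tau> (\<phi> :: 'a \<Rightarrow> real). Lp_bound p f N \<Longrightarrow> \<tau> > 0 \<Longrightarrow> dual_unit q \<phi> \<Longrightarrow>
    (\<integral>\<^sup>+x. (\<integral>\<^sup>+y. ennreal (\<bar>f x\<bar> * (heat \<tau> (x - y) * \<bar>\<phi> y\<bar>)) \<partial>lborel) \<partial>lborel)
      \<le> ennreal (C * N * \<tau> powr (- (real DIM('a) * (1/p - 1/q) / 2)))"
proof -
  let ?n = "real DIM('a)"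
  let ?g = "gauss_mass TYPE('a)"
  have q: "q \<ge> 1" using p pq by simp
  define e where "e = (q - p) / p"
  have e: "e > 0" using p pq by (simp add: e_def)
  define C where "C = (1 / ?g) powr (e / q)"
  have C: "C \<ge> 0" by (simp add: C_def)
  show thesis
  proof (rule that[OF C])
    fix f :: "'a \<Rightarrow> real" and N \<tau> :: real and \<phi> :: "'a \<Rightarrow> real"
    assume f: "Lp_bound p f N" and \<tau>: "\<tau> > 0" and \<phi>: "dual_unit q \<phi>"
    have N: "N \<ge> 0" and [measurable]: "f \<in> borel_measurable borel" using f by (auto simp: Lp_bound_def)
    have fI: "(\<integral>\<^sup>+x. ennreal (\<bar>f x\<bar> powr p) \<partial>lborel) \<le> ennreal (N powr p)" using f by (simp add: Lp_bound_def)
    note [measurable] = bdd_intD(2)[OF dual_unit_bdd_int[OF \<phi>]]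
    let ?X = "C * N * \<tau> powr (- (?n * (1/p - 1/q) / 2))"
    define c where "c = \<tau> powr (- ?n / 2) / ?g"
    have c: "c > 0" using \<tau> gauss_mass_pos[where 'a='a] by (simp add: c_def)
    define H where "H y = (\<integral>\<^sup>+x. ennreal (heat \<tau> (x - y) * \<bar>f x\<bar>) \<partial>lborel)" for y
    define P where "P y = (\<integral>\<^sup>+x. ennreal (heat \<tau> (x - y)) * ennreal (\<bar>f x\<bar> powr p) \<partial>lborel)" for y
    have [measurable]: "H \<in> borel_measurable borel" "P \<in> borel_measurable borel" unfolding H_def P_def by measurable
    have Pb: "P y \<le> ennreal (c * N powr p)" for y
    proof -
      have "P y \<le> (\<integral>\<^sup>+x. ennreal c * ennreal (\<bar>f x\<bar> powr p) \<partial>lborel)"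
        unfolding P_def c_def using heat_le_sup[OF \<tau>] by (intro nn_integral_mono mult_right_mono ennreal_leI) auto
      also have "\<dots> = ennreal c * (\<integral>\<^sup>+x. ennreal (\<bar>f x\<bar> powr p) \<partial>lborel)" by (rule nn_integral_cmult) measurable
      also have "\<dots> \<le> ennreal c * ennreal (N powr p)" by (rule mult_left_mono[OF fI]) simp
      finally show ?thesis using c by (simp add: ennreal_mult)
    qed
    have PI: "(\<integral>\<^sup>+y. P y \<partial>lborel) \<le> ennreal (N powr p)"
    proof -
      have hm: "heat \<tau> (x - y) = heat \<tau> (y - x)" for x y :: 'a using heat_minus[of \<tau> "x - y"] by simp
      have "(\<integral>\<^sup>+y. P y \<partial>lborel) = (\<integral>\<^sup>+x. ennreal (heat \<tau> x) \<partial>(lborel :: 'a measure)) * (\<integral>\<^sup>+y. ennreal (\<bar>f y\<bar> powr p) \<partial>lborel)"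
        unfolding P_def hm[of _ y for y] by (rule nn_integral_conv) measurable
      then show ?thesis using fI nn_integral_heat[OF \<tau>, where 'a='a] by simp
    qed
    have HP: "\<exists>\<pi>\<ge>0. P y = ennreal \<pi> \<and> H y \<le> ennreal (\<pi> powr (1/p)) \<and> \<pi> \<le> c * N powr p" for y
    proof -
      obtain \<pi> where \<pi>: "P y = ennreal \<pi>" "\<pi> \<ge> 0" using le_less_trans[OF Pb[of y] ennreal_less_top] by (cases "P y") auto
      \<comment> \<open>With the kernel as density this is a probability measure, so Hoelder's
        inequality against the constant 1 is Jensen's inequality.\<close>
      let ?M = "density lborel (\<lambda>x. ennreal (heat \<tau> (x - y)))"
      have "(\<integral>\<^sup>+x. ennreal (\<bar>f x\<bar> * 1 powr (p - 1)) \<partial>?M) \<le> ennreal (\<pi> powr (1/p) * 1 powr (p - 1))"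
      proof (rule holder_powr[OF p])
        have "(\<integral>\<^sup>+x. ennreal (\<bar>f x\<bar> powr p) \<partial>?M) = P y" by (simp add: P_def nn_integral_density)
        also have "P y = ennreal ((\<pi> powr (1/p)) powr p)" using \<pi> p by (simp add: powr_powr)
        finally show "(\<integral>\<^sup>+x. ennreal (\<bar>f x\<bar> powr p) \<partial>?M) \<le> ennreal ((\<pi> powr (1/p)) powr p)" by simp
        show "(\<integral>\<^sup>+x. ennreal (1 powr p) \<partial>?M) \<le> ennreal (1 powr p)"
          using \<tau> by (simp add: emeasure_density)
      qed auto
      moreover have "(\<integral>\<^sup>+x. ennreal (\<bar>f x\<bar> * 1 powr (p - 1)) \<partial>?M) = H y"
        by (simp add: H_def nn_integral_density ennreal_mult)
      moreover have "\<pi> \<le> c * N powr p" using Pb[of y] c unfolding \<pi>(1) by (simp add: ennreal_le_iff)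
      ultimately show ?thesis using \<pi> by auto
    qed
    define Hr where "Hr y = enn2real (H y)" for y
    have HHr: "H y = ennreal (Hr y)" for y
      using HP[of y] unfolding Hr_def by (metis ennreal_enn2real ennreal_less_top le_less_trans)
    have Xq: "?X powr q = (c * N powr p) powr e * N powr p"
    proof -
      have "?X powr q = (1 / ?g) powr e * N powr q * (\<tau> powr (- ?n / 2)) powr e"
      proof -
        have 1: "- (?n * (1/p - 1/q) / 2) * q = (- ?n / 2) * e" using p pq by (simp add: e_def field_simps)
        have 2: "C powr q = (1 / ?g) powr e" unfolding C_def powr_powr using q by simp
        have "?X powr q = C powr q * N powr q * (\<tau> powr (- (?n * (1/p - 1/q) / 2))) powr q"
          using N C by (simp add: powr_mult)
        then show ?thesis unfolding 2 powr_powr 1 .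
      qed
      moreover have "N powr q = (N powr p) powr e * N powr p"
      proof -
        have "p * e + p = q" using p by (simp add: e_def)
        then show ?thesis unfolding powr_powr powr_add[symmetric] by simp
      qed
      moreover have "(c * N powr p) powr e = (1 / ?g) powr e * (\<tau> powr (- ?n / 2)) powr e * (N powr p) powr e"
        unfolding c_def using \<tau> gauss_mass_pos[where 'a='a] by (simp add: powr_mult powr_divide)
      ultimately show ?thesis by simp
    qed
    have "(\<integral>\<^sup>+y. ennreal (\<bar>Hr y\<bar> * norm (\<phi> y)) \<partial>lborel) \<le> ennreal ?X"
    proof (rule dual_unit_pairing[OF \<phi> q])
      show "?X \<ge> 0" using C N by simp
      show "Hr \<in> borel_measurable borel" unfolding Hr_def by measurable
      have "(\<integral>\<^sup>+y. ennreal (\<bar>Hr y\<bar> powr q) \<partial>lborel) \<le> (\<integral>\<^sup>+y. ennreal ((c * N powr p) powr e) * P y \<partial>lborel)"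
      proof (intro nn_integral_mono)
        fix y
        obtain \<pi> where \<pi>: "\<pi> \<ge> 0" "P y = ennreal \<pi>" "H y \<le> ennreal (\<pi> powr (1/p))" "\<pi> \<le> c * N powr p" using HP[of y] by blast
        have "0 \<le> Hr y" by (simp add: Hr_def)
        have "Hr y \<le> \<pi> powr (1/p)" using \<pi>(3) unfolding HHr by (simp add: ennreal_le_iff)
        then have "\<bar>Hr y\<bar> powr q \<le> (\<pi> powr (1/p)) powr q" using q \<open>0 \<le> Hr y\<close> by (intro powr_mono2) auto
        also have "\<dots> = \<pi> powr e * \<pi>"
        proof -
          have "1/p * q = e + 1" using p by (simp add: e_def field_simps)
          then have "(\<pi> powr (1/p)) powr q = \<pi> powr e * \<pi> powr 1" by (simp only: powr_powr powr_add)
          then show ?thesis using \<pi>(1) by simp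
        qed
        also have "\<dots> \<le> (c * N powr p) powr e * \<pi>" using \<pi> e by (intro mult_right_mono powr_mono2) auto
        finally show "ennreal (\<bar>Hr y\<bar> powr q) \<le> ennreal ((c * N powr p) powr e) * P y"
          unfolding \<pi>(2) using \<pi>(1) by (simp flip: ennreal_mult)
      qed
      also have "\<dots> = ennreal ((c * N powr p) powr e) * (\<integral>\<^sup>+y. P y \<partial>lborel)" by (rule nn_integral_cmult) measurable
      also have "\<dots> \<le> ennreal ((c * N powr p) powr e) * ennreal (N powr p)" by (rule mult_left_mono[OF PI]) simp
      also have "\<dots> = ennreal (?X powr q)" unfolding Xq by (simp add: ennreal_mult)
      finally show "(\<integral>\<^sup>+y. ennreal (\<bar>Hr y\<bar> powr q) \<partial>lborel) \<le> ennreal (?X powr q)" .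
    qed
    moreover have "(\<integral>\<^sup>+x. (\<integral>\<^sup>+y. ennreal (\<bar>f x\<bar> * (heat \<tau> (x - y) * \<bar>\<phi> y\<bar>)) \<partial>lborel) \<partial>lborel) = (\<integral>\<^sup>+y. ennreal (\<bar>Hr y\<bar> * norm (\<phi> y)) \<partial>lborel)"
    proof -
      have "(\<integral>\<^sup>+x. (\<integral>\<^sup>+y. ennreal (\<bar>f x\<bar> * (heat \<tau> (x - y) * \<bar>\<phi> y\<bar>)) \<partial>lborel) \<partial>lborel) = (\<integral>\<^sup>+y. (\<integral>\<^sup>+x. ennreal (\<bar>f x\<bar> * (heat \<tau> (x - y) * \<bar>\<phi> y\<bar>)) \<partial>lborel) \<partial>lborel)"
        by (rule lborel_pair.Fubini') measurable
      also have "\<dots> = (\<integral>\<^sup>+y. ennreal \<bar>Hr y\<bar> * ennreal \<bar>\<phi> y\<bar> \<partial>lborel)"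
      proof (rule nn_integral_cong)
        fix y
        have "(\<integral>\<^sup>+x. ennreal (\<bar>f x\<bar> * (heat \<tau> (x - y) * \<bar>\<phi> y\<bar>)) \<partial>lborel) = (\<integral>\<^sup>+x. ennreal (heat \<tau> (x - y) * \<bar>f x\<bar>) * ennreal \<bar>\<phi> y\<bar> \<partial>lborel)"
          by (intro nn_integral_cong) (simp add: mult_ac flip: ennreal_mult)
        also have "\<dots> = H y * ennreal \<bar>\<phi> y\<bar>" unfolding H_def by (rule nn_integral_multc) measurable
        finally show "(\<integral>\<^sup>+x. ennreal (\<bar>f x\<bar> * (heat \<tau> (x - y) * \<bar>\<phi> y\<bar>)) \<partial>lborel) = ennreal \<bar>Hr y\<bar> * ennreal \<bar>\<phi> y\<bar>"
          unfolding HHr by (simp add: Hr_def)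
      qed
      finally show ?thesis by (simp add: ennreal_mult)
    qed
    ultimately show "(\<integral>\<^sup>+x. (\<integral>\<^sup>+y. ennreal (\<bar>f x\<bar> * (heat \<tau> (x - y) * \<bar>\<phi> y\<bar>)) \<partial>lborel) \<partial>lborel) \<le> ennreal ?X" by simp
  qed
qed

section \<open>Recovering the heat semigroup from its time derivative\<close>

lemma heat_dt_sup:
  fixes z :: "'a::euclidean_space"
  assumes t: "t > 0"
  shows "\<bar>heat_dt t z\<bar> \<le> (2 + real DIM('a)) * heat_const TYPE('a) / gauss_mass TYPE('a) * t powr (- (1 + real DIM('a) / 2))"
proof -
  let ?n = "real DIM('a)"
  have "heat (2 * t) z \<le> (2 * t) powr (- ?n / 2) / gauss_mass TYPE('a)"
    using t by (intro heat_le_sup) auto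
  also have "\<dots> \<le> t powr (- ?n / 2) / gauss_mass TYPE('a)"
    using t gauss_mass_pos[where 'a='a] by (intro divide_right_mono powr_mono2') auto
  finally have "(2 + ?n) * heat_const TYPE('a) * t powr (-1) * heat (2 * t) z
     \<le> (2 + ?n) * heat_const TYPE('a) * t powr (-1) * (t powr (- ?n / 2) / gauss_mass TYPE('a))"
    by (intro mult_left_mono) (auto simp: heat_const_def)
  also have "\<dots> = (2 + ?n) * heat_const TYPE('a) / gauss_mass TYPE('a) * (t powr (-1) * t powr (- ?n / 2))" by (simp only: times_divide_eq_right times_divide_eq_left mult.assoc)
  also have "t powr (-1) * t powr (- ?n / 2) = t powr (- (1 + ?n / 2))"
    unfolding powr_add[symmetric] by simp
  finally show ?thesis using abs_heat_dt_le[OF t, of z] by linarith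
qed

text \<open>\<open>rl 1\<close> is Lebesgue measure on the positive half-line, so this is the
  fundamental theorem of calculus together with the decay of \<open>heat t\<close> to 0 at infinity.
  The shift \<delta> keeps the integrand away from its singularity at time 0.\<close>

lemma heat_eq_integral_dt:
  fixes z :: "'a::euclidean_space"
  assumes \<delta>: "\<delta> > 0"
  shows "(\<integral>\<tau>. heat_dt (\<tau> + \<delta>) z \<partial>rl 1) = - heat \<delta> z"
proof -
  let ?n = "real DIM('a)"
  let ?F = "\<lambda>\<tau>. heat_dt (\<tau> + \<delta>) z"
  let ?K = "(2 + ?n) * heat_const TYPE('a) / gauss_mass TYPE('a)"
  have K: "?K \<ge> 0" using gauss_mass_pos[where 'a='a] by (simp add: heat_const_def)
  obtain C where C: "C \<ge> 0" "\<And>s. s > 0 \<Longrightarrow> (\<integral>\<^sup>+t. ennreal ((t + s) powr (- (1 + ?n / 2))) \<partial>rl 1) \<le> ennreal (C * s powr (1 - (1 + ?n / 2)))"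
    using rl_shift_bound[of 1 "1 + ?n / 2"] by auto
  have le: "\<bar>?F \<tau>\<bar> \<le> ?K * (\<tau> + \<delta>) powr (- (1 + ?n / 2))" if "\<tau> > 0" for \<tau>
    using that \<delta> by (intro heat_dt_sup) simp
  have int: "integrable (rl 1) ?F"
  proof (rule integrableI_bounded)
    have "(\<integral>\<^sup>+\<tau>. ennreal (norm (?F \<tau>)) \<partial>rl 1) \<le> (\<integral>\<^sup>+\<tau>. ennreal ?K * ennreal ((\<tau> + \<delta>) powr (- (1 + ?n / 2))) \<partial>rl 1)"
    proof (rule nn_integral_mono_AE, use AE_rl_pos[OF zero_less_one] in eventually_elim)
      fix \<tau> :: real assume "0 < \<tau>"
      then show "ennreal (norm (?F \<tau>)) \<le> ennreal ?K * ennreal ((\<tau> + \<delta>) powr (- (1 + ?n / 2)))"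
        using le[of \<tau>] K unfolding ennreal_mult[OF K powr_ge_zero, symmetric] real_norm_def by (intro ennreal_leI)
    qed
    also have "\<dots> = ennreal ?K * (\<integral>\<^sup>+\<tau>. ennreal ((\<tau> + \<delta>) powr (- (1 + ?n / 2))) \<partial>rl 1)"
      by (rule nn_integral_cmult) measurable
    also have "\<dots> \<le> ennreal ?K * ennreal (C * \<delta> powr (1 - (1 + ?n / 2)))"
      by (rule mult_left_mono[OF C(2)[OF \<delta>]]) simp
    also have "\<dots> < \<infinity>" by (simp add: ennreal_mult_less_top)
    finally show "(\<integral>\<^sup>+\<tau>. ennreal (norm (?F \<tau>)) \<partial>rl 1) < \<infinity>" .
  qed measurable
  have fin: "(\<integral>\<tau>. indicator {..real k} \<tau> * ?F \<tau> \<partial>rl 1) = heat (real k + \<delta>) z - heat \<delta> z" for k :: nat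
  proof -
    have "(\<integral>\<tau>. indicator {..real k} \<tau> * ?F \<tau> \<partial>rl 1) = (\<integral>\<tau>. (indicator {0<..} \<tau> * \<tau> powr (1 - 1)) *\<^sub>R (indicator {..real k} \<tau> * ?F \<tau>) \<partial>lborel)"
      unfolding rl_def by (simp add: integral_density)
    \<comment> \<open>The two domains of integration differ only by the point 0, a null set.\<close>
    also have "\<dots> = (\<integral>\<tau>. indicator {0..real k} \<tau> *\<^sub>R ?F \<tau> \<partial>lborel)"
      by (rule integral_cong_AE, measurable, rule AE_mp[OF AE_lborel_singleton[of 0]]) (auto intro!: AE_I2 simp: indicator_def)
    also have "\<dots> = heat (real k + \<delta>) z - heat (0 + \<delta>) z"
    proof (rule integral_FTC_Icc[where F = "\<lambda>\<tau>. heat (\<tau> + \<delta>) z"])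
      show "((\<lambda>\<tau>. heat (\<tau> + \<delta>) z) has_vector_derivative ?F s) (at s within {0..real k})" if "0 \<le> s" "s \<le> real k" for s
      proof -
        have "((\<lambda>\<tau>. heat (\<tau> + \<delta>) z) has_real_derivative ?F s * 1) (at s)"
          by (rule DERIV_chain2[OF heat_has_derivative_time]) (use that \<delta> in \<open>auto intro!: derivative_eq_intros\<close>)
        then show ?thesis
          by (auto simp: has_real_derivative_iff_has_vector_derivative intro: has_vector_derivative_at_within)
      qed
      show "continuous_on {0..real k} ?F"
        unfolding heat_dt_def heat_def using gauss_mass_pos[where 'a='a] \<delta>
        by (intro continuous_intros) auto
    qed simp
    finally show ?thesis by simp
  qed
  have "(\<lambda>k. \<integral>\<tau>. indicator {..real k} \<tau> * ?F \<tau> \<partial>rl 1) \<longlonglongrightarrow> (\<integral>\<tau>. ?F \<tau> \<partial>rl 1)"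
  proof (rule integral_dominated_convergence[OF _ _ integrable_norm[OF int]])
    show "AE \<tau> in rl 1. (\<lambda>k. indicator {..real k} \<tau> * ?F \<tau>) \<longlonglongrightarrow> ?F \<tau>"
    proof (intro AE_I2)
      fix \<tau> :: real
      obtain m :: nat where m: "\<tau> \<le> real m" using real_arch_simple by blast
      show "(\<lambda>k. indicator {..real k} \<tau> * ?F \<tau>) \<longlonglongrightarrow> ?F \<tau>"
        by (rule tendsto_eventually, rule eventually_mono[OF eventually_ge_at_top[of m]]) (use m in auto)
    qed
    show "AE \<tau> in rl 1. norm (indicator {..real k} \<tau> * ?F \<tau>) \<le> norm (?F \<tau>)" for k :: nat
      by (intro AE_I2) (auto simp: indicator_def)
  qed measurable
  then have 1: "(\<lambda>k. heat (real k + \<delta>) z - heat \<delta> z) \<longlonglongrightarrow> (\<integral>\<tau>. ?F \<tau> \<partial>rl 1)" unfolding fin .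
  have "(\<lambda>k. heat (real k + \<delta>) z) \<longlonglongrightarrow> 0"
  proof (rule tendsto_sandwich[OF _ _ tendsto_const])
    show "\<forall>\<^sub>F k in sequentially. 0 \<le> heat (real k + \<delta>) z" by simp
    show "\<forall>\<^sub>F k in sequentially. heat (real k + \<delta>) z \<le> (real k + \<delta>) powr (- ?n / 2) / gauss_mass TYPE('a)"
      using \<delta> by (intro always_eventually allI heat_le_sup) auto
    have "filterlim (\<lambda>k. real k + \<delta>) at_top sequentially"
      by (rule filterlim_at_top_mono[OF filterlim_real_sequentially]) (use \<delta> in auto)
    then have "(\<lambda>k. (real k + \<delta>) powr (- ?n / 2)) \<longlonglongrightarrow> 0" by (intro tendsto_neg_powr) auto
    from tendsto_divide_zero[OF this] show "(\<lambda>k. (real k + \<delta>) powr (- ?n / 2) / gauss_mass TYPE('a)) \<longlonglongrightarrow> 0" .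
  qed
  from tendsto_diff[OF this tendsto_const] have "(\<lambda>k. heat (real k + \<delta>) z - heat \<delta> z) \<longlonglongrightarrow> 0 - heat \<delta> z" .
  with 1 show ?thesis using LIMSEQ_unique by fastforce
qed

definition dt_conv :: "('a::euclidean_space \<Rightarrow> real) \<Rightarrow> real \<Rightarrow> 'a \<Rightarrow> real" where
  "dt_conv \<phi> \<tau> x = (\<integral>y. heat_dt \<tau> (x - y) * \<phi> y \<partial>lborel)"

definition heat_conv :: "('a::euclidean_space \<Rightarrow> real) \<Rightarrow> real \<Rightarrow> 'a \<Rightarrow> real" where
  "heat_conv \<phi> \<tau> x = (\<integral>y. heat \<tau> (x - y) * \<phi> y \<partial>lborel)"

lemma measurable_dt_conv [measurable (raw)]:
  fixes h :: "'b \<Rightarrow> 'a::euclidean_space"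
  assumes [measurable]: "\<phi> \<in> borel_measurable borel" "g \<in> borel_measurable N" "h \<in> borel_measurable N"
  shows "(\<lambda>x. dt_conv \<phi> (g x) (h x)) \<in> borel_measurable N"
  unfolding dt_conv_def by measurable

lemma measurable_heat_conv [measurable (raw)]:
  fixes h :: "'b \<Rightarrow> 'a::euclidean_space"
  assumes [measurable]: "\<phi> \<in> borel_measurable borel" "g \<in> borel_measurable N" "h \<in> borel_measurable N"
  shows "(\<lambda>x. heat_conv \<phi> (g x) (h x)) \<in> borel_measurable N"
  unfolding heat_conv_def by measurable

lemma integrable_dt_conv:
  fixes \<phi> :: "'a::euclidean_space \<Rightarrow> real"
  assumes \<tau>: "\<tau> > 0" and \<phi>: "bdd_int \<phi>"
  shows "integrable lborel (\<lambda>y. heat_dt \<tau> (x - y) * \<phi> y)"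
proof -
  note [measurable] = bdd_intD(2)[OF \<phi>]
  have hm: "(\<lambda>(x, y). heat_dt \<tau> (x - y) * \<phi> y) \<in> borel_measurable (borel \<Otimes>\<^sub>M borel)" by measurable
  show ?thesis
    by (rule conv_dominated(1)[OF integrable_abs[OF integrable_heat_dt[OF \<tau>]] bdd_int_norm[OF \<phi>] hm]) (simp add: abs_mult)
qed

lemma abs_dt_conv_le:
  fixes \<phi> :: "'a::euclidean_space \<Rightarrow> real"
  assumes \<tau>: "\<tau> > 0" and \<phi>: "bdd_int \<phi>"
  shows "ennreal \<bar>dt_conv \<phi> \<tau> x\<bar> \<le> ennreal ((2 + real DIM('a)) * heat_const TYPE('a) * \<tau> powr (-1)) * (\<integral>\<^sup>+y. ennreal (heat (2 * \<tau>) (x - y) * \<bar>\<phi> y\<bar>) \<partial>lborel)"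
proof -
  note [measurable] = bdd_intD(2)[OF \<phi>]
  let ?K = "(2 + real DIM('a)) * heat_const TYPE('a) * \<tau> powr (-1)"
  have K: "?K \<ge> 0" by (simp add: heat_const_def)
  have "ennreal \<bar>dt_conv \<phi> \<tau> x\<bar> \<le> (\<integral>\<^sup>+y. ennreal (norm (heat_dt \<tau> (x - y) * \<phi> y)) \<partial>lborel)"
    unfolding dt_conv_def real_norm_def[symmetric] by (rule integral_norm_bound_ennreal[OF integrable_dt_conv[OF \<tau> \<phi>]])
  also have "\<dots> \<le> (\<integral>\<^sup>+y. ennreal ?K * ennreal (heat (2 * \<tau>) (x - y) * \<bar>\<phi> y\<bar>) \<partial>lborel)"
  proof (intro nn_integral_mono)
    fix y
    have "norm (heat_dt \<tau> (x - y) * \<phi> y) \<le> ?K * (heat (2 * \<tau>) (x - y) * \<bar>\<phi> y\<bar>)"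
      using mult_right_mono[OF abs_heat_dt_le[OF \<tau>, of "x - y"] abs_ge_zero[of "\<phi> y"]] by (simp only: real_norm_def abs_mult mult.assoc)
    then show "ennreal (norm (heat_dt \<tau> (x - y) * \<phi> y)) \<le> ennreal ?K * ennreal (heat (2 * \<tau>) (x - y) * \<bar>\<phi> y\<bar>)"
      unfolding ennreal_mult[OF K mult_nonneg_nonneg[OF heat_nonneg abs_ge_zero], symmetric] by (rule ennreal_leI)
  qed
  also have "\<dots> = ennreal ?K * (\<integral>\<^sup>+y. ennreal (heat (2 * \<tau>) (x - y) * \<bar>\<phi> y\<bar>) \<partial>lborel)"
    by (rule nn_integral_cmult) measurable
  finally show ?thesis .
qed

text \<open>The time derivative costs one power of \<tau> and a doubling of the time;
  \<open>heat_conv_pairing\<close> gives the rest. The doubling is undone because the remaining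
  exponent is not positive.\<close>

lemma dt_conv_pairing:
  fixes p q :: real
  assumes p: "1 \<le> p" and pq: "p < q"
  obtains K where "K \<ge> 0" "\<And>(f :: 'a::euclidean_space \<Rightarrow> real) N \<tau> (\<phi> :: 'a \<Rightarrow> real). Lp_bound p f N \<Longrightarrow> \<tau> > 0 \<Longrightarrow> dual_unit q \<phi> \<Longrightarrow>
    (\<integral>\<^sup>+x. ennreal \<bar>f x * dt_conv \<phi> \<tau> x\<bar> \<partial>lborel) \<le> ennreal (K * N * \<tau> powr (- (1 + real DIM('a) * (1/p - 1/q) / 2)))"
proof -
  define \<theta> where "\<theta> = real DIM('a) * (1/p - 1/q) / 2"
  have \<theta>: "\<theta> \<ge> 0" unfolding \<theta>_def using p pq by (simp add: field_simps)
  obtain C where C: "C \<ge> 0" "\<And>(f :: 'a \<Rightarrow> real) N \<tau> (\<phi> :: 'a \<Rightarrow> real). Lp_bound p f N \<Longrightarrow> \<tau> > 0 \<Longrightarrow> dual_unit q \<phi> \<Longrightarrow>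
    (\<integral>\<^sup>+x. (\<integral>\<^sup>+y. ennreal (\<bar>f x\<bar> * (heat \<tau> (x - y) * \<bar>\<phi> y\<bar>)) \<partial>lborel) \<partial>lborel) \<le> ennreal (C * N * \<tau> powr (- \<theta>))"
    unfolding \<theta>_def by (rule heat_conv_pairing[OF p pq, where 'a='a]) blast
  let ?k = "(2 + real DIM('a)) * heat_const TYPE('a)"
  have k: "?k \<ge> 0" by (simp add: heat_const_def)
  show thesis
  proof (rule that[of "?k * C"])
    show "?k * C \<ge> 0" using k C(1) by simp
    fix f :: "'a \<Rightarrow> real" and N \<tau> :: real and \<phi> :: "'a \<Rightarrow> real"
    assume f: "Lp_bound p f N" and \<tau>: "\<tau> > 0" and \<phi>: "dual_unit q \<phi>"
    have N: "N \<ge> 0" and [measurable]: "f \<in> borel_measurable borel" using f by (auto simp: Lp_bound_def)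
    note \<phi>b = dual_unit_bdd_int[OF \<phi>]
    note [measurable] = bdd_intD(2)[OF \<phi>b]
    have "(\<integral>\<^sup>+x. ennreal \<bar>f x * dt_conv \<phi> \<tau> x\<bar> \<partial>lborel) \<le> (\<integral>\<^sup>+x. ennreal (?k * \<tau> powr (-1)) * (\<integral>\<^sup>+y. ennreal (\<bar>f x\<bar> * (heat (2 * \<tau>) (x - y) * \<bar>\<phi> y\<bar>)) \<partial>lborel) \<partial>lborel)"
    proof (intro nn_integral_mono)
      fix x
      have "ennreal \<bar>f x * dt_conv \<phi> \<tau> x\<bar> = ennreal \<bar>f x\<bar> * ennreal \<bar>dt_conv \<phi> \<tau> x\<bar>" by (simp add: abs_mult ennreal_mult)
      also have "\<dots> \<le> ennreal \<bar>f x\<bar> * (ennreal (?k * \<tau> powr (-1)) * (\<integral>\<^sup>+y. ennreal (heat (2 * \<tau>) (x - y) * \<bar>\<phi> y\<bar>) \<partial>lborel))"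
        by (rule mult_left_mono[OF abs_dt_conv_le[OF \<tau> \<phi>b]]) simp
      also have "\<dots> = ennreal (?k * \<tau> powr (-1)) * (ennreal \<bar>f x\<bar> * (\<integral>\<^sup>+y. ennreal (heat (2 * \<tau>) (x - y) * \<bar>\<phi> y\<bar>) \<partial>lborel))"
        by (simp only: mult.left_commute)
      also have "ennreal \<bar>f x\<bar> * (\<integral>\<^sup>+y. ennreal (heat (2 * \<tau>) (x - y) * \<bar>\<phi> y\<bar>) \<partial>lborel) = (\<integral>\<^sup>+y. ennreal \<bar>f x\<bar> * ennreal (heat (2 * \<tau>) (x - y) * \<bar>\<phi> y\<bar>) \<partial>lborel)"
        by (rule nn_integral_cmult[symmetric]) measurable
      also have "\<dots> = (\<integral>\<^sup>+y. ennreal (\<bar>f x\<bar> * (heat (2 * \<tau>) (x - y) * \<bar>\<phi> y\<bar>)) \<partial>lborel)"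
        by (intro nn_integral_cong ennreal_mult[symmetric]) auto
      finally show "ennreal \<bar>f x * dt_conv \<phi> \<tau> x\<bar> \<le> ennreal (?k * \<tau> powr (-1)) * (\<integral>\<^sup>+y. ennreal (\<bar>f x\<bar> * (heat (2 * \<tau>) (x - y) * \<bar>\<phi> y\<bar>)) \<partial>lborel)" .
    qed
    also have "\<dots> = ennreal (?k * \<tau> powr (-1)) * (\<integral>\<^sup>+x. (\<integral>\<^sup>+y. ennreal (\<bar>f x\<bar> * (heat (2 * \<tau>) (x - y) * \<bar>\<phi> y\<bar>)) \<partial>lborel) \<partial>lborel)"
      by (rule nn_integral_cmult) measurable
    also have "\<dots> \<le> ennreal (?k * \<tau> powr (-1)) * ennreal (C * N * (2 * \<tau>) powr (- \<theta>))"
      using \<tau> by (intro mult_left_mono C(2)[OF f _ \<phi>]) auto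
    also have "\<dots> \<le> ennreal (?k * \<tau> powr (-1)) * ennreal (C * N * \<tau> powr (- \<theta>))"
      using \<tau> C(1) N \<theta> by (intro mult_left_mono ennreal_leI powr_mono2') auto
    also have "\<dots> = ennreal (?k * \<tau> powr (-1) * (C * N * \<tau> powr (- \<theta>)))"
      using k C(1) N by (intro ennreal_mult[symmetric]) auto
    also have "?k * \<tau> powr (-1) * (C * N * \<tau> powr (- \<theta>)) = ?k * C * N * (\<tau> powr (-1) * \<tau> powr (- \<theta>))" by (simp only: mult_ac)
    also have "\<tau> powr (-1) * \<tau> powr (- \<theta>) = \<tau> powr (- (1 + \<theta>))" unfolding powr_add[symmetric] by simp
    finally show "(\<integral>\<^sup>+x. ennreal \<bar>f x * dt_conv \<phi> \<tau> x\<bar> \<partial>lborel) \<le> ennreal (?k * C * N * \<tau> powr (- (1 + real DIM('a) * (1/p - 1/q) / 2)))"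
      unfolding \<theta>_def .
  qed
qed

text \<open>The kernel identity is integrated against \<phi>; the sup bound of
  \<open>heat_dt\<close> and the integrability of \<phi> make the double integral converge
  absolutely.\<close>

lemma heat_conv_eq_integral_dt:
  fixes \<phi> :: "'a::euclidean_space \<Rightarrow> real"
  assumes \<delta>: "\<delta> > 0" and \<phi>: "bdd_int \<phi>"
  shows "(\<integral>\<tau>. dt_conv \<phi> (\<tau> + \<delta>) x \<partial>rl 1) = - heat_conv \<phi> \<delta> x"
proof -
  let ?n = "real DIM('a)"
  note [measurable] = bdd_intD(2)[OF \<phi>]
  define K where "K = (2 + ?n) * heat_const TYPE('a) / gauss_mass TYPE('a)"
  have K: "K \<ge> 0" unfolding K_def using gauss_mass_pos[where 'a='a] by (simp add: heat_const_def)
  obtain C where C: "C \<ge> 0" "\<And>s. s > 0 \<Longrightarrow> (\<integral>\<^sup>+t. ennreal ((t + s) powr (- (1 + ?n / 2))) \<partial>rl 1) \<le> ennreal (C * s powr (1 - (1 + ?n / 2)))"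
    using rl_shift_bound[of 1 "1 + ?n / 2"] by auto
  have int: "integrable (lborel \<Otimes>\<^sub>M rl 1) (\<lambda>(y, \<tau>). heat_dt (\<tau> + \<delta>) (x - y) * \<phi> y)"
  proof (rule integrableI_bounded)
    show "(\<lambda>(y, \<tau>). heat_dt (\<tau> + \<delta>) (x - y) * \<phi> y) \<in> borel_measurable (lborel \<Otimes>\<^sub>M rl 1)" by measurable
    have "(\<integral>\<^sup>+p. ennreal (norm (case p of (y, \<tau>) \<Rightarrow> heat_dt (\<tau> + \<delta>) (x - y) * \<phi> y)) \<partial>(lborel \<Otimes>\<^sub>M rl 1)) = (\<integral>\<^sup>+y. (\<integral>\<^sup>+\<tau>. ennreal (norm (heat_dt (\<tau> + \<delta>) (x - y) * \<phi> y)) \<partial>rl 1) \<partial>lborel)"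
      by (subst rl.nn_integral_fst[symmetric]) (auto simp: split_beta')
    also have "\<dots> \<le> (\<integral>\<^sup>+y. ennreal (K * (C * \<delta> powr (1 - (1 + ?n / 2)))) * ennreal \<bar>\<phi> y\<bar> \<partial>lborel)"
    proof (intro nn_integral_mono)
      fix y
      have "(\<integral>\<^sup>+\<tau>. ennreal (norm (heat_dt (\<tau> + \<delta>) (x - y) * \<phi> y)) \<partial>rl 1) \<le> (\<integral>\<^sup>+\<tau>. ennreal (K * \<bar>\<phi> y\<bar>) * ennreal ((\<tau> + \<delta>) powr (- (1 + ?n / 2))) \<partial>rl 1)"
      proof (rule nn_integral_mono_AE, use AE_rl_pos[OF zero_less_one] in eventually_elim)
        fix \<tau> :: real assume "0 < \<tau>"
        then have "\<tau> + \<delta> > 0" using \<delta> by simp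
        from mult_right_mono[OF heat_dt_sup[OF this, of "x - y"] abs_ge_zero[of "\<phi> y"]]
        have "norm (heat_dt (\<tau> + \<delta>) (x - y) * \<phi> y) \<le> K * \<bar>\<phi> y\<bar> * (\<tau> + \<delta>) powr (- (1 + ?n / 2))"
          unfolding K_def[symmetric] by (simp add: abs_mult mult_ac)
        then show "ennreal (norm (heat_dt (\<tau> + \<delta>) (x - y) * \<phi> y)) \<le> ennreal (K * \<bar>\<phi> y\<bar>) * ennreal ((\<tau> + \<delta>) powr (- (1 + ?n / 2)))"
          unfolding ennreal_mult[OF mult_nonneg_nonneg[OF K abs_ge_zero] powr_ge_zero, symmetric] by (rule ennreal_leI)
      qed
      also have "\<dots> = ennreal (K * \<bar>\<phi> y\<bar>) * (\<integral>\<^sup>+\<tau>. ennreal ((\<tau> + \<delta>) powr (- (1 + ?n / 2))) \<partial>rl 1)"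
        by (rule nn_integral_cmult) measurable
      also have "\<dots> \<le> ennreal (K * \<bar>\<phi> y\<bar>) * ennreal (C * \<delta> powr (1 - (1 + ?n / 2)))"
        by (rule mult_left_mono[OF C(2)[OF \<delta>]]) simp
      also have "\<dots> = ennreal (K * (C * \<delta> powr (1 - (1 + ?n / 2)))) * ennreal \<bar>\<phi> y\<bar>"
        using K C(1) by (simp add: mult_ac flip: ennreal_mult)
      finally show "(\<integral>\<^sup>+\<tau>. ennreal (norm (heat_dt (\<tau> + \<delta>) (x - y) * \<phi> y)) \<partial>rl 1) \<le> ennreal (K * (C * \<delta> powr (1 - (1 + ?n / 2)))) * ennreal \<bar>\<phi> y\<bar>" .
    qed
    also have "\<dots> = ennreal (K * (C * \<delta> powr (1 - (1 + ?n / 2)))) * (\<integral>\<^sup>+y. ennreal \<bar>\<phi> y\<bar> \<partial>lborel)"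
      by (rule nn_integral_cmult) measurable
    also have "\<dots> < \<infinity>" using bdd_intD(1)[OF \<phi>] by (auto simp: integrable_iff_bounded ennreal_mult_less_top)
    finally show "(\<integral>\<^sup>+p. ennreal (norm (case p of (y, \<tau>) \<Rightarrow> heat_dt (\<tau> + \<delta>) (x - y) * \<phi> y)) \<partial>(lborel \<Otimes>\<^sub>M rl 1)) < \<infinity>" .
  qed
  have "(\<integral>\<tau>. dt_conv \<phi> (\<tau> + \<delta>) x \<partial>rl 1) = (\<integral>y. (\<integral>\<tau>. heat_dt (\<tau> + \<delta>) (x - y) * \<phi> y \<partial>rl 1) \<partial>lborel)"
    unfolding dt_conv_def using lborel_rl.Fubini_integral[OF int] .
  also have "\<dots> = (\<integral>y. - (heat \<delta> (x - y) * \<phi> y) \<partial>lborel)"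
    by (simp add: heat_eq_integral_dt[OF \<delta>])
  also have "\<dots> = - heat_conv \<phi> \<delta> x" unfolding heat_conv_def by (rule Bochner_Integration.integral_minus)
  finally show ?thesis .
qed

text \<open>Used with two weights: \<open>b = 1\<close>, where the inner average is a heat
  convolution, and b = (1 - \<alpha>)/2, where it is a fractional divergence up to a
  constant.\<close>

lemma heat_pairing_swap:
  fixes f \<phi> :: "'a::euclidean_space \<Rightarrow> real"
  assumes f: "Lp_bound p f N" and \<phi>: "bdd_int \<phi>" and s: "s > 0" and b: "0 \<le> b" "b < 1 + \<theta>"
    and K: "K \<ge> 0" "\<And>\<tau>. \<tau> > 0 \<Longrightarrow> (\<integral>\<^sup>+x. ennreal \<bar>f x * dt_conv \<phi> \<tau> x\<bar> \<partial>lborel) \<le> ennreal (K * \<tau> powr (- (1 + \<theta>)))"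
  shows "integrable (rl b) (\<lambda>t. \<integral>x. f x * dt_conv \<phi> (t + s) x \<partial>lborel)"
    and "(\<integral>t. (\<integral>x. f x * dt_conv \<phi> (t + s) x \<partial>lborel) \<partial>rl b) = (\<integral>x. f x * (\<integral>t. dt_conv \<phi> (t + s) x \<partial>rl b) \<partial>lborel)"
proof -
  have [measurable]: "f \<in> borel_measurable borel" using f by (auto simp: Lp_bound_def)
  note [measurable] = bdd_intD(2)[OF \<phi>]
  obtain C where C: "\<And>s. s > 0 \<Longrightarrow> (\<integral>\<^sup>+t. ennreal ((t + s) powr (- (1 + \<theta>))) \<partial>rl b) \<le> ennreal (C * s powr (b - (1 + \<theta>)))"
    using rl_shift_bound[OF b] by metis
  have int: "integrable (lborel \<Otimes>\<^sub>M rl b) (\<lambda>(x, t). f x * dt_conv \<phi> (t + s) x)"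
  proof (rule integrableI_bounded)
    show "(\<lambda>(x, t). f x * dt_conv \<phi> (t + s) x) \<in> borel_measurable (lborel \<Otimes>\<^sub>M rl b)" by measurable
    have "(\<integral>\<^sup>+z. ennreal (norm (case z of (x, t) \<Rightarrow> f x * dt_conv \<phi> (t + s) x)) \<partial>(lborel \<Otimes>\<^sub>M rl b)) = (\<integral>\<^sup>+x. (\<integral>\<^sup>+t. ennreal (norm (f x * dt_conv \<phi> (t + s) x)) \<partial>rl b) \<partial>lborel)"
      by (subst rl.nn_integral_fst[symmetric]) (auto simp: split_beta')
    also have "\<dots> = (\<integral>\<^sup>+t. (\<integral>\<^sup>+x. ennreal (norm (f x * dt_conv \<phi> (t + s) x)) \<partial>lborel) \<partial>rl b)"
      by (rule rl_lborel.Fubini') measurable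
    also have "\<dots> \<le> (\<integral>\<^sup>+t. ennreal K * ennreal ((t + s) powr (- (1 + \<theta>))) \<partial>rl b)"
    proof (rule nn_integral_mono_AE, use AE_rl_nonneg in eventually_elim)
      fix t :: real assume "0 \<le> t"
      then have "t + s > 0" using s by simp
      from K(2)[OF this] show "(\<integral>\<^sup>+x. ennreal (norm (f x * dt_conv \<phi> (t + s) x)) \<partial>lborel) \<le> ennreal K * ennreal ((t + s) powr (- (1 + \<theta>)))"
        unfolding real_norm_def ennreal_mult[OF K(1) powr_ge_zero] .
    qed
    also have "\<dots> = ennreal K * (\<integral>\<^sup>+t. ennreal ((t + s) powr (- (1 + \<theta>))) \<partial>rl b)" by (rule nn_integral_cmult) measurable
    also have "\<dots> \<le> ennreal K * ennreal (C * s powr (b - (1 + \<theta>)))" by (rule mult_left_mono[OF C[OF s]]) simp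
    also have "\<dots> < \<infinity>" by (simp add: ennreal_mult_less_top)
    finally show "(\<integral>\<^sup>+z. ennreal (norm (case z of (x, t) \<Rightarrow> f x * dt_conv \<phi> (t + s) x)) \<partial>(lborel \<Otimes>\<^sub>M rl b)) < \<infinity>" .
  qed
  show "integrable (rl b) (\<lambda>t. \<integral>x. f x * dt_conv \<phi> (t + s) x \<partial>lborel)" by (rule lborel_rl.integrable_snd[OF int])
  have "(\<integral>t. (\<integral>x. f x * dt_conv \<phi> (t + s) x \<partial>lborel) \<partial>rl b) = (\<integral>x. (\<integral>t. f x * dt_conv \<phi> (t + s) x \<partial>rl b) \<partial>lborel)"
    by (rule lborel_rl.Fubini_integral[OF int])
  then show "(\<integral>t. (\<integral>x. f x * dt_conv \<phi> (t + s) x \<partial>lborel) \<partial>rl b) = (\<integral>x. f x * (\<integral>t. dt_conv \<phi> (t + s) x \<partial>rl b) \<partial>lborel)"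
    by (simp only: integral_mult_right_zero)
qed

text \<open>The gradient of the heat smoothing of a scalar \<phi>. It turns scalar duality into a
  pairing with a vector field, the kind of object on which the variation acts.\<close>

definition grad_field :: "real \<Rightarrow> ('a::euclidean_space \<Rightarrow> real) \<Rightarrow> 'a \<Rightarrow> 'a" where
  "grad_field s \<phi> y = (\<integral>v. \<phi> v *\<^sub>R heat_grad s (y - v) \<partial>lborel)"

lemma
  fixes \<phi> :: "'a::euclidean_space \<Rightarrow> real"
  assumes s: "s > 0" and \<phi>: "bdd_int \<phi>"
  shows bdd_int_grad_field: "bdd_int (grad_field s \<phi>)"
    and integrable_grad_field: "integrable lborel (\<lambda>v. \<phi> v *\<^sub>R heat_grad s (y - v))"
proof -
  note [measurable] = bdd_intD(2)[OF \<phi>]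
  have hm: "(\<lambda>(y, v). \<phi> v *\<^sub>R heat_grad s (y - v)) \<in> borel_measurable (borel \<Otimes>\<^sub>M borel)" by measurable
  have h: "norm (\<phi> v *\<^sub>R heat_grad s (y - v)) \<le> norm (heat_grad s (y - v)) * norm (\<phi> v)" for y v by simp
  note cd = conv_dominated[OF integrable_norm[OF integrable_heat_grad[OF s]] bdd_int_norm[OF \<phi>] hm h]
  show "bdd_int (grad_field s \<phi>)" unfolding grad_field_def by (rule cd(2))
  show "integrable lborel (\<lambda>v. \<phi> v *\<^sub>R heat_grad s (y - v))" by (rule cd(1))
qed

text \<open>Divergence of a gradient again: the two kernels compose to \<open>4 * heat_dt\<close>.
  Fubini is justified by the boundedness of \<phi> and the integrability of both kernels.\<close>

lemma grad_conv_grad_field: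
  fixes \<phi> :: "'a::euclidean_space \<Rightarrow> real"
  assumes t: "t > 0" and s: "s > 0" and \<phi>: "bdd_int \<phi>"
  shows "grad_conv t (grad_field s \<phi>) x = 4 * dt_conv \<phi> (t + s) x"
proof -
  note [measurable] = bdd_intD(2)[OF \<phi>]
  obtain C where C: "C > 0" "\<And>x. norm (\<phi> x) \<le> C" using bdd_int_bound[OF \<phi>] by metis
  define D where "D = (\<integral>v. norm (heat_grad s v) \<partial>(lborel :: 'a measure))"
  have D: "(\<integral>\<^sup>+v. ennreal (norm (heat_grad s (y - v))) \<partial>lborel) = ennreal D" for y :: 'a
  proof -
    have "(\<integral>\<^sup>+v. ennreal (norm (heat_grad s (y - v))) \<partial>lborel) = (\<integral>\<^sup>+v. ennreal (norm (heat_grad s v)) \<partial>(lborel :: 'a measure))"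
      by (rule nn_integral_lborel_reflect) measurable
    also have "\<dots> = ennreal D" unfolding D_def
      by (rule nn_integral_eq_integral[OF integrable_norm[OF integrable_heat_grad[OF s]]]) simp
    finally show ?thesis .
  qed
  have D0: "D \<ge> 0" unfolding D_def by simp
  have int: "integrable (lborel \<Otimes>\<^sub>M lborel) (\<lambda>(y, v). heat_grad t (x - y) \<bullet> (\<phi> v *\<^sub>R heat_grad s (y - v)))"
  proof (rule integrableI_bounded)
    show "(\<lambda>(y, v). heat_grad t (x - y) \<bullet> (\<phi> v *\<^sub>R heat_grad s (y - v))) \<in> borel_measurable (lborel \<Otimes>\<^sub>M lborel)" by measurable
    have "(\<integral>\<^sup>+p. ennreal (norm (case p of (y, v) \<Rightarrow> heat_grad t (x - y) \<bullet> (\<phi> v *\<^sub>R heat_grad s (y - v)))) \<partial>(lborel \<Otimes>\<^sub>M lborel)) = (\<integral>\<^sup>+y. (\<integral>\<^sup>+v. ennreal (norm (heat_grad t (x - y) \<bullet> (\<phi> v *\<^sub>R heat_grad s (y - v)))) \<partial>lborel) \<partial>lborel)"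
      by (subst lborel.nn_integral_fst[symmetric]) (auto simp: split_beta')
    also have "\<dots> \<le> (\<integral>\<^sup>+y. ennreal (norm (C * D * norm (heat_grad t (x - y)))) \<partial>lborel)"
    proof (intro nn_integral_mono)
      fix y
      have "(\<integral>\<^sup>+v. ennreal (norm (heat_grad t (x - y) \<bullet> (\<phi> v *\<^sub>R heat_grad s (y - v)))) \<partial>lborel) \<le> (\<integral>\<^sup>+v. ennreal (C * norm (heat_grad t (x - y))) * ennreal (norm (heat_grad s (y - v))) \<partial>lborel)"
      proof (intro nn_integral_mono)
        fix v
        have "norm (heat_grad t (x - y) \<bullet> (\<phi> v *\<^sub>R heat_grad s (y - v))) \<le> norm (heat_grad t (x - y)) * norm (\<phi> v *\<^sub>R heat_grad s (y - v))"
          unfolding real_norm_def by (rule Cauchy_Schwarz_ineq2)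
        also have "\<dots> \<le> norm (heat_grad t (x - y)) * (C * norm (heat_grad s (y - v)))"
          unfolding norm_scaleR using C(2)[of v] by (intro mult_left_mono) (auto intro!: mult_right_mono)
        finally show "ennreal (norm (heat_grad t (x - y) \<bullet> (\<phi> v *\<^sub>R heat_grad s (y - v)))) \<le> ennreal (C * norm (heat_grad t (x - y))) * ennreal (norm (heat_grad s (y - v)))"
          using C(1) by (simp add: mult_ac flip: ennreal_mult)
      qed
      also have "\<dots> = ennreal (C * norm (heat_grad t (x - y))) * (\<integral>\<^sup>+v. ennreal (norm (heat_grad s (y - v))) \<partial>lborel)"
        by (rule nn_integral_cmult) measurable
      also have "\<dots> = ennreal (norm (C * D * norm (heat_grad t (x - y))))"
        unfolding D using C(1) D0 by (simp add: abs_mult mult_ac flip: ennreal_mult)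
      finally show "(\<integral>\<^sup>+v. ennreal (norm (heat_grad t (x - y) \<bullet> (\<phi> v *\<^sub>R heat_grad s (y - v)))) \<partial>lborel) \<le> ennreal (norm (C * D * norm (heat_grad t (x - y))))" .
    qed
    also have "\<dots> < \<infinity>"
    proof -
      have "integrable lborel (\<lambda>y. C * D * norm (heat_grad t (x - y)))"
        by (intro integrable_mult_right integrable_norm integrable_lborel_reflect[OF integrable_heat_grad[OF t]])
      then show ?thesis unfolding integrable_iff_bounded by blast
    qed
    finally show "(\<integral>\<^sup>+p. ennreal (norm (case p of (y, v) \<Rightarrow> heat_grad t (x - y) \<bullet> (\<phi> v *\<^sub>R heat_grad s (y - v)))) \<partial>(lborel \<Otimes>\<^sub>M lborel)) < \<infinity>" .
  qed
  have "grad_conv t (grad_field s \<phi>) x = (\<integral>y. (\<integral>v. heat_grad t (x - y) \<bullet> (\<phi> v *\<^sub>R heat_grad s (y - v)) \<partial>lborel) \<partial>lborel)"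
    unfolding grad_conv_def grad_field_def
    by (intro Bochner_Integration.integral_cong refl integral_inner_right[symmetric] integrable_grad_field[OF s \<phi>])
  also have "\<dots> = (\<integral>v. (\<integral>y. heat_grad t (x - y) \<bullet> (\<phi> v *\<^sub>R heat_grad s (y - v)) \<partial>lborel) \<partial>lborel)"
    using lborel_pair.Fubini_integral[OF int, symmetric] .
  also have "\<dots> = (\<integral>v. 4 * (heat_dt (t + s) (x - v) * \<phi> v) \<partial>lborel)"
  proof (rule Bochner_Integration.integral_cong[OF refl])
    fix v
    have "(\<integral>y. heat_grad t (x - y) \<bullet> (\<phi> v *\<^sub>R heat_grad s (y - v)) \<partial>lborel) = (\<integral>u. heat_grad t (x - (v + u)) \<bullet> (\<phi> v *\<^sub>R heat_grad s (v + u - v)) \<partial>lborel)"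
      by (rule integral_lborel_translate[symmetric]) measurable
    also have "\<dots> = (\<integral>u. \<phi> v * (heat_grad t (x - v - u) \<bullet> heat_grad s u) \<partial>lborel)"
      by (simp add: diff_diff_add)
    also have "\<dots> = \<phi> v * (4 * heat_dt (t + s) (x - v))"
      by (simp only: integral_mult_right_zero heat_grad_conv_heat_grad[OF t s])
    finally show "(\<integral>y. heat_grad t (x - y) \<bullet> (\<phi> v *\<^sub>R heat_grad s (y - v)) \<partial>lborel) = 4 * (heat_dt (t + s) (x - v) * \<phi> v)"
      by simp
  qed
  also have "\<dots> = 4 * dt_conv \<phi> (t + s) x" unfolding dt_conv_def by (rule integral_mult_right_zero)
  finally show ?thesis .
qed

text \<open>The gradient adds the factor \<open>s powr (-1/2)\<close> to
  \<open>heat_dual_bound\<close>. Its kernel is integrated last, so that the dual bound is applied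
  at the shifted points \<open>x - u\<close>, where it is uniform.\<close>

lemma grad_field_dual_bound:
  assumes q: "q \<ge> 1"
  obtains C where "C > 0" "\<And>s \<phi> (x::'a::euclidean_space). s > 0 \<Longrightarrow> dual_unit q (\<phi> :: 'a \<Rightarrow> real) \<Longrightarrow>
    (\<integral>\<^sup>+y. ennreal (heat s (x - y) * norm (grad_field s \<phi> y)) \<partial>lborel) \<le> ennreal (C * s powr (- (real DIM('a) * (1 - 1/q) / 2 + 1/2)))"
proof -
  define \<kappa> where "\<kappa> = real DIM('a) * (1 - 1/q) / 2"
  obtain C where C: "C > 0" "\<And>s \<phi> (x::'a). s > 0 \<Longrightarrow> dual_unit q (\<phi> :: 'a \<Rightarrow> real) \<Longrightarrow>
    (\<integral>\<^sup>+y. ennreal (heat s (x - y) * norm (\<phi> y)) \<partial>lborel) \<le> ennreal (C * s powr (- \<kappa>))"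
    unfolding \<kappa>_def by (rule heat_dual_bound[OF q, where 'a='a and 'b=real]) blast
  let ?k = "2 * heat_const TYPE('a)"
  have k: "?k > 0" using heat_const_pos[where 'a='a] by simp
  show thesis
  proof (rule that[of "?k * C"])
    show "?k * C > 0" using k C(1) by simp
    fix s :: real and \<phi> :: "'a \<Rightarrow> real" and x :: 'a assume s: "s > 0" and \<phi>: "dual_unit q \<phi>"
    note \<phi>b = dual_unit_bdd_int[OF \<phi>]
    note [measurable] = bdd_intD(2)[OF \<phi>b]
    have "(\<integral>\<^sup>+y. ennreal (heat s (x - y) * norm (grad_field s \<phi> y)) \<partial>lborel) \<le> (\<integral>\<^sup>+y. (\<integral>\<^sup>+v. ennreal (norm (heat_grad s (y - v)) * (heat s (x - y) * \<bar>\<phi> v\<bar>)) \<partial>lborel) \<partial>lborel)"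
    proof (intro nn_integral_mono)
      fix y
      have "ennreal (norm (grad_field s \<phi> y)) \<le> (\<integral>\<^sup>+v. ennreal (norm (\<phi> v *\<^sub>R heat_grad s (y - v))) \<partial>lborel)"
        unfolding grad_field_def by (rule integral_norm_bound_ennreal[OF integrable_grad_field[OF s \<phi>b]])
      then have "ennreal (heat s (x - y)) * ennreal (norm (grad_field s \<phi> y)) \<le> ennreal (heat s (x - y)) * (\<integral>\<^sup>+v. ennreal (norm (\<phi> v *\<^sub>R heat_grad s (y - v))) \<partial>lborel)"
        by (rule mult_left_mono) simp
      also have "\<dots> = (\<integral>\<^sup>+v. ennreal (heat s (x - y)) * ennreal (norm (\<phi> v *\<^sub>R heat_grad s (y - v))) \<partial>lborel)"
        by (rule nn_integral_cmult[symmetric]) measurable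
      also have "\<dots> = (\<integral>\<^sup>+v. ennreal (norm (heat_grad s (y - v)) * (heat s (x - y) * \<bar>\<phi> v\<bar>)) \<partial>lborel)"
        by (intro nn_integral_cong) (simp add: mult_ac flip: ennreal_mult)
      finally show "ennreal (heat s (x - y) * norm (grad_field s \<phi> y)) \<le> (\<integral>\<^sup>+v. ennreal (norm (heat_grad s (y - v)) * (heat s (x - y) * \<bar>\<phi> v\<bar>)) \<partial>lborel)"
        by (simp add: ennreal_mult)
    qed
    also have "\<dots> = (\<integral>\<^sup>+v. (\<integral>\<^sup>+y. ennreal (norm (heat_grad s (y - v)) * (heat s (x - y) * \<bar>\<phi> v\<bar>)) \<partial>lborel) \<partial>lborel)"
      by (rule lborel_pair.Fubini') measurable
    also have "\<dots> = (\<integral>\<^sup>+v. (\<integral>\<^sup>+u. ennreal (norm (heat_grad s (v + u - v)) * (heat s (x - (v + u)) * \<bar>\<phi> v\<bar>)) \<partial>lborel) \<partial>lborel)"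
      by (intro nn_integral_cong nn_integral_lborel_translate[symmetric]) measurable
    also have "\<dots> = (\<integral>\<^sup>+v. (\<integral>\<^sup>+u. ennreal (norm (heat_grad s u)) * ennreal (heat s (x - u - v) * norm (\<phi> v)) \<partial>lborel) \<partial>lborel)"
      by (intro nn_integral_cong) (simp add: diff_diff_eq add.commute flip: ennreal_mult)
    also have "\<dots> = (\<integral>\<^sup>+u. (\<integral>\<^sup>+v. ennreal (norm (heat_grad s u)) * ennreal (heat s (x - u - v) * norm (\<phi> v)) \<partial>lborel) \<partial>lborel)"
      by (rule lborel_pair.Fubini') measurable
    also have "\<dots> \<le> (\<integral>\<^sup>+u. ennreal (?k * s powr (-1/2) * (C * s powr (- \<kappa>))) * ennreal (heat (2 * s) u) \<partial>(lborel :: 'a measure))"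
    proof (intro nn_integral_mono)
      fix u :: 'a
      have "(\<integral>\<^sup>+v. ennreal (norm (heat_grad s u)) * ennreal (heat s (x - u - v) * norm (\<phi> v)) \<partial>lborel) = ennreal (norm (heat_grad s u)) * (\<integral>\<^sup>+v. ennreal (heat s (x - u - v) * norm (\<phi> v)) \<partial>lborel)"
        by (rule nn_integral_cmult) measurable
      also have "\<dots> \<le> ennreal (?k * s powr (-1/2) * heat (2 * s) u) * ennreal (C * s powr (- \<kappa>))"
        by (intro mult_mono ennreal_leI norm_heat_grad_le[OF s] C(2)[OF s \<phi>]) auto
      also have "\<dots> = ennreal (?k * s powr (-1/2) * (C * s powr (- \<kappa>))) * ennreal (heat (2 * s) u)"
        using k C(1) by (simp add: mult_ac flip: ennreal_mult)
      finally show "(\<integral>\<^sup>+v. ennreal (norm (heat_grad s u)) * ennreal (heat s (x - u - v) * norm (\<phi> v)) \<partial>lborel) \<le> ennreal (?k * s powr (-1/2) * (C * s powr (- \<kappa>))) * ennreal (heat (2 * s) u)" .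
    qed
    also have "\<dots> = ennreal (?k * s powr (-1/2) * (C * s powr (- \<kappa>)))"
      using s nn_integral_heat[of "2 * s", where 'a='a] by (simp add: nn_integral_cmult)
    also have "?k * s powr (-1/2) * (C * s powr (- \<kappa>)) = ?k * C * (s powr (- \<kappa>) * s powr (-1/2))" by (simp only: mult_ac)
    also have "s powr (- \<kappa>) * s powr (-1/2) = s powr (- (\<kappa> + 1/2))" unfolding powr_add[symmetric] by simp
    finally show "(\<integral>\<^sup>+y. ennreal (heat s (x - y) * norm (grad_field s \<phi> y)) \<partial>lborel) \<le> ennreal (?k * C * s powr (- (real DIM('a) * (1 - 1/q) / 2 + 1/2)))"
      unfolding \<kappa>_def .
  qed
qed

text \<open>The time integral has order 1, split as e + b with b = (1 - \<alpha>)/2: the inner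
  average is a divergence of order \<alpha> and sees the variation, the outer one is estimated by
  powers. Convergence near 0 requires e - \<kappa> = (\<alpha> - n (1 - 1/q))/2 > 0; at infinity it
  comes from \<theta> > 0, that is, from p < q. The constant does not depend on \<delta>.\<close>

lemma heat_conv_var_bound:
  fixes p q \<alpha> :: real
  assumes \<alpha>: "0 < \<alpha>" "\<alpha> \<le> 1" and p: "1 \<le> p" and pq: "p < q"
    and sub: "real DIM('a::euclidean_space) * (1 - 1/q) < \<alpha>"
  obtains C where "C \<ge> 0" "\<And>(f :: 'a \<Rightarrow> real) N V \<phi> \<delta>. Lp_bound p f N \<Longrightarrow> var_bound \<alpha> f V \<Longrightarrow> dual_unit q (\<phi> :: 'a \<Rightarrow> real) \<Longrightarrow> \<delta> > 0 \<Longrightarrow>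
    \<bar>\<integral>x. f x * heat_conv \<phi> \<delta> x \<partial>lborel\<bar> \<le> C * (N + V)"
proof -
  define b where "b = (1 - \<alpha>) / 2"
  define e where "e = 1 - b"
  define \<theta> where "\<theta> = real DIM('a) * (1/p - 1/q) / 2"
  define \<kappa> where "\<kappa> = real DIM('a) * (1 - 1/q) / 2 + 1/2"
  have q: "q \<ge> 1" using p pq by simp
  have b: "0 \<le> b" "b < 1/2" and e: "e > 0" "e + b = 1" using \<alpha> by (auto simp: b_def e_def)
  have "1/q < 1/p" using p pq by (simp add: frac_less2)
  then have \<theta>: "\<theta> > 0" unfolding \<theta>_def by simp
  have "0 \<le> 1 - 1/q" using q by simp
  define \<omega> where "\<omega> = real DIM('a) * (1 - 1/q)"
  have "0 \<le> \<omega>" "\<omega> < \<alpha>" using sub \<open>0 \<le> 1 - 1/q\<close> by (simp_all add: \<omega>_def)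
  then have \<kappa>: "0 < e + - \<kappa>" "\<kappa> > 0" unfolding e_def b_def \<kappa>_def \<omega>_def[symmetric] by (auto simp: field_simps)
  obtain K where K: "K \<ge> 0" "\<And>(f :: 'a \<Rightarrow> real) N \<tau> (\<phi> :: 'a \<Rightarrow> real). Lp_bound p f N \<Longrightarrow> \<tau> > 0 \<Longrightarrow> dual_unit q \<phi> \<Longrightarrow>
    (\<integral>\<^sup>+x. ennreal \<bar>f x * dt_conv \<phi> \<tau> x\<bar> \<partial>lborel) \<le> ennreal (K * N * \<tau> powr (- (1 + \<theta>)))"
    unfolding \<theta>_def by (rule dt_conv_pairing[OF p pq, where 'a='a]) blast
  obtain Cv where Cv: "Cv \<ge> 0"
    "\<And>(f :: 'a \<Rightarrow> real) p N V s \<phi> S. p \<ge> 1 \<Longrightarrow> Lp_bound p f N \<Longrightarrow> var_bound \<alpha> f V \<Longrightarrow> s > 0 \<Longrightarrow>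
      bdd_int \<phi> \<Longrightarrow> S > 0 \<Longrightarrow> (\<And>x. (\<integral>\<^sup>+y. ennreal (heat s (x - y) * norm (\<phi> y)) \<partial>lborel) \<le> ennreal S) \<Longrightarrow>
      \<bar>\<integral>x. f x * frac_grad_conv b s \<phi> x \<partial>lborel\<bar> \<le> Cv * V * S"
    using \<alpha> unfolding b_def by (rule_tac var_bound_heat_pairing[where 'a='a and \<alpha>=\<alpha>]) auto
  obtain Cg where Cg: "Cg > 0" "\<And>s \<phi> (x::'a). s > 0 \<Longrightarrow> dual_unit q (\<phi> :: 'a \<Rightarrow> real) \<Longrightarrow>
    (\<integral>\<^sup>+y. ennreal (heat s (x - y) * norm (grad_field s \<phi> y)) \<partial>lborel) \<le> ennreal (Cg * s powr (- \<kappa>))"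
    unfolding \<kappa>_def by (rule grad_field_dual_bound[OF q, where 'a='a]) blast
  have b\<theta>: "b < 1 + \<theta>" using b \<theta> by simp
  obtain Cs where Cs: "Cs \<ge> 0" "\<And>s. s > 0 \<Longrightarrow> (\<integral>\<^sup>+t. ennreal ((t + s) powr (- (1 + \<theta>))) \<partial>rl b) \<le> ennreal (Cs * s powr (b - (1 + \<theta>)))"
    using rl_shift_bound[OF b(1) b\<theta>] by metis
  note B = rl_beta_pos[OF e(1) b(1)]
  \<comment> \<open>The two parts of the outer integral: \<open>A1\<close> will multiply the
    variation, \<open>A2\<close> the norm of \<open>f\<close>.\<close>
  define A1 where "A1 = Cv * Cg * (1/2) powr (- \<kappa>) / 4 / (e - \<kappa>)"
  define A2 where "A2 = K * Cs / \<theta>"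
  have A: "A1 \<ge> 0" "A2 \<ge> 0" using Cv(1) Cg(1) K(1) Cs(1) \<kappa> \<theta> by (auto simp: A1_def A2_def)
  show thesis
  proof (rule that[of "(A1 + A2) / rl_beta e b"])
    show "(A1 + A2) / rl_beta e b \<ge> 0" using A B by simp
    fix f :: "'a \<Rightarrow> real" and N V and \<phi> :: "'a \<Rightarrow> real" and \<delta> :: real
    assume f: "Lp_bound p f N" and V: "var_bound \<alpha> f V" and \<phi>: "dual_unit q \<phi>" and \<delta>: "\<delta> > 0"
    have N0: "N \<ge> 0" and V0: "V \<ge> 0" and [measurable]: "f \<in> borel_measurable borel" using f V by (auto simp: Lp_bound_def var_bound_def)
    note \<phi>b = dual_unit_bdd_int[OF \<phi>]
    note [measurable] = bdd_intD(2)[OF \<phi>b]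
    \<comment> \<open>\<open>l\<close> pairs \<open>f\<close> with the time derivative of the
      smoothed \<phi>. Its average \<open>u\<close> against \<open>rl b\<close> has two bounds,
      \<open>u1\<close> from the norm of \<open>f\<close> and \<open>u2\<close> from the
      variation.\<close>
    define l where "l \<tau> = (\<integral>x. f x * dt_conv \<phi> \<tau> x \<partial>lborel)" for \<tau>
    have [measurable]: "l \<in> borel_measurable borel" unfolding l_def by measurable
    have KN: "K * N \<ge> 0" using K(1) N0 by simp
    note lnn = K(2)[OF f _ \<phi>]
    have lb: "ennreal \<bar>l \<tau>\<bar> \<le> ennreal (K * N * \<tau> powr (- (1 + \<theta>)))" if "\<tau> > 0" for \<tau>
    proof -
      have "integrable lborel (\<lambda>x. f x * dt_conv \<phi> \<tau> x)"
        using le_less_trans[OF lnn[OF that]] by (intro integrableI_bounded) auto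
      from integral_norm_bound_ennreal[OF this] show ?thesis
        unfolding l_def real_norm_def using lnn[OF that] by (rule order_trans)
    qed
    define u where "u s = (\<integral>t. l (t + s) \<partial>rl b)" for s
    have u1: "\<bar>u s\<bar> \<le> K * N * Cs * s powr (b - (1 + \<theta>))" if s: "s > 0" for s
    proof -
      have "ennreal \<bar>u s\<bar> \<le> (\<integral>\<^sup>+t. ennreal (norm (l (t + s))) \<partial>rl b)"
        unfolding u_def real_norm_def[symmetric] l_def
        by (rule integral_norm_bound_ennreal[OF heat_pairing_swap(1)[OF f \<phi>b s b(1) b\<theta> KN lnn]])
      also have "\<dots> \<le> (\<integral>\<^sup>+t. ennreal (K * N) * ennreal ((t + s) powr (- (1 + \<theta>))) \<partial>rl b)"
      proof (rule nn_integral_mono_AE, use AE_rl_nonneg in eventually_elim)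
        fix t :: real assume "0 \<le> t"
        then show "ennreal (norm (l (t + s))) \<le> ennreal (K * N) * ennreal ((t + s) powr (- (1 + \<theta>)))"
          using lb[of "t + s"] s unfolding real_norm_def ennreal_mult[OF KN powr_ge_zero] by simp
      qed
      also have "\<dots> = ennreal (K * N) * (\<integral>\<^sup>+t. ennreal ((t + s) powr (- (1 + \<theta>))) \<partial>rl b)" by (rule nn_integral_cmult) measurable
      also have "\<dots> \<le> ennreal (K * N) * ennreal (Cs * s powr (b - (1 + \<theta>)))" by (rule mult_left_mono[OF Cs(2)[OF s]]) simp
      also have "\<dots> = ennreal (K * N * Cs * s powr (b - (1 + \<theta>)))" using KN Cs(1) by (simp add: mult.assoc flip: ennreal_mult)
      finally show ?thesis using KN Cs(1) by (subst (asm) ennreal_le_iff) auto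
    qed
    have u2: "\<bar>u s\<bar> \<le> Cv * V * Cg * (1/2) powr (- \<kappa>) / 4 * s powr (- \<kappa>)" if s: "s > 0" for s
    proof -
      \<comment> \<open>The time \<open>s\<close> is halved: one half goes into the gradient field,
        the other remains as smoothing time for the variation estimate.\<close>
      have s2: "s / 2 > 0" using s by simp
      have "u s = (\<integral>x. f x * (\<integral>t. dt_conv \<phi> (t + s) x \<partial>rl b) \<partial>lborel)"
        unfolding u_def l_def by (rule heat_pairing_swap(2)[OF f \<phi>b s b(1) b\<theta> KN lnn])
      also have "\<dots> = (\<integral>x. (1/4) * (f x * frac_grad_conv b (s/2) (grad_field (s/2) \<phi>) x) \<partial>lborel)"
      proof (rule Bochner_Integration.integral_cong[OF refl])
        fix x
        note gb = bdd_int_grad_field[OF s2 \<phi>b]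
        note [measurable] = bdd_intD(2)[OF gb]
        have "frac_grad_conv b (s/2) (grad_field (s/2) \<phi>) x = (\<integral>t. grad_conv (t + s/2) (grad_field (s/2) \<phi>) x \<partial>rl b)"
          by (rule frac_grad_conv_eq[OF b s2 gb])
        also have "\<dots> = (\<integral>t. 4 * dt_conv \<phi> (t + s) x \<partial>rl b)"
        proof (rule integral_cong_AE, measurable, use AE_rl_nonneg in eventually_elim)
          fix t :: real assume "0 \<le> t"
          then have "t + s/2 > 0" using s by simp
          from grad_conv_grad_field[OF this s2 \<phi>b] show "grad_conv (t + s/2) (grad_field (s/2) \<phi>) x = 4 * dt_conv \<phi> (t + s) x" by (simp add: add.commute)
        qed
        also have "\<dots> = 4 * (\<integral>t. dt_conv \<phi> (t + s) x \<partial>rl b)" by (rule integral_mult_right_zero)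
        finally show "f x * (\<integral>t. dt_conv \<phi> (t + s) x \<partial>rl b) = (1/4) * (f x * frac_grad_conv b (s/2) (grad_field (s/2) \<phi>) x)" by simp
      qed
      also have "\<dots> = (1/4) * (\<integral>x. f x * frac_grad_conv b (s/2) (grad_field (s/2) \<phi>) x \<partial>lborel)" by (rule integral_mult_right_zero)
      finally have "\<bar>u s\<bar> = \<bar>\<integral>x. f x * frac_grad_conv b (s/2) (grad_field (s/2) \<phi>) x \<partial>lborel\<bar> / 4" by simp
      also have "\<dots> \<le> Cv * V * (Cg * (s/2) powr (- \<kappa>)) / 4"
        using Cg(1) s by (intro divide_right_mono Cv(2)[OF p f V s2 bdd_int_grad_field[OF s2 \<phi>b]] Cg(2)[OF s2 \<phi>]) auto
      also have "(s/2) powr (- \<kappa>) = (1/2) powr (- \<kappa>) * s powr (- \<kappa>)" using s by (subst powr_mult[symmetric]) auto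
      finally show ?thesis by (simp add: mult_ac)
    qed
    have \<theta>1: "(1::real) < 1 + \<theta>" using \<theta> by simp
    have I: "integrable (rl (e + b)) (\<lambda>\<tau>. l (\<tau> + \<delta>))"
      unfolding e(2) l_def by (rule heat_pairing_swap(1)[OF f \<phi>b \<delta> _ \<theta>1 KN lnn]) simp
    have "(\<integral>\<tau>. l (\<tau> + \<delta>) \<partial>rl 1) = (\<integral>x. f x * (\<integral>\<tau>. dt_conv \<phi> (\<tau> + \<delta>) x \<partial>rl 1) \<partial>lborel)"
      unfolding l_def by (rule heat_pairing_swap(2)[OF f \<phi>b \<delta> _ \<theta>1 KN lnn]) simp
    also have "\<dots> = - (\<integral>x. f x * heat_conv \<phi> \<delta> x \<partial>lborel)"
      by (simp add: heat_conv_eq_integral_dt[OF \<delta> \<phi>b])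
    finally have h: "(\<integral>\<tau>. l (\<tau> + \<delta>) \<partial>rl (e + b)) = - (\<integral>x. f x * heat_conv \<phi> \<delta> x \<partial>lborel)" unfolding e(2) .
    have "(\<integral>s. (\<integral>t. l (s + t + \<delta>) \<partial>rl b) \<partial>rl e) = rl_beta e b * (\<integral>\<tau>. l (\<tau> + \<delta>) \<partial>rl (e + b))"
      by (rule integral_rl_rl(2)[OF e(1) b(1) I])
    moreover have "(\<integral>t. l (s + t + \<delta>) \<partial>rl b) = u (s + \<delta>)" for s unfolding u_def by (simp add: ac_simps)
    ultimately have main: "(\<integral>s. u (s + \<delta>) \<partial>rl e) = - (rl_beta e b * (\<integral>x. f x * heat_conv \<phi> \<delta> x \<partial>lborel))" unfolding h by simp
    have [measurable]: "u \<in> borel_measurable borel" unfolding u_def by measurable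
    let ?c1 = "Cv * V * Cg * (1/2) powr (- \<kappa>) / 4"
    have c1: "?c1 \<ge> 0" using Cv(1) V0 Cg(1) by simp
    have c2: "K * N * Cs \<ge> 0" using KN Cs(1) by simp
    have nn: "(\<integral>\<^sup>+s. ennreal \<bar>u (s + \<delta>)\<bar> \<partial>rl e) \<le> ennreal (?c1 * (1 powr (e + - \<kappa>) / (e + - \<kappa>)) + (K * N * Cs) * (1 powr (- \<theta>) / \<theta>))"
    proof (rule nn_integral_rl_split)
      fix s :: real
      { assume s: "0 < s" "s < 1"
        \<comment> \<open>The bounds for \<open>u\<close> decrease in the time, so the shift by
          \<delta> only helps and the estimate is uniform in it.\<close>
        have "\<bar>u (s + \<delta>)\<bar> \<le> ?c1 * (s + \<delta>) powr (- \<kappa>)" using s \<delta> by (intro u2) simp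
        also have "\<dots> \<le> ?c1 * s powr (- \<kappa>)" using s \<delta> \<kappa> c1 by (intro mult_left_mono powr_mono2') auto
        finally show "ennreal \<bar>u (s + \<delta>)\<bar> \<le> ennreal (?c1 * s powr (- \<kappa>))" by (rule ennreal_leI) }
      { assume s: "1 \<le> s"
        have eq: "b - (1 + \<theta>) = - e - \<theta>" by (simp add: e_def)
        have "\<bar>u (s + \<delta>)\<bar> \<le> K * N * Cs * (s + \<delta>) powr (- e - \<theta>)" unfolding eq[symmetric] using s \<delta> by (intro u1) simp
        also have "\<dots> \<le> K * N * Cs * s powr (- e - \<theta>)" using s \<delta> e \<theta> c2 by (intro mult_left_mono powr_mono2') auto
        finally show "ennreal \<bar>u (s + \<delta>)\<bar> \<le> ennreal (K * N * Cs * s powr (- e - \<theta>))" by (rule ennreal_leI) }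
    qed (use e \<kappa> \<theta> c1 c2 in auto)
    also have "?c1 * (1 powr (e + - \<kappa>) / (e + - \<kappa>)) + (K * N * Cs) * (1 powr (- \<theta>) / \<theta>) = A1 * V + A2 * N"
      by (simp add: A1_def A2_def mult_ac)
    also have "ennreal (A1 * V + A2 * N) \<le> ennreal ((A1 + A2) * (N + V))"
      using A N0 V0 mult_nonneg_nonneg[OF A(1) N0] mult_nonneg_nonneg[OF A(2) V0] by (intro ennreal_leI) (simp add: algebra_simps)
    finally have nn: "(\<integral>\<^sup>+s. ennreal \<bar>u (s + \<delta>)\<bar> \<partial>rl e) \<le> ennreal ((A1 + A2) * (N + V))" .
    then have "integrable (rl e) (\<lambda>s. u (s + \<delta>))"
      by (intro integrableI_bounded) (auto intro: le_less_trans)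
    from integral_norm_bound_ennreal[OF this] have "ennreal \<bar>\<integral>s. u (s + \<delta>) \<partial>rl e\<bar> \<le> ennreal ((A1 + A2) * (N + V))"
      unfolding real_norm_def using nn by (rule order_trans)
    then have "rl_beta e b * \<bar>\<integral>x. f x * heat_conv \<phi> \<delta> x \<partial>lborel\<bar> \<le> (A1 + A2) * (N + V)"
      unfolding main using A N0 V0 B by (subst (asm) ennreal_le_iff) (auto simp: abs_mult)
    then show "\<bar>\<integral>x. f x * heat_conv \<phi> \<delta> x \<partial>lborel\<bar> \<le> (A1 + A2) / rl_beta e b * (N + V)"
      using B by (simp add: field_simps)
  qed
qed

section \<open>Letting the smoothing time tend to zero\<close>

lemma heat_conv_scaled:
  fixes \<phi> :: "'a::euclidean_space \<Rightarrow> real"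
  assumes r: "r > 0" and [measurable]: "\<phi> \<in> borel_measurable borel"
  shows "heat_conv \<phi> (r\<^sup>2) x = (\<integral>v. heat 1 v * \<phi> (x - r *\<^sub>R v) \<partial>lborel)"
proof -
  have "heat_conv \<phi> (r\<^sup>2) x = (\<integral>z. heat (r\<^sup>2) (x - (x - z)) * \<phi> (x - z) \<partial>lborel)"
    unfolding heat_conv_def by (rule integral_lborel_reflect[symmetric]) measurable
  also have "\<dots> = (\<integral>z. heat (r\<^sup>2) z * \<phi> (x - z) \<partial>lborel)" by simp
  also have "\<dots> = (\<integral>v. r ^ DIM('a) * (heat (r\<^sup>2) (r *\<^sub>R v) * \<phi> (x - r *\<^sub>R v)) \<partial>lborel)"
    using r by (subst lborel_affine[of r 0]) (simp_all add: integral_density integral_distr ennreal_power)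
  also have "\<dots> = (\<integral>v. heat 1 v * \<phi> (x - r *\<^sub>R v) \<partial>lborel)"
  proof (rule Bochner_Integration.integral_cong[OF refl])
    fix v :: 'a
    have "r ^ DIM('a) * (r\<^sup>2) powr (- real DIM('a) / 2) = 1"
    proof -
      have "(r\<^sup>2) powr (- real DIM('a) / 2) = (r powr 2) powr (- real DIM('a) / 2)" using r by simp
      also have "\<dots> = r powr (- real DIM('a))" by (simp add: powr_powr)
      finally show ?thesis using r by (simp add: powr_minus powr_realpow)
    qed
    then have "r ^ DIM('a) * heat (r\<^sup>2) (r *\<^sub>R v) = heat 1 v"
      unfolding heat_def using r by (simp add: power_mult_distrib flip: mult.assoc)
    then show "r ^ DIM('a) * (heat (r\<^sup>2) (r *\<^sub>R v) * \<phi> (x - r *\<^sub>R v)) = heat 1 v * \<phi> (x - r *\<^sub>R v)"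
      by (simp flip: mult.assoc)
  qed
  finally show ?thesis .
qed

text \<open>Scaling puts the time into the argument, and Fubini leaves a fixed Gaussian average of
  \<open>\<psi> (r *\<^sub>R v)\<close>, where \<open>\<psi> u\<close> pairs \<open>f\<close> with
  the translate of \<phi> by \<open>u\<close>. \<psi> is bounded and tends to
  \<open>\<psi> 0\<close> along the arguments in question, so dominated convergence applies.\<close>

lemma heat_conv_pairing_tendsto:
  fixes f \<phi> :: "'a::euclidean_space \<Rightarrow> real"
  assumes p: "p \<ge> 1" and f: "Lp_bound p f N" and \<phi>c: "continuous_on UNIV \<phi>" and \<phi>B: "\<And>x. norm (\<phi> x) \<le> B" and \<phi>R: "\<And>x. R < norm x \<Longrightarrow> \<phi> x = 0"
  shows "(\<lambda>k. \<integral>x. f x * heat_conv \<phi> ((1 / real (Suc k))\<^sup>2) x \<partial>lborel) \<longlonglongrightarrow> (\<integral>x. f x * \<phi> x \<partial>lborel)"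
proof -
  have [measurable]: "f \<in> borel_measurable borel" using f by (auto simp: Lp_bound_def)
  have \<phi>m[measurable]: "\<phi> \<in> borel_measurable borel" using \<phi>c by (rule borel_measurable_continuous_onI)
  have B0: "B \<ge> 0" using order_trans[OF norm_ge_zero \<phi>B[of 0]] .
  have ballb: "bdd_int (\<lambda>x::'a. B * indicator (cball 0 \<rho>) x)" for \<rho>
  proof -
    have "integrable lborel (\<lambda>x::'a. indicator (cball 0 \<rho>) x :: real)"
      using emeasure_bounded_finite[of "cball (0::'a) \<rho>"] by auto
    then have "bdd_int (\<lambda>x::'a. indicator (cball 0 \<rho>) x :: real)"
      unfolding bdd_int_def by (intro conjI exI[of _ 1] allI) (assumption, simp add: indicator_def)
    then show ?thesis by (rule bdd_int_cmult)
  qed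
  have \<phi>le: "norm (\<phi> x) \<le> B * indicator (cball 0 R) x" for x using \<phi>B[of x] \<phi>R[of x] by (auto simp: indicator_def not_le)
  have \<phi>b: "bdd_int \<phi>" by (rule bdd_int_dominated[OF ballb \<phi>m \<phi>le])
  define \<psi> where "\<psi> u = (\<integral>x. f x * \<phi> (x - u) \<partial>lborel)" for u
  have [measurable]: "\<psi> \<in> borel_measurable borel" unfolding \<psi>_def by measurable
  have fi: "integrable lborel (\<lambda>x. f x * \<phi> (x - u))" for u by (rule integrable_Lp_mult[OF p f bdd_int_translate[OF \<phi>b]])
  \<comment> \<open>A bound uniform in the translation, by the same splitting at |f| = 1 as in
    \<open>integrable_Lp_mult\<close>.\<close>
  obtain S where S: "S \<ge> 0" "\<And>u. (\<integral>\<^sup>+x. ennreal \<bar>f x * \<phi> (x - u)\<bar> \<partial>lborel) \<le> ennreal S"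
  proof
    let ?S = "(\<integral>x. \<bar>\<phi> x\<bar> \<partial>lborel) + B * N powr p"
    show "?S \<ge> 0" using B0 by simp
    fix u
    have "(\<integral>\<^sup>+x. ennreal \<bar>f x * \<phi> (x - u)\<bar> \<partial>lborel) \<le> (\<integral>\<^sup>+x. ennreal \<bar>\<phi> (- u + x)\<bar> + ennreal B * ennreal (\<bar>f x\<bar> powr p) \<partial>lborel)"
    proof (intro nn_integral_mono)
      fix x
      have "\<bar>f x\<bar> * \<bar>\<phi> (x - u)\<bar> \<le> \<bar>\<phi> (x - u)\<bar> + B * \<bar>f x\<bar> powr p"
      proof (cases "\<bar>f x\<bar> \<le> 1")
        case True
        then have "\<bar>f x\<bar> * \<bar>\<phi> (x - u)\<bar> \<le> \<bar>\<phi> (x - u)\<bar>" by (simp add: mult_left_le_one_le)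
        then show ?thesis using B0 by (simp add: add_increasing2)
      next
        case False
        then have "\<bar>f x\<bar> powr 1 \<le> \<bar>f x\<bar> powr p" using p by (intro powr_mono) auto
        then have "\<bar>f x\<bar> * \<bar>\<phi> (x - u)\<bar> \<le> \<bar>f x\<bar> powr p * B" using False \<phi>B[of "x - u"] by (intro mult_mono) auto
        then show ?thesis by (simp add: mult.commute add_increasing)
      qed
      then show "ennreal \<bar>f x * \<phi> (x - u)\<bar> \<le> ennreal \<bar>\<phi> (- u + x)\<bar> + ennreal B * ennreal (\<bar>f x\<bar> powr p)"
        using B0 by (simp add: abs_mult flip: ennreal_mult ennreal_plus)
    qed
    also have "\<dots> = (\<integral>\<^sup>+x. ennreal \<bar>\<phi> (- u + x)\<bar> \<partial>lborel) + ennreal B * (\<integral>\<^sup>+x. ennreal (\<bar>f x\<bar> powr p) \<partial>lborel)"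
      by (simp add: nn_integral_add nn_integral_cmult)
    also have "(\<integral>\<^sup>+x. ennreal \<bar>\<phi> (- u + x)\<bar> \<partial>lborel) = (\<integral>\<^sup>+x. ennreal \<bar>\<phi> x\<bar> \<partial>lborel)"
      by (rule nn_integral_lborel_translate) measurable
    also have "\<dots> = ennreal (\<integral>x. \<bar>\<phi> x\<bar> \<partial>lborel)"
      by (rule nn_integral_eq_integral[OF integrable_abs[OF bdd_intD(1)[OF \<phi>b]]]) simp
    also have "ennreal (\<integral>x. \<bar>\<phi> x\<bar> \<partial>lborel) + ennreal B * (\<integral>\<^sup>+x. ennreal (\<bar>f x\<bar> powr p) \<partial>lborel) \<le> ennreal (\<integral>x. \<bar>\<phi> x\<bar> \<partial>lborel) + ennreal B * ennreal (N powr p)"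
      using f by (intro add_left_mono mult_left_mono) (auto simp: Lp_bound_def)
    also have "\<dots> = ennreal ?S" using B0 by (simp flip: ennreal_mult ennreal_plus)
    finally show "(\<integral>\<^sup>+x. ennreal \<bar>f x * \<phi> (x - u)\<bar> \<partial>lborel) \<le> ennreal ?S" .
  qed
  have \<psi>S: "\<bar>\<psi> u\<bar> \<le> S" for u
  proof -
    have "ennreal (norm (\<psi> u)) \<le> ennreal S"
      unfolding \<psi>_def using integral_norm_bound_ennreal[OF fi[of u]] S(2)[of u] by (auto intro: order_trans)
    then show ?thesis using S(1) by (simp add: ennreal_le_iff)
  qed
  have h: "(\<integral>x. f x * heat_conv \<phi> (r\<^sup>2) x \<partial>lborel) = (\<integral>v. heat 1 v * \<psi> (r *\<^sub>R v) \<partial>lborel)" if r: "r > 0" for r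
  proof -
    have int: "integrable (lborel \<Otimes>\<^sub>M lborel) (\<lambda>(v, x). heat 1 v * (f x * \<phi> (x - r *\<^sub>R v)))"
    proof (rule integrableI_bounded)
      show "(\<lambda>(v, x). heat 1 v * (f x * \<phi> (x - r *\<^sub>R v))) \<in> borel_measurable (lborel \<Otimes>\<^sub>M lborel)" by measurable
      have "(\<integral>\<^sup>+z. ennreal (norm (case z of (v, x) \<Rightarrow> heat 1 v * (f x * \<phi> (x - r *\<^sub>R v)))) \<partial>(lborel \<Otimes>\<^sub>M lborel)) = (\<integral>\<^sup>+v. (\<integral>\<^sup>+x. ennreal (norm (heat 1 v * (f x * \<phi> (x - r *\<^sub>R v)))) \<partial>lborel) \<partial>lborel)"
        by (subst lborel.nn_integral_fst[symmetric]) (auto simp: split_beta')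
      also have "\<dots> \<le> (\<integral>\<^sup>+v. ennreal S * ennreal (heat 1 v) \<partial>(lborel :: 'a measure))"
      proof (intro nn_integral_mono)
        fix v :: 'a
        have "(\<integral>\<^sup>+x. ennreal (norm (heat 1 v * (f x * \<phi> (x - r *\<^sub>R v)))) \<partial>lborel) = (\<integral>\<^sup>+x. ennreal (heat 1 v) * ennreal \<bar>f x * \<phi> (x - r *\<^sub>R v)\<bar> \<partial>lborel)"
          by (intro nn_integral_cong) (simp add: abs_mult[of "heat 1 v"] ennreal_mult)
        also have "\<dots> = ennreal (heat 1 v) * (\<integral>\<^sup>+x. ennreal \<bar>f x * \<phi> (x - r *\<^sub>R v)\<bar> \<partial>lborel)" by (rule nn_integral_cmult) measurable
        also have "\<dots> \<le> ennreal (heat 1 v) * ennreal S" by (rule mult_left_mono[OF S(2)]) simp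
        finally show "(\<integral>\<^sup>+x. ennreal (norm (heat 1 v * (f x * \<phi> (x - r *\<^sub>R v)))) \<partial>lborel) \<le> ennreal S * ennreal (heat 1 v)" by (simp add: mult.commute)
      qed
      also have "\<dots> = ennreal S" using nn_integral_heat[of 1, where 'a='a] by (simp add: nn_integral_cmult)
      also have "\<dots> < \<infinity>" by simp
      finally show "(\<integral>\<^sup>+z. ennreal (norm (case z of (v, x) \<Rightarrow> heat 1 v * (f x * \<phi> (x - r *\<^sub>R v)))) \<partial>(lborel \<Otimes>\<^sub>M lborel)) < \<infinity>" .
    qed
    have "(\<integral>x. f x * heat_conv \<phi> (r\<^sup>2) x \<partial>lborel) = (\<integral>x. (\<integral>v. heat 1 v * (f x * \<phi> (x - r *\<^sub>R v)) \<partial>lborel) \<partial>lborel)"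
      unfolding heat_conv_scaled[OF r \<phi>m] by (simp only: mult.left_commute[of "heat 1 _"] integral_mult_right_zero)
    also have "\<dots> = (\<integral>v. (\<integral>x. heat 1 v * (f x * \<phi> (x - r *\<^sub>R v)) \<partial>lborel) \<partial>lborel)"
      using lborel_pair.Fubini_integral[OF int] .
    also have "\<dots> = (\<integral>v. heat 1 v * \<psi> (r *\<^sub>R v) \<partial>lborel)" unfolding \<psi>_def by (simp only: integral_mult_right_zero)
    finally show ?thesis .
  qed
  have \<psi>lim: "(\<lambda>k. \<psi> ((1 / real (Suc k)) *\<^sub>R v)) \<longlonglongrightarrow> \<psi> 0" for v
    unfolding \<psi>_def
  proof (rule integral_dominated_convergence)
    show "integrable lborel (\<lambda>x. \<bar>f x * (B * indicator (cball 0 (R + norm v)) x)\<bar>)"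
      by (intro integrable_abs integrable_Lp_mult[OF p f ballb])
    show "AE x in lborel. norm (f x * \<phi> (x - (1 / real (Suc k)) *\<^sub>R v)) \<le> \<bar>f x * (B * indicator (cball 0 (R + norm v)) x)\<bar>" for k
    proof (rule AE_I2)
      fix x
      have nv: "norm ((1 / real (Suc k)) *\<^sub>R v) \<le> norm v" by (simp add: divide_le_eq mult_le_cancel_left1)
      have "norm (\<phi> (x - (1 / real (Suc k)) *\<^sub>R v)) \<le> B * indicator (cball 0 (R + norm v)) x"
      proof (cases "norm x \<le> R + norm v")
        case False
        have "R < norm (x - (1 / real (Suc k)) *\<^sub>R v)"
          using norm_triangle_ineq2[of x "(1 / real (Suc k)) *\<^sub>R v"] nv False by linarith
        then show ?thesis using \<phi>R B0 by simp
      qed (use \<phi>B in simp)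
      then show "norm (f x * \<phi> (x - (1 / real (Suc k)) *\<^sub>R v)) \<le> \<bar>f x * (B * indicator (cball 0 (R + norm v)) x)\<bar>"
        unfolding real_norm_def abs_mult[of "f x"] by (rule mult_left_mono[OF order_trans[OF _ abs_ge_self] abs_ge_zero])
    qed
    show "AE x in lborel. (\<lambda>k. f x * \<phi> (x - (1 / real (Suc k)) *\<^sub>R v)) \<longlonglongrightarrow> f x * \<phi> (x - 0)"
    proof (rule AE_I2, rule tendsto_mult_left)
      fix x
      have "(\<lambda>k. x - (1 / real (Suc k)) *\<^sub>R v) \<longlonglongrightarrow> x - 0 *\<^sub>R v"
        by (intro tendsto_diff tendsto_const tendsto_scaleR) (use LIMSEQ_Suc[OF lim_1_over_n] in simp)
      moreover have "isCont \<phi> (x - 0 *\<^sub>R v)" using \<phi>c continuous_on_eq_continuous_at by blast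
      ultimately show "(\<lambda>k. \<phi> (x - (1 / real (Suc k)) *\<^sub>R v)) \<longlonglongrightarrow> \<phi> (x - 0)"
        using isCont_tendsto_compose by fastforce
    qed
  qed measurable
  have "(\<lambda>k. \<integral>v. heat 1 v * \<psi> ((1 / real (Suc k)) *\<^sub>R v) \<partial>(lborel :: 'a measure)) \<longlonglongrightarrow> (\<integral>v. heat 1 v * \<psi> 0 \<partial>(lborel :: 'a measure))"
  proof (rule integral_dominated_convergence)
    show "integrable (lborel :: 'a measure) (\<lambda>v. heat 1 v * S)" using integrable_heat[of 1, where 'a='a] by simp
    show "AE v in (lborel :: 'a measure). (\<lambda>k. heat 1 v * \<psi> ((1 / real (Suc k)) *\<^sub>R v)) \<longlonglongrightarrow> heat 1 v * \<psi> 0"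
      by (intro AE_I2 tendsto_mult_left \<psi>lim)
    show "AE v in (lborel :: 'a measure). norm (heat 1 v * \<psi> ((1 / real (Suc k)) *\<^sub>R v)) \<le> heat 1 v * S" for k
      using \<psi>S by (intro AE_I2) (simp add: abs_mult mult_left_mono)
  qed measurable
  moreover have "(\<integral>v. heat 1 v * \<psi> 0 \<partial>(lborel :: 'a measure)) = (\<integral>x. f x * \<phi> x \<partial>lborel)"
    using integral_heat[of 1, where 'a='a] by (simp add: \<psi>_def)
  moreover have "(\<integral>x. f x * heat_conv \<phi> ((1 / real (Suc k))\<^sup>2) x \<partial>lborel) = (\<integral>v. heat 1 v * \<psi> ((1 / real (Suc k)) *\<^sub>R v) \<partial>(lborel :: 'a measure))" for k
    by (rule h) simp
  ultimately show ?thesis by (simp only:)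
qed

text \<open>The function G = (|\<phi>|/c)^(1/(q-1)) witnesses membership, so dividing by any
  positive bound \<open>c\<close> of the conjugate norm suffices.\<close>

lemma dual_unit_normalized:
  fixes \<phi> :: "'a::euclidean_space \<Rightarrow> real"
  assumes q: "q > 1" and [measurable]: "\<phi> \<in> borel_measurable borel" and B: "\<And>x. norm (\<phi> x) \<le> B" and R: "\<And>x. R < norm x \<Longrightarrow> \<phi> x = 0"
    and I: "(\<integral>\<^sup>+x. ennreal (\<bar>\<phi> x\<bar> powr (q / (q - 1))) \<partial>lborel) \<le> ennreal (c powr (q / (q - 1)))" and c: "c > 0"
  shows "dual_unit q (\<lambda>x. \<phi> x / c)"
proof -
  define G where "G x = (\<bar>\<phi> x\<bar> / c) powr (1 / (q - 1))" for x
  have [measurable]: "G \<in> borel_measurable borel" unfolding G_def by measurable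
  have 1: "norm (\<phi> x / c) \<le> G x powr (q - 1)" for x using q c by (simp add: G_def powr_powr)
  have "(\<integral>\<^sup>+x. ennreal (G x powr q) \<partial>lborel) = (\<integral>\<^sup>+x. ennreal (1 / c powr (q / (q - 1))) * ennreal (\<bar>\<phi> x\<bar> powr (q / (q - 1))) \<partial>lborel)"
    using c by (intro nn_integral_cong) (simp add: G_def powr_powr powr_divide flip: ennreal_mult)
  also have "\<dots> = ennreal (1 / c powr (q / (q - 1))) * (\<integral>\<^sup>+x. ennreal (\<bar>\<phi> x\<bar> powr (q / (q - 1))) \<partial>lborel)" by (rule nn_integral_cmult) measurable
  also have "\<dots> \<le> ennreal (1 / c powr (q / (q - 1))) * ennreal (c powr (q / (q - 1)))" by (rule mult_left_mono[OF I]) simp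
  also have "\<dots> = 1" using c by (simp flip: ennreal_mult)
  finally have 2: "(\<integral>\<^sup>+x. ennreal (G x powr q) \<partial>lborel) \<le> 1" .
  show ?thesis
    unfolding dual_unit_def
  proof (intro conjI)
    show "\<exists>B. \<forall>x. norm (\<phi> x / c) \<le> B" using B c by (intro exI[of _ "B / c"]) (simp add: divide_right_mono)
    show "\<exists>R. \<forall>x. R < norm x \<longrightarrow> \<phi> x / c = 0" using R by (intro exI[of _ R]) simp
    show "\<exists>G\<in>borel_measurable borel. (\<forall>x. 0 \<le> G x \<and> norm (\<phi> x / c) \<le> G x powr (q - 1)) \<and> (\<integral>\<^sup>+x. ennreal (G x powr q) \<partial>lborel) \<le> 1"
      using 1 2 by (intro bexI[of _ G]) (auto simp: G_def)
  qed measurable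
qed

text \<open>\<open>measurable_on\<close> provides continuous functions converging almost everywhere.
  Clipping them to [-B, B] and multiplying by a continuous cut-off that is 1 on the ball of radius
  \<open>R\<close> gives a common majorant without changing the limit.\<close>

lemma continuous_approx:
  fixes \<phi> :: "'a::euclidean_space \<Rightarrow> real"
  assumes [measurable]: "\<phi> \<in> borel_measurable borel" and B: "\<And>x. \<bar>\<phi> x\<bar> \<le> B" and R: "\<And>x. R < norm x \<Longrightarrow> \<phi> x = 0"
  obtains \<phi>n where "\<And>n. continuous_on UNIV (\<phi>n n)" "\<And>n x. \<bar>\<phi>n n x\<bar> \<le> B * indicator (cball 0 (R + 1)) x"
    "AE x in lborel. (\<lambda>n::nat. \<phi>n n x) \<longlonglongrightarrow> \<phi> x"
proof -
  have B0: "B \<ge> 0" using order_trans[OF abs_ge_zero B[of 0]] .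
  have "\<phi> \<in> borel_measurable (lebesgue_on UNIV)" by (simp add: lebesgue_on_UNIV_eq measurable_completion)
  then have "\<phi> measurable_on UNIV" by (subst measurable_on_iff_borel_measurable) auto
  then obtain Z g where Z: "negligible Z" and g: "\<And>n. continuous_on UNIV (g n)" "\<And>x. x \<notin> Z \<Longrightarrow> (\<lambda>n. g n x) \<longlonglongrightarrow> \<phi> x"
    unfolding measurable_on_def by (auto simp only: UNIV_I if_True)
  have "Z \<in> null_sets lebesgue" using Z by (simp add: negligible_iff_null_sets)
  \<comment> \<open>The exceptional set is enlarged to a Borel null set, since \<open>lborel\<close>
    is not complete.\<close>
  then obtain Z' where Z': "Z' \<in> null_sets lborel" "Z \<subseteq> Z'" by (meson null_sets_completion_iff2)
  define cut where "cut x = max 0 (min 1 (R + 1 - norm x))" for x :: 'a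
  define \<phi>n where "\<phi>n n x = max (- B) (min B (g n x)) * cut x" for n x
  show thesis
  proof (rule that)
    show "continuous_on UNIV (\<phi>n n)" for n unfolding \<phi>n_def cut_def by (intro continuous_intros g)
    show "\<bar>\<phi>n n x\<bar> \<le> B * indicator (cball 0 (R + 1)) x" for n x
    proof -
      have "\<bar>max (- B) (min B (g n x))\<bar> \<le> B" using B0 by (auto simp: max_def min_def)
      moreover have "\<bar>cut x\<bar> \<le> indicator (cball 0 (R + 1)) x" by (cases "x \<in> cball 0 (R + 1)") (auto simp: cut_def)
      ultimately show ?thesis unfolding \<phi>n_def abs_mult using B0 by (intro mult_mono) auto
    qed
    have lim: "(\<lambda>n. \<phi>n n x) \<longlonglongrightarrow> \<phi> x" if "x \<notin> Z'" for x
    proof -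
      have "x \<notin> Z" using that Z' by blast
      from g(2)[OF this] have "(\<lambda>n. \<phi>n n x) \<longlonglongrightarrow> max (- B) (min B (\<phi> x)) * cut x"
        unfolding \<phi>n_def by (intro tendsto_intros)
      moreover have "max (- B) (min B (\<phi> x)) = \<phi> x" using B[of x] by (auto simp: max_def min_def abs_le_iff)
      moreover have "\<phi> x * cut x = \<phi> x" using R[of x] by (cases "R < norm x") (auto simp: cut_def)
      ultimately show ?thesis by simp
    qed
    show "AE x in lborel. (\<lambda>n. \<phi>n n x) \<longlonglongrightarrow> \<phi> x"
      using AE_not_in[OF Z'(1)] lim by (rule eventually_mono)
  qed
qed

text \<open>The limit \<delta> to 0 is taken against continuous dual fields. General dual fields are
  approximated almost everywhere by continuous ones, which need not lie in the dual unit ball and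
  must be renormalised; this costs the factor 2.\<close>

lemma BV_Lq_embedding:
  fixes p q \<alpha> :: real
  assumes \<alpha>: "0 < \<alpha>" "\<alpha> \<le> 1" and p: "1 \<le> p" and pq: "p < q"
    and sub: "real DIM('a::euclidean_space) * (1 - 1/q) < \<alpha>"
  obtains C where "C \<ge> 0" "\<And>(f :: 'a \<Rightarrow> real) N V. Lp_bound p f N \<Longrightarrow> var_bound \<alpha> f V \<Longrightarrow> Lp_bound q f (C * (N + V))"
proof -
  obtain C where C: "C \<ge> 0" and CB: "\<And>(f :: 'a \<Rightarrow> real) N V \<phi> \<delta>. Lp_bound p f N \<Longrightarrow> var_bound \<alpha> f V \<Longrightarrow> dual_unit q (\<phi> :: 'a \<Rightarrow> real) \<Longrightarrow> \<delta> > 0 \<Longrightarrow>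
    \<bar>\<integral>x. f x * heat_conv \<phi> \<delta> x \<partial>lborel\<bar> \<le> C * (N + V)"
    by (rule heat_conv_var_bound[OF \<alpha> p pq sub]) blast
  define q' where "q' = q / (q - 1)"
  have q: "q > 1" using p pq by simp
  have q': "q' \<ge> 1" using q by (simp add: q'_def)
  show thesis
  proof (rule that[of "2 * C"])
    show "2 * C \<ge> 0" using C by simp
    fix f :: "'a \<Rightarrow> real" and N V assume f: "Lp_bound p f N" and V: "var_bound \<alpha> f V"
    have N0: "N \<ge> 0" and V0: "V \<ge> 0" and fm[measurable]: "f \<in> borel_measurable borel" using f V by (auto simp: Lp_bound_def var_bound_def)
    have cont: "\<bar>\<integral>x. f x * \<phi> x \<partial>lborel\<bar> \<le> C * (N + V)"
      if \<phi>: "dual_unit q \<phi>" and \<phi>c: "continuous_on UNIV \<phi>" for \<phi> :: "'a \<Rightarrow> real"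
    proof -
      obtain B R where "\<And>x. norm (\<phi> x) \<le> B" "\<And>x. R < norm x \<Longrightarrow> \<phi> x = 0" using \<phi> unfolding dual_unit_def by blast
      from heat_conv_pairing_tendsto[OF p f \<phi>c this]
      have "(\<lambda>k. \<bar>\<integral>x. f x * heat_conv \<phi> ((1 / real (Suc k))\<^sup>2) x \<partial>lborel\<bar>) \<longlonglongrightarrow> \<bar>\<integral>x. f x * \<phi> x \<partial>lborel\<bar>"
        by (intro tendsto_rabs)
      then show ?thesis by (rule LIMSEQ_le_const2) (intro exI allI impI CB[OF f V \<phi>], simp)
    qed
    have "(\<integral>\<^sup>+x. ennreal (norm (f x) powr q) \<partial>lborel) \<le> ennreal ((2 * C * (N + V)) powr q)"
    proof (rule converse_holder)
      show "q \<ge> 1" using q by simp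
      show "0 \<le> 2 * C * (N + V)" using C N0 V0 by simp
      fix \<phi> :: "'a \<Rightarrow> real" assume \<phi>: "dual_unit q \<phi>"
      obtain B R where B: "\<And>x. \<bar>\<phi> x\<bar> \<le> B" and R: "\<And>x. R < norm x \<Longrightarrow> \<phi> x = 0" and \<phi>m[measurable]: "\<phi> \<in> borel_measurable borel"
        using \<phi> unfolding dual_unit_def real_norm_def by blast
      obtain G where Gm: "G \<in> borel_measurable borel" and G: "\<And>x. 0 \<le> G x" "\<And>x. norm (\<phi> x) \<le> G x powr (q - 1)" "(\<integral>\<^sup>+x. ennreal (G x powr q) \<partial>lborel) \<le> 1"
        using \<phi> unfolding dual_unit_def by blast
      have B0: "B \<ge> 0" using order_trans[OF abs_ge_zero B[of 0]] .
      obtain \<phi>n where \<phi>n: "\<And>n. continuous_on UNIV (\<phi>n n)" "\<And>n x. \<bar>\<phi>n n x\<bar> \<le> B * indicator (cball 0 (R + 1)) x"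
        "AE x in lborel. (\<lambda>n::nat. \<phi>n n x) \<longlonglongrightarrow> \<phi> x"
        by (rule continuous_approx[of \<phi> B R, OF \<phi>m B], erule R, rule that)
      have [measurable]: "\<phi>n n \<in> borel_measurable borel" for n by (rule borel_measurable_continuous_onI[OF \<phi>n(1)])
      have ballb: "bdd_int (\<lambda>x::'a. indicator (cball 0 (R + 1)) x :: real)"
      proof -
        have "integrable lborel (\<lambda>x::'a. indicator (cball 0 (R + 1)) x :: real)"
          using emeasure_bounded_finite[of "cball (0::'a) (R + 1)"] by auto
        then show ?thesis unfolding bdd_int_def by (intro conjI exI[of _ 1] allI) (assumption, simp add: indicator_def)
      qed
      define I where "I n = (\<integral>x. \<bar>\<phi>n n x\<bar> powr q' \<partial>lborel)" for n
      have dom: "\<bar>\<phi>n n x\<bar> powr q' \<le> B powr q' * indicator (cball 0 (R + 1)) x" for n x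
      proof (cases "x \<in> cball 0 (R + 1)")
        case True
        then show ?thesis using \<phi>n(2)[of n x] q' by (simp add: powr_mono2)
      next
        case False
        then show ?thesis using \<phi>n(2)[of n x] by (simp add: indicator_def)
      qed
      have i: "integrable lborel (\<lambda>x. \<bar>\<phi>n n x\<bar> powr q')" for n
      proof (rule Bochner_Integration.integrable_bound[OF bdd_intD(1)[OF bdd_int_cmult[OF ballb, of "B powr q'"]]])
        show "AE x in lborel. norm (\<bar>\<phi>n n x\<bar> powr q') \<le> norm (B powr q' * indicator (cball 0 (R + 1)) x)"
          using order_trans[OF dom abs_ge_self] by (intro AE_I2) simp
      qed measurable
      have I0: "I n \<ge> 0" for n unfolding I_def by simp
      have Ilim: "I \<longlonglongrightarrow> (\<integral>x. \<bar>\<phi> x\<bar> powr q' \<partial>lborel)"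
        unfolding I_def
      proof (rule integral_dominated_convergence[OF _ _ bdd_intD(1)[OF bdd_int_cmult[OF ballb, of "B powr q'"]]])
        show "AE x in lborel. (\<lambda>n. \<bar>\<phi>n n x\<bar> powr q') \<longlonglongrightarrow> \<bar>\<phi> x\<bar> powr q'"
          using \<phi>n(3)
        proof eventually_elim
          case (elim x)
          show ?case by (rule tendsto_powr'[OF tendsto_rabs[OF elim] tendsto_const]) (use q' in simp)
        qed
        show "AE x in lborel. norm (\<bar>\<phi>n n x\<bar> powr q') \<le> B powr q' * indicator (cball 0 (R + 1)) x" for n
          using dom by (intro AE_I2) simp
      qed measurable
      \<comment> \<open>The witness \<open>G\<close> bounds the conjugate norm of \<phi>, because (q
        - 1) q' = q.\<close>
      have I1: "(\<integral>x. \<bar>\<phi> x\<bar> powr q' \<partial>lborel) \<le> 1"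
      proof -
        have "(\<integral>\<^sup>+x. ennreal (\<bar>\<phi> x\<bar> powr q') \<partial>lborel) \<le> (\<integral>\<^sup>+x. ennreal (G x powr q) \<partial>lborel)"
        proof (intro nn_integral_mono ennreal_leI)
          fix x
          have "\<bar>\<phi> x\<bar> powr q' \<le> (G x powr (q - 1)) powr q'" using G(2)[of x] q' by (intro powr_mono2) auto
          also have "\<dots> = G x powr q" using q by (simp add: powr_powr q'_def)
          finally show "\<bar>\<phi> x\<bar> powr q' \<le> G x powr q" .
        qed
        then have "(\<integral>\<^sup>+x. ennreal (\<bar>\<phi> x\<bar> powr q') \<partial>lborel) \<le> ennreal 1" using G(3) by simp
        then show ?thesis by (intro integral_real_bounded) auto
      qed
      \<comment> \<open>The summand 1 keeps the divisor positive even when an approximation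
        vanishes. In the limit the divisor is at most \<open>2 powr (1 / q')\<close>, hence at most
        2.\<close>
      define c where "c n = (I n + 1) powr (1 / q')" for n
      have c0: "c n > 0" for n using I0[of n] by (simp add: c_def)
      have "dual_unit q (\<lambda>x. \<phi>n n x / c n)" for n
      proof (rule dual_unit_normalized[OF q _ _ _ _ c0, where B = B and R = "R + 1"])
        show "norm (\<phi>n n x) \<le> B" for x using \<phi>n(2)[of n x] B0 by (cases "x \<in> cball 0 (R + 1)") auto
        show "R + 1 < norm x \<Longrightarrow> \<phi>n n x = 0" for x using \<phi>n(2)[of n x] by (simp add: indicator_def)
        have "(\<integral>\<^sup>+x. ennreal (\<bar>\<phi>n n x\<bar> powr q') \<partial>lborel) = ennreal (I n)" unfolding I_def using i by (intro nn_integral_eq_integral) auto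
        also have "\<dots> \<le> ennreal (c n powr q')" unfolding c_def powr_powr using q' I0[of n] by (intro ennreal_leI) simp
        finally show "(\<integral>\<^sup>+x. ennreal (\<bar>\<phi>n n x\<bar> powr (q / (q - 1))) \<partial>lborel) \<le> ennreal (c n powr (q / (q - 1)))" unfolding q'_def .
      qed measurable
      then have quot: "\<bar>\<integral>x. f x * (\<phi>n n x / c n) \<partial>lborel\<bar> \<le> C * (N + V)" for n
        using c0[of n] by (intro cont continuous_intros \<phi>n(1)) auto
      have bound: "\<bar>\<integral>x. f x * \<phi>n n x \<partial>lborel\<bar> \<le> C * (N + V) * c n" for n
        using quot[of n] c0[of n] by (simp add: pos_divide_le_eq)
      have "(\<lambda>n. \<integral>x. f x * \<phi>n n x \<partial>lborel) \<longlonglongrightarrow> (\<integral>x. f x * \<phi> x \<partial>lborel)"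
      proof (rule integral_dominated_convergence[OF _ _ integrable_abs[OF integrable_Lp_mult[OF p f bdd_int_cmult[OF ballb, of B]]]])
        show "AE x in lborel. (\<lambda>n. f x * \<phi>n n x) \<longlonglongrightarrow> f x * \<phi> x"
          by (rule eventually_mono[OF \<phi>n(3) tendsto_mult_left])
        show "AE x in lborel. norm (f x * \<phi>n n x) \<le> \<bar>f x * (B * indicator (cball 0 (R + 1)) x)\<bar>" for n
          unfolding real_norm_def abs_mult[of "f _"]
          by (intro AE_I2 mult_left_mono[OF order_trans[OF \<phi>n(2) abs_ge_self] abs_ge_zero])
      qed measurable
      then have l1: "(\<lambda>n. \<bar>\<integral>x. f x * \<phi>n n x \<partial>lborel\<bar>) \<longlonglongrightarrow> \<bar>\<integral>x. f x * \<phi> x \<partial>lborel\<bar>" by (rule tendsto_rabs)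
      have "c \<longlonglongrightarrow> ((\<integral>x. \<bar>\<phi> x\<bar> powr q' \<partial>lborel) + 1) powr (1 / q')"
        unfolding c_def by (intro tendsto_powr tendsto_add Ilim tendsto_const) (simp add: add_nonneg_eq_0_iff)
      then have l2: "(\<lambda>n. C * (N + V) * c n) \<longlonglongrightarrow> C * (N + V) * ((\<integral>x. \<bar>\<phi> x\<bar> powr q' \<partial>lborel) + 1) powr (1 / q')"
        by (rule tendsto_mult_left)
      have "\<bar>\<integral>x. f x * \<phi> x \<partial>lborel\<bar> \<le> C * (N + V) * ((\<integral>x. \<bar>\<phi> x\<bar> powr q' \<partial>lborel) + 1) powr (1 / q')"
        by (rule LIMSEQ_le[OF l1 l2]) (use bound in auto)
      also have "\<dots> \<le> C * (N + V) * 2"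
      proof (rule mult_left_mono)
        have "((\<integral>x. \<bar>\<phi> x\<bar> powr q' \<partial>lborel) + 1) powr (1 / q') \<le> 2 powr (1 / q')"
          using I1 q' by (intro powr_mono2) auto
        also have "\<dots> \<le> 2 powr 1" using q' by (intro powr_mono) auto
        finally show "((\<integral>x. \<bar>\<phi> x\<bar> powr q' \<partial>lborel) + 1) powr (1 / q') \<le> 2" by simp
      qed (use C N0 V0 in simp)
      finally show "(\<integral>x. f x \<bullet> \<phi> x \<partial>lborel) \<le> 2 * C * (N + V)" by (simp add: mult_ac)
    qed (rule fm)
    then show "Lp_bound q f (2 * C * (N + V))" unfolding Lp_bound_def using C N0 V0 by simp
  qed
qed

section \<open>Lebesgue and Borel representatives\<close>

lemma frac_div_measurable:
  fixes \<phi> :: "'a::euclidean_space \<Rightarrow> 'a"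
  assumes \<gamma>: "0 < \<gamma>" "\<gamma> \<le> 1" and \<phi>: "\<phi> \<in> test_fields"
  shows "frac_div \<gamma> \<phi> \<in> borel_measurable borel"
proof (cases "\<gamma> = 1")
  case True
  have "smooth \<phi>" using \<phi> by (simp add: test_fields_def)
  from smooth_partial_measurable[OF this, of "[]"]
  have [measurable]: "(\<lambda>x. frechet_derivative \<phi> (at x) b) \<in> borel_measurable borel" for b by simp
  show ?thesis unfolding frac_div_def[abs_def] using True by simp
next
  case False
  then have \<gamma>': "\<gamma> < 1" using \<gamma> by simp
  obtain w where \<phi>b: "bdd_int \<phi>" and md: "modulus_dom \<phi> w" using test_field_modulus_dom[OF \<phi>] by metis
  note [measurable] = bdd_intD(2)[OF \<phi>b]
  show ?thesis unfolding frac_div_eq[OF \<gamma>(1) \<gamma>' md bdd_intD(2)[OF \<phi>b], abs_def] frac_int_def by measurable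
qed

lemma test_field_measurable: "\<phi> \<in> test_fields \<Longrightarrow> \<phi> \<in> borel_measurable borel"
  using test_field_modulus_dom bdd_intD(2) by metis

text \<open>The supremum in \<open>frac_var\<close> is non-negative because the zero field competes.
  It is produced as the zero multiple of an existing test field, so that smoothness and homogeneity
  of \<open>frac_div\<close> are inherited.\<close>

lemma zero_test_field:
  obtains \<phi> :: "'a::euclidean_space \<Rightarrow> 'a" where "\<phi> \<in> test_fields" "\<And>x. \<phi> x = 0" "\<And>\<gamma> x. frac_div \<gamma> \<phi> x = 0"
proof -
  have "bdd_int (\<lambda>x::'a. 0::'a)" by (auto simp: bdd_int_def)
  from heat_approx_test_field[OF zero_less_one this, of 0]
  have t: "heat_approx 1 (\<lambda>x::'a. 0) 0 \<in> test_fields" .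
  show thesis
  proof (rule that[OF test_field_scaleR[OF t, of 0]])
    show "frac_div \<gamma> (\<lambda>x. 0 *\<^sub>R heat_approx 1 (\<lambda>x::'a. 0) 0 x) x = 0" for \<gamma> x
      using frac_div_scaleR[OF t, of \<gamma> 0 x] by (rule trans) simp
  qed simp
qed

text \<open>The definitions integrate over \<open>lebesgue\<close>, the estimates over
  \<open>lborel\<close>; the two agree once \<open>f\<close> is replaced by a Borel representative
  and the other factor is Borel.\<close>

lemma lebesgue_integral_borel_version:
  fixes f f' h :: "'a::euclidean_space \<Rightarrow> real"
  assumes f: "f \<in> borel_measurable lebesgue" and f': "f' \<in> borel_measurable borel" and ae: "AE x in lborel. f x = f' x"
    and h: "h \<in> borel_measurable borel"
  shows "(LINT x|lebesgue. f x * h x) = (\<integral>x. f' x * h x \<partial>lborel)"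
proof -
  have [measurable]: "h \<in> borel_measurable lebesgue" "f' \<in> borel_measurable lebesgue" using h f' by (auto intro: measurable_completion)
  note [measurable] = f
  have "(LINT x|lebesgue. f x * h x) = (LINT x|lebesgue. f' x * h x)"
    by (rule integral_cong_AE) (use AE_completion[OF ae] in \<open>auto elim!: eventually_mono\<close>)
  also have "\<dots> = (\<integral>x. f' x * h x \<partial>lborel)" using f' h by (intro integral_completion) auto
  finally show ?thesis .
qed

lemma lp_norm_le_of_bound:
  fixes f :: "'a::euclidean_space \<Rightarrow> 'b::euclidean_space"
  assumes q: "q \<ge> 1" and N: "N \<ge> 0" and I: "(\<integral>\<^sup>+x. ennreal (norm (f x) powr q) \<partial>lborel) \<le> ennreal (N powr q)"
  shows "lp_norm (ennreal q) f \<le> ennreal N"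
proof -
  let ?I = "\<integral>\<^sup>+x. ennreal (norm (f x) powr q) \<partial>lebesgue"
  have I': "?I \<le> ennreal (N powr q)" using I by (simp add: nn_integral_completion)
  then have fin: "?I \<noteq> \<infinity>" by (auto simp: top_unique)
  have "enn2real ?I \<le> N powr q" using I' by (intro enn2real_leI) auto
  then have "enn2real ?I powr (1 / q) \<le> (N powr q) powr (1 / q)" using q by (intro powr_mono2) auto
  also have "\<dots> = N" using q N by (simp add: powr_powr)
  finally have "ennreal (enn2real ?I powr (1 / q)) \<le> ennreal N" by (rule ennreal_leI)
  then show ?thesis unfolding lp_norm_def using q fin by (simp add: Let_def)
qed

text \<open>Finiteness of \<open>lp_norm\<close> and \<open>frac_var\<close> yields the real numbers
  \<open>N\<close> and \<open>V\<close> on which all estimates are built, for a Borel function equal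
  to \<open>f\<close> almost everywhere.\<close>

lemma BV_space_borel_version:
  fixes f :: "'a::euclidean_space \<Rightarrow> real"
  assumes \<alpha>: "0 < \<alpha>" "\<alpha> \<le> 1" and p: "1 \<le> p" and f: "f \<in> BV_space \<alpha> (ennreal p)"
  obtains f' N V where "AE x in lborel. f x = f' x" "lp_norm (ennreal p) f = ennreal N" "Lp_bound p f' N"
    "frac_var \<alpha> f = ereal V" "var_bound \<alpha> f' V"
proof -
  have fm: "f \<in> borel_measurable lebesgue" and fL: "lp_norm (ennreal p) f < \<infinity>" and fV: "frac_var \<alpha> f < \<infinity>"
    using f by (auto simp: BV_space_def Lp_def)
  obtain f' where f'm: "f' \<in> borel_measurable lborel" and ae: "AE x in lborel. f x = f' x"
    using completion_ex_borel_measurable_real[OF fm] by blast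
  have [measurable]: "f' \<in> borel_measurable borel" using f'm by simp
  let ?I = "\<integral>\<^sup>+x. ennreal (norm (f x) powr p) \<partial>lebesgue"
  define N where "N = enn2real ?I powr (1 / p)"
  have ep: "enn2real (ennreal p) = p" "ennreal p \<noteq> \<infinity>" using p by auto
  have fin: "?I \<noteq> \<infinity>" using fL unfolding lp_norm_def Let_def ep(1) by (auto split: if_splits)
  have lp: "lp_norm (ennreal p) f = ennreal N" unfolding lp_norm_def Let_def ep(1) N_def using ep(2) fin by simp
  have "(\<integral>\<^sup>+x. ennreal (norm (f' x) powr p) \<partial>lborel) = (\<integral>\<^sup>+x. ennreal (norm (f x) powr p) \<partial>lborel)"
    by (rule nn_integral_cong_AE, rule eventually_mono[OF ae]) simp
  also have "\<dots> = ?I" by (simp add: nn_integral_completion)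
  also have "\<dots> = ennreal (enn2real ?I)" using fin by (simp add: less_top)
  also have "enn2real ?I = N powr p" using p by (simp add: N_def powr_powr)
  finally have LN: "Lp_bound p f' N" unfolding Lp_bound_def by (simp add: N_def)
  have pair: "(LINT x|lebesgue. f x * frac_div \<alpha> \<phi> x) = (\<integral>x. f' x * frac_div \<alpha> \<phi> x \<partial>lborel)" if "\<phi> \<in> test_fields" for \<phi>
    by (rule lebesgue_integral_borel_version[OF fm _ ae frac_div_measurable[OF \<alpha> that]]) measurable
  have le: "ereal (\<integral>x. f' x * frac_div \<alpha> \<phi> x \<partial>lborel) \<le> frac_var \<alpha> f" if "\<phi> \<in> test_fields" "\<forall>x. norm (\<phi> x) \<le> 1" for \<phi>
    unfolding frac_var_def pair[OF that(1), symmetric] using that by (intro SUP_upper) simp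
  have V0: "frac_var \<alpha> f \<ge> 0"
  proof -
    obtain \<phi> :: "'a \<Rightarrow> 'a" where \<phi>: "\<phi> \<in> test_fields" "\<And>x. \<phi> x = 0" "\<And>\<gamma> x. frac_div \<gamma> \<phi> x = 0" by (rule zero_test_field) (rule that)
    show ?thesis using le[OF \<phi>(1)] \<phi>(2,3) by (simp add: zero_ereal_def)
  qed
  obtain V where V: "frac_var \<alpha> f = ereal V" using V0 fV by (cases "frac_var \<alpha> f") auto
  have "var_bound \<alpha> f' V" unfolding var_bound_def using le V0 unfolding V by auto
  then show thesis by (rule that[OF ae lp LN V])
qed

lemma Lp_bound_mono: "Lp_bound p f N \<Longrightarrow> 0 \<le> p \<Longrightarrow> N \<le> M \<Longrightarrow> Lp_bound p f M"
  unfolding Lp_bound_def by (meson ennreal_leI order_trans powr_mono2)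

lemma Lp_of_Lp_bound:
  fixes f f' :: "'a::euclidean_space \<Rightarrow> 'b::euclidean_space"
  assumes f: "f \<in> borel_measurable lebesgue" and ae: "AE x in lborel. f x = f' x" and q: "1 \<le> q" and b: "Lp_bound q f' N"
  shows "f \<in> Lp (ennreal q)" "lp_norm (ennreal q) f \<le> ennreal N"
proof -
  have "(\<integral>\<^sup>+x. ennreal (norm (f x) powr q) \<partial>lborel) = (\<integral>\<^sup>+x. ennreal (norm (f' x) powr q) \<partial>lborel)"
    by (rule nn_integral_cong_AE, rule eventually_mono[OF ae]) simp
  then show "lp_norm (ennreal q) f \<le> ennreal N" using b q by (intro lp_norm_le_of_bound) (auto simp: Lp_bound_def)
  then show "f \<in> Lp (ennreal q)" unfolding Lp_def using f by (auto intro: le_less_trans)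
qed

lemma BV_subset_S_quantitative:
  fixes \<alpha> \<beta> p q :: real
  assumes \<beta>: "0 < \<beta>" and \<beta>\<alpha>: "\<beta> < \<alpha>" and \<alpha>1: "\<alpha> \<le> 1" and p: "1 \<le> p" and pq: "p \<le> q"
    and sub: "real DIM('a::euclidean_space) * (1 - 1/q) < \<alpha> - \<beta>"
  obtains C where "C \<ge> 0" "\<And>f :: 'a \<Rightarrow> real. f \<in> BV_space \<alpha> (ennreal p) \<Longrightarrow> f \<in> Lp (ennreal q) \<and>
    (\<exists>g. g \<in> Lp (ennreal q) \<and> weak_frac_grad \<beta> f g \<and>
      enn2ereal (lp_norm (ennreal q) f + lp_norm (ennreal q) g) \<le> ereal C * BV_norm \<alpha> (ennreal p) f)"
proof -
  have \<alpha>: "0 < \<alpha>" and q: "1 \<le> q" using assms by auto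
  obtain C1 where C1: "C1 \<ge> 0" and emb: "\<And>(f :: 'a \<Rightarrow> real) N V. Lp_bound p f N \<Longrightarrow> var_bound \<alpha> f V \<Longrightarrow> Lp_bound q f (C1 * (N + V))"
  \<comment> \<open>For p = q the embedding is trivial with constant 1.
    \<open>BV_Lq_embedding\<close> covers p < q, where its decay at large times is strict.\<close>
  proof (cases "p = q")
    case True
    have "Lp_bound q f (1 * (N + V))" if f: "Lp_bound p f N" and V: "var_bound \<alpha> f V" for f :: "'a \<Rightarrow> real" and N V
      by (rule Lp_bound_mono[of q f N]) (use f V q in \<open>auto simp: var_bound_def True\<close>)
    then show ?thesis by (rule that[OF zero_le_one])
  next
    case False
    then have "p < q" using pq by simp
    \<comment> \<open>The embedding corresponds to the limiting value \<beta> = 0 in the exponent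
      condition.\<close>
    moreover have "real DIM('a) * (1 - 1/q) < \<alpha>" using sub \<beta> by linarith
    ultimately show ?thesis by (rule BV_Lq_embedding[OF \<alpha> \<alpha>1 p]) (rule that)
  qed
  obtain C2 where C2: "C2 \<ge> 0" and grad: "\<And>(f :: 'a \<Rightarrow> real) N V. Lp_bound q f N \<Longrightarrow> var_bound \<alpha> f V \<Longrightarrow>
    \<exists>g. Lp_bound q g (C2 * (N + V)) \<and> (\<forall>\<phi>\<in>test_fields. frac_div \<beta> \<phi> \<in> borel_measurable borel \<and>
      (\<integral>x. f x * frac_div \<beta> \<phi> x \<partial>lborel) = - (\<integral>x. g x \<bullet> \<phi> x \<partial>lborel))"
    by (rule frac_gradient_exists[OF \<beta> \<beta>\<alpha> \<alpha>1 q sub]) blast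
  \<comment> \<open>The gradient estimate is fed with the L^q bound \<open>C1 * (N + V)\<close> in
    place of \<open>N\<close>, which produces the term \<open>C2 * (C1 + 1)\<close>.\<close>
  define C where "C = C1 + C2 * (C1 + 1)"
  show thesis
  proof (rule that[of C])
    show "C \<ge> 0" using C1 C2 by (simp add: C_def)
    fix f :: "'a \<Rightarrow> real" assume f: "f \<in> BV_space \<alpha> (ennreal p)"
    then have fm: "f \<in> borel_measurable lebesgue" by (simp add: BV_space_def Lp_def)
    obtain f' N V where ae: "AE x in lborel. f x = f' x" and lp: "lp_norm (ennreal p) f = ennreal N" and N: "Lp_bound p f' N"
      and V: "frac_var \<alpha> f = ereal V" "var_bound \<alpha> f' V" by (rule BV_space_borel_version[OF \<alpha> \<alpha>1 p f]) (rule that)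
    have N0: "N \<ge> 0" and V0: "V \<ge> 0" and f'm: "f' \<in> borel_measurable borel" using N V by (auto simp: Lp_bound_def var_bound_def)
    note f'q = emb[OF N V(2)]
    obtain g where g: "Lp_bound q g (C2 * (C1 * (N + V) + V))" and wg: "\<And>\<phi> :: 'a \<Rightarrow> 'a. \<phi> \<in> test_fields \<Longrightarrow> frac_div \<beta> \<phi> \<in> borel_measurable borel"
      "\<And>\<phi>. \<phi> \<in> test_fields \<Longrightarrow> (\<integral>x. f' x * frac_div \<beta> \<phi> x \<partial>lborel) = - (\<integral>x. g x \<bullet> \<phi> x \<partial>lborel)"
      using grad[OF f'q V(2)] by blast
    have gm: "g \<in> borel_measurable borel" using g by (simp add: Lp_bound_def)
    have gm': "g \<in> borel_measurable lebesgue" using gm by (auto intro: measurable_completion)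
    note fL = Lp_of_Lp_bound[OF fm ae q f'q] and gL = Lp_of_Lp_bound[OF gm' AE_I2[OF refl] q g]
    have w: "weak_frac_grad \<beta> f g"
      unfolding weak_frac_grad_def
    proof
      fix \<phi> :: "'a \<Rightarrow> 'a" assume \<phi>: "\<phi> \<in> test_fields"
      have "(LINT x|lebesgue. g x \<bullet> \<phi> x) = (\<integral>x. g x \<bullet> \<phi> x \<partial>lborel)"
        using gm test_field_measurable[OF \<phi>] by (intro integral_completion) auto
      then show "(LINT x|lebesgue. f x * frac_div \<beta> \<phi> x) = - (LINT x|lebesgue. g x \<bullet> \<phi> x)"
        using lebesgue_integral_borel_version[OF fm f'm ae wg(1)[OF \<phi>]] wg(2)[OF \<phi>] by simp
    qed
    have "lp_norm (ennreal q) f + lp_norm (ennreal q) g \<le> ennreal (C1 * (N + V)) + ennreal (C2 * (C1 * (N + V) + V))"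
      by (rule add_mono[OF fL(2) gL(2)])
    also have "\<dots> = ennreal (C1 * (N + V) + C2 * (C1 * (N + V) + V))" using C1 C2 N0 V0 by (intro ennreal_plus[symmetric]) auto
    also have "\<dots> \<le> ennreal (C * (N + V))"
    proof (rule ennreal_leI)
      have "C2 * (C1 * (N + V) + V) \<le> C2 * (C1 * (N + V) + (N + V))" using C2 N0 by (intro mult_left_mono) auto
      then show "C1 * (N + V) + C2 * (C1 * (N + V) + V) \<le> C * (N + V)" by (simp add: C_def algebra_simps)
    qed
    finally have "enn2ereal (lp_norm (ennreal q) f + lp_norm (ennreal q) g) \<le> enn2ereal (ennreal (C * (N + V)))"
      by (simp add: less_eq_ennreal.rep_eq)
    also have "\<dots> = ereal C * BV_norm \<alpha> (ennreal p) f"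
      using \<open>C \<ge> 0\<close> N0 V0 unfolding BV_norm_def lp V(1) by (simp add: enn2ereal_ennreal)
    finally show "f \<in> Lp (ennreal q) \<and> (\<exists>g. g \<in> Lp (ennreal q) \<and> weak_frac_grad \<beta> f g \<and>
      enn2ereal (lp_norm (ennreal q) f + lp_norm (ennreal q) g) \<le> ereal C * BV_norm \<alpha> (ennreal p) f)"
      using fL(1) gL(1) w by blast
  qed
qed

theorem theorem3p7:
  fixes \<alpha> \<beta> :: real and p q :: ennreal
  assumes "0 < \<beta>" and "\<beta> < \<alpha>" and "\<alpha> \<le> 1"
    and "1 \<le> p" and "p \<le> q"
    and "q < ennreal (real DIM('a::euclidean_space) / (real DIM('a) + \<beta> - \<alpha>))"
  shows "(BV_space \<alpha> p :: ('a \<Rightarrow> real) set) \<subseteq> S_space \<beta> q \<and>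
         (\<exists>C::real. C \<ge> 0 \<and> (\<forall>f \<in> (BV_space \<alpha> p :: ('a \<Rightarrow> real) set).
            \<exists>g. g \<in> Lp q \<and> weak_frac_grad \<beta> f g \<and>
                enn2ereal (lp_norm q f + lp_norm q g) \<le> ereal C * BV_norm \<alpha> p f))"
proof -
  let ?n = "real DIM('a)"
  have n: "?n \<ge> 1" by (simp add: Suc_le_eq)
  \<comment> \<open>Positive because \<alpha> - \<beta> < 1 \<le> n; the fraction in the hypothesis
    on \<open>q\<close> is thus a genuine positive real.\<close>
  have d: "?n + \<beta> - \<alpha> > 0" using n assms(1-3) by linarith
  \<comment> \<open>The strict upper bound forces \<open>q\<close>, and hence \<open>p\<close>, to
    be finite, so the infinite exponent never occurs.\<close>
  obtain q' where q': "q = ennreal q'" "0 \<le> q'" using assms(6) by (cases q) auto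
  obtain p' where p': "p = ennreal p'" "0 \<le> p'" using assms(5) q' by (cases p) (auto simp: top_unique)
  have p1: "1 \<le> p'" using assms(4) p'(2) unfolding p'(1) ennreal_1[symmetric] by (subst (asm) ennreal_le_iff) auto
  have pq: "p' \<le> q'" using assms(5) q' unfolding p'(1) by simp
  have "q' < ?n / (?n + \<beta> - \<alpha>)" using assms(6) q' by (simp add: ennreal_less_iff)
  \<comment> \<open>Dividing q (n + \<beta> - \<alpha>) < n by q gives the condition n (1 - 1/q) <
    \<alpha> - \<beta>, in which the time integrals converge.\<close>
  then have "q' * (?n + \<beta> - \<alpha>) < ?n" using d by (simp add: pos_less_divide_eq)
  then have sub: "?n * (1 - 1 / q') < \<alpha> - \<beta>" using p1 pq by (simp add: field_simps)
  obtain C where C: "C \<ge> 0" "\<And>f :: 'a \<Rightarrow> real. f \<in> BV_space \<alpha> p \<Longrightarrow> f \<in> Lp q \<and>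
    (\<exists>g. g \<in> Lp q \<and> weak_frac_grad \<beta> f g \<and> enn2ereal (lp_norm q f + lp_norm q g) \<le> ereal C * BV_norm \<alpha> p f)"
    unfolding p'(1) q'(1) by (rule BV_subset_S_quantitative[OF assms(1-3) p1 pq sub]) blast
  have "BV_space \<alpha> p \<subseteq> (S_space \<beta> q :: ('a \<Rightarrow> real) set)"
    using C(2) unfolding S_space_def by blast
  then show ?thesis using C by blast
qed

end
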